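(* Let $\Omega \subset \mathbb{R}^2$ be open and connected. Let $u : \Omega \to \mathbb{R}^2$ be Lipschitz, and let $g \in C^2(\mathbb{R})$ satisfy $g''(t) > 0$ for all $t \in \mathbb{R}$ and $g(0) = g'(0) = 0$. Suppose that $$\operatorname{div}\big(g'(\det(Du))\operatorname{cof}^T(Du)\big) = 0$$ holds in the weak sense in $\Omega$ and that $\det(Du) \neq 0$ a.e. in $\Omega$. Then $\det(Du)$ is essentially locally constant, in the sense that there exists an open set $\Omega_0 \subset \Omega$ with $|\Omega \setminus \Omega_0| = 0$ such that, on $\Omega_0$, $x \mapsto \det(Du)(x)$ is locally constant. If, moreover, there exists $\delta > 0$ such that $(\det(Du))^2 \ge \delta$ a.e. in $\Omega$, then $\det(Du)$ is constant in $\Omega$.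
   Context: $|E|$ denotes Lebesgue measure. $Du$ is the a.e. defined Jacobian matrix, $(Du)_{ij} = \partial_j u_i$. For $X \in \mathbb{R}^{n\times n}$, $\operatorname{cof}(X)$ is the matrix with entries $\operatorname{cof}(X)_{ij} = (-1)^{i+j}\det(M_{ji}(X))$, where $M_{ji}(X)$ is obtained from $X$ by deleting the $j$-th row and $i$-th column (so $X\operatorname{cof}(X) = \operatorname{cof}(X)X = \det(X)\,\mathrm{id}$), and $\operatorname{cof}^T(X)$ is its transpose. Divergences of matrix fields are taken row-wise; the equation in the weak sense means $\int_\Omega g'(\det(Du))\langle \operatorname{cof}^T(Du), D\eta\rangle\,dx = 0$ for all $\eta \in C_c^\infty(\Omega,\mathbb{R}^2)$, where $\langle\cdot,\cdot\rangle$ is the Hilbert-Schmidt scalar product. Since $\det(Du)$ is only defined a.e., (locally) constant is understood up to null sets: locally constant on $\Omega_0$ means that every point of $\Omega_0$ has a neighborhood on which $\det(Du)$ equals a constant a.e. *)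

theory Defs
  imports "HOL-Analysis.Analysis"
begin

primrec Ck :: "nat \<Rightarrow> ('a::real_normed_vector \<Rightarrow> 'b::real_normed_vector) \<Rightarrow> bool" where
  "Ck 0 f \<longleftrightarrow> continuous_on UNIV f"
| "Ck (Suc k) f \<longleftrightarrow>
     (\<forall>x. f differentiable (at x)) \<and> (\<forall>v. Ck k (\<lambda>x. frechet_derivative f (at x) v))"

(* C_c^infinity(\<Omega>, R^2); elements are represented by their extension by zero to the whole plane. *)
definition test_functions :: "(real^2) set \<Rightarrow> (real^2 \<Rightarrow> real^2) set" where
  "test_functions \<Omega> =
     {\<eta>. (\<forall>k. Ck k \<eta>) \<and> compact (closure {x. \<eta> x \<noteq> 0}) \<and> closure {x. \<eta> x \<noteq> 0} \<subseteq> \<Omega>}"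

(* X with row i and column j deleted. The index type 2 has exactly the elements 1 and 2,
   addition is modulo 2, so i + 1 is the index different from i. *)
definition minor :: "real^2^2 \<Rightarrow> 2 \<Rightarrow> 2 \<Rightarrow> real^1^1" where
  "minor X i j = (\<chi> k l. X $ (i + 1) $ (j + 1))"

(* The sign (-1)^(i+j) is positive iff i = j since i, j range over {1, 2}.
   The minor is taken at (j, i): this is the adjugate, whose transpose is the cofactor matrix. *)
definition cof :: "real^2^2 \<Rightarrow> real^2^2" where
  "cof X = (\<chi> i j. (if i = j then 1 else - 1) * det (minor X j i))"

lemma three_eq_one_2: "(3::2) = 1"
  by simp

lemma cof_works:
  "X ** cof X = det X *\<^sub>R mat 1" "cof X ** X = det X *\<^sub>R mat 1"
  by (simp_all add: vec_eq_iff forall_2 matrix_matrix_mult_def sum_2 mat_def cof_def minor_def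
      det_1 det_2 three_eq_one_2 algebra_simps)

(* Row-wise divergence in the weak sense. The inner product of real^2^2 is the
   Hilbert-Schmidt product. The integral is 0 by convention if the integrand is not integrable;
   this does not occur for essentially bounded measurable F, such as continuous functions of
   jacobian u (at x) with u Lipschitz (unspecified only on the null set where u is not
   differentiable, which is harmless for the complete measure lebesgue). *)
definition weakly_div_free :: "(real^2) set \<Rightarrow> (real^2 \<Rightarrow> real^2^2) \<Rightarrow> bool" where
  "weakly_div_free \<Omega> F \<longleftrightarrow>
     (\<forall>\<eta> \<in> test_functions \<Omega>. (LINT x:\<Omega>|lebesgue. F x \<bullet> jacobian \<eta> (at x)) = 0)"

definition ae_constant_on :: "('a::euclidean_space \<Rightarrow> 'b) \<Rightarrow> 'a set \<Rightarrow> bool" where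
  "ae_constant_on f S \<longleftrightarrow> (\<exists>c. AE x\<in>S in lebesgue. f x = c)"

definition ae_locally_constant_on :: "('a::euclidean_space \<Rightarrow> 'b) \<Rightarrow> 'a set \<Rightarrow> bool" where
  "ae_locally_constant_on f S \<longleftrightarrow>
     (\<forall>x\<in>S. \<exists>U. open U \<and> x \<in> U \<and> U \<subseteq> S \<and> ae_constant_on f U)"

end

theory Submission
  imports Defs "HOL-Complex_Analysis.Great_Picard"
begin

text \<open>Put \<open>\<beta> = g' (det Du)\<close>. Testing the equation shows that the rows of \<open>\<beta> Du\<close> are weakly curl-free, so
  locally \<open>Dw = \<beta> Du\<close> for a Lipschitz map \<open>w\<close>, and \<open>\<beta> det Du > 0\<close> almost everywhere because \<open>g'\<close> is
  increasing with \<open>g' 0 = 0\<close>. Since \<open>D(w \<bullet> e)\<close> is parallel to \<open>D(u \<bullet> e)\<close>, the Jacobian of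
  \<open>\<phi>(u) (\<alpha> + \<gamma> (w \<bullet> e)\<^sup>2)\<close> and \<open>w \<bullet> e\<close> only sees the derivative of \<open>\<phi>\<close> orthogonally to \<open>e\<close>; as it
  integrates to 0, the moments of \<open>w \<bullet> e\<close> on the fibres of \<open>u\<close>, with respect to \<open>\<beta> det Du dx\<close>, do not vary in that
  direction. If \<open>x0\<close> is isolated in its fibre, normalise \<open>u x0 = w x0 = 0\<close>: letting the fibre approach that
  of 0 forces \<open>w\<close> to be parallel to \<open>u\<close> near \<open>x0\<close>. Differentiating gives \<open>w = \<beta> u\<close>, and then \<open>D\<beta> = 0\<close>, so
  \<open>\<beta>\<close>, hence \<open>det Du\<close>, is constant near \<open>x0\<close>.
  Points where \<open>u\<close> is differentiable with \<open>det Du \<noteq> 0\<close> are isolated in their fibres, which gives the first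
  claim. If \<open>\<beta> det Du\<close> is bounded below, then all fibres are locally finite by a flux estimate, and
  the second claim follows by connectedness.\<close>

subsection \<open>Differentiability of Lipschitz functions on the line\<close>

text \<open>The weight \<open>\<beta> * det Du\<close> is positive whatever the sign of
  \<open>det Du\<close>, so the moments are integrals against a positive measure even where
  \<open>u\<close> reverses orientation. The fibre over y is represented by the kernel
  \<open>ker \<epsilon> (u x - y)\<close>: only integrals over the domain occur, and no change of
  variables is made under the possibly noninjective map \<open>u\<close>. Given y, one takes e with
  \<open>rot e = y\<close>. Then e is orthogonal to y, the invariance along \<open>rot e\<close>
  leads straight from the fibre of 0 to that of y, and \<open>w x \<bullet> e\<close> is the
  determinant of y and \<open>w x\<close>. Its second moment is taken because a first moment could
  vanish by cancellation, whereas a vanishing second moment forces the determinant to vanish almost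
  everywhere. Isolation of \<open>x0\<close> ensures that \<open>w\<close> is small wherever
  \<open>u\<close> is small: another preimage of \<open>u x0\<close> could carry another value of
  \<open>w\<close>. Here the two claims part. For the first, points that are not visibly isolated
  form a null set; for the second, infinite fibres must be excluded also where \<open>u\<close> is
  not differentiable, and this is what the lower bound on the weight provides.\<close>

lemma Vitali_intervals:
  fixes S :: "real set"
  assumes "\<And>x d. \<lbrakk>x \<in> S; 0 < d\<rbrakk> \<Longrightarrow> \<exists>a b. P a b \<and> a < x \<and> x < b \<and> b - a < d"
  obtains C where "countable C" "\<And>a b. (a, b) \<in> C \<Longrightarrow> P a b \<and> a < b"
    "disjoint_family_on (\<lambda>(a, b). {a..b}) C" "negligible (S - (\<Union>(a, b)\<in>C. {a..b}))"
proof -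
  define K where "K = {(a, b). P a b \<and> a < b}"
  have cb: "cball ((fst i + snd i) / 2) ((snd i - fst i) / 2) = {fst i..snd i}" for i :: "real \<times> real"
    by (auto simp: cball_eq_atLeastAtMost field_simps)
  obtain C where C: "countable C" "C \<subseteq> K"
    "pairwise (\<lambda>i j. disjnt {fst i..snd i} {fst j..snd j}) C"
    "negligible (S - (\<Union>i \<in> C. {fst i..snd i}))"
  proof (rule Vitali_covering_theorem_cballs[of K "\<lambda>i. (snd i - fst i) / 2" S "\<lambda>i. (fst i + snd i) / 2",
        unfolded cb])
    show "0 < (snd i - fst i) / 2" if "i \<in> K" for i
      using that by (auto simp: K_def)
    show "\<exists>i. i \<in> K \<and> x \<in> {fst i..snd i} \<and> (snd i - fst i) / 2 < d" if xS: "x \<in> S" and "0 < d" for x d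
    proof -
      from assms[OF xS, of "2 * d"] \<open>0 < d\<close> obtain a b where "P a b" "a < x" "x < b" "b - a < 2 * d"
        by auto
      then show ?thesis by (intro exI[of _ "(a, b)"]) (auto simp: K_def)
    qed
  qed
  show ?thesis
  proof
    show "countable C" by fact
    show "P a b \<and> a < b" if "(a, b) \<in> C" for a b
      using that C(2) by (auto simp: K_def)
    show "disjoint_family_on (\<lambda>(a, b). {a..b}) C"
      using C(3) by (auto simp: disjoint_family_on_def pairwise_def disjnt_def split_beta)
    show "negligible (S - (\<Union>(a, b)\<in>C. {a..b}))"
      using C(4) by (simp add: split_beta)
  qed
qed

lemma emeasure_le_of_negligible_Diff:
  assumes "S \<in> sets borel" "T \<in> sets borel" "negligible (S - T)"
  shows "emeasure lborel S \<le> emeasure lborel T"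
proof -
  have "S - T \<in> null_sets lborel"
    using assms by (auto simp: negligible_iff_null_sets null_sets_def)
  then have "emeasure lborel (T \<union> (S - T)) = emeasure lborel T"
    using assms by (intro emeasure_Un_null_set) auto
  moreover have "emeasure lborel S \<le> emeasure lborel (T \<union> (S - T))"
    using assms by (intro emeasure_mono) auto
  ultimately show ?thesis by simp
qed

text \<open>The intervals on which \<open>\<nu>\<close> has density at least \<open>q\<close> form a
  Vitali cover of \<open>S\<close> inside \<open>V\<close>; a disjoint subfamily fills
  \<open>S\<close> up to a null set, and \<open>\<nu>\<close> is summed over it. Although
  \<open>\<nu>\<close> may charge Lebesgue null sets, the uncovered part does no harm, as
  \<open>\<nu> V\<close> is only bounded from below.\<close>

lemma Vitali_lower_density:
  fixes \<nu> :: "real measure"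
  assumes \<nu>: "sets \<nu> = sets borel" and S: "S \<in> sets borel" and V: "open V" "S \<subseteq> V"
    and dens: "\<And>x d. \<lbrakk>x \<in> S; 0 < d\<rbrakk> \<Longrightarrow>
      \<exists>a b. ennreal (q * (b - a)) \<le> emeasure \<nu> {a..b} \<and> a < x \<and> x < b \<and> b - a < d"
    and q: "0 \<le> q"
  shows "ennreal q * emeasure lborel S \<le> emeasure \<nu> V"
proof -
  define P where "P = (\<lambda>a b. ennreal (q * (b - a)) \<le> emeasure \<nu> {a..b} \<and> {a..b} \<subseteq> V)"
  have *: "\<exists>a b. P a b \<and> a < x \<and> x < b \<and> b - a < d" if x: "x \<in> S" and d: "0 < d" for x d
  proof -
    obtain e where e: "e > 0" "ball x e \<subseteq> V"
      using V x by (meson openE subsetD)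
    obtain a b where ab: "ennreal (q * (b - a)) \<le> emeasure \<nu> {a..b}" "a < x" "x < b" "b - a < min d e"
      using dens[OF x, of "min d e"] d e by auto
    have "{a..b} \<subseteq> ball x e" using ab by (auto simp: ball_eq_greaterThanLessThan)
    then have "P a b" using ab(1) e(2) by (auto simp: P_def)
    then show ?thesis using ab by auto
  qed
  obtain C where C: "countable C" "\<And>a b. (a, b) \<in> C \<Longrightarrow> P a b \<and> a < b"
    "disjoint_family_on (\<lambda>(a, b). {a..b}) C" "negligible (S - (\<Union>(a, b)\<in>C. {a..b}))"
    by (rule Vitali_intervals[OF *]) (blast intro: that)+
  have [measurable]: "(\<Union>(a, b)\<in>C. {a..b}) \<in> sets borel"
    using C(1) by (intro sets.countable_UN') (auto simp: split_beta)
  have "ennreal q * emeasure lborel S \<le> ennreal q * emeasure lborel (\<Union>(a, b)\<in>C. {a..b})"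
    using C(4) S by (intro mult_left_mono emeasure_le_of_negligible_Diff) auto
  also have "\<dots> = ennreal q * (\<integral>\<^sup>+i. emeasure lborel (case i of (a, b) \<Rightarrow> {a..b}) \<partial>count_space C)"
    using C by (subst emeasure_UN_countable) (auto simp: split_beta)
  also have "\<dots> = (\<integral>\<^sup>+i. ennreal q * emeasure lborel (case i of (a, b) \<Rightarrow> {a..b}) \<partial>count_space C)"
    by (subst nn_integral_cmult) auto
  also have "\<dots> \<le> (\<integral>\<^sup>+i. emeasure \<nu> (case i of (a, b) \<Rightarrow> {a..b}) \<partial>count_space C)"
  proof (intro nn_integral_mono)
    fix i assume "i \<in> space (count_space C)"
    then show "ennreal q * emeasure lborel (case i of (a, b) \<Rightarrow> {a..b}) \<le> emeasure \<nu> (case i of (a, b) \<Rightarrow> {a..b})"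
      using C(2)[of "fst i" "snd i"] q by (auto simp: split_beta P_def ennreal_mult')
  qed
  also have "\<dots> = emeasure \<nu> (\<Union>(a, b)\<in>C. {a..b})"
    using C by (subst emeasure_UN_countable) (auto simp: split_beta \<nu>)
  also have "\<dots> \<le> emeasure \<nu> V"
  proof (intro emeasure_mono)
    show "(\<Union>(a, b)\<in>C. {a..b}) \<subseteq> V" using C(2) unfolding P_def by blast
  qed (use V \<nu> in auto)
  finally show ?thesis .
qed

text \<open>The cover misses a null set of \<open>S\<close>, which \<open>\<nu>\<close> might
  charge, so the upper bound is given for the union \<open>V\<close> of the chosen intervals and not
  for \<open>S\<close>. The intervals are taken open, so that \<open>V\<close> can serve as the
  neighbourhood in \<open>Vitali_lower_density\<close>.\<close>

lemma Vitali_upper_density: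
  fixes \<nu> :: "real measure"
  assumes \<nu>: "sets \<nu> = sets borel" and U: "open U" "S \<subseteq> U"
    and dens: "\<And>x d. \<lbrakk>x \<in> S; 0 < d\<rbrakk> \<Longrightarrow>
      \<exists>a b. emeasure \<nu> {a..b} \<le> ennreal (p * (b - a)) \<and> a < x \<and> x < b \<and> b - a < d"
    and p: "0 \<le> p"
  obtains V where "open V" "negligible (S - V)" "emeasure \<nu> V \<le> ennreal p * emeasure lborel U"
proof -
  define P where "P = (\<lambda>a b. emeasure \<nu> {a..b} \<le> ennreal (p * (b - a)) \<and> {a..b} \<subseteq> U)"
  have *: "\<exists>a b. P a b \<and> a < x \<and> x < b \<and> b - a < d" if x: "x \<in> S" and d: "0 < d" for x d
  proof -
    obtain e where e: "e > 0" "ball x e \<subseteq> U"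
      using U x by (meson openE subsetD)
    obtain a b where ab: "emeasure \<nu> {a..b} \<le> ennreal (p * (b - a))" "a < x" "x < b" "b - a < min d e"
      using dens[OF x, of "min d e"] d e by auto
    have "{a..b} \<subseteq> ball x e" using ab by (auto simp: ball_eq_greaterThanLessThan)
    then have "P a b" using ab(1) e(2) by (auto simp: P_def)
    then show ?thesis using ab by auto
  qed
  obtain C where C: "countable C" "\<And>a b. (a, b) \<in> C \<Longrightarrow> P a b \<and> a < b"
    "disjoint_family_on (\<lambda>(a, b). {a..b}) C" "negligible (S - (\<Union>(a, b)\<in>C. {a..b}))"
    by (rule Vitali_intervals[OF *]) (blast intro: that)+
  \<comment> \<open>Passing to open intervals loses the endpoints only, and these are
    countable.\<close>
  define V where "V = (\<Union>(a, b)\<in>C. {a<..<b})"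
  have "open V" by (auto simp: V_def)
  moreover have "negligible (S - V)"
  proof (rule negligible_subset)
    have "countable (fst ` C \<union> snd ` C)" using C(1) by auto
    then show "negligible ((S - (\<Union>(a, b)\<in>C. {a..b})) \<union> (fst ` C \<union> snd ` C))"
      using C(4) by (intro negligible_Un) (auto simp: negligible_iff_null_sets intro: null_sets_completionI countable_imp_null_set_lborel)
    show "S - V \<subseteq> (S - (\<Union>(a, b)\<in>C. {a..b})) \<union> (fst ` C \<union> snd ` C)"
    proof
      fix x assume x: "x \<in> S - V"
      show "x \<in> (S - (\<Union>(a, b)\<in>C. {a..b})) \<union> (fst ` C \<union> snd ` C)"
      proof (cases "x \<in> (\<Union>(a, b)\<in>C. {a..b})")
        case True
        then obtain a b where ab: "(a, b) \<in> C" "a \<le> x" "x \<le> b" by auto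
        with x have "x = a \<or> x = b" by (fastforce simp: V_def)
        with ab show ?thesis by force
      qed (use x in auto)
    qed
  qed
  moreover have "emeasure \<nu> V \<le> ennreal p * emeasure lborel U"
  proof -
    have "emeasure \<nu> V \<le> emeasure \<nu> (\<Union>(a, b)\<in>C. {a..b})"
      using C(1) by (intro emeasure_mono sets.countable_UN') (auto simp: V_def \<nu> split_beta intro!: bexI)
    also have "\<dots> = (\<integral>\<^sup>+i. emeasure \<nu> (case i of (a, b) \<Rightarrow> {a..b}) \<partial>count_space C)"
      using C by (subst emeasure_UN_countable) (auto simp: split_beta \<nu>)
    also have "\<dots> \<le> (\<integral>\<^sup>+i. ennreal p * emeasure lborel (case i of (a, b) \<Rightarrow> {a..b}) \<partial>count_space C)"
    proof (intro nn_integral_mono)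
      fix i assume "i \<in> space (count_space C)"
      then show "emeasure \<nu> (case i of (a, b) \<Rightarrow> {a..b}) \<le> ennreal p * emeasure lborel (case i of (a, b) \<Rightarrow> {a..b})"
        using C(2)[of "fst i" "snd i"] p by (auto simp: split_beta P_def ennreal_mult')
    qed
    also have "\<dots> = ennreal p * (\<integral>\<^sup>+i. emeasure lborel (case i of (a, b) \<Rightarrow> {a..b}) \<partial>count_space C)"
      by (subst nn_integral_cmult) auto
    also have "\<dots> = ennreal p * emeasure lborel (\<Union>(a, b)\<in>C. {a..b})"
      using C by (subst emeasure_UN_countable) (auto simp: split_beta)
    also have "\<dots> \<le> ennreal p * emeasure lborel U"
    proof (intro mult_left_mono emeasure_mono)
      show "(\<Union>(a, b)\<in>C. {a..b}) \<subseteq> U" using C(2) unfolding P_def by blast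
    qed (use U in auto)
    finally show ?thesis .
  qed
  ultimately show ?thesis by (rule that)
qed

text \<open>Let \<open>\<nu>\<close> be the Stieltjes measure of \<open>f\<close>. For an open
  \<open>U\<close> slightly larger than \<open>S\<close>, the two Vitali estimates combine to q |S|
  \<le> \<nu>(V) \<le> p |U|, and letting \<open>U\<close> shrink gives q |S| \<le> p |S|. As p < q,
  this forces |S| = 0, boundedness of \<open>S\<close> making |S| finite.\<close>

lemma negligible_distinct_derivates:
  fixes f :: "real \<Rightarrow> real"
  assumes mono: "mono f" and cont: "continuous_on UNIV f" and pq: "0 \<le> p" "p < q"
    and S: "S \<in> sets borel" "bounded S"
    and lo: "\<And>x d. \<lbrakk>x \<in> S; 0 < d\<rbrakk> \<Longrightarrow> \<exists>a b. f b - f a \<le> p * (b - a) \<and> a < x \<and> x < b \<and> b - a < d"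
    and hi: "\<And>x d. \<lbrakk>x \<in> S; 0 < d\<rbrakk> \<Longrightarrow> \<exists>a b. q * (b - a) \<le> f b - f a \<and> a < x \<and> x < b \<and> b - a < d"
  shows "negligible S"
proof -
  let ?\<nu> = "interval_measure f"
  have \<nu>: "sets ?\<nu> = sets borel" by simp
  have em: "emeasure ?\<nu> {a..b} = ennreal (f b - f a)" if "a \<le> b" for a b
    using that mono cont by (intro emeasure_interval_measure_Icc) (auto simp: monoD)
  have lo': "\<exists>a b. emeasure ?\<nu> {a..b} \<le> ennreal (p * (b - a)) \<and> a < x \<and> x < b \<and> b - a < d"
    if x: "x \<in> S" and d: "0 < d" for x d
  proof -
    obtain a b where "f b - f a \<le> p * (b - a)" "a < x" "x < b" "b - a < d" using lo[OF x d] by blast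
    then show ?thesis using em[of a b] by (intro exI[of _ a] exI[of _ b]) (auto intro: ennreal_leI)
  qed
  have hi': "\<exists>a b. ennreal (q * (b - a)) \<le> emeasure ?\<nu> {a..b} \<and> a < x \<and> x < b \<and> b - a < d"
    if x: "x \<in> S" and d: "0 < d" for x d
  proof -
    obtain a b where "q * (b - a) \<le> f b - f a" "a < x" "x < b" "b - a < d" using hi[OF x d] by blast
    then show ?thesis using em[of a b] by (intro exI[of _ a] exI[of _ b]) (auto intro: ennreal_leI)
  qed
  have fin: "emeasure lborel S < \<infinity>"
    using S emeasure_bounded_finite by blast
  define m where "m = measure lborel S"
  have m: "emeasure lborel S = ennreal m"
    using fin by (simp add: m_def emeasure_eq_ennreal_measure less_top)
  have "q * m \<le> p * (m + e)" if e: "e > 0" for e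
  proof -
    obtain U where U: "open U" "S \<subseteq> U" "emeasure lborel (U - S) < ennreal e"
      using outer_regular_lborel[OF S(1) e] .
    obtain V where V: "open V" "negligible (S - V)" "emeasure ?\<nu> V \<le> ennreal p * emeasure lborel U"
      using Vitali_upper_density[OF \<nu> U(1,2) lo' pq(1)] by blast
    have "emeasure lborel U = emeasure lborel S + emeasure lborel (U - S)"
      using U S by (subst plus_emeasure) (auto intro!: arg_cong[where f="emeasure lborel"])
    also have "\<dots> \<le> ennreal m + ennreal e"
      using U(3) m by (intro add_mono) auto
    finally have U': "emeasure lborel U \<le> ennreal (m + e)"
      using e by (simp add: m_def ennreal_plus)
    \<comment> \<open>The lower estimate needs a subset of the open set \<open>V\<close>; passing
      from \<open>S\<close> to \<open>S \<inter> V\<close> costs a null set.\<close>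
    have "ennreal q * emeasure lborel (S \<inter> V) \<le> emeasure ?\<nu> V"
      using S(1) V(1) pq hi' by (intro Vitali_lower_density) auto
    moreover have "emeasure lborel S \<le> emeasure lborel (S \<inter> V)"
      using S V by (intro emeasure_le_of_negligible_Diff) (auto simp: Diff_Int)
    ultimately have "ennreal q * ennreal m \<le> ennreal p * ennreal (m + e)"
      using V(3) U' m by (metis (no_types, lifting) mult_left_mono order_trans zero_le)
    then show ?thesis
      using pq e by (simp add: ennreal_mult'[symmetric] m_def ennreal_le_iff flip: ennreal_plus)
  qed
  then have "q * m \<le> p * m"
  proof -
    assume A: "\<And>e. e > 0 \<Longrightarrow> q * m \<le> p * (m + e)"
    show ?thesis
    proof (rule field_le_epsilon)
      fix e :: real assume e: "e > 0"
      have "q * m \<le> p * (m + e / (p + 1))" using A[of "e / (p + 1)"] e pq by simp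
      also have "\<dots> \<le> p * m + e" using e pq by (simp add: field_simps)
      finally show "q * m \<le> p * m + e" .
    qed
  qed
  then have "m \<le> 0" using pq by (simp add: mult_le_cancel_right)
  then have "emeasure lborel S = 0" using m by (simp add: ennreal_neg)
  then show ?thesis using S by (simp add: negligible_iff_null_sets null_sets_def)
qed

text \<open>The Vitali argument controls quotients over intervals with \<open>x\<close> in their
  interior. When one endpoint tends to \<open>x\<close>, continuity turns them into the one-sided
  quotients that define the derivative.\<close>

lemma has_real_derivative_of_interval_quotients:
  fixes f :: "real \<Rightarrow> real"
  assumes cont: "continuous_on UNIV f"
    and lim: "\<And>e. e > 0 \<Longrightarrow> \<exists>d>0. \<forall>a b. a < x \<and> x < b \<and> b - a < d \<longrightarrow> \<bar>f b - f a - l * (b - a)\<bar> \<le> e * (b - a)"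
  shows "(f has_real_derivative l) (at x)"
proof -
  have "((\<lambda>y. (f y - f x) / (y - x)) \<longlongrightarrow> l) (at x)"
  proof (rule LIM_I)
    fix r :: real assume r: "r > 0"
    obtain d where d: "d > 0" and D: "\<And>a b. a < x \<and> x < b \<and> b - a < d \<longrightarrow> \<bar>f b - f a - l * (b - a)\<bar> \<le> (r / 2) * (b - a)"
      using lim[of "r / 2"] r by auto
    have "norm ((f y - f x) / (y - x) - l) < r" if y: "y \<noteq> x" "norm (y - x) < d" for y
    proof -
      have "\<bar>f y - f x - l * (y - x)\<bar> \<le> (r / 2) * \<bar>y - x\<bar>"
      proof (cases "x < y")
        case True
        have "\<forall>\<^sub>F a in at_left x. \<bar>f y - f a - l * (y - a)\<bar> \<le> (r / 2) * (y - a)"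
        proof -
          have "\<forall>\<^sub>F a in at_left x. a \<in> {y - d<..<x}"
            using y True by (intro eventually_at_left_real) auto
          then show ?thesis by eventually_elim (use D True in auto)
        qed
        moreover have "((\<lambda>a. \<bar>f y - f a - l * (y - a)\<bar>) \<longlongrightarrow> \<bar>f y - f x - l * (y - x)\<bar>) (at_left x)"
          using cont by (intro tendsto_intros) (auto simp: continuous_on_def intro: tendsto_within_subset)
        moreover have "((\<lambda>a. (r / 2) * (y - a)) \<longlongrightarrow> (r / 2) * \<bar>y - x\<bar>) (at_left x)"
          using True by (auto intro!: tendsto_eq_intros)
        ultimately show ?thesis
          by (intro tendsto_le[OF trivial_limit_at_left_real])
      next
        case False
        have "\<forall>\<^sub>F b in at_right x. \<bar>f b - f y - l * (b - y)\<bar> \<le> (r / 2) * (b - y)"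
        proof -
          have "\<forall>\<^sub>F b in at_right x. b \<in> {x<..<y + d}"
            using y False by (intro eventually_at_right_real) auto
          then show ?thesis by eventually_elim (use D False y in auto)
        qed
        moreover have "((\<lambda>b. \<bar>f b - f y - l * (b - y)\<bar>) \<longlongrightarrow> \<bar>f x - f y - l * (x - y)\<bar>) (at_right x)"
          using cont by (intro tendsto_intros) (auto simp: continuous_on_def intro: tendsto_within_subset)
        moreover have "((\<lambda>b. (r / 2) * (b - y)) \<longlongrightarrow> (r / 2) * (x - y)) (at_right x)"
          by (intro tendsto_intros)
        ultimately have "\<bar>f x - f y - l * (x - y)\<bar> \<le> (r / 2) * (x - y)"
          by (intro tendsto_le[OF trivial_limit_at_right_real])
        then show ?thesis using False by (simp add: abs_if algebra_simps split: if_splits)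
      qed
      moreover have "(f y - f x) / (y - x) - l = (f y - f x - l * (y - x)) / (y - x)"
        using y by (simp add: field_simps)
      ultimately have "\<bar>(f y - f x) / (y - x) - l\<bar> \<le> r / 2"
        using y by (simp add: abs_divide divide_simps mult.commute)
      then show ?thesis using r by simp
    qed
    then show "\<exists>s>0. \<forall>y. y \<noteq> x \<and> norm (y - x) < s \<longrightarrow> norm ((f y - f x) / (y - x) - l) < r"
      using d by blast
  qed
  then show ?thesis by (simp add: has_field_derivative_iff)
qed

text \<open>The set is a countable intersection of unions of open intervals, hence a G-delta set,
  whatever the predicate \<open>Q\<close> is.\<close>

lemma borel_small_intervals:
  "{x::real. \<forall>d>0. \<exists>a b. Q a b \<and> a < x \<and> x < b \<and> b - a < d} \<in> sets borel" (is "?A \<in> _")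
proof -
  define W where "W n = (\<Union>(a, b)\<in>{(a, b). Q a b \<and> b - a < 1 / real (Suc n)}. {a<..<b})" for n
  have "?A = (\<Inter>n. W n)"
  proof (intro set_eqI iffI)
    fix x assume "x \<in> (\<Inter>n. W n)"
    then have *: "\<exists>a b. Q a b \<and> a < x \<and> x < b \<and> b - a < 1 / real (Suc n)" for n
      unfolding W_def by fastforce
    have "\<exists>a b. Q a b \<and> a < x \<and> x < b \<and> b - a < d" if d: "d > 0" for d
    proof -
      obtain n where "1 / real (Suc n) < d" using nat_approx_posE[OF d] by metis
      then show ?thesis using *[of n] by (meson less_trans)
    qed
    then show "x \<in> ?A" by blast
  next
    fix x assume x: "x \<in> ?A"
    show "x \<in> (\<Inter>n. W n)"
    proof
      fix n
      have "0 < 1 / real (Suc n)" by simp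
      with x obtain a b where "Q a b" "a < x" "x < b" "b - a < 1 / real (Suc n)" by blast
      then show "x \<in> W n" unfolding W_def by force
    qed
  qed
  moreover have "open (W n)" for n by (auto simp: W_def)
  ultimately show ?thesis by (auto intro!: sets.countable_INT)
qed

text \<open>\<open>H q\<close> and \<open>K p\<close> collect the points with quotients at least
  \<open>q\<close>, respectively at most \<open>p\<close>, over arbitrarily short intervals. For
  rational p < q their intersection is null. Off the union of these null sets the upper and lower
  derivates agree, and the derivative is the supremum of all \<open>q\<close> with
  \<open>x \<in> H q\<close>, which is finite by the Lipschitz bound.\<close>

lemma mono_lipschitz_differentiable_ae:
  fixes f :: "real \<Rightarrow> real"
  assumes lip: "L-lipschitz_on UNIV f" and mono: "mono f"
  shows "negligible {x. \<not> f differentiable at x}"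
proof -
  have cont: "continuous_on UNIV f" using lip lipschitz_on_continuous_on by blast
  have fL: "f b - f a \<le> L * (b - a)" if "a \<le> b" for a b
    using lipschitz_onD[OF lip, of b a] that by (auto simp: dist_real_def)
  have f0: "0 \<le> f b - f a" if "a \<le> b" for a b
    using monoD[OF mono that] by simp
  define H where "H q = {x. \<forall>d>0. \<exists>a b. q * (b - a) \<le> f b - f a \<and> a < x \<and> x < b \<and> b - a < d}" for q
  define K where "K p = {x. \<forall>d>0. \<exists>a b. f b - f a \<le> p * (b - a) \<and> a < x \<and> x < b \<and> b - a < d}" for p
  have Hm: "H q \<in> sets borel" and Km: "K q \<in> sets borel" for q
    unfolding H_def K_def by (rule borel_small_intervals)+
  have neg: "negligible (H q \<inter> K p \<inter> {- real n..real n})" if "0 \<le> p" "p < q" for p q n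
    using mono cont that Hm Km
    by (intro negligible_distinct_derivates[of f p q]) (auto simp: H_def K_def intro: bounded_subset)
  \<comment> \<open>The sets are cut into bounded pieces because
    \<open>negligible_distinct_derivates\<close> treats bounded sets.\<close>
  define N where "N = (\<Union>(p, q)\<in>{(p, q). p \<in> \<rat> \<and> q \<in> \<rat> \<and> 0 \<le> p \<and> p < q}. \<Union>n. H q \<inter> K p \<inter> {- real n..real n})"
  have "countable {(p, q::real). p \<in> \<rat> \<and> q \<in> \<rat> \<and> 0 \<le> p \<and> p < q}"
    by (rule countable_subset[of _ "\<rat> \<times> \<rat>"]) (auto intro: countable_rat)
  then have "N \<in> null_sets lebesgue"
    unfolding N_def using neg
    by (intro null_sets_UN') (auto simp: negligible_iff_null_sets simp del: UN_simps)
  then have "negligible N" by (simp add: negligible_iff_null_sets)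
  moreover have "{x. \<not> f differentiable at x} \<subseteq> N"
  proof (rule ccontr)
    assume "\<not> {x. \<not> f differentiable at x} \<subseteq> N"
    then obtain x where nd: "\<not> f differentiable at x" and xN: "x \<notin> N" by auto
    have sep: "\<not> (x \<in> H q \<and> x \<in> K p)" if "0 \<le> p" "p < q" "p \<in> \<rat>" "q \<in> \<rat>" for p q
    proof -
      obtain n where "\<bar>x\<bar> \<le> real n" using real_arch_simple by blast
      then show ?thesis using xN that unfolding N_def by (auto simp: abs_le_iff)
    qed
    have H0: "0 \<in> {q. x \<in> H q}"
    proof -
      have "\<exists>a b. 0 \<le> f b - f a \<and> a < x \<and> x < b \<and> b - a < d" if "d > 0" for d
        using that f0[of "x - d / 3" "x + d / 3"]
        by (intro exI[of _ "x - d / 3"] exI[of _ "x + d / 3"]) auto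
      then show ?thesis by (auto simp: H_def)
    qed
    have HL: "q \<le> L" if xH: "x \<in> H q" for q
    proof -
      obtain a b where "q * (b - a) \<le> f b - f a" "a < x" "x < b"
        using xH zero_less_one[where 'a=real] unfolding H_def by blast
      with fL[of a b] have "q * (b - a) \<le> L * (b - a)" "0 < b - a" by linarith+
      then show ?thesis by (simp add: mult_le_cancel_right)
    qed
    define l where "l = Sup {q. x \<in> H q}"
    have bdd: "bdd_above {q. x \<in> H q}" using HL by (auto simp: bdd_above_def)
    have Hmono: "x \<in> H q" if xH: "x \<in> H q'" and le: "q \<le> q'" for q q'
      unfolding H_def
    proof (intro CollectI allI impI)
      fix d :: real assume "d > 0"
      then obtain a b where ab: "q' * (b - a) \<le> f b - f a" "a < x" "x < b" "b - a < d"
        using xH unfolding H_def by blast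
      moreover have "q * (b - a) \<le> q' * (b - a)"
        using ab le by (intro mult_right_mono) auto
      ultimately show "\<exists>a b. q * (b - a) \<le> f b - f a \<and> a < x \<and> x < b \<and> b - a < d"
        by (intro exI[of _ a] exI[of _ b] conjI) linarith+
    qed
    have l0: "l \<ge> 0" using H0 bdd by (auto simp: l_def intro: cSup_upper)
    have "(f has_real_derivative l) (at x)"
    proof (rule has_real_derivative_of_interval_quotients[OF cont])
      fix e :: real assume e: "e > 0"
      have "x \<notin> H (l + e)"
        using cSup_upper[OF _ bdd, of "l + e"] e by (auto simp: l_def)
      then obtain d1 where d1: "d1 > 0" "\<And>a b. a < x \<Longrightarrow> x < b \<Longrightarrow> b - a < d1 \<Longrightarrow> f b - f a < (l + e) * (b - a)"
        unfolding H_def by (auto simp: not_le)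
      \<comment> \<open>The null sets in \<open>N\<close> are indexed by \<open>p \<ge> 0\<close>.
        If \<open>l - e < 0\<close>, no such \<open>p\<close> is called for, since monotonicity
        already bounds the quotients below by 0.\<close>
      obtain d2 where d2: "d2 > 0" "\<And>a b. a < x \<Longrightarrow> x < b \<Longrightarrow> b - a < d2 \<Longrightarrow> (l - e) * (b - a) \<le> f b - f a"
      proof (cases "l - e < 0")
        case True
        show ?thesis
          by (rule that[of 1]) (use f0 True in \<open>auto intro: order_trans[OF mult_nonpos_nonneg]\<close>)
      next
        case False
        obtain p where p: "p \<in> \<rat>" "l - e < p" "p < l - e / 2"
          using Rats_dense_in_real[of "l - e" "l - e / 2"] e by auto
        obtain q where q: "q \<in> \<rat>" "l - e / 2 < q" "q < l"
          using Rats_dense_in_real[of "l - e / 2" l] e by auto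
        obtain q' where "x \<in> H q'" "q < q'"
          using less_cSupD[of "{q. x \<in> H q}" q] q(3) H0 by (auto simp: l_def)
        then have "x \<in> H q" using Hmono by auto
        with sep[of p q] p q False have "x \<notin> K p" by auto
        then obtain d where "d > 0" "\<And>a b. a < x \<Longrightarrow> x < b \<Longrightarrow> b - a < d \<Longrightarrow> f b - f a > p * (b - a)"
          unfolding K_def by (auto simp: not_le)
        moreover have "(l - e) * (b - a) \<le> p * (b - a)" if "a < b" for a b
          using p that by (intro mult_right_mono) auto
        ultimately show ?thesis using that[of d] by (meson less_imp_le less_trans order_trans)
      qed
      have "\<bar>f b - f a - l * (b - a)\<bar> \<le> e * (b - a)" if "a < x" "x < b" "b - a < min d1 d2" for a b
        using d1(2)[of a b] d2(2)[of a b] that by (auto simp: abs_le_iff algebra_simps)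
      then show "\<exists>d>0. \<forall>a b. a < x \<and> x < b \<and> b - a < d \<longrightarrow> \<bar>f b - f a - l * (b - a)\<bar> \<le> e * (b - a)"
        using d1(1) d2(1) by (intro exI[of _ "min d1 d2"]) auto
    qed
    with nd show False by (auto simp: real_differentiable_def)
  qed
  ultimately show ?thesis by (rule negligible_subset)
qed

text \<open>Adding the line \<open>L * x\<close> makes \<open>f\<close> monotone without affecting
  differentiability.\<close>

lemma lipschitz_real_differentiable_ae:
  fixes f :: "real \<Rightarrow> real"
  assumes lip: "L-lipschitz_on UNIV f"
  shows "negligible {x. \<not> f differentiable at x}"
proof -
  have 1: "(L + L)-lipschitz_on UNIV (\<lambda>x. f x + L * x)"
    using lip lipschitz_on_cmult_real_nonneg[OF lipschitz_on_id lipschitz_on_nonneg[OF lip]]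
    by (intro lipschitz_on_add) auto
  have 2: "mono (\<lambda>x. f x + L * x)"
  proof (rule monoI)
    fix x y :: real assume "x \<le> y"
    then show "f x + L * x \<le> f y + L * y"
      using lipschitz_onD[OF lip, of x y] by (auto simp: dist_real_def algebra_simps)
  qed
  have "f differentiable at x" if "(\<lambda>x. f x + L * x) differentiable at x" for x
  proof -
    have "(\<lambda>x. (f x + L * x) - L * x) differentiable at x"
      using that by (intro differentiable_diff) auto
    then show ?thesis by simp
  qed
  then have "{x. \<not> f differentiable at x} \<subseteq> {x. \<not> (\<lambda>x. f x + L * x) differentiable at x}" by auto
  then show ?thesis
    using mono_lipschitz_differentiable_ae[OF 1 2] negligible_subset by blast
qed

subsection \<open>Smooth bump functions\<close>

lemma Ck_imp_continuous: "Ck k f \<Longrightarrow> continuous_on UNIV f"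
  by (cases k) (simp_all add: continuous_at_imp_continuous_on differentiable_imp_continuous_within)

lemma Ck_Suc_imp: "Ck (Suc k) f \<Longrightarrow> Ck k f"
proof (induction k arbitrary: f)
  case 0
  then show ?case using Ck_imp_continuous by (metis Ck.simps(1))
next
  case (Suc k)
  then show ?case by (metis Ck.simps(2))
qed

lemma Ck_const: "Ck k (\<lambda>x. c)"
  by (induction k arbitrary: c) auto

lemma Ck_bounded_linear: 
  assumes "bounded_linear h" "Ck k f"
  shows "Ck k (\<lambda>x. h (f x))"
  using assms(2)
proof (induction k arbitrary: f)
  case 0
  then show ?case using bounded_linear.continuous_on[OF assms(1)] by auto
next
  case (Suc k)
  have d: "((\<lambda>x. h (f x)) has_derivative (\<lambda>v. h (frechet_derivative f (at x) v))) (at x)" for x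
    using Suc.prems by (intro bounded_linear.has_derivative[OF assms(1)]) (auto simp: frechet_derivative_works)
  then have "frechet_derivative (\<lambda>x. h (f x)) (at x) = (\<lambda>v. h (frechet_derivative f (at x) v))" for x
    by (metis frechet_derivative_at)
  then show ?case using d Suc by (auto simp: differentiable_def)
qed

lemma Ck_add:
  assumes "Ck k f" "Ck k g"
  shows "Ck k (\<lambda>x. f x + g x)"
  using assms
proof (induction k arbitrary: f g)
  case 0
  then show ?case by (auto intro: continuous_intros)
next
  case (Suc k)
  have d: "((\<lambda>x. f x + g x) has_derivative (\<lambda>v. frechet_derivative f (at x) v + frechet_derivative g (at x) v)) (at x)" for x
    using Suc.prems by (intro derivative_intros) (auto simp: frechet_derivative_works)
  then have "frechet_derivative (\<lambda>x. f x + g x) (at x) = (\<lambda>v. frechet_derivative f (at x) v + frechet_derivative g (at x) v)" for x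
    by (metis frechet_derivative_at)
  then show ?case using d Suc by (auto simp: differentiable_def)
qed

lemma Ck_mult:
  fixes f g :: "'a::real_normed_vector \<Rightarrow> real"
  assumes "Ck k f" "Ck k g"
  shows "Ck k (\<lambda>x. f x * g x)"
  using assms
proof (induction k arbitrary: f g)
  case 0
  then show ?case by (auto intro: continuous_intros)
next
  case (Suc k)
  have d: "((\<lambda>x. f x * g x) has_derivative (\<lambda>v. f x * frechet_derivative g (at x) v + frechet_derivative f (at x) v * g x)) (at x)" for x
    using Suc.prems by (intro derivative_intros) (auto simp: frechet_derivative_works)
  then have *: "frechet_derivative (\<lambda>x. f x * g x) (at x) = (\<lambda>v. f x * frechet_derivative g (at x) v + frechet_derivative f (at x) v * g x)" for x
    by (metis frechet_derivative_at)
  show ?case using d Suc Ck_Suc_imp[OF Suc.prems(1)] Ck_Suc_imp[OF Suc.prems(2)]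
    by (auto simp: differentiable_def * intro: Ck_add)
qed

lemma Ck_prod:
  fixes f :: "'i \<Rightarrow> 'a::real_normed_vector \<Rightarrow> real"
  assumes "\<And>i. i \<in> I \<Longrightarrow> Ck k (f i)"
  shows "Ck k (\<lambda>x. \<Prod>i\<in>I. f i x)"
  using assms
proof (induction I rule: infinite_finite_induct)
  case (insert i I)
  have "Ck k (\<lambda>x. f i x * (\<Prod>i\<in>I. f i x))"
    using insert by (intro Ck_mult) auto
  then show ?case using insert by simp
qed (simp_all add: Ck_const)

text \<open>The classical smooth function exp(-1/t) with a polynomial in 1/t as a factor. The
  polynomial makes the family closed under differentiation, so that smoothness of every order is a
  single induction.\<close>

definition flat :: "real poly \<Rightarrow> real \<Rightarrow> real" where
  "flat p t = (if t > 0 then poly p (1 / t) * exp (- (1 / t)) else 0)"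

lemma poly_div_exp_tendsto_0: "((\<lambda>s. poly p s * exp (- s)) \<longlongrightarrow> 0) at_top" for p :: "real poly"
proof -
  \<comment> \<open>The power \<open>s ^ k\<close> strengthens the induction:
    \<open>pCons a p\<close> is \<open>a\<close> plus \<open>s\<close> times \<open>p\<close>, and
    the factor \<open>s\<close> is absorbed by raising \<open>k\<close>.\<close>
  have "((\<lambda>s. s ^ k * (poly p s * exp (- s))) \<longlongrightarrow> 0) at_top" for k
  proof (induction p arbitrary: k)
    case 0
    then show ?case by simp
  next
    case (pCons a p)
    have "((\<lambda>s. a * (s ^ k / exp s) + s ^ Suc k * (poly p s * exp (- s))) \<longlongrightarrow> a * 0 + 0) at_top"
      by (intro tendsto_add tendsto_mult tendsto_const tendsto_power_div_exp_0 pCons)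
    moreover have "(\<lambda>s. s ^ k * (poly (pCons a p) s * exp (- s))) =
        (\<lambda>s. a * (s ^ k / exp s) + s ^ Suc k * (poly p s * exp (- s)))"
      by (auto simp: exp_minus field_simps)
    ultimately show ?case by simp
  qed
  from this[of 0] show ?thesis by simp
qed

lemma flat_tendsto_0: "(flat p \<longlongrightarrow> 0) (at 0)"
proof -
  have "((\<lambda>t. poly p (inverse t) * exp (- inverse t)) \<longlongrightarrow> 0) (at_right 0)"
    using filterlim_compose[OF poly_div_exp_tendsto_0 filterlim_inverse_at_top_right] .
  moreover have "\<forall>\<^sub>F t in at_right 0. poly p (inverse t) * exp (- inverse t) = flat p t"
    by (auto simp: eventually_at_filter flat_def inverse_eq_divide)
  ultimately have "(flat p \<longlongrightarrow> 0) (at_right 0)"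
    using tendsto_cong by force
  moreover have "(flat p \<longlongrightarrow> 0) (at_left 0)"
  proof (rule Lim_transform_eventually)
    show "((\<lambda>t. 0) \<longlongrightarrow> 0) (at_left 0)" by simp
    show "\<forall>\<^sub>F t in at_left 0. 0 = flat p t"
      by (auto simp: eventually_at_filter flat_def)
  qed
  ultimately show ?thesis by (simp add: filterlim_split_at)
qed

text \<open>With s = 1/t one has ds/dt = -s^2, so the derivative of p(s) exp(-s) in t is s^2 (p -
  p')(s) exp(-s).\<close>

definition flat_pderiv :: "real poly \<Rightarrow> real poly" where
  "flat_pderiv p = [:0, 0, 1:] * (p - pderiv p)"

lemma DERIV_flat: "(flat p has_real_derivative flat (flat_pderiv p) t) (at t)"
proof (cases "t = 0")
  case True
  \<comment> \<open>At the origin the difference quotient is again a member of the family, with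
    \<open>p\<close> multiplied by the variable, and every member tends to 0 there.\<close>
  have "((\<lambda>y. (flat p y - flat p 0) / (y - 0)) \<longlongrightarrow> 0) (at 0)"
  proof (rule Lim_transform_eventually)
    show "(flat ([:0, 1:] * p) \<longlongrightarrow> 0) (at 0)" by (rule flat_tendsto_0)
    show "\<forall>\<^sub>F y in at 0. flat ([:0, 1:] * p) y = (flat p y - flat p 0) / (y - 0)"
      by (auto simp: eventually_at_filter flat_def)
  qed
  then show ?thesis using True by (simp add: has_field_derivative_iff flat_def)
next
  case False
  then consider "t > 0" | "t < 0" by linarith
  then show ?thesis
  proof cases
    case 1
    have "((\<lambda>t. poly p (1 / t) * exp (- (1 / t))) has_real_derivative flat (flat_pderiv p) t) (at t)"
      using 1 by (auto intro!: derivative_eq_intros DERIV_chain'[OF _ poly_DERIV]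
          simp: flat_def flat_pderiv_def field_simps power2_eq_square)
    then show ?thesis
    proof (rule has_field_derivative_transform_within_open[where S="{0<..}"])
      show "poly p (1 / x) * exp (- (1 / x)) = flat p x" if "x \<in> {0<..}" for x
        using that by (simp add: flat_def)
    qed (use 1 in auto)
  next
    case 2
    have "((\<lambda>t. 0) has_real_derivative flat (flat_pderiv p) t) (at t)"
      using 2 by (simp add: flat_def)
    then show ?thesis
      by (rule has_field_derivative_transform_within_open[where S="{..<0}"]) (use 2 in \<open>auto simp: flat_def\<close>)
  qed
qed

text \<open>The affine argument \<open>c + x \<bullet> v\<close> covers both kinds of factors of a
  bump, those increasing and those decreasing in a coordinate.\<close>

lemma Ck_flat: "Ck k (\<lambda>x::'a::real_inner. flat p (c + x \<bullet> v))"
proof (induction k arbitrary: p)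
  case 0
  have "continuous_on UNIV (flat p)"
    by (intro continuous_at_imp_continuous_on ballI DERIV_isCont[OF DERIV_flat])
  then have "continuous_on UNIV (\<lambda>x. flat p (c + x \<bullet> v))"
    by (rule continuous_on_compose2[of UNIV "flat p" UNIV]) (intro continuous_intros, simp)
  then show ?case by simp
next
  case (Suc k)
  have d: "((\<lambda>x. flat p (c + x \<bullet> v)) has_derivative (\<lambda>w. flat (flat_pderiv p) (c + x \<bullet> v) * (w \<bullet> v))) (at x)" for x
  proof -
    have "((\<lambda>x. c + x \<bullet> v) has_derivative (\<lambda>w. w \<bullet> v)) (at x)"
      by (auto intro!: derivative_eq_intros)
    from has_derivative_compose[OF this DERIV_flat[unfolded has_field_derivative_def]]
    show ?thesis by simp
  qed
  then have *: "frechet_derivative (\<lambda>x. flat p (c + x \<bullet> v)) (at x) = (\<lambda>w. flat (flat_pderiv p) (c + x \<bullet> v) * (w \<bullet> v))" for x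
    by (metis frechet_derivative_at)
  have "Ck k (\<lambda>x. flat (flat_pderiv p) (c + x \<bullet> v) * (w \<bullet> v))" for w
    by (rule Ck_mult[OF Suc Ck_const])
  then show ?case
    using d by (auto simp: differentiable_def *)
qed

text \<open>Being a product over the coordinates, it is positive exactly on \<open>box a b\<close>.
  The parameter \<open>n\<close> drives each factor to 1 at positive arguments, so that bumps on a
  fixed box approximate its indicator.\<close>

definition bump :: "real \<Rightarrow> 'a::euclidean_space \<Rightarrow> 'a \<Rightarrow> 'a \<Rightarrow> real" where
  "bump n a b x = (\<Prod>i\<in>Basis. flat 1 (n * (x \<bullet> i - a \<bullet> i)) * flat 1 (n * (b \<bullet> i - x \<bullet> i)))"

lemma flat_1_bounds: "0 \<le> flat 1 t" "flat 1 t \<le> 1" "flat 1 t > 0 \<longleftrightarrow> t > 0"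
  by (simp_all add: flat_def)

lemma Ck_bump: "Ck k (bump n a b)"
proof -
  have 1: "flat 1 (n * (x \<bullet> i - a \<bullet> i)) = flat 1 (- n * (a \<bullet> i) + x \<bullet> (n *\<^sub>R i))" for x i
    by (simp add: algebra_simps)
  have 2: "flat 1 (n * (b \<bullet> i - x \<bullet> i)) = flat 1 (n * (b \<bullet> i) + x \<bullet> (- n *\<^sub>R i))" for x i
    by (simp add: algebra_simps)
  show ?thesis
    unfolding bump_def[abs_def] by (intro Ck_prod Ck_mult) (subst 1 2, rule Ck_flat)+
qed

lemma bump_nonneg: "0 \<le> bump n a b x"
  unfolding bump_def by (intro prod_nonneg mult_nonneg_nonneg flat_1_bounds)

lemma bump_le_1: "bump n a b x \<le> 1"
  unfolding bump_def by (intro prod_le_1) (auto intro!: mult_le_one flat_1_bounds mult_nonneg_nonneg)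

lemma bump_pos_iff: "n > 0 \<Longrightarrow> 0 < bump n a b x \<longleftrightarrow> x \<in> box a b"
proof -
  assume n: "n > 0"
  have "0 < bump n a b x \<longleftrightarrow> (\<forall>i\<in>Basis. flat 1 (n * (x \<bullet> i - a \<bullet> i)) > 0 \<and> flat 1 (n * (b \<bullet> i - x \<bullet> i)) > 0)"
  proof
    assume "0 < bump n a b x"
    then have "\<forall>i\<in>Basis. flat 1 (n * (x \<bullet> i - a \<bullet> i)) * flat 1 (n * (b \<bullet> i - x \<bullet> i)) \<noteq> 0"
      unfolding bump_def by (auto simp: prod_zero_iff less_le)
    then show "\<forall>i\<in>Basis. flat 1 (n * (x \<bullet> i - a \<bullet> i)) > 0 \<and> flat 1 (n * (b \<bullet> i - x \<bullet> i)) > 0"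
      using flat_1_bounds(1) by (auto simp: less_le)
  qed (auto simp: bump_def intro!: prod_pos)
  then show ?thesis using n by (auto simp: flat_1_bounds box_def zero_less_mult_iff)
qed

lemma bump_eq_0: "n > 0 \<Longrightarrow> x \<notin> box a b \<Longrightarrow> bump n a b x = 0"
  using bump_pos_iff[of n a b x] bump_nonneg[of n a b x] by (auto simp: less_le)

lemma bump_tendsto_indicator:
  "(\<lambda>n. bump (real (Suc n)) a b x) \<longlonglongrightarrow> indicator (box a b) x"
proof (cases "x \<in> box a b")
  case True
  have fl: "(\<lambda>n. flat 1 (real (Suc n) * t)) \<longlonglongrightarrow> 1" if t: "t > 0" for t
  proof -
    have "(\<lambda>n. exp (- (1 / t * inverse (real (Suc n))))) \<longlonglongrightarrow> exp (- (1 / t * 0))"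
      by (intro tendsto_intros LIMSEQ_inverse_real_of_nat)
    moreover have "flat 1 (real (Suc n) * t) = exp (- (1 / t * inverse (real (Suc n))))" for n
    proof -
      have "0 < real (Suc n) * t" using t by (intro mult_pos_pos) auto
      then show ?thesis by (simp add: flat_def divide_inverse mult.commute del: of_nat_Suc)
    qed
    ultimately show ?thesis by simp
  qed
  have "(\<lambda>n. bump (real (Suc n)) a b x) \<longlonglongrightarrow> (\<Prod>i\<in>(Basis::'a set). 1 * 1)"
    unfolding bump_def using True by (intro tendsto_prod tendsto_mult fl) (auto simp: box_def)
  then show ?thesis using True by simp
next
  case False
  then show ?thesis by (simp add: bump_eq_0)
qed

lemma bump_measurable [measurable]: "bump n a b \<in> borel_measurable borel"
  using Ck_bump[of 0] by (auto intro: borel_measurable_continuous_onI)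

lemma bump_differentiable: "(bump n a b) differentiable (at x)"
  using Ck_bump[of 1 n a b] by simp

lemma bump_translate: "bump n a b (x + c) = bump n (a - c) (b - c) x"
proof -
  have "(x + c) \<bullet> i - a \<bullet> i = x \<bullet> i - (a - c) \<bullet> i" "b \<bullet> i - (x + c) \<bullet> i = (b - c) \<bullet> i - x \<bullet> i" for i
    by (simp_all add: inner_diff_left inner_add_left)
  then show ?thesis by (simp only: bump_def)
qed

text \<open>The derivative is continuous, hence bounded on the compact \<open>cbox a b\<close>, and
  it vanishes off that box.\<close>

lemma bump_lipschitz:
  assumes n: "n > 0"
  obtains K where "K-lipschitz_on UNIV (bump n a b)"
proof -
  have cont: "continuous_on UNIV (\<lambda>x. frechet_derivative (bump n a b) (at x) v)" for v
    using Ck_bump[of 1 n a b] by simp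
  have d: "(bump n a b has_derivative frechet_derivative (bump n a b) (at x)) (at x)" for x
    using bump_differentiable frechet_derivative_works by blast
  have "\<exists>K. \<forall>x\<in>cbox a b. \<bar>frechet_derivative (bump n a b) (at x) i\<bar> \<le> K" for i
  proof -
    have "bounded ((\<lambda>x. frechet_derivative (bump n a b) (at x) i) ` cbox a b)"
      by (intro compact_imp_bounded compact_continuous_image continuous_on_subset[OF cont]) auto
    then show ?thesis unfolding bounded_iff by auto
  qed
  then obtain K where K: "\<And>i x. x \<in> cbox a b \<Longrightarrow> \<bar>frechet_derivative (bump n a b) (at x) i\<bar> \<le> K i" by metis
  define M where "M = (\<Sum>i\<in>Basis. K i)"
  have on: "onorm (frechet_derivative (bump n a b) (at x)) \<le> max M 0" for x
  proof (cases "x \<in> cbox a b")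
    case True
    show ?thesis
    proof (rule onorm_le)
      fix v :: 'a
      interpret linear "frechet_derivative (bump n a b) (at x)"
        using d has_derivative_linear by blast
      have "frechet_derivative (bump n a b) (at x) v = frechet_derivative (bump n a b) (at x) (\<Sum>i\<in>Basis. (v \<bullet> i) *\<^sub>R i)"
        by (simp add: euclidean_representation)
      also have "\<dots> = (\<Sum>i\<in>Basis. (v \<bullet> i) * frechet_derivative (bump n a b) (at x) i)"
        by (simp add: sum scale)
      also have "norm \<dots> \<le> (\<Sum>i\<in>Basis. norm v * K i)"
        using K[OF True] by (intro sum_norm_le) (auto simp: abs_mult intro!: mult_mono Basis_le_norm)
      also have "\<dots> \<le> max M 0 * norm v"
        unfolding M_def sum_distrib_left[symmetric]
        by (subst mult.commute) (intro mult_right_mono, auto)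
      finally show "norm (frechet_derivative (bump n a b) (at x) v) \<le> max M 0 * norm v" .
    qed
  next
    case False
    have "(bump n a b has_derivative (\<lambda>v. 0)) (at x)"
    proof (rule has_derivative_transform_within_open[where s="- cbox a b"])
      show "((\<lambda>x. 0) has_derivative (\<lambda>v. 0)) (at x)" by simp
      show "0 = bump n a b y" if "y \<in> - cbox a b" for y
        using that bump_eq_0[OF n, of y a b] box_subset_cbox by (metis Compl_iff subsetD)
    qed (use False in auto)
    then have "frechet_derivative (bump n a b) (at x) = (\<lambda>v. 0)" by (metis frechet_derivative_at)
    then show ?thesis by (simp add: onorm_zero)
  qed
  show ?thesis
  proof (rule that[of "max M 0"])
    show "(max M 0)-lipschitz_on UNIV (bump n a b)"
    proof (rule lipschitz_onI)
      show "dist (bump n a b x) (bump n a b y) \<le> max M 0 * dist x y" for x y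
        unfolding dist_norm using d on
        by (intro differentiable_bound[of UNIV "bump n a b" "\<lambda>x. frechet_derivative (bump n a b) (at x)"]) auto
    qed simp
  qed
qed

section \<open>The fundamental lemma of the calculus of variations\<close>

lemma integrable_indicator_box: "integrable lborel (\<lambda>x. C * indicat_real (box a b) x)"
proof -
  have "integrable lborel (indicat_real (box a b))"
    by (rule integrable_real_indicator) (use emeasure_lborel_box_finite in auto)
  then show ?thesis by (rule integrable_mult_right)
qed

text \<open>Boxes form an intersection-stable generator of the Borel sets, and the sets over which
  \<open>h\<close> integrates to 0 are closed under complements and countable disjoint unions. As
  \<open>h\<close> vanishes off \<open>box c d\<close> and two boxes meet in a box, subboxes of
  \<open>box c d\<close> are enough.\<close>

lemma AE_zero_of_box_integrals:
  fixes h :: "'a::euclidean_space \<Rightarrow> real"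
  assumes h: "integrable lborel h" and S: "\<And>x. x \<notin> box c d \<Longrightarrow> h x = 0"
    and box: "\<And>a b. box a b \<subseteq> box c d \<Longrightarrow> (\<integral>x. indicator (box a b) x * h x \<partial>lborel) = 0"
  shows "AE x in lborel. h x = 0"
proof (rule sigma_finite_measure.density_zero[OF sigma_finite_lborel h])
  have int: "set_integrable lborel A h" if "A \<in> sets borel" for A
    unfolding set_integrable_def by (rule integrable_mult_indicator) (use that h in auto)
  have all: "(LINT x:box a b|lborel. h x) = 0" for a b
  proof -
    obtain a' b' where ab: "box a b \<inter> box c d = box a' b'" unfolding box_Int_box by blast
    have "(\<integral>x. indicator (box a' b') x * h x \<partial>lborel) = 0"
      using ab by (intro box) auto
    moreover have "indicator (box a b) x *\<^sub>R h x = indicator (box a' b') x * h x" for x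
      using S[of x] by (auto simp: ab[symmetric] indicator_def)
    ultimately show ?thesis by (simp only: set_lebesgue_integral_def)
  qed
  have univ: "(\<integral>x. h x \<partial>lborel) = 0"
  proof -
    have "(\<integral>x. h x \<partial>lborel) = (LINT x:box c d|lborel. h x)"
      unfolding set_lebesgue_integral_def using S
      by (intro Bochner_Integration.integral_cong) (auto simp: indicator_def)
    then show ?thesis using all[of c d] by simp
  qed
  fix A :: "'a set" assume A: "A \<in> sets lborel"
  have IS: "Int_stable (range (\<lambda>(a, b). box a b :: 'a set))"
  proof (rule Int_stableI)
    fix A B :: "'a set" assume "A \<in> range (\<lambda>(a, b). box a b)" "B \<in> range (\<lambda>(a, b). box a b)"
    then obtain a b c d where "A = box a b" "B = box c d" by auto
    moreover obtain a' b' where "box a b \<inter> box c d = box a' b'" unfolding box_Int_box by blast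
    ultimately have "A \<inter> B = (\<lambda>(a, b). box a b) (a', b')" by simp
    then show "A \<inter> B \<in> range (\<lambda>(a, b). box a b)" by (rule range_eqI)
  qed
  have cl: "range (\<lambda>(a, b). box a b) \<subseteq> Pow (UNIV :: 'a set)" by simp
  from A have "A \<in> sigma_sets UNIV (range (\<lambda>(a, b). box a b))"
    by (simp add: borel_eq_box)
  then show "(LINT x:A|lborel. h x) = 0"
  proof (induction A rule: sigma_sets_induct_disjoint[OF IS cl, consumes 1, case_names basic empty compl union])
    case (basic A)
    then show ?case using all by auto
  next
    case empty
    show ?case by (simp add: set_lebesgue_integral_def)
  next
    case (compl A)
    then have A: "A \<in> sets borel" by (simp add: borel_eq_box)
    have "(LINT x:UNIV - A|lborel. h x) = (\<integral>x. h x - indicator A x *\<^sub>R h x \<partial>lborel)"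
      unfolding set_lebesgue_integral_def by (intro Bochner_Integration.integral_cong) (auto simp: indicator_def)
    also have "\<dots> = (\<integral>x. h x \<partial>lborel) - (LINT x:A|lborel. h x)"
      unfolding set_lebesgue_integral_def using h int[OF A]
      by (intro Bochner_Integration.integral_diff) (auto simp: set_integrable_def)
    finally show ?case using compl univ by simp
  next
    case (union A)
    then have A: "A i \<in> sets borel" for i by (auto simp: borel_eq_box)
    have "(LINT x:(\<Union>i. A i)|lborel. h x) = (\<Sum>i. (LINT x:(A i)|lborel. h x))"
      using union A by (intro lebesgue_integral_countable_add int) (auto simp: disjoint_family_on_def)
    then show ?case using union by simp
  qed
qed

text \<open>Bumps converge to the indicator of their box while \<open>h\<close> stays bounded, so
  the integrals of \<open>h\<close> over boxes vanish too; countably many such boxes exhaust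
  \<open>S\<close>. The lemma serves below to identify weak derivatives with pointwise ones.\<close>

lemma AE_zero_of_bump_integrals:
  fixes h :: "'a::euclidean_space \<Rightarrow> real"
  assumes [measurable]: "h \<in> borel_measurable borel" and C: "AE x in lborel. \<bar>h x\<bar> \<le> C" and S: "open S"
    and bump: "\<And>n a b. n > 0 \<Longrightarrow> cbox a b \<subseteq> S \<Longrightarrow> (\<integral>x. h x * bump n a b x \<partial>lborel) = 0"
  shows "AE x in lborel. x \<in> S \<longrightarrow> h x = 0"
proof -
  have box0: "(\<integral>x. h x * indicator (box a b) x \<partial>lborel) = 0" if ab: "cbox a b \<subseteq> S" for a b
  proof -
    have "(\<lambda>n. \<integral>x. h x * bump (real (Suc n)) a b x \<partial>lborel) \<longlonglongrightarrow> (\<integral>x. h x * indicator (box a b) x \<partial>lborel)"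
    proof (rule integral_dominated_convergence[where w="\<lambda>x. C * indicator (box a b) x"])
      show "integrable lborel (\<lambda>x. C * indicat_real (box a b) x)"
        by (rule integrable_indicator_box)
      show "AE x in lborel. (\<lambda>n. h x * bump (real (Suc n)) a b x) \<longlonglongrightarrow> h x * indicator (box a b) x"
        by (intro AE_I2 tendsto_mult tendsto_const bump_tendsto_indicator)
      show "AE x in lborel. norm (h x * bump (real (Suc n)) a b x) \<le> C * indicator (box a b) x" for n
        using C
      proof eventually_elim
        case (elim x)
        then have "\<bar>h x\<bar> * bump (real (Suc n)) a b x \<le> C * 1" if "x \<in> box a b"
          by (intro mult_mono bump_nonneg bump_le_1) auto
        then show ?case
          using bump_nonneg[of "real (Suc n)" a b x] bump_eq_0[of "real (Suc n)" x a b]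
          by (auto simp: abs_mult indicator_def)
      qed
    qed auto
    then show ?thesis using bump[OF _ ab] by (simp add: LIMSEQ_const_iff)
  qed
  have small: "AE x in lborel. x \<in> box c d \<longrightarrow> h x = 0" if cd: "cbox c d \<subseteq> S" for c d
  proof -
    have int: "integrable lborel (\<lambda>x. indicator (box c d) x * h x)"
    proof (rule Bochner_Integration.integrable_bound[where f="\<lambda>x. C * indicator (box c d) x"])
      show "integrable lborel (\<lambda>x. C * indicat_real (box c d) x)"
        by (rule integrable_indicator_box)
      show "AE x in lborel. norm (indicator (box c d) x * h x) \<le> norm (C * indicat_real (box c d) x)"
        using C by eventually_elim (auto simp: indicator_def)
    qed auto
    have "AE x in lborel. indicator (box c d) x * h x = 0"
    proof (rule AE_zero_of_box_integrals[OF int, of c d])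
      fix a b assume ab: "box a b \<subseteq> box c d"
      show "(\<integral>x. indicator (box a b) x * (indicator (box c d) x * h x) \<partial>lborel) = 0"
      proof (cases "box a b = {}")
        case False
        then have "cbox a b \<subseteq> cbox c d"
          using closure_mono[OF ab] ab by (metis closure_box closure_empty subset_empty)
        then have "cbox a b \<subseteq> S" using cd by auto
        from box0[OF this] show ?thesis
          using ab by (subst Bochner_Integration.integral_cong[OF refl, where g="\<lambda>x. h x * indicator (box a b) x"])
            (auto simp: indicator_def)
      qed auto
    qed auto
    then show ?thesis by eventually_elim (auto simp: indicator_def)
  qed
  obtain D where D: "countable D" "\<And>X. X \<in> D \<Longrightarrow> \<exists>a b. X = box a b \<and> cbox a b \<subseteq> S" "S \<subseteq> \<Union>D"
  proof -
    define Q where "Q = {X. \<exists>a b. X = box a b \<and> cbox a b \<subseteq> S}"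
    have op: "\<And>X. X \<in> Q \<Longrightarrow> open X" by (auto simp: Q_def)
    obtain D1 where D1: "D1 \<subseteq> Q" "countable D1" "\<Union>D1 = \<Union>Q"
      by (rule Lindelof[OF op])
    have "S \<subseteq> \<Union>Q"
    proof
      fix x assume "x \<in> S"
      then obtain a b where "cbox a b \<subseteq> S" "x \<in> box a b"
        by (rule open_contains_cbox[OF S]) (rule that)
      then show "x \<in> \<Union>Q" by (auto simp: Q_def)
    qed
    then show ?thesis using D1 by (intro that[of D1]) (auto simp: Q_def)
  qed
  have "AE x in lborel. \<forall>X\<in>D. x \<in> X \<longrightarrow> h x = 0"
  proof (subst AE_ball_countable[OF D(1)], rule ballI)
    fix X assume "X \<in> D"
    then obtain a b where "X = box a b" "cbox a b \<subseteq> S" using D(2) by blast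
    then show "AE x in lborel. x \<in> X \<longrightarrow> h x = 0" using small by simp
  qed
  then show ?thesis
  proof eventually_elim
    case (elim x)
    show ?case
    proof
      assume "x \<in> S"
      then obtain X where "X \<in> D" "x \<in> X" using D(3) by blast
      then show "h x = 0" using elim by blast
    qed
  qed
qed

subsection \<open>Rademacher's theorem\<close>

lemma integral_lborel_translate:
  fixes F :: "'a::euclidean_space \<Rightarrow> 'b::{banach, second_countable_topology}"
  assumes [measurable]: "F \<in> borel_measurable borel"
  shows "(\<integral>x. F (x + c) \<partial>lborel) = (\<integral>x. F x \<partial>lborel)"
proof -
  have "(\<integral>x. F x \<partial>lborel) = (\<integral>x. F x \<partial>distr lborel borel ((+) c))"
    by (simp add: lborel_distr_plus)
  also have "\<dots> = (\<integral>x. F (c + x) \<partial>lborel)"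
    by (rule integral_distr) auto
  finally show ?thesis by (simp add: add.commute)
qed

lemma lborel_integrable_translate:
  fixes F :: "'a::euclidean_space \<Rightarrow> 'b::{banach, second_countable_topology}"
  assumes "integrable lborel F"
  shows "integrable lborel (\<lambda>x. F (x + c))"
proof -
  have [measurable]: "F \<in> borel_measurable borel" using borel_measurable_integrable[OF assms] by simp
  have "integrable (distr lborel borel ((+) c)) F" using assms by (simp add: lborel_distr_plus)
  then have "integrable lborel (\<lambda>x. F (c + x))" by (subst (asm) integrable_distr_eq) auto
  then show ?thesis by (simp add: add.commute)
qed

lemma emeasure_lborel_translate:
  fixes N :: "'a::euclidean_space set"
  assumes [measurable]: "N \<in> sets borel"
  shows "(\<integral>\<^sup>+x. indicator N (x + c) \<partial>lborel) = emeasure lborel N"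
proof -
  have "emeasure lborel N = (\<integral>\<^sup>+x. indicator N x \<partial>distr lborel borel ((+) c))"
    by (simp add: lborel_distr_plus)
  also have "\<dots> = (\<integral>\<^sup>+x. indicator N (c + x) \<partial>lborel)"
    by (rule nn_integral_distr) auto
  finally show ?thesis by (simp add: add.commute)
qed

text \<open>With rational increments the Cauchy criterion for the quotients uses countable
  quantifiers only, which makes the set of differentiability points Borel in the application.
  Continuity of \<open>f\<close> recovers real increments.\<close>

lemma has_real_derivative_of_rational_quotients:
  fixes f :: "real \<Rightarrow> real"
  assumes cont: "continuous_on UNIV f"
    and cauchy: "\<And>k::nat. \<exists>m::nat. \<forall>s t::rat. s \<noteq> 0 \<and> t \<noteq> 0 \<and> \<bar>of_rat s\<bar> < 1 / real (Suc m) \<and> \<bar>of_rat t\<bar> < 1 / real (Suc m) \<longrightarrow>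
        \<bar>(f (of_rat s) - f 0) / of_rat s - (f (of_rat t) - f 0) / of_rat t\<bar> \<le> 1 / real (Suc k)"
  shows "f differentiable (at 0)"
proof -
  define q where "q t = (f t - f 0) / t" for t
  have contq: "continuous_on (- {0}) q"
    unfolding q_def by (intro continuous_intros continuous_on_subset[OF cont]) auto
  define m where "m k = (SOME m::nat. \<forall>s t::rat. s \<noteq> 0 \<and> t \<noteq> 0 \<and> \<bar>of_rat s\<bar> < 1 / real (Suc m) \<and> \<bar>of_rat t\<bar> < 1 / real (Suc m) \<longrightarrow>
        \<bar>q (of_rat s) - q (of_rat t)\<bar> \<le> 1 / real (Suc k))" for k
  have m: "\<bar>q (of_rat s) - q (of_rat t)\<bar> \<le> 1 / real (Suc k)"
    if "s \<noteq> 0" "t \<noteq> 0" "\<bar>of_rat s\<bar> < 1 / real (Suc (m k))" "\<bar>of_rat t\<bar> < 1 / real (Suc (m k))" for s t :: rat and k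
    using someI_ex[OF cauchy[of k, folded q_def]] that unfolding m_def by blast
  define r where "r n = q (of_rat (1 / of_nat (Suc n)))" for n
  have rr: "of_rat (1 / of_nat (Suc n)) = 1 / real (Suc n)" for n
    by (simp only: of_rat_divide of_rat_1 of_rat_of_nat_eq)
  have r_small: "\<bar>of_rat (1 / of_nat (Suc n)) :: real\<bar> < 1 / real (Suc j)" if "n > j" for n j
    using that by (simp only: rr) (simp add: field_simps)
  have "Cauchy r"
  proof (rule metric_CauchyI)
    fix e :: real assume "e > 0"
    then obtain k where k: "1 / real (Suc k) < e" using nat_approx_posE by blast
    have "dist (r i) (r j) < e" if "i \<ge> Suc (m k)" "j \<ge> Suc (m k)" for i j
      using m[of "1 / of_nat (Suc i)" "1 / of_nat (Suc j)" k] r_small[of "m k" i] r_small[of "m k" j] that k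
      by (simp add: r_def dist_real_def del: of_nat_Suc)
    then show "\<exists>M. \<forall>i\<ge>M. \<forall>j\<ge>M. dist (r i) (r j) < e" by blast
  qed
  then obtain D where D: "r \<longlonglongrightarrow> D" using Cauchy_convergent_iff convergent_def by blast
  have ratD: "\<bar>q (of_rat t) - D\<bar> \<le> 1 / real (Suc k)" if "t \<noteq> 0" "\<bar>of_rat t\<bar> < 1 / real (Suc (m k))" for t :: rat and k
  proof (rule tendsto_le[OF sequentially_bot tendsto_const])
    show "(\<lambda>n. \<bar>q (of_rat t) - r n\<bar>) \<longlonglongrightarrow> \<bar>q (of_rat t) - D\<bar>" by (intro tendsto_intros D)
    show "\<forall>\<^sub>F n in sequentially. \<bar>q (of_rat t) - r n\<bar> \<le> 1 / real (Suc k)"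
      unfolding eventually_sequentially
    proof (intro exI[of _ "Suc (m k)"] allI impI)
      fix n assume "n \<ge> Suc (m k)"
      then show "\<bar>q (of_rat t) - r n\<bar> \<le> 1 / real (Suc k)"
        unfolding r_def using that r_small[of "m k" n] by (intro m) auto
    qed
  qed
  \<comment> \<open>If the bound failed at a real \<open>t\<close>, it would fail on a neighbourhood
    of \<open>t\<close> by continuity, and this neighbourhood contains a rational.\<close>
  have realD: "\<bar>q t - D\<bar> \<le> 1 / real (Suc k)" if t: "t \<noteq> 0" "\<bar>t\<bar> < 1 / real (Suc (m k))" for t :: real and k
  proof (rule ccontr)
    assume n: "\<not> ?thesis"
    define I where "I = {- (1 / real (Suc (m k)))<..<1 / real (Suc (m k))} - {0}"
    have "open I" by (auto simp: I_def)
    have "continuous_on I (\<lambda>t. \<bar>q t - D\<bar>)"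
      by (intro continuous_intros continuous_on_subset[OF contq]) (auto simp: I_def)
    then have "open (I \<inter> (\<lambda>t. \<bar>q t - D\<bar>) -` {1 / real (Suc k)<..})"
      using \<open>open I\<close> by (subst Int_commute) (simp add: continuous_on_open_vimage[OF \<open>open I\<close>] Int_commute)
    moreover have "t \<in> I \<inter> (\<lambda>t. \<bar>q t - D\<bar>) -` {1 / real (Suc k)<..}"
      using n t unfolding I_def by auto
    ultimately obtain e where e: "e > 0" "ball t e \<subseteq> I \<inter> (\<lambda>t. \<bar>q t - D\<bar>) -` {1 / real (Suc k)<..}"
      by (meson openE)
    obtain w where w: "w \<in> \<rat>" "t - e < w" "w < t + e"
      using Rats_dense_in_real[of "t - e" "t + e"] e by auto
    then obtain s where s: "w = of_rat s" by (meson Rats_cases)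
    have "w \<in> ball t e" using w by (auto simp: dist_real_def)
    then have "w \<in> I" "\<bar>q w - D\<bar> > 1 / real (Suc k)" using e by auto
    moreover from \<open>w \<in> I\<close> have "s \<noteq> 0" "\<bar>of_rat s :: real\<bar> < 1 / real (Suc (m k))"
      unfolding I_def s abs_less_iff by (auto simp del: of_nat_Suc)
    ultimately show False using ratD[of s k] s by auto
  qed
  have "((\<lambda>t. (f t - f 0) / (t - 0)) \<longlongrightarrow> D) (at 0)"
  proof (rule LIM_I)
    fix e :: real assume "e > 0"
    then obtain k where k: "1 / real (Suc k) < e" using nat_approx_posE by blast
    have "norm ((f t - f 0) / (t - 0) - D) < e" if "t \<noteq> 0" "norm (t - 0) < 1 / real (Suc (m k))" for t
      using realD[of t k] that k by (simp add: q_def)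
    then show "\<exists>s>0. \<forall>x. x \<noteq> 0 \<and> norm (x - 0) < s \<longrightarrow> norm ((f x - f 0) / (x - 0) - D) < e"
      by (intro exI[of _ "1 / real (Suc (m k))"]) simp
  qed
  then have "(f has_real_derivative D) (at 0)" by (simp add: has_field_derivative_iff)
  then show ?thesis by (auto simp: real_differentiable_def)
qed

lemma lipschitz_on_line:
  fixes f :: "'a::real_normed_vector \<Rightarrow> real"
  assumes "L-lipschitz_on UNIV f"
  shows "(L * norm v)-lipschitz_on UNIV (\<lambda>t. f (x + t *\<^sub>R v))"
proof (rule lipschitz_onI)
  show "dist (f (x + s *\<^sub>R v)) (f (x + t *\<^sub>R v)) \<le> L * norm v * dist s t" for s t
    using lipschitz_onD[OF assms, of "x + s *\<^sub>R v" "x + t *\<^sub>R v"]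
    by (simp add: dist_norm scaleR_left_diff_distrib[symmetric] ac_simps)
qed (use lipschitz_on_nonneg[OF assms] in auto)

lemma lipschitz_measurable:
  fixes f :: "'a::euclidean_space \<Rightarrow> 'b::real_normed_vector"
  shows "L-lipschitz_on UNIV f \<Longrightarrow> f \<in> borel_measurable borel"
  by (rule borel_measurable_continuous_onI) (rule lipschitz_on_continuous_on)

text \<open>By the one-dimensional result each line in direction \<open>v\<close> meets the Borel
  set \<open>N\<close> of bad points in a null set. Instead of splitting the space along
  \<open>v\<close>, the measure of \<open>N\<close> is written as the average over
  \<open>t \<in> {0..1}\<close> of the measures of its translates by multiples of \<open>v\<close>,
  and Fubini exchanges the two integrations.\<close>

lemma lipschitz_directional_derivative_ae:
  fixes f :: "'a::euclidean_space \<Rightarrow> real"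
  assumes lip: "L-lipschitz_on UNIV f"
  shows "AE x in lborel. (\<lambda>t. f (x + t *\<^sub>R v)) differentiable (at 0)"
proof -
  note [measurable] = lipschitz_measurable[OF lip]
  define q where "q x t = (f (x + t *\<^sub>R v) - f x) / t" for x t
  have [measurable]: "(\<lambda>x. q x t) \<in> borel_measurable borel" for t
    unfolding q_def by measurable
  define N where "N = {x. \<not> (\<forall>k::nat. \<exists>m::nat. \<forall>s t::rat. s \<noteq> 0 \<and> t \<noteq> 0 \<and> \<bar>of_rat s\<bar> < 1 / real (Suc m) \<and> \<bar>of_rat t\<bar> < 1 / real (Suc m) \<longrightarrow>
        \<bar>q x (of_rat s) - q x (of_rat t)\<bar> \<le> 1 / real (Suc k))}"
  have [measurable]: "N \<in> sets borel" unfolding N_def by measurable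
  have out: "(\<lambda>t. f (x + t *\<^sub>R v)) differentiable (at 0)" if "x \<notin> N" for x
  proof (rule has_real_derivative_of_rational_quotients)
    show "continuous_on UNIV (\<lambda>t. f (x + t *\<^sub>R v))"
      using lipschitz_on_continuous_on[OF lipschitz_on_line[OF lip]] .
  next
    fix k :: nat
    show "\<exists>m::nat. \<forall>s t::rat. s \<noteq> 0 \<and> t \<noteq> 0 \<and> \<bar>of_rat s\<bar> < 1 / real (Suc m) \<and> \<bar>of_rat t\<bar> < 1 / real (Suc m) \<longrightarrow>
        \<bar>(f (x + of_rat s *\<^sub>R v) - f (x + 0 *\<^sub>R v)) / of_rat s - (f (x + of_rat t *\<^sub>R v) - f (x + 0 *\<^sub>R v)) / of_rat t\<bar> \<le> 1 / real (Suc k)"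
      using that unfolding N_def q_def scaleR_zero_left add_0_right mem_Collect_eq not_not by (rule spec)
  qed
  have inN: "x \<notin> N" if d: "(\<lambda>t. f (x + t *\<^sub>R v)) differentiable (at 0)" for x
  proof -
    obtain D where "((\<lambda>t. f (x + t *\<^sub>R v)) has_real_derivative D) (at 0)"
      using d by (auto simp: real_differentiable_def)
    then have D: "(q x \<longlongrightarrow> D) (at 0)" by (simp add: has_field_derivative_iff q_def[abs_def])
    have "\<exists>m::nat. \<forall>s t::rat. s \<noteq> 0 \<and> t \<noteq> 0 \<and> \<bar>of_rat s\<bar> < 1 / real (Suc m) \<and> \<bar>of_rat t\<bar> < 1 / real (Suc m) \<longrightarrow>
        \<bar>q x (of_rat s) - q x (of_rat t)\<bar> \<le> 1 / real (Suc k)" for k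
    proof -
      have "0 < 1 / real (Suc k) / 2" by simp
      from LIM_D[OF D this] obtain d where d: "d > 0"
        "\<And>t. t \<noteq> 0 \<Longrightarrow> \<bar>t\<bar> < d \<Longrightarrow> \<bar>q x t - D\<bar> < 1 / real (Suc k) / 2" by auto
      obtain m where m: "1 / real (Suc m) < d" using nat_approx_posE[OF d(1)] by blast
      show ?thesis
      proof (intro exI[of _ m] allI impI)
        fix s t :: rat
        assume "s \<noteq> 0 \<and> t \<noteq> 0 \<and> \<bar>of_rat s\<bar> < 1 / real (Suc m) \<and> \<bar>of_rat t\<bar> < 1 / real (Suc m)"
        then have "\<bar>q x (of_rat s) - D\<bar> < 1 / real (Suc k) / 2" "\<bar>q x (of_rat t) - D\<bar> < 1 / real (Suc k) / 2"
          using d(2)[of "of_rat s"] d(2)[of "of_rat t"] m by auto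
        from add_strict_mono[OF this]
        have "\<bar>q x (of_rat s) - D\<bar> + \<bar>q x (of_rat t) - D\<bar> < 1 / real (Suc k)"
          unfolding field_sum_of_halves .
        moreover have "\<bar>q x (of_rat s) - q x (of_rat t)\<bar> \<le> \<bar>q x (of_rat s) - D\<bar> + \<bar>q x (of_rat t) - D\<bar>"
          by (rule abs_leI) (simp_all add: abs_if)
        ultimately show "\<bar>q x (of_rat s) - q x (of_rat t)\<bar> \<le> 1 / real (Suc k)"
          by (rule order_trans[OF _ less_imp_le, rotated])
      qed
    qed
    then show ?thesis unfolding N_def by blast
  qed
  have line: "(\<integral>\<^sup>+t. indicator {0..1} t * indicator N (x + t *\<^sub>R v) \<partial>lborel) = 0" for x
  proof -
    let ?T = "{t. x + t *\<^sub>R v \<in> N}"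
    have "?T \<subseteq> {t. \<not> (\<lambda>t. f (x + t *\<^sub>R v)) differentiable at t}"
    proof
      fix t assume t: "t \<in> ?T"
      show "t \<in> {t. \<not> (\<lambda>t. f (x + t *\<^sub>R v)) differentiable at t}"
      proof (rule ccontr)
        assume "t \<notin> {t. \<not> (\<lambda>t. f (x + t *\<^sub>R v)) differentiable at t}"
        then obtain D where "((\<lambda>t. f (x + t *\<^sub>R v)) has_real_derivative D) (at (t + 0))"
          by (auto simp: real_differentiable_def)
        then have "((\<lambda>s. f (x + (t + s) *\<^sub>R v)) has_real_derivative D) (at 0)"
          using DERIV_shift[of "\<lambda>t. f (x + t *\<^sub>R v)" D 0 t] by (simp add: add.commute)
        then have "(\<lambda>s. f (x + t *\<^sub>R v + s *\<^sub>R v)) differentiable (at 0)"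
          by (auto simp: real_differentiable_def scaleR_add_left add.assoc)
        with inN t show False by auto
      qed
    qed
    then have "negligible ?T"
      using lipschitz_real_differentiable_ae[OF lipschitz_on_line[OF lip]] negligible_subset by blast
    moreover have T[measurable]: "?T \<in> sets borel" by measurable
    ultimately have "emeasure lborel ?T = 0"
      by (simp add: negligible_iff_null_sets null_sets_def)
    moreover have "(\<integral>\<^sup>+t. indicator {0..1} t * indicator N (x + t *\<^sub>R v) \<partial>lborel) \<le> (\<integral>\<^sup>+t. indicator ?T t \<partial>lborel)"
      by (intro nn_integral_mono) (auto simp: indicator_def)
    ultimately show ?thesis by simp
  qed
  have "emeasure lborel N = (\<integral>\<^sup>+t. indicator {0..1::real} t * emeasure lborel N \<partial>lborel)"
    by (simp add: nn_integral_multc)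
  also have "\<dots> = (\<integral>\<^sup>+t. (\<integral>\<^sup>+x. indicator {0..1} t * indicator N (x + t *\<^sub>R v) \<partial>lborel) \<partial>lborel)"
    by (intro nn_integral_cong) (simp add: nn_integral_cmult emeasure_lborel_translate)
  also have "\<dots> = (\<integral>\<^sup>+x. (\<integral>\<^sup>+t. indicator {0..1} t * indicator N (x + t *\<^sub>R v) \<partial>lborel) \<partial>lborel)"
    by (rule lborel_pair.Fubini') measurable
  also have "\<dots> = 0" by (simp add: line)
  finally have "N \<in> null_sets lborel" by (simp add: null_sets_def)
  then have "AE x in lborel. x \<notin> N" by (rule AE_not_in)
  then show ?thesis by eventually_elim (rule out)
qed

text \<open>A directional derivative, taken along the fixed sequence 1/(n+1). In this form it is
  total and Borel for every Borel function; where the limit does not exist its value is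
  unspecified.\<close>

definition pd :: "'a::real_normed_vector \<Rightarrow> ('a \<Rightarrow> real) \<Rightarrow> 'a \<Rightarrow> real" where
  "pd v f x = lim (\<lambda>n. (f (x + (1 / real (Suc n)) *\<^sub>R v) - f x) / (1 / real (Suc n)))"

lemma difference_quotient_tendsto:
  fixes f :: "'a::real_normed_vector \<Rightarrow> real"
  assumes "((\<lambda>t. f (x + t *\<^sub>R v)) has_real_derivative D) (at 0)" "h \<longlonglongrightarrow> 0" "\<And>n. h n \<noteq> 0"
  shows "(\<lambda>n. (f (x + h n *\<^sub>R v) - f x) / h n) \<longlonglongrightarrow> D"
proof -
  have "((\<lambda>t. (f (x + t *\<^sub>R v) - f x) / t) \<longlongrightarrow> D) (at 0)"
    using assms(1) by (simp add: has_field_derivative_iff)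
  moreover have "filterlim h (at 0) sequentially"
    using assms(2,3) by (simp add: filterlim_at)
  ultimately show ?thesis by (rule filterlim_compose)
qed

lemma LIMSEQ_1_div_Suc: "(\<lambda>n. 1 / real (Suc n)) \<longlonglongrightarrow> 0"
  using LIMSEQ_inverse_real_of_nat by (simp add: inverse_eq_divide)

lemma pd_eqI: "((\<lambda>t. f (x + t *\<^sub>R v)) has_real_derivative D) (at 0) \<Longrightarrow> pd v f x = D"
  unfolding pd_def by (rule limI, rule difference_quotient_tendsto[OF _ LIMSEQ_1_div_Suc]) auto

lemma has_derivative_directional:
  fixes f :: "'a::real_normed_vector \<Rightarrow> real"
  assumes "(f has_derivative D) (at x)"
  shows "((\<lambda>t. f (x + t *\<^sub>R v)) has_real_derivative D v) (at 0)"
proof -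
  have "((\<lambda>t. x + t *\<^sub>R v) has_derivative (\<lambda>t. t *\<^sub>R v)) (at 0)"
    by (auto intro!: derivative_eq_intros)
  from has_derivative_compose[OF this, of f D] assms
  have "((\<lambda>t. f (x + t *\<^sub>R v)) has_derivative (\<lambda>t. D (t *\<^sub>R v))) (at 0)" by simp
  moreover have "(\<lambda>t. D (t *\<^sub>R v)) = (*) (D v)"
    using linear_scale[OF has_derivative_linear[OF assms]] by (auto simp: mult.commute)
  ultimately show ?thesis by (simp add: has_field_derivative_def)
qed

lemma pd_has_derivative: "(f has_derivative D) (at x) \<Longrightarrow> pd v f x = D v"
  by (rule pd_eqI[OF has_derivative_directional])

lemma pd_measurable [measurable (raw)]:
  fixes f :: "'a::euclidean_space \<Rightarrow> real"
  assumes [measurable]: "f \<in> borel_measurable borel"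
  shows "pd v f \<in> borel_measurable borel"
  unfolding pd_def[abs_def] by measurable

lemma pd_ae:
  fixes f :: "'a::euclidean_space \<Rightarrow> real"
  assumes lip: "L-lipschitz_on UNIV f"
  shows "AE x in lborel. ((\<lambda>t. f (x + t *\<^sub>R v)) has_real_derivative pd v f x) (at 0)"
  using lipschitz_directional_derivative_ae[OF lip, of v]
proof eventually_elim
  case (elim x)
  then obtain D where D: "((\<lambda>t. f (x + t *\<^sub>R v)) has_real_derivative D) (at 0)"
    by (auto simp: real_differentiable_def)
  with pd_eqI[OF D] show ?case by simp
qed

lemma lipschitz_difference_quotient_bound:
  fixes f :: "'a::real_normed_vector \<Rightarrow> real"
  assumes lip: "L-lipschitz_on UNIV f"
  shows "\<bar>(f (x + h *\<^sub>R v) - f x) / h\<bar> \<le> L * norm v"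
proof (cases "h = 0")
  case True
  then show ?thesis using lipschitz_on_nonneg[OF lip] by simp
next
  case False
  have "\<bar>f (x + h *\<^sub>R v) - f x\<bar> \<le> L * norm v * \<bar>h\<bar>"
    using lipschitz_onD[OF lip, of "x + h *\<^sub>R v" x] by (simp add: dist_norm dist_real_def ac_simps)
  then show ?thesis using False by (simp add: abs_divide divide_simps)
qed

lemma pd_bound_at:
  fixes f :: "'a::real_normed_vector \<Rightarrow> real"
  assumes lip: "L-lipschitz_on UNIV f" and d: "((\<lambda>t. f (x + t *\<^sub>R v)) has_real_derivative D) (at 0)"
  shows "\<bar>D\<bar> \<le> L * norm v"
proof -
  have "(\<lambda>n. \<bar>(f (x + (1 / real (Suc n)) *\<^sub>R v) - f x) / (1 / real (Suc n))\<bar>) \<longlonglongrightarrow> \<bar>D\<bar>"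
    by (intro tendsto_rabs difference_quotient_tendsto[OF d LIMSEQ_1_div_Suc]) auto
  moreover have "\<bar>(f (x + (1 / real (Suc n)) *\<^sub>R v) - f x) / (1 / real (Suc n))\<bar> \<le> L * norm v" for n
    by (rule lipschitz_difference_quotient_bound[OF lip])
  ultimately show ?thesis using LIMSEQ_le_const2 by blast
qed

lemma pd_bound_ae:
  fixes f :: "'a::euclidean_space \<Rightarrow> real"
  assumes lip: "L-lipschitz_on UNIV f"
  shows "AE x in lborel. \<bar>pd v f x\<bar> \<le> L * norm v"
  using pd_ae[OF lip, of v] by eventually_elim (rule pd_bound_at[OF lip])

lemma integrable_const_cball: "integrable lborel (\<lambda>x::'a::euclidean_space. C * indicat_real (cball a r) x)"
proof -
  have "integrable lborel (indicat_real (cball a r :: 'a set))"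
    by (rule integrable_real_indicator) (use emeasure_bounded_finite[of "cball a r"] in auto)
  then show ?thesis by (rule integrable_mult_right)
qed

lemma lipschitz_growth:
  fixes f :: "'a::real_normed_vector \<Rightarrow> real"
  assumes lip: "L-lipschitz_on UNIV f" and x: "x \<in> cball 0 r"
  shows "\<bar>f x\<bar> \<le> \<bar>f 0\<bar> + L * r"
proof -
  have "\<bar>f x - f 0\<bar> \<le> L * norm x" using lipschitz_onD[OF lip, of x 0] by (simp add: dist_real_def)
  also have "\<dots> \<le> L * r" using x lipschitz_on_nonneg[OF lip] by (intro mult_left_mono) auto
  finally show ?thesis by linarith
qed

lemma integrable_bounded_support:
  fixes F :: "'a::euclidean_space \<Rightarrow> real"
  assumes [measurable]: "F \<in> borel_measurable borel"
    and b: "AE x in lborel. \<bar>F x\<bar> \<le> C * indicator (cball 0 r) x"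
  shows "integrable lborel F"
proof (rule Bochner_Integration.integrable_bound[OF integrable_const_cball[of C 0 r]])
  show "AE x in lborel. norm (F x) \<le> norm (C * indicat_real (cball 0 r) x)"
    using b by eventually_elim simp
qed auto

text \<open>Translation invariance turns forward quotients of \<open>f\<close> into backward
  quotients of \<open>g\<close>. The Lipschitz constants bound the quotients and the support of
  \<open>g\<close> confines the integrals to a ball, so dominated convergence applies on both
  sides.\<close>

lemma pd_by_parts:
  fixes f g :: "'a::euclidean_space \<Rightarrow> real"
  assumes f: "L-lipschitz_on UNIV f" and g: "K-lipschitz_on UNIV g" and supp: "\<And>x. x \<notin> cball 0 r \<Longrightarrow> g x = 0"
  shows "(\<integral>x. pd v f x * g x \<partial>lborel) = - (\<integral>x. f x * pd v g x \<partial>lborel)"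
proof -
  note [measurable] = lipschitz_measurable[OF f] lipschitz_measurable[OF g]
  have L: "L \<ge> 0" and K: "K \<ge> 0" using f g lipschitz_on_nonneg by auto
  define h where "h n = 1 / real (Suc n)" for n
  have h: "h n > 0" "h n \<le> 1" for n by (auto simp: h_def field_simps)
  have h0: "h \<longlonglongrightarrow> 0" unfolding h_def[abs_def] by (rule LIMSEQ_1_div_Suc)
  \<comment> \<open>Shifts of the support are by \<open>h n *\<^sub>R v\<close> with
    \<open>h n \<le> 1\<close>, hence by at most \<open>norm v\<close>.\<close>
  define R where "R = r + norm v"
  define G where "G = \<bar>g 0\<bar> + K * \<bar>r\<bar>"
  have G: "G \<ge> 0" using K by (auto simp: G_def)
  have gG: "\<bar>g x\<bar> \<le> G * indicator (cball 0 r) x" for x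
  proof (cases "x \<in> cball 0 r")
    case True
    then show ?thesis using lipschitz_growth[OF g, of x "\<bar>r\<bar>"] by (auto simp: G_def)
  qed (simp add: supp)
  have gG': "\<bar>g x\<bar> \<le> G" for x
    using gG[of x] G by (cases "x \<in> cball 0 r") auto
  define F where "F = \<bar>f 0\<bar> + L * R"
  have fF: "\<bar>f x\<bar> \<le> F" if "x \<in> cball 0 R" for x
    using lipschitz_growth[OF f, of x R] that by (auto simp: F_def)
  have gsh: "g (x - h n *\<^sub>R v) = 0" if "x \<notin> cball 0 R" for x n
  proof (rule supp)
    have "norm x \<le> norm (x - h n *\<^sub>R v) + norm (h n *\<^sub>R v)" by (metis diff_add_cancel norm_triangle_ineq)
    also have "norm (h n *\<^sub>R v) \<le> norm v" using h[of n] by (simp add: mult_left_le_one_le)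
    finally show "x - h n *\<^sub>R v \<notin> cball 0 r" using that by (auto simp: R_def)
  qed
  have g0: "g x = 0" if "x \<notin> cball 0 R" for x
    using that by (intro supp) (auto simp: R_def intro: order_trans)
  have 1: "(\<lambda>n. \<integral>x. (f (x + h n *\<^sub>R v) - f x) / h n * g x \<partial>lborel) \<longlonglongrightarrow> (\<integral>x. pd v f x * g x \<partial>lborel)"
  proof (rule integral_dominated_convergence[OF _ _ integrable_const_cball[of "L * norm v * G" 0 r]])
    show "AE x in lborel. (\<lambda>n. (f (x + h n *\<^sub>R v) - f x) / h n * g x) \<longlonglongrightarrow> pd v f x * g x"
      using pd_ae[OF f, of v]
    proof eventually_elim
      case (elim x)
      then show ?case
        by (intro tendsto_mult tendsto_const difference_quotient_tendsto[OF _ h0]) (use h in \<open>auto simp: less_imp_neq[symmetric]\<close>)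
    qed
    show "AE x in lborel. norm ((f (x + h n *\<^sub>R v) - f x) / h n * g x) \<le> L * norm v * G * indicator (cball 0 r) x" for n
    proof (rule AE_I2)
      fix x
      have "norm ((f (x + h n *\<^sub>R v) - f x) / h n * g x) = \<bar>(f (x + h n *\<^sub>R v) - f x) / h n\<bar> * \<bar>g x\<bar>"
        by (simp add: abs_mult)
      also have "\<dots> \<le> (L * norm v) * (G * indicator (cball 0 r) x)"
        using L by (intro mult_mono lipschitz_difference_quotient_bound[OF f] gG) auto
      finally show "norm ((f (x + h n *\<^sub>R v) - f x) / h n * g x) \<le> L * norm v * G * indicator (cball 0 r) x"
        by (simp add: mult.assoc)
    qed
  qed measurable
  have 2: "(\<lambda>n. \<integral>x. f x * ((g (x + (- h n) *\<^sub>R v) - g x) / (- h n)) \<partial>lborel) \<longlonglongrightarrow> (\<integral>x. f x * pd v g x \<partial>lborel)"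
  proof (rule integral_dominated_convergence[OF _ _ integrable_const_cball[of "F * (K * norm v)" 0 R]])
    show "AE x in lborel. (\<lambda>n. f x * ((g (x + (- h n) *\<^sub>R v) - g x) / (- h n))) \<longlonglongrightarrow> f x * pd v g x"
      using pd_ae[OF g, of v]
    proof eventually_elim
      case (elim x)
      have "(\<lambda>n. - h n) \<longlonglongrightarrow> 0" using tendsto_minus[OF h0] by simp
      then show ?case
        using elim by (intro tendsto_mult tendsto_const difference_quotient_tendsto) (use h in \<open>auto simp: less_imp_neq[symmetric]\<close>)
    qed
    show "AE x in lborel. norm (f x * ((g (x + (- h n) *\<^sub>R v) - g x) / (- h n))) \<le> F * (K * norm v) * indicator (cball 0 R) x" for n
    proof (rule AE_I2)
      fix x
      show "norm (f x * ((g (x + (- h n) *\<^sub>R v) - g x) / (- h n))) \<le> F * (K * norm v) * indicator (cball 0 R) x"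
      proof (cases "x \<in> cball 0 R")
        case True
        have "\<bar>f x\<bar> * \<bar>(g (x + (- h n) *\<^sub>R v) - g x) / (- h n)\<bar> \<le> F * (K * norm v)"
          using fF[OF True] by (intro mult_mono lipschitz_difference_quotient_bound[OF g]) auto
        then show ?thesis using True unfolding real_norm_def abs_mult by simp
      next
        case False
        then show ?thesis using gsh[OF False, of n] g0[OF False] by simp
      qed
    qed
  qed measurable
  have eq: "(\<integral>x. (f (x + h n *\<^sub>R v) - f x) / h n * g x \<partial>lborel) = - (\<integral>x. f x * ((g (x + (- h n) *\<^sub>R v) - g x) / (- h n)) \<partial>lborel)" for n
  proof -
    have i1: "integrable lborel (\<lambda>x. f x * g (x - h n *\<^sub>R v))"
    proof (rule integrable_bounded_support[where C="F * G" and r=R])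
      show "AE x in lborel. \<bar>f x * g (x - h n *\<^sub>R v)\<bar> \<le> F * G * indicator (cball 0 R) x"
      proof (rule AE_I2)
        fix x
        have "\<bar>g (x - h n *\<^sub>R v)\<bar> \<le> G"
          by (rule gG')
        then show "\<bar>f x * g (x - h n *\<^sub>R v)\<bar> \<le> F * G * indicator (cball 0 R) x"
          using fF[of x] gsh[of x n] by (cases "x \<in> cball 0 R") (auto simp: abs_mult intro!: mult_mono)
      qed
    qed measurable
    have i2: "integrable lborel (\<lambda>x. f x * g x)"
    proof (rule integrable_bounded_support[where C="F * G" and r=R])
      show "AE x in lborel. \<bar>f x * g x\<bar> \<le> F * G * indicator (cball 0 R) x"
      proof (rule AE_I2)
        fix x
        have "\<bar>g x\<bar> \<le> G"
          by (rule gG')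
        then show "\<bar>f x * g x\<bar> \<le> F * G * indicator (cball 0 R) x"
          using fF[of x] g0[of x] by (cases "x \<in> cball 0 R") (auto simp: abs_mult intro!: mult_mono)
      qed
    qed measurable
    have i3: "integrable lborel (\<lambda>x. f (x + h n *\<^sub>R v) * g x)"
      using lborel_integrable_translate[of "\<lambda>x. f x * g (x - h n *\<^sub>R v)" "h n *\<^sub>R v"] i1 by simp
    have t: "(\<integral>x. f (x + h n *\<^sub>R v) * g x \<partial>lborel) = (\<integral>x. f x * g (x - h n *\<^sub>R v) \<partial>lborel)"
      using integral_lborel_translate[of "\<lambda>x. f x * g (x - h n *\<^sub>R v)" "h n *\<^sub>R v"] by simp
    have "(\<integral>x. (f (x + h n *\<^sub>R v) - f x) / h n * g x \<partial>lborel) = (\<integral>x. (f (x + h n *\<^sub>R v) * g x - f x * g x) / h n \<partial>lborel)"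
      by (intro Bochner_Integration.integral_cong) (auto simp: algebra_simps diff_divide_distrib)
    also have "\<dots> = ((\<integral>x. f x * g (x - h n *\<^sub>R v) \<partial>lborel) - (\<integral>x. f x * g x \<partial>lborel)) / h n"
      using i2 i3 t by simp
    also have "\<dots> = (\<integral>x. (f x * g (x - h n *\<^sub>R v) - f x * g x) / h n \<partial>lborel)"
      using i1 i2 by simp
    also have "\<dots> = (\<integral>x. - (f x * ((g (x + (- h n) *\<^sub>R v) - g x) / (- h n))) \<partial>lborel)"
      by (intro Bochner_Integration.integral_cong) (auto simp: algebra_simps diff_divide_distrib)
    finally show ?thesis by simp
  qed
  show ?thesis
    using LIMSEQ_unique[OF 1] tendsto_minus[OF 2] by (simp only: eq)
qed

text \<open>Linearity in the direction is clear for the smooth bumps. Integration by parts carries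
  it over to \<open>f\<close> in the weak sense, and the fundamental lemma makes it an identity
  almost everywhere.\<close>

lemma pd_representation_ae:
  fixes f :: "'a::euclidean_space \<Rightarrow> real"
  assumes f: "L-lipschitz_on UNIV f"
  shows "AE x in lborel. pd v f x = (\<Sum>i\<in>Basis. (v \<bullet> i) * pd i f x)"
proof -
  note [measurable] = lipschitz_measurable[OF f]
  have L: "L \<ge> 0" using f lipschitz_on_nonneg by auto
  define h where "h x = pd v f x - (\<Sum>i\<in>Basis. (v \<bullet> i) * pd i f x)" for x
  have [measurable]: "h \<in> borel_measurable borel" unfolding h_def[abs_def] by measurable
  define C where "C = L * norm v + (\<Sum>i\<in>(Basis::'a set). \<bar>v \<bullet> i\<bar> * L)"
  have hC: "AE x in lborel. \<bar>h x\<bar> \<le> C"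
  proof -
    have "AE x in lborel. \<forall>i\<in>Basis. \<bar>pd i f x\<bar> \<le> L * norm i"
    proof (subst AE_finite_all[OF finite_Basis], rule ballI)
      show "AE x in lborel. \<bar>pd i f x\<bar> \<le> L * norm i" for i by (rule pd_bound_ae[OF f])
    qed
    then show ?thesis using pd_bound_ae[OF f, of v]
    proof eventually_elim
      case (elim x)
      have "\<bar>h x\<bar> \<le> \<bar>pd v f x\<bar> + (\<Sum>i\<in>Basis. \<bar>(v \<bullet> i) * pd i f x\<bar>)"
        unfolding h_def by (rule order_trans[OF abs_triangle_ineq4 add_left_mono[OF sum_abs]])
      also have "\<dots> \<le> C"
        unfolding C_def using elim by (intro add_mono sum_mono) (auto simp: abs_mult intro!: mult_left_mono)
      finally show ?case .
    qed
  qed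
  have "AE x in lborel. x \<in> UNIV \<longrightarrow> h x = 0"
  proof (rule AE_zero_of_bump_integrals[OF _ hC])
    fix n :: real and a b :: 'a assume n: "n > 0"
    define g where "g = bump n a b"
    obtain K where K: "K-lipschitz_on UNIV g" unfolding g_def by (rule bump_lipschitz[OF n])
    note [measurable] = lipschitz_measurable[OF K]
    obtain r where r: "cbox a b \<subseteq> cball 0 r"
      using bounded_subset_ballD[OF bounded_cbox, of a b 0] ball_subset_cball by blast
    have supp: "g x = 0" if "x \<notin> cball 0 r" for x
      unfolding g_def using that r box_subset_cbox[of a b] by (intro bump_eq_0[OF n]) blast
    have gb: "\<bar>g x\<bar> \<le> 1" for x using bump_nonneg[of n a b x] bump_le_1[of n a b x] by (simp add: g_def)
    define D where "D x = frechet_derivative g (at x)" for x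
    have D: "(g has_derivative D x) (at x)" for x
      using bump_differentiable[of n a b x] by (simp add: D_def g_def frechet_derivative_works)
    have pdD: "pd w g x = D x w" for w x by (rule pd_has_derivative[OF D])
    have int: "integrable lborel (\<lambda>x. pd w f x * g x)" for w
    proof (rule integrable_bounded_support[where C="L * norm w" and r=r])
      show "AE x in lborel. \<bar>pd w f x * g x\<bar> \<le> L * norm w * indicator (cball 0 r) x"
        using pd_bound_ae[OF f, of w]
      proof eventually_elim
        case (elim x)
        have "\<bar>pd w f x\<bar> * \<bar>g x\<bar> \<le> L * norm w * 1" using elim gb[of x] L by (intro mult_mono) auto
        then show ?case using supp[of x] by (cases "x \<in> cball 0 r") (auto simp: abs_mult)
      qed
    qed measurable
    have intg: "integrable lborel (\<lambda>x. f x * pd w g x)" for w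
    proof (rule integrable_bounded_support[where C="(\<bar>f 0\<bar> + L * \<bar>r\<bar>) * (K * norm w)" and r="\<bar>r\<bar>"])
      show "AE x in lborel. \<bar>f x * pd w g x\<bar> \<le> (\<bar>f 0\<bar> + L * \<bar>r\<bar>) * (K * norm w) * indicator (cball 0 \<bar>r\<bar>) x"
      proof (rule AE_I2)
        fix x
        show "\<bar>f x * pd w g x\<bar> \<le> (\<bar>f 0\<bar> + L * \<bar>r\<bar>) * (K * norm w) * indicator (cball 0 \<bar>r\<bar>) x"
        proof (cases "x \<in> cball 0 \<bar>r\<bar>")
          case True
          have "\<bar>pd w g x\<bar> \<le> K * norm w"
            unfolding pdD by (rule pd_bound_at[OF K has_derivative_directional[OF D]])
          then have "\<bar>f x\<bar> * \<bar>pd w g x\<bar> \<le> (\<bar>f 0\<bar> + L * \<bar>r\<bar>) * (K * norm w)"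
            using L by (intro mult_mono lipschitz_growth[OF f True]) auto
          then show ?thesis using True by (simp add: abs_mult)
        next
          case False
          have "(g has_derivative (\<lambda>v. 0)) (at x)"
          proof (rule has_derivative_transform_within_open[where s="- cball 0 \<bar>r\<bar>"])
            show "((\<lambda>x. 0) has_derivative (\<lambda>v. 0)) (at x)" by simp
            show "0 = g y" if "y \<in> - cball 0 \<bar>r\<bar>" for y
              using that supp[of y] by auto
          qed (use False in auto)
          then have "pd w g x = 0" by (rule pd_has_derivative)
          then show ?thesis using False by simp
        qed
      qed
    qed measurable
    have "(\<integral>x. h x * g x \<partial>lborel) = (\<integral>x. pd v f x * g x - (\<Sum>i\<in>Basis. (v \<bullet> i) * (pd i f x * g x)) \<partial>lborel)"
      unfolding h_def by (intro Bochner_Integration.integral_cong) (auto simp: algebra_simps sum_distrib_left sum_distrib_right)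
    also have "\<dots> = (\<integral>x. pd v f x * g x \<partial>lborel) - (\<Sum>i\<in>Basis. (v \<bullet> i) * (\<integral>x. pd i f x * g x \<partial>lborel))"
      using int by simp
    also have "\<dots> = - (\<integral>x. f x * pd v g x \<partial>lborel) + (\<Sum>i\<in>Basis. (v \<bullet> i) * (\<integral>x. f x * pd i g x \<partial>lborel))"
      using pd_by_parts[OF f K supp] by (simp add: sum_negf)
    also have "(\<Sum>i\<in>Basis. (v \<bullet> i) * (\<integral>x. f x * pd i g x \<partial>lborel)) = (\<integral>x. (\<Sum>i\<in>Basis. (v \<bullet> i) * (f x * pd i g x)) \<partial>lborel)"
      using intg by simp
    also have "\<dots> = (\<integral>x. f x * pd v g x \<partial>lborel)"
    proof (intro Bochner_Integration.integral_cong refl)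
      fix x
      have "D x v = D x (\<Sum>i\<in>Basis. (v \<bullet> i) *\<^sub>R i)" by (simp add: euclidean_representation)
      also have "\<dots> = (\<Sum>i\<in>Basis. (v \<bullet> i) * D x i)"
        using has_derivative_linear[OF D[of x]] by (simp add: linear_sum linear_scale)
      finally show "(\<Sum>i\<in>Basis. (v \<bullet> i) * (f x * pd i g x)) = f x * pd v g x"
        by (simp add: pdD sum_distrib_left mult.left_commute)
    qed
    finally show "(\<integral>x. h x * bump n a b x \<partial>lborel) = 0" by (simp add: g_def)
  qed auto
  then show ?thesis by eventually_elim (simp add: h_def)
qed

text \<open>Almost everywhere the derivatives along a countable dense set of directions exist and
  are values of one linear map \<open>G\<close>. Finitely many of these directions come close to
  every unit vector, and the Lipschitz bound makes the passage from one direction to a nearby one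
  uniform.\<close>

theorem Rademacher:
  fixes f :: "'a::euclidean_space \<Rightarrow> real"
  assumes f: "L-lipschitz_on UNIV f"
  shows "AE x in lborel. (f has_derivative (\<lambda>v. \<Sum>i\<in>Basis. (v \<bullet> i) * pd i f x)) (at x)"
proof -
  have L: "L \<ge> 0" using f lipschitz_on_nonneg by auto
  obtain D :: "'a set" where D: "countable D" "\<And>X. open X \<Longrightarrow> X \<noteq> {} \<Longrightarrow> \<exists>d\<in>D. d \<in> X"
    using countable_dense_exists by metis
  have "AE x in lborel. \<forall>v\<in>D. ((\<lambda>t. f (x + t *\<^sub>R v)) has_real_derivative (\<Sum>i\<in>Basis. (v \<bullet> i) * pd i f x)) (at 0)"
  proof (subst AE_ball_countable[OF D(1)], rule ballI)
    fix v :: 'a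
    show "AE x in lborel. ((\<lambda>t. f (x + t *\<^sub>R v)) has_real_derivative (\<Sum>i\<in>Basis. (v \<bullet> i) * pd i f x)) (at 0)"
      using pd_ae[OF f, of v] pd_representation_ae[OF f, of v] by eventually_elim simp
  qed
  then show ?thesis
  proof eventually_elim
    case (elim x)
    define G where "G v = (\<Sum>i\<in>Basis. (v \<bullet> i) * pd i f x)" for v
    have lin: "bounded_linear G"
      unfolding G_def by (intro bounded_linear_sum bounded_linear_mult_const bounded_linear_inner_left)
    then obtain B where B: "B > 0" "\<And>v. \<bar>G v\<bar> \<le> B * norm v"
      using bounded_linear.pos_bounded[OF lin] by (auto simp: mult.commute)
    have "(f has_derivative G) (at x)"
      unfolding has_derivative_at_alt
    proof (intro conjI lin allI impI)
      fix e :: real assume e: "e > 0"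
      \<comment> \<open>Replacing a direction by one at distance less than \<eta> costs at most
        \<open>L * (t * \<eta>)\<close> for \<open>f\<close> and \<open>t * (B * \<eta>)\<close> for
        \<open>G\<close>; together this is \<open>e / 2 * t\<close>.\<close>
      define \<eta> where "\<eta> = e / (2 * (L + B))"
      have \<eta>: "\<eta> > 0" using e L B by (auto simp: \<eta>_def)
      have cov: "cball 0 1 \<subseteq> (\<Union>v\<in>D. ball v \<eta>)"
      proof
        fix w :: 'a
        obtain v where "v \<in> D" "v \<in> ball w \<eta>" using D(2)[of "ball w \<eta>"] \<eta> by auto
        then show "w \<in> (\<Union>v\<in>D. ball v \<eta>)" by (auto simp: dist_commute)
      qed
      obtain F where F: "F \<subseteq> D" "finite F" "cball 0 1 \<subseteq> (\<Union>v\<in>F. ball v \<eta>)"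
        by (rule compactE_image[OF compact_cball _ cov]) auto
      have "\<exists>d>0. \<forall>t. \<bar>t\<bar> < d \<longrightarrow> \<bar>f (x + t *\<^sub>R v) - f x - t * G v\<bar> \<le> e / 2 * \<bar>t\<bar>" if "v \<in> F" for v
      proof -
        have "((\<lambda>t. f (x + t *\<^sub>R v)) has_derivative (\<lambda>t. t * G v)) (at 0)"
          using elim that F(1) unfolding has_field_derivative_def G_def by (auto simp: mult.commute[of _ "sum _ _"])
        then show ?thesis
          unfolding has_derivative_at_alt using e half_gt_zero[OF e] by fastforce
      qed
      then obtain d where d: "\<And>v. v \<in> F \<Longrightarrow> d v > 0"
        "\<And>v t. v \<in> F \<Longrightarrow> \<bar>t\<bar> < d v \<Longrightarrow> \<bar>f (x + t *\<^sub>R v) - f x - t * G v\<bar> \<le> e / 2 * \<bar>t\<bar>"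
        by metis
      define d0 where "d0 = Min (insert 1 (d ` F))"
      have d0: "d0 > 0" "\<And>v. v \<in> F \<Longrightarrow> d0 \<le> d v"
        using d(1) F(2) by (auto simp: d0_def)
      have "norm (f y - f x - G (y - x)) \<le> e * norm (y - x)" if y: "norm (y - x) < d0" for y
      proof (cases "y = x")
        case True
        then show ?thesis using linear_0[OF bounded_linear.linear[OF lin]] by simp
      next
        case False
        define t where "t = norm (y - x)"
        have t: "t > 0" using False by (simp add: t_def)
        define w where "w = (1 / t) *\<^sub>R (y - x)"
        have yw: "y = x + t *\<^sub>R w" using t by (simp add: w_def)
        have "norm w = 1" using t by (simp add: w_def) (simp add: t_def)
        then obtain v where v: "v \<in> F" "norm (v - w) < \<eta>" using F(3) by (force simp: dist_norm)
        have 1: "\<bar>f (x + t *\<^sub>R v) - f x - t * G v\<bar> \<le> e / 2 * t"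
          using d(2)[OF v(1), of t] d0(2)[OF v(1)] y t by (simp add: t_def)
        have "\<bar>f (x + t *\<^sub>R w) - f (x + t *\<^sub>R v)\<bar> \<le> L * (t * norm (v - w))"
          using lipschitz_onD[OF f, of "x + t *\<^sub>R w" "x + t *\<^sub>R v"] t
          by (simp add: dist_norm scaleR_right_diff_distrib[symmetric] norm_minus_commute)
        also have "\<dots> \<le> L * (t * \<eta>)" using v t L by (intro mult_left_mono) auto
        finally have 2: "\<bar>f (x + t *\<^sub>R w) - f (x + t *\<^sub>R v)\<bar> \<le> L * (t * \<eta>)" .
        have "\<bar>t * G v - t * G w\<bar> = t * \<bar>G (v - w)\<bar>"
          using t linear_diff[OF bounded_linear.linear[OF lin]] by (simp add: abs_mult right_diff_distrib[symmetric])
        also have "\<dots> \<le> t * (B * \<eta>)"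
        proof (intro mult_left_mono)
          have "B * norm (v - w) \<le> B * \<eta>" using v B(1) by (intro mult_left_mono) auto
          with B(2)[of "v - w"] show "\<bar>G (v - w)\<bar> \<le> B * \<eta>" by linarith
        qed (use t in auto)
        finally have 3: "\<bar>t * G v - t * G w\<bar> \<le> t * (B * \<eta>)" .
        have "s * (e / (2 * s)) = e / 2" if "s \<noteq> 0" for s :: real using that by simp
        from this[of "L + B"] have "(L + B) * \<eta> = e / 2" using L B(1) by (simp only: \<eta>_def)
        then have "t * ((L + B) * \<eta>) = e / 2 * t" by simp
        then have 4: "L * (t * \<eta>) + t * (B * \<eta>) = e / 2 * t"
          by (simp add: algebra_simps)
        have 5: "G (y - x) = t * G w"
          using linear_scale[OF bounded_linear.linear[OF lin]] by (simp add: yw)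
        have "\<bar>f y - f x - G (y - x)\<bar> \<le> e * t"
          using 1 2 3 4 unfolding 5 by (simp only: yw)
        then show ?thesis by (simp add: t_def)
      qed
      then show "\<exists>d>0. \<forall>y. norm (y - x) < d \<longrightarrow> norm (f y - f x - G (y - x)) \<le> e * norm (y - x)"
        using d0(1) by blast
    qed
    then show ?case by (simp add: G_def[abs_def])
  qed
qed

subsection \<open>Commuting weak derivatives and mollification\<close>

lemma lipschitz_on_mult_bounded:
  fixes f g :: "'a::metric_space \<Rightarrow> real"
  assumes f: "L-lipschitz_on S f" "\<And>x. x \<in> S \<Longrightarrow> \<bar>f x\<bar> \<le> A"
    and g: "K-lipschitz_on S g" "\<And>x. x \<in> S \<Longrightarrow> \<bar>g x\<bar> \<le> B"
    and nonneg: "0 \<le> A" "0 \<le> B"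
  shows "(A * K + B * L)-lipschitz_on S (\<lambda>x. f x * g x)"
proof (rule lipschitz_onI)
  have LK: "0 \<le> L" "0 \<le> K" using f g lipschitz_on_nonneg by auto
  then show "0 \<le> A * K + B * L" using nonneg by simp
  fix x y assume x: "x \<in> S" and y: "y \<in> S"
  have "f x * g x - f y * g y = f x * (g x - g y) + g y * (f x - f y)" by (simp add: algebra_simps)
  then have "\<bar>f x * g x - f y * g y\<bar> \<le> \<bar>f x\<bar> * \<bar>g x - g y\<bar> + \<bar>g y\<bar> * \<bar>f x - f y\<bar>"
    by (metis abs_mult abs_triangle_ineq)
  also have "\<dots> \<le> A * (K * dist x y) + B * (L * dist x y)"
    using f(2)[OF x] g(2)[OF y] lipschitz_onD[OF f(1) x y] lipschitz_onD[OF g(1) x y] nonneg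
    by (intro add_mono mult_mono) (auto simp: dist_real_def)
  finally show "dist (f x * g x) (f y * g y) \<le> (A * K + B * L) * dist x y"
    by (simp add: dist_real_def algebra_simps)
qed

text \<open>Both sides are limits of difference quotients; pairing a forward quotient of \<open>a\<close> with a
  backward quotient of \<open>b\<close> makes the two discrete integrals equal by translation invariance.\<close>

lemma pd_commute:
  fixes a b :: "'a::euclidean_space \<Rightarrow> real"
  assumes a: "L-lipschitz_on UNIV a" and b: "K-lipschitz_on UNIV b" and supp: "\<And>x. x \<notin> cball 0 r \<Longrightarrow> a x = 0"
  shows "(\<integral>x. pd v a x * pd w b x \<partial>lborel) = (\<integral>x. pd w a x * pd v b x \<partial>lborel)"
proof -
  note [measurable] = lipschitz_measurable[OF a] lipschitz_measurable[OF b]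
  have L: "L \<ge> 0" and K: "K \<ge> 0" using a b lipschitz_on_nonneg by auto
  define h where "h n = 1 / real (Suc n)" for n
  have h: "h n > 0" "h n \<le> 1" "h n \<noteq> 0" "- h n \<noteq> 0" for n by (auto simp: h_def field_simps)
  have h0: "h \<longlonglongrightarrow> 0" unfolding h_def[abs_def] by (rule LIMSEQ_1_div_Suc)
  have h0': "(\<lambda>n. - h n) \<longlonglongrightarrow> 0" using tendsto_minus[OF h0] by simp
  define R where "R = \<bar>r\<bar> + norm v + norm w"
  have hv: "norm (h n *\<^sub>R v) \<le> norm v" for v :: 'a and n
    using h[of n] by (simp add: mult_left_le_one_le)
  have supp0: "a x = 0" if "\<bar>r\<bar> < norm x" for x
    using that by (intro supp) auto
  have a0: "a (x + h n *\<^sub>R v) = 0" "a (x + h n *\<^sub>R w) = 0" "a (x + h n *\<^sub>R v + h n *\<^sub>R w) = 0" "a x = 0"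
    if x: "x \<notin> cball 0 R" for x n
  proof -
    have "norm x \<le> norm (x + h n *\<^sub>R v) + norm (h n *\<^sub>R v)" "norm x \<le> norm (x + h n *\<^sub>R w) + norm (h n *\<^sub>R w)"
      "norm (x + h n *\<^sub>R v) \<le> norm (x + h n *\<^sub>R v + h n *\<^sub>R w) + norm (h n *\<^sub>R w)"
      by (metis add_diff_cancel norm_triangle_ineq4)+
    then have "\<bar>r\<bar> < norm (x + h n *\<^sub>R v)" "\<bar>r\<bar> < norm (x + h n *\<^sub>R w)"
       "\<bar>r\<bar> < norm (x + h n *\<^sub>R v + h n *\<^sub>R w)" "\<bar>r\<bar> < norm x"
      using hv[of n v] hv[of n w] x norm_ge_zero[of v] norm_ge_zero[of w] unfolding R_def mem_cball_0 by linarith+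
    then show "a (x + h n *\<^sub>R v) = 0" "a (x + h n *\<^sub>R w) = 0" "a (x + h n *\<^sub>R v + h n *\<^sub>R w) = 0" "a x = 0"
      by (auto intro: supp0)
  qed
  define I where "I v w n = (\<integral>x. (a (x + h n *\<^sub>R v) - a x) / h n * ((b (x + (- h n) *\<^sub>R w) - b x) / (- h n)) \<partial>lborel)" for v w n
  have lim: "I v' w' \<longlonglongrightarrow> (\<integral>x. pd v' a x * pd w' b x \<partial>lborel)" if vw: "v' = v \<or> v' = w" for v' w'
    unfolding I_def
  proof (rule integral_dominated_convergence[OF _ _ integrable_const_cball[of "L * norm v' * (K * norm w')" 0 R]])
    show "AE x in lborel. (\<lambda>n. (a (x + h n *\<^sub>R v') - a x) / h n * ((b (x + (- h n) *\<^sub>R w') - b x) / (- h n)))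
        \<longlonglongrightarrow> pd v' a x * pd w' b x"
      using pd_ae[OF a, of v'] pd_ae[OF b, of w']
    proof eventually_elim
      case (elim x)
      show ?case
        by (intro tendsto_mult difference_quotient_tendsto[OF elim(1) h0 h(3)] difference_quotient_tendsto[OF elim(2) h0' h(4)])
    qed
    show "AE x in lborel. norm ((a (x + h n *\<^sub>R v') - a x) / h n * ((b (x + (- h n) *\<^sub>R w') - b x) / (- h n)))
        \<le> L * norm v' * (K * norm w') * indicator (cball 0 R) x" for n
    proof (rule AE_I2)
      fix x
      show "norm ((a (x + h n *\<^sub>R v') - a x) / h n * ((b (x + (- h n) *\<^sub>R w') - b x) / (- h n)))
        \<le> L * norm v' * (K * norm w') * indicator (cball 0 R) x"
      proof (cases "x \<in> cball 0 R")
        case True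
        have "norm ((a (x + h n *\<^sub>R v') - a x) / h n * ((b (x + (- h n) *\<^sub>R w') - b x) / (- h n)))
            \<le> L * norm v' * (K * norm w')"
          unfolding real_norm_def abs_mult using L
          by (intro mult_mono lipschitz_difference_quotient_bound[OF a] lipschitz_difference_quotient_bound[OF b]) auto
        then show ?thesis using True by simp
      next
        case False
        then have "a (x + h n *\<^sub>R v') - a x = 0" using a0[OF False] vw by auto
        then show ?thesis using False by simp
      qed
    qed
  qed measurable
  define B where "B = \<bar>b 0\<bar> + K * \<bar>R + norm v + norm w\<bar>"
  have bB: "\<bar>b x\<bar> \<le> B" if "norm x \<le> R + norm v + norm w" for x
    using lipschitz_growth[OF b, of x "\<bar>R + norm v + norm w\<bar>"] that by (auto simp: B_def)
  define A where "A = \<bar>a 0\<bar> + L * \<bar>r\<bar>"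
  have aA: "\<bar>a x\<bar> \<le> A" for x
    using lipschitz_growth[OF a, of x "\<bar>r\<bar>"] supp0[of x] L by (cases "norm x \<le> \<bar>r\<bar>") (auto simp: A_def)
  have AB: "A \<ge> 0" "B \<ge> 0" using L K by (auto simp: A_def B_def)
  have int: "integrable lborel (\<lambda>x. a (x + c) * b x)" if c: "c = 0 \<or> c = h n *\<^sub>R v \<or> c = h n *\<^sub>R w \<or> c = h n *\<^sub>R v + h n *\<^sub>R w" for c n
  proof (rule integrable_bounded_support[where C="A * B" and r=R])
    show "AE x in lborel. \<bar>a (x + c) * b x\<bar> \<le> A * B * indicator (cball 0 R) x"
    proof (rule AE_I2)
      fix x
      show "\<bar>a (x + c) * b x\<bar> \<le> A * B * indicator (cball 0 R) x"
      proof (cases "x \<in> cball 0 R")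
        case True
        then have "\<bar>b x\<bar> \<le> B"
          by (intro bB) (use norm_ge_zero[of v] norm_ge_zero[of w] in \<open>simp add: add_increasing2\<close>)
        then have "\<bar>a (x + c)\<bar> * \<bar>b x\<bar> \<le> A * B"
          using aA[of "x + c"] AB by (intro mult_mono) auto
        then show ?thesis using True by (simp add: abs_mult)
      next
        case False
        have "a (x + c) = 0" using a0(1-3)[OF False, of n] a0(4)[OF False] c by (auto simp: add.assoc)
        then show ?thesis using False by simp
      qed
    qed
  qed measurable
  \<comment> \<open>Once the backward shift of \<open>b\<close> is translated onto \<open>a\<close>,
    only correlations \<open>T\<close> at the four shifts 0, \<open>h n *\<^sub>R v\<close>,
    \<open>h n *\<^sub>R w\<close> and their sum remain, in a combination symmetric in the two
    directions.\<close>
  define T where "T c = (\<integral>x. a (x + c) * b x \<partial>lborel)" for c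
  have expand: "I v' w' n = (T (h n *\<^sub>R v') - T (h n *\<^sub>R v' + h n *\<^sub>R w') - T 0 + T (h n *\<^sub>R w')) / (h n * h n)"
    if vw: "v' = v \<and> w' = w \<or> v' = w \<and> w' = v" for v' w' n
  proof -
    have i: "integrable lborel (\<lambda>x. a (x + c) * b x)" if "c = 0 \<or> c = h n *\<^sub>R v' \<or> c = h n *\<^sub>R w' \<or> c = h n *\<^sub>R v' + h n *\<^sub>R w'" for c
      using that vw by (intro int[of c n]) (auto simp: add.commute)
    have tr: "integrable lborel (\<lambda>x. a (x + c) * b (x - h n *\<^sub>R w'))"
      "(\<integral>x. a (x + c) * b (x - h n *\<^sub>R w') \<partial>lborel) = T (c + h n *\<^sub>R w')"
      if c: "c = 0 \<or> c = h n *\<^sub>R v'" for c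
    proof -
      define F where "F x = a (x + (c + h n *\<^sub>R w')) * b x" for x
      have 1: "integrable lborel F" unfolding F_def using c by (intro i) auto
      have 2: "F (x + (- h n *\<^sub>R w')) = a (x + c) * b (x - h n *\<^sub>R w')" for x
        by (simp add: F_def algebra_simps)
      have [measurable]: "F \<in> borel_measurable borel" unfolding F_def by measurable
      show "integrable lborel (\<lambda>x. a (x + c) * b (x - h n *\<^sub>R w'))"
        using lborel_integrable_translate[OF 1, of "- h n *\<^sub>R w'"] by (simp only: 2)
      show "(\<integral>x. a (x + c) * b (x - h n *\<^sub>R w') \<partial>lborel) = T (c + h n *\<^sub>R w')"
        using integral_lborel_translate[of F "- h n *\<^sub>R w'"] by (simp only: 2) (simp add: T_def F_def[abs_def])
    qed
    have "I v' w' n = (\<integral>x. (a (x + h n *\<^sub>R v') * b x - a (x + h n *\<^sub>R v') * b (x - h n *\<^sub>R w')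
        - a (x + 0) * b x + a (x + 0) * b (x - h n *\<^sub>R w')) / (h n * h n) \<partial>lborel)"
      unfolding I_def
    proof (intro Bochner_Integration.integral_cong refl)
      fix x
      have *: "p / s * (q / (- s)) = (p * (- q)) / (s * s)" for p q s :: real by simp
      show "(a (x + h n *\<^sub>R v') - a x) / h n * ((b (x + (- h n) *\<^sub>R w') - b x) / (- h n)) =
        (a (x + h n *\<^sub>R v') * b x - a (x + h n *\<^sub>R v') * b (x - h n *\<^sub>R w')
        - a (x + 0) * b x + a (x + 0) * b (x - h n *\<^sub>R w')) / (h n * h n)"
        unfolding * by (intro arg_cong2[where f="(/)"] refl) (simp add: algebra_simps)
    qed
    also have "\<dots> = ((\<integral>x. a (x + h n *\<^sub>R v') * b x \<partial>lborel) - (\<integral>x. a (x + h n *\<^sub>R v') * b (x - h n *\<^sub>R w') \<partial>lborel)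
        - (\<integral>x. a (x + 0) * b x \<partial>lborel) + (\<integral>x. a (x + 0) * b (x - h n *\<^sub>R w') \<partial>lborel)) / (h n * h n)"
    proof -
      have four: "(\<integral>x. (p x - q x - r x + s x) / c \<partial>lborel) = ((\<integral>x. p x \<partial>lborel) - (\<integral>x. q x \<partial>lborel)
          - (\<integral>x. r x \<partial>lborel) + (\<integral>x. s x \<partial>lborel)) / c"
        if "integrable lborel p" "integrable lborel q" "integrable lborel r" "integrable lborel s"
        for p q r s :: "'a \<Rightarrow> real" and c
        using that by simp
      show ?thesis
        by (rule four) (rule i tr(1); simp)+
    qed
    also have "\<dots> = (T (h n *\<^sub>R v') - T (h n *\<^sub>R v' + h n *\<^sub>R w') - T 0 + T (0 + h n *\<^sub>R w')) / (h n * h n)"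
      by (subst (1 2) tr(2)) (simp_all add: T_def)
    finally show ?thesis by simp
  qed
  have "I v w n = I w v n" for n
    by (simp add: expand add.commute)
  then have "I v w = I w v" by auto
  then show ?thesis using LIMSEQ_unique[OF lim[of v w]] lim[of w v] by simp
qed

text \<open>The Lipschitz bound at \<open>x0\<close> passes to the derivatives, which are limits of
  quotients; this gives their measurability, their integrability and the dominating function
  \<open>2 * g\<close> for the normalised error of linearisation.\<close>

lemma has_derivative_integral:
  fixes F :: "'a::euclidean_space \<Rightarrow> 'b \<Rightarrow> real"
  assumes int: "\<And>x. integrable M (F x)"
    and d: "\<And>z. ((\<lambda>x. F x z) has_derivative F' z) (at x0)"
    and lip: "\<And>x z. \<bar>F x z - F x0 z\<bar> \<le> g z * norm (x - x0)"
    and g: "integrable M g"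
  shows "((\<lambda>x. \<integral>z. F x z \<partial>M) has_derivative (\<lambda>v. \<integral>z. F' z v \<partial>M)) (at x0)"
proof -
  have dq: "(\<lambda>n. (F (x0 + (1 / real (Suc n)) *\<^sub>R v) z - F x0 z) / (1 / real (Suc n))) \<longlonglongrightarrow> F' z v" for z v
    by (rule difference_quotient_tendsto[OF has_derivative_directional[OF d] LIMSEQ_1_div_Suc]) simp
  have bd: "\<bar>F' z v\<bar> \<le> g z * norm v" for z v
  proof (rule LIMSEQ_le_const2[OF tendsto_rabs[OF dq]], intro exI[of _ 0] allI impI)
    fix n
    show "\<bar>(F (x0 + (1 / real (Suc n)) *\<^sub>R v) z - F x0 z) / (1 / real (Suc n))\<bar> \<le> g z * norm v"
    proof -
      have *: "\<bar>p / s\<bar> \<le> B" if "s > 0" "\<bar>p\<bar> \<le> B * s" for p s B :: real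
        using that by (simp add: abs_divide divide_simps)
      show ?thesis
        by (rule *) (use lip[of "x0 + (1 / real (Suc n)) *\<^sub>R v" z] in \<open>simp_all add: ac_simps\<close>)
    qed
  qed
  have meas: "(\<lambda>z. F' z v) \<in> borel_measurable M" for v
  proof (rule borel_measurable_LIMSEQ_metric[OF _ dq])
    have [measurable]: "F x \<in> borel_measurable M" for x using int by auto
    show "(\<lambda>z. (F (x0 + (1 / real (Suc n)) *\<^sub>R v) z - F x0 z) / (1 / real (Suc n))) \<in> borel_measurable M" for n
      by measurable
  qed
  have intF': "integrable M (\<lambda>z. F' z v)" for v
  proof (rule Bochner_Integration.integrable_bound[OF _ meas])
    show "integrable M (\<lambda>z. g z * norm v)" using g by simp
    show "AE z in M. norm (F' z v) \<le> norm (g z * norm v)"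
      using bd by (intro AE_I2) (auto intro: order_trans[OF _ abs_ge_self])
  qed
  have lin: "linear (F' z)" for z using d has_derivative_linear by blast
  have bl: "bounded_linear (\<lambda>v. \<integral>z. F' z v \<partial>M)"
  proof
    fix v w :: 'a and c :: real
    show "(\<integral>z. F' z (v + w) \<partial>M) = (\<integral>z. F' z v \<partial>M) + (\<integral>z. F' z w \<partial>M)"
      using intF' by (simp add: linear_add[OF lin])
    show "(\<integral>z. F' z (c *\<^sub>R v) \<partial>M) = c *\<^sub>R (\<integral>z. F' z v \<partial>M)"
      by (simp add: linear_scale[OF lin])
    show "\<exists>K. \<forall>x. norm (\<integral>z. F' z x \<partial>M) \<le> norm x * K"
    proof (intro exI[of _ "\<integral>z. g z \<partial>M"] allI)
      fix v
      have "norm (\<integral>z. F' z v \<partial>M) \<le> (\<integral>z. norm (F' z v) \<partial>M)" by (rule integral_norm_bound)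
      also have "\<dots> \<le> (\<integral>z. g z * norm v \<partial>M)" using intF' g bd by (intro integral_mono) auto
      finally show "norm (\<integral>z. F' z v \<partial>M) \<le> norm v * (\<integral>z. g z \<partial>M)" by (simp add: mult.commute)
    qed
  qed
  show ?thesis
    unfolding has_derivative_iff_norm
  proof (intro conjI bl, unfold tendsto_at_iff_sequentially, intro allI impI)
    fix X :: "nat \<Rightarrow> 'a" assume X: "\<forall>i. X i \<in> UNIV - {x0}" "X \<longlonglongrightarrow> x0"
    define E where "E n z = (F (X n) z - F x0 z - F' z (X n - x0)) / norm (X n - x0)" for n z
    have "(\<lambda>n. \<integral>z. E n z \<partial>M) \<longlonglongrightarrow> (\<integral>z. 0 \<partial>M)"
    proof (rule integral_dominated_convergence[where w="\<lambda>z. 2 * g z"])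
      show "E n \<in> borel_measurable M" for n
        unfolding E_def using int meas by (auto intro!: borel_measurable_divide borel_measurable_diff)
      show "AE z in M. (\<lambda>n. E n z) \<longlonglongrightarrow> 0"
      proof (rule AE_I2)
        fix z
        have "((\<lambda>y. norm (F y z - F x0 z - F' z (y - x0)) / norm (y - x0)) \<longlongrightarrow> 0) (at x0)"
          using d[of z] unfolding has_derivative_iff_norm by blast
        with X have "(\<lambda>n. norm (F (X n) z - F x0 z - F' z (X n - x0)) / norm (X n - x0)) \<longlonglongrightarrow> 0"
          unfolding tendsto_at_iff_sequentially comp_def by blast
        then have "(\<lambda>n. norm (E n z)) \<longlonglongrightarrow> 0" by (simp add: E_def)
        then show "(\<lambda>n. E n z) \<longlonglongrightarrow> 0" by (rule tendsto_norm_zero_cancel)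
      qed
      show "AE z in M. norm (E n z) \<le> 2 * g z" for n
      proof (rule AE_I2)
        fix z
        have pos: "norm (X n - x0) > 0" using X(1) by auto
        have "\<bar>F (X n) z - F x0 z - F' z (X n - x0)\<bar> \<le> 2 * g z * norm (X n - x0)"
          using lip[of "X n" z] bd[of z "X n - x0"] by linarith
        then show "norm (E n z) \<le> 2 * g z" using pos by (simp add: E_def divide_simps)
      qed
    qed (use g in auto)
    moreover have "(\<integral>z. E n z \<partial>M) = ((\<integral>z. F (X n) z \<partial>M) - (\<integral>z. F x0 z \<partial>M) - (\<integral>z. F' z (X n - x0) \<partial>M)) / norm (X n - x0)" for n
      unfolding E_def using int intF' by simp
    ultimately have "(\<lambda>n. norm (((\<integral>z. F (X n) z \<partial>M) - (\<integral>z. F x0 z \<partial>M) - (\<integral>z. F' z (X n - x0) \<partial>M)) / norm (X n - x0))) \<longlonglongrightarrow> 0"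
      using tendsto_norm_zero by fastforce
    then show "((\<lambda>y. norm ((\<integral>z. F y z \<partial>M) - (\<integral>z. F x0 z \<partial>M) - (\<integral>z. F' z (y - x0) \<partial>M)) / norm (y - x0)) \<circ> X) \<longlonglongrightarrow> 0"
      by (simp add: comp_def)
  qed
qed

text \<open>An unnormalised mollifier on the cube of half-width \<epsilon>; it is divided by its
  integral where a mean is wanted. It is not a rescaling of one fixed profile, and of its integral
  only positivity is used. Its translates are literally bumps with parameter 1, so that weak
  equations tested with such bumps can be tested with it.\<close>

definition ker :: "real \<Rightarrow> 'a::euclidean_space \<Rightarrow> real" where
  "ker \<epsilon> = bump 1 (- (\<epsilon> *\<^sub>R (\<Sum>Basis))) (\<epsilon> *\<^sub>R (\<Sum>Basis))"

lemma ker_shift: "ker \<epsilon> (z - x) = bump 1 (x - \<epsilon> *\<^sub>R (\<Sum>Basis)) (x + \<epsilon> *\<^sub>R (\<Sum>Basis)) z"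
  using bump_translate[of 1 "- (\<epsilon> *\<^sub>R (\<Sum>Basis))" "\<epsilon> *\<^sub>R (\<Sum>Basis)" z "- x"]
  by (simp add: ker_def add.commute)

lemma ker_nonneg: "0 \<le> ker \<epsilon> y" and ker_le_1: "ker \<epsilon> y \<le> 1"
  by (simp_all add: ker_def bump_nonneg bump_le_1)

lemma cbox_One_norm:
  fixes x y :: "'a::euclidean_space"
  assumes "y \<in> cbox (x - \<epsilon> *\<^sub>R (\<Sum>Basis)) (x + \<epsilon> *\<^sub>R (\<Sum>Basis))"
  shows "norm (y - x) \<le> \<epsilon> * DIM('a)"
proof -
  have "norm (y - x) \<le> (\<Sum>i\<in>Basis. \<bar>(y - x) \<bullet> i\<bar>)" by (rule norm_le_l1)
  also have "\<dots> \<le> (\<Sum>i\<in>(Basis::'a set). \<epsilon>)"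
    using assms by (intro sum_mono) (force simp: mem_box inner_diff_left inner_add_left inner_sum_left inner_Basis abs_le_iff if_distrib sum.delta algebra_simps cong: if_cong)
  finally show ?thesis by (simp add: mult.commute)
qed

lemma ker_support:
  fixes y :: "'a::euclidean_space"
  assumes "ker \<epsilon> y \<noteq> 0"
  shows "norm y \<le> \<epsilon> * DIM('a)"
proof -
  have "y \<in> box (- (\<epsilon> *\<^sub>R (\<Sum>Basis))) (\<epsilon> *\<^sub>R (\<Sum>Basis))"
    using assms bump_eq_0[of 1 y] unfolding ker_def by fastforce
  then have "y \<in> cbox (0 - \<epsilon> *\<^sub>R (\<Sum>Basis)) (0 + \<epsilon> *\<^sub>R (\<Sum>Basis))"
    using box_subset_cbox by auto
  from cbox_One_norm[OF this] show ?thesis by simp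
qed

lemma ker_lipschitz:
  obtains K where "K-lipschitz_on UNIV (ker \<epsilon> :: 'a::euclidean_space \<Rightarrow> real)"
  using bump_lipschitz[of 1] unfolding ker_def by (metis zero_less_one)

lemma ker_has_derivative: "(ker \<epsilon> has_derivative (\<lambda>v. pd v (ker \<epsilon>) y)) (at y)"
proof -
  have d: "(ker \<epsilon> has_derivative frechet_derivative (ker \<epsilon>) (at y)) (at y)"
    unfolding ker_def using bump_differentiable frechet_derivative_works by blast
  then have "frechet_derivative (ker \<epsilon>) (at y) = (\<lambda>v. pd v (ker \<epsilon>) y)"
    using pd_has_derivative[OF d] by auto
  with d show ?thesis by simp
qed

lemma pd_ker_continuous: "continuous_on UNIV (pd v (ker \<epsilon> :: 'a::euclidean_space \<Rightarrow> real))"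
proof -
  have "frechet_derivative (ker \<epsilon>) (at y) v = pd v (ker \<epsilon>) y" for y :: 'a
    using frechet_derivative_at[OF ker_has_derivative] by metis
  moreover have "continuous_on UNIV (\<lambda>y. frechet_derivative (ker \<epsilon> :: 'a \<Rightarrow> real) (at y) v)"
  proof -
    have "Ck 1 (ker \<epsilon> :: 'a \<Rightarrow> real)" unfolding ker_def by (rule Ck_bump)
    then show ?thesis by simp
  qed
  ultimately show ?thesis by simp
qed

lemma ker_measurable [measurable]: "ker \<epsilon> \<in> borel_measurable borel"
  unfolding ker_def by measurable

lemma ker_integrable: "integrable lborel (ker \<epsilon> :: 'a::euclidean_space \<Rightarrow> real)"
proof (rule integrable_bounded_support[where C=1 and r="\<epsilon> * DIM('a)"])
  show "AE x in lborel. \<bar>ker \<epsilon> x\<bar> \<le> 1 * indicator (cball 0 (\<epsilon> * DIM('a))) (x::'a)"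
  proof (rule AE_I2)
    fix x :: 'a
    show "\<bar>ker \<epsilon> x\<bar> \<le> 1 * indicator (cball 0 (\<epsilon> * DIM('a))) x"
      using ker_support[of \<epsilon> x] ker_nonneg[of \<epsilon> x] ker_le_1[of \<epsilon> x]
      by (cases "ker \<epsilon> x = 0") auto
  qed
qed measurable

lemma ker_integral_pos:
  assumes "\<epsilon> > 0"
  shows "(\<integral>x. ker \<epsilon> (x::'a::euclidean_space) \<partial>lborel) > 0"
proof -
  have "(\<integral>x. ker \<epsilon> (x::'a) \<partial>lborel) \<noteq> 0"
  proof
    assume "(\<integral>x. ker \<epsilon> (x::'a) \<partial>lborel) = 0"
    then have "AE x in lborel. ker \<epsilon> (x::'a) = 0"
      using integral_nonneg_eq_0_iff_AE[OF ker_integrable] ker_nonneg by auto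
    then have "AE x::'a in lborel. x \<notin> box (- (\<epsilon> *\<^sub>R (\<Sum>Basis))) (\<epsilon> *\<^sub>R (\<Sum>Basis))"
      by eventually_elim (metis bump_pos_iff ker_def less_irrefl zero_less_one)
    then have "box (- (\<epsilon> *\<^sub>R (\<Sum>Basis))) (\<epsilon> *\<^sub>R (\<Sum>Basis) :: 'a) \<in> null_sets lborel"
      by (subst AE_iff_null_sets) auto
    moreover have "emeasure lborel (box (- (\<epsilon> *\<^sub>R (\<Sum>Basis))) (\<epsilon> *\<^sub>R (\<Sum>Basis) :: 'a)) = (\<Prod>b\<in>(Basis::'a set). 2 * \<epsilon>)"
      using assms by (subst emeasure_lborel_box_eq) (auto simp: inner_add_left inner_diff_left intro!: prod.cong)
    ultimately show False using assms by (simp add: null_sets_def)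
  qed
  moreover have "(\<integral>x. ker \<epsilon> (x::'a) \<partial>lborel) \<ge> 0" by (intro integral_nonneg_AE AE_I2 ker_nonneg)
  ultimately show ?thesis by linarith
qed

lemma ker_integral_shift:
  "integrable lborel (\<lambda>z. ker \<epsilon> (z - x :: 'a::euclidean_space))"
  "(\<integral>z. ker \<epsilon> (z - x) \<partial>lborel) = (\<integral>z. ker \<epsilon> (z::'a) \<partial>lborel)"
  using lborel_integrable_translate[OF ker_integrable, of \<epsilon> "- x"]
    integral_lborel_translate[OF ker_measurable, of \<epsilon> "- x"] by simp_all

lemma ker_sym: "ker \<epsilon> (- y) = ker \<epsilon> y"
  unfolding ker_def bump_def
  by (intro prod.cong refl) (simp add: mult.commute add.commute)

text \<open>The derivative falls on the smooth kernel, with a minus sign from the argument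
  \<open>z - x\<close>, and the Lipschitz constant of the kernel dominates.\<close>

lemma moll_has_derivative:
  fixes G :: "'a::euclidean_space \<Rightarrow> real"
  assumes G: "integrable lborel G"
  shows "((\<lambda>x. \<integral>z. G z * ker \<epsilon> (z - x) \<partial>lborel) has_derivative
    (\<lambda>v. \<integral>z. - (G z * pd v (ker \<epsilon>) (z - x)) \<partial>lborel)) (at x)"
proof -
  obtain K where K: "K-lipschitz_on UNIV (ker \<epsilon> :: 'a \<Rightarrow> real)" by (rule ker_lipschitz)
  have [measurable]: "G \<in> borel_measurable borel" using borel_measurable_integrable[OF G] by simp
  show ?thesis
  proof (rule has_derivative_integral[where g="\<lambda>z. \<bar>G z\<bar> * K"])
    show "integrable lborel (\<lambda>z. G z * ker \<epsilon> (z - x))" for x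
    proof (rule Bochner_Integration.integrable_bound[OF G])
      show "AE z in lborel. norm (G z * ker \<epsilon> (z - x)) \<le> norm (G z)"
        by (intro AE_I2) (simp add: abs_mult mult_left_le ker_nonneg ker_le_1)
    qed measurable
    fix z
    have "((\<lambda>x. ker \<epsilon> (z - x)) has_derivative (\<lambda>v. pd (- v) (ker \<epsilon>) (z - x))) (at x)"
      by (rule has_derivative_compose[where g="ker \<epsilon>" and f="\<lambda>x. z - x", OF _ ker_has_derivative])
        (auto intro!: derivative_eq_intros)
    moreover have "pd (- v) (ker \<epsilon>) (z - x) = - pd v (ker \<epsilon>) (z - x)" for v
      using has_derivative_linear[OF ker_has_derivative] linear_neg by blast
    ultimately show "((\<lambda>x. G z * ker \<epsilon> (z - x)) has_derivative (\<lambda>v. - (G z * pd v (ker \<epsilon>) (z - x)))) (at x)"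
      by (auto intro!: derivative_eq_intros)
    fix y
    have "\<bar>ker \<epsilon> (z - y) - ker \<epsilon> (z - x)\<bar> \<le> K * norm (y - x)"
      using lipschitz_onD[OF K, of "z - y" "z - x"] by (simp add: dist_norm dist_real_def norm_minus_commute)
    then have "\<bar>G z\<bar> * \<bar>ker \<epsilon> (z - y) - ker \<epsilon> (z - x)\<bar> \<le> \<bar>G z\<bar> * (K * norm (y - x))"
      by (rule mult_left_mono) simp
    then show "\<bar>G z * ker \<epsilon> (z - y) - G z * ker \<epsilon> (z - x)\<bar> \<le> \<bar>G z\<bar> * K * norm (y - x)"
      by (simp add: right_diff_distrib[symmetric] abs_mult mult.assoc)
  qed (use G in auto)
qed

lemma moll_close:
  fixes f :: "'a::euclidean_space \<Rightarrow> real"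
  assumes f: "L-lipschitz_on UNIV f" and \<epsilon>: "\<epsilon> > 0"
  shows "integrable lborel (\<lambda>z. f z * ker \<epsilon> (z - x))"
    "\<bar>(\<integral>z. f z * ker \<epsilon> (z - x) \<partial>lborel) - f x * (\<integral>z. ker \<epsilon> (z::'a) \<partial>lborel)\<bar>
      \<le> L * (\<epsilon> * DIM('a)) * (\<integral>z. ker \<epsilon> (z::'a) \<partial>lborel)"
proof -
  note [measurable] = lipschitz_measurable[OF f]
  have L: "L \<ge> 0" using f lipschitz_on_nonneg by auto
  have bd: "\<bar>(f z - f x) * ker \<epsilon> (z - x)\<bar> \<le> L * (\<epsilon> * DIM('a)) * ker \<epsilon> (z - x)" for z
  proof (cases "ker \<epsilon> (z - x) = 0")
    case False
    have "\<bar>f z - f x\<bar> \<le> L * norm (z - x)" using lipschitz_onD[OF f, of z x] by (simp add: dist_norm)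
    also have "\<dots> \<le> L * (\<epsilon> * DIM('a))" using ker_support[OF False] L by (rule mult_left_mono)
    finally show ?thesis using ker_nonneg[of \<epsilon> "z - x"] by (auto simp: abs_mult intro: mult_right_mono)
  qed simp
  have i1: "integrable lborel (\<lambda>z. (f z - f x) * ker \<epsilon> (z - x))"
  proof (rule Bochner_Integration.integrable_bound)
    show "integrable lborel (\<lambda>z. L * (\<epsilon> * DIM('a)) * ker \<epsilon> (z - x))"
      by (intro integrable_mult_right ker_integral_shift(1))
    show "AE z in lborel. norm ((f z - f x) * ker \<epsilon> (z - x)) \<le> norm (L * (\<epsilon> * DIM('a)) * ker \<epsilon> (z - x))"
      using bd by (intro AE_I2) (auto intro: order_trans[OF _ abs_ge_self])
  qed measurable
  have i2: "integrable lborel (\<lambda>z. f x * ker \<epsilon> (z - x))"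
      by (intro integrable_mult_right ker_integral_shift(1))
  have eq: "f z * ker \<epsilon> (z - x) = (f z - f x) * ker \<epsilon> (z - x) + f x * ker \<epsilon> (z - x)" for z
    by (simp add: algebra_simps)
  show "integrable lborel (\<lambda>z. f z * ker \<epsilon> (z - x))"
    unfolding eq by (rule Bochner_Integration.integrable_add[OF i1 i2])
  have "(\<integral>z. f z * ker \<epsilon> (z - x) \<partial>lborel) - f x * (\<integral>z. ker \<epsilon> (z::'a) \<partial>lborel) = (\<integral>z. (f z - f x) * ker \<epsilon> (z - x) \<partial>lborel)"
    unfolding eq Bochner_Integration.integral_add[OF i1 i2] by (simp add: ker_integral_shift(2))
  also have "\<bar>\<dots>\<bar> \<le> (\<integral>z. L * (\<epsilon> * DIM('a)) * ker \<epsilon> (z - x) \<partial>lborel)"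
    using bd i1
    by (intro order_trans[OF integral_abs_bound] integral_mono integrable_mult_right ker_integral_shift(1)) auto
  finally show "\<bar>(\<integral>z. f z * ker \<epsilon> (z - x) \<partial>lborel) - f x * (\<integral>z. ker \<epsilon> (z::'a) \<partial>lborel)\<bar>
      \<le> L * (\<epsilon> * DIM('a)) * (\<integral>z. ker \<epsilon> (z::'a) \<partial>lborel)"
    by (simp add: ker_integral_shift(2))
qed

subsection \<open>Potentials of weakly curl-free fields\<close>

lemma ker_abs_le_1: "\<bar>ker \<epsilon> y\<bar> \<le> 1"
  using ker_nonneg[of \<epsilon> y] ker_le_1[of \<epsilon> y] by simp

text \<open>The primitive is the line integral along the segment from \<open>x0\<close>. Symmetry of
  the derivatives turns the integrand of its derivative in direction \<open>v\<close> into the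
  \<open>t\<close>-derivative of the sum of \<open>t * P i (p x t) * (v \<bullet> i)\<close>, so the
  integral is the value at the endpoint \<open>x\<close>. The global bounds on \<open>P\<close>
  dominate the differentiation under the integral; symmetry is used only along the segment, which
  stays in the ball.\<close>

lemma poincare_ball:
  fixes P :: "'a::euclidean_space \<Rightarrow> 'a \<Rightarrow> real" and DP :: "'a \<Rightarrow> 'a \<Rightarrow> 'a \<Rightarrow> real"
  assumes d: "\<And>i x. i \<in> Basis \<Longrightarrow> (P i has_derivative DP i x) (at x)"
    and cont: "\<And>i v. i \<in> Basis \<Longrightarrow> continuous_on UNIV (\<lambda>x. DP i x v)"
    and bdd: "\<And>i x. i \<in> Basis \<Longrightarrow> \<bar>P i x\<bar> \<le> M"
    and lip: "\<And>i. i \<in> Basis \<Longrightarrow> C-lipschitz_on UNIV (P i)"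
    and sym: "\<And>i j x. i \<in> Basis \<Longrightarrow> j \<in> Basis \<Longrightarrow> x \<in> ball x0 r \<Longrightarrow> DP i x j = DP j x i"
  obtains W where "W x0 = 0" "\<And>x. x \<in> ball x0 r \<Longrightarrow> (W has_derivative (\<lambda>v. \<Sum>i\<in>Basis. P i x * (v \<bullet> i))) (at x)"
proof -
  define p where "p x t = x0 + t *\<^sub>R (x - x0)" for x t
  define F where "F x t = indicator {0..1} t * (\<Sum>i\<in>Basis. P i (p x t) * ((x - x0) \<bullet> i))" for x and t :: real
  define W where "W x = (\<integral>t. F x t \<partial>lborel)" for x
  have C: "C \<ge> 0" using lip[OF SOME_Basis] lipschitz_on_nonneg by auto
  have M: "M \<ge> 0" using bdd[OF SOME_Basis, of x0] by linarith
  have contP: "continuous_on UNIV (P i)" if "i \<in> Basis" for i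
    using lipschitz_on_continuous_on[OF lip[OF that]] .
  have contPp: "continuous_on UNIV (\<lambda>t. P i (p x t))" if "i \<in> Basis" for i x
    unfolding p_def by (rule continuous_on_compose2[OF contP[OF that]]) (auto intro!: continuous_intros)
  have contDp: "continuous_on UNIV (\<lambda>t. DP i (p x t) v)" if "i \<in> Basis" for i x v
    unfolding p_def by (rule continuous_on_compose2[OF cont[OF that]]) (auto intro!: continuous_intros)
  have lin: "linear (DP i x)" if "i \<in> Basis" for i x
    using has_derivative_linear[OF d[OF that]] .
  have der: "(W has_derivative (\<lambda>v. \<integral>t. indicator {0..1} t *
      (\<Sum>i\<in>Basis. P i (p y t) * (v \<bullet> i) + t * DP i (p y t) v * ((y - x0) \<bullet> i)) \<partial>lborel)) (at y)" for y
    unfolding W_def[abs_def]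
  proof (rule has_derivative_integral[where g="\<lambda>t. real DIM('a) * (M + C * norm (y - x0)) * indicator {0..1} t"])
    show "integrable lborel (F x)" for x
    proof -
      have "integrable lborel (\<lambda>t. indicator {0..1} t *\<^sub>R (\<Sum>i\<in>Basis. P i (p x t) * ((x - x0) \<bullet> i)))"
        by (intro borel_integrable_compact continuous_intros continuous_on_subset[OF contPp]) auto
      then show ?thesis by (simp add: F_def[abs_def])
    qed
    show "integrable lborel (\<lambda>t. real DIM('a) * (M + C * norm (y - x0)) * indicator {0..1::real} t)"
      by (intro integrable_mult_right) simp
    fix t :: real
    have dP: "((\<lambda>x. P i (p x t)) has_derivative (\<lambda>v. t * DP i (p y t) v)) (at y)" if i: "i \<in> Basis" for i
    proof -
      have "((\<lambda>x. p x t) has_derivative (\<lambda>v. t *\<^sub>R v)) (at y)"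
        unfolding p_def by (auto intro!: derivative_eq_intros)
      from has_derivative_compose[OF this d[OF i]] show ?thesis
        by (simp add: linear_scale[OF lin[OF i]])
    qed
    have "((\<lambda>x. \<Sum>i\<in>Basis. P i (p x t) * ((x - x0) \<bullet> i)) has_derivative
        (\<lambda>v. \<Sum>i\<in>Basis. P i (p y t) * (v \<bullet> i) + t * DP i (p y t) v * ((y - x0) \<bullet> i))) (at y)"
      by (intro has_derivative_sum has_derivative_mult dP) (auto intro!: derivative_eq_intros)
    then show "((\<lambda>x. F x t) has_derivative (\<lambda>v. indicator {0..1} t *
        (\<Sum>i\<in>Basis. P i (p y t) * (v \<bullet> i) + t * DP i (p y t) v * ((y - x0) \<bullet> i)))) (at y)"
      unfolding F_def by (rule has_derivative_mult_right)
    fix x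
    show "\<bar>F x t - F y t\<bar> \<le> real DIM('a) * (M + C * norm (y - x0)) * indicator {0..1} t * norm (x - y)"
    proof (cases "t \<in> {0..1}")
      case True
      have pp: "norm (p x t - p y t) \<le> norm (x - y)"
        using True by (simp add: p_def scaleR_right_diff_distrib[symmetric] mult_left_le_one_le)
      have "\<bar>P i (p x t) * ((x - x0) \<bullet> i) - P i (p y t) * ((y - x0) \<bullet> i)\<bar> \<le> (M + C * norm (y - x0)) * norm (x - y)"
        if i: "i \<in> Basis" for i
      proof -
        have "P i (p x t) * ((x - x0) \<bullet> i) - P i (p y t) * ((y - x0) \<bullet> i)
            = P i (p x t) * ((x - y) \<bullet> i) + (P i (p x t) - P i (p y t)) * ((y - x0) \<bullet> i)"
          by (simp add: algebra_simps)
        also have "\<bar>\<dots>\<bar> \<le> \<bar>P i (p x t)\<bar> * \<bar>(x - y) \<bullet> i\<bar> + \<bar>P i (p x t) - P i (p y t)\<bar> * \<bar>(y - x0) \<bullet> i\<bar>"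
          by (metis abs_mult abs_triangle_ineq)
        also have "\<dots> \<le> M * norm (x - y) + (C * norm (x - y)) * norm (y - x0)"
        proof (intro add_mono mult_mono bdd i Basis_le_norm)
          have "\<bar>P i (p x t) - P i (p y t)\<bar> \<le> C * norm (p x t - p y t)"
            using lipschitz_onD[OF lip[OF i], of "p x t" "p y t"] by (simp add: dist_norm)
          also have "\<dots> \<le> C * norm (x - y)" using pp C by (rule mult_left_mono)
          finally show "\<bar>P i (p x t) - P i (p y t)\<bar> \<le> C * norm (x - y)" .
        qed (use M C in auto)
        finally show ?thesis by (simp add: algebra_simps)
      qed
      then have "\<bar>\<Sum>i\<in>Basis. P i (p x t) * ((x - x0) \<bullet> i) - P i (p y t) * ((y - x0) \<bullet> i)\<bar>
          \<le> (\<Sum>i\<in>(Basis::'a set). (M + C * norm (y - x0)) * norm (x - y))"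
        by (intro order_trans[OF sum_abs] sum_mono) auto
      then show ?thesis using True by (simp add: F_def sum_subtractf)
    qed (simp add: F_def)
  qed
  show ?thesis
  proof (rule that[of W])
    show "W x0 = 0" by (simp add: W_def F_def)
    fix x assume x: "x \<in> ball x0 r"
    have pball: "p x t \<in> ball x0 r" if "0 \<le> t" "t \<le> 1" for t
    proof -
      have "norm (p x t - x0) \<le> norm (x - x0)" using that by (simp add: p_def mult_left_le_one_le)
      then show ?thesis using x by (simp add: dist_norm norm_minus_commute)
    qed
    have "(\<integral>t. indicator {0..1} t * (\<Sum>i\<in>Basis. P i (p x t) * (v \<bullet> i) + t * DP i (p x t) v * ((x - x0) \<bullet> i)) \<partial>lborel)
      = (\<Sum>i\<in>Basis. P i x * (v \<bullet> i))" (is "?I = _") for v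
    proof -
      have "?I = (\<integral>t. (\<Sum>i\<in>Basis. (P i (p x t) + t * DP i (p x t) (x - x0)) * (v \<bullet> i)) * indicator {0..1} t \<partial>lborel)"
      proof (intro Bochner_Integration.integral_cong refl)
        fix t :: real
        show "indicator {0..1} t * (\<Sum>i\<in>Basis. P i (p x t) * (v \<bullet> i) + t * DP i (p x t) v * ((x - x0) \<bullet> i))
          = (\<Sum>i\<in>Basis. (P i (p x t) + t * DP i (p x t) (x - x0)) * (v \<bullet> i)) * indicator {0..1} t"
        proof (cases "t \<in> {0..1}")
          case True
          have exp: "DP i (p x t) z = (\<Sum>j\<in>Basis. (z \<bullet> j) * DP i (p x t) j)" if i: "i \<in> Basis" for i z
          proof -
            have "DP i (p x t) z = DP i (p x t) (\<Sum>j\<in>Basis. (z \<bullet> j) *\<^sub>R j)" by (simp add: euclidean_representation)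
            then show ?thesis using lin[OF i] by (simp add: linear_sum linear_scale)
          qed
          have "(\<Sum>i\<in>Basis. DP i (p x t) v * ((x - x0) \<bullet> i)) = (\<Sum>i\<in>Basis. \<Sum>j\<in>Basis. (v \<bullet> j) * DP i (p x t) j * ((x - x0) \<bullet> i))"
            by (intro sum.cong refl, subst exp) (assumption, rule sum_distrib_right)
          also have "\<dots> = (\<Sum>j\<in>Basis. \<Sum>i\<in>Basis. (v \<bullet> j) * DP i (p x t) j * ((x - x0) \<bullet> i))"
            by (rule sum.swap)
          also have "\<dots> = (\<Sum>j\<in>Basis. DP j (p x t) (x - x0) * (v \<bullet> j))"
          proof (intro sum.cong refl)
            fix j :: 'a assume j: "j \<in> Basis"
            have "(\<Sum>i\<in>Basis. (v \<bullet> j) * DP i (p x t) j * ((x - x0) \<bullet> i)) = (\<Sum>i\<in>Basis. ((x - x0) \<bullet> i) * DP j (p x t) i * (v \<bullet> j))"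
              using sym[OF _ j pball[of t]] True by (intro sum.cong refl) simp
            also have "\<dots> = DP j (p x t) (x - x0) * (v \<bullet> j)"
              by (subst (2) exp[OF j]) (simp only: sum_distrib_right)
            finally show "(\<Sum>i\<in>Basis. (v \<bullet> j) * DP i (p x t) j * ((x - x0) \<bullet> i)) = DP j (p x t) (x - x0) * (v \<bullet> j)" .
          qed
          finally have "t * (\<Sum>i\<in>Basis. DP i (p x t) v * ((x - x0) \<bullet> i)) = t * (\<Sum>j\<in>Basis. DP j (p x t) (x - x0) * (v \<bullet> j))"
            by simp
          then have "(\<Sum>i\<in>Basis. t * DP i (p x t) v * ((x - x0) \<bullet> i)) = (\<Sum>i\<in>Basis. t * DP i (p x t) (x - x0) * (v \<bullet> i))"
            by (simp only: sum_distrib_left mult.assoc)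
          then show ?thesis using True by (simp only: sum.distrib distrib_right) simp
        qed simp
      qed
      also have "\<dots> = (\<Sum>i\<in>Basis. 1 * P i (p x 1) * (v \<bullet> i)) - (\<Sum>i\<in>Basis. 0 * P i (p x 0) * (v \<bullet> i))"
      proof (rule integral_FTC_Icc_real)
        fix t :: real
        have dPt: "((\<lambda>t. P i (p x t)) has_real_derivative DP i (p x t) (x - x0)) (at t)" if i: "i \<in> Basis" for i
        proof -
          have "((\<lambda>t. p x t) has_derivative (\<lambda>s. s *\<^sub>R (x - x0))) (at t)"
            unfolding p_def by (auto intro!: derivative_eq_intros)
          from has_derivative_compose[OF this d[OF i]] show ?thesis
            by (simp add: linear_scale[OF lin[OF i]] has_field_derivative_def mult_commute_abs)
        qed
        show "((\<lambda>t. \<Sum>i\<in>Basis. t * P i (p x t) * (v \<bullet> i)) has_real_derivative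
          (\<Sum>i\<in>Basis. (P i (p x t) + t * DP i (p x t) (x - x0)) * (v \<bullet> i))) (at t)"
          by (intro DERIV_sum) (auto intro!: derivative_eq_intros dPt)
        have "continuous_on UNIV (\<lambda>t. \<Sum>i\<in>Basis. (P i (p x t) + t * DP i (p x t) (x - x0)) * (v \<bullet> i))"
          by (intro continuous_intros contPp contDp)
        then show "isCont (\<lambda>t. \<Sum>i\<in>Basis. (P i (p x t) + t * DP i (p x t) (x - x0)) * (v \<bullet> i)) t"
          by (simp add: continuous_on_eq_continuous_at)
      qed simp
      finally show ?thesis by (simp add: p_def)
    qed
    then show "(W has_derivative (\<lambda>v. \<Sum>i\<in>Basis. P i x * (v \<bullet> i))) (at x)"
      using der[of x] by simp
  qed
qed

text \<open>The nearest-point projection onto a closed convex set does not increase distances, so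
  composition with it extends a Lipschitz map from the ball with the same constant.\<close>

lemma lipschitz_on_projection_cball:
  fixes f :: "'a::euclidean_space \<Rightarrow> 'b::metric_space"
  assumes f: "L-lipschitz_on (cball x0 r) f" and r: "r \<ge> 0"
  shows "L-lipschitz_on UNIV (\<lambda>x. f (closest_point (cball x0 r) x))"
proof (rule lipschitz_onI)
  have ne: "cball x0 r \<noteq> {}" using r by simp
  fix x y
  have "dist (f (closest_point (cball x0 r) x)) (f (closest_point (cball x0 r) y))
      \<le> L * dist (closest_point (cball x0 r) x) (closest_point (cball x0 r) y)"
    using ne by (intro lipschitz_onD[OF f] closest_point_in_set) auto
  also have "\<dots> \<le> L * dist x y"
    using ne lipschitz_on_nonneg[OF f] by (intro mult_left_mono closest_point_lipschitz) auto
  finally show "dist (f (closest_point (cball x0 r) x)) (f (closest_point (cball x0 r) y)) \<le> L * dist x y" .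
qed (rule lipschitz_on_nonneg[OF f])

text \<open>The mollified fields are smooth and curl-free on a slightly smaller ball, so they have
  primitives. Since these are Lipschitz with a constant depending only on \<open>M\<close> and the
  dimension, Arzela-Ascoli provides a uniformly convergent subsequence. The limit is Lipschitz, and
  its weak derivatives, which are its pointwise ones almost everywhere, are the given
  fields.\<close>

lemma potential_exists:
  fixes G :: "'a::euclidean_space \<Rightarrow> 'a \<Rightarrow> real"
  assumes meas: "\<And>i. i \<in> Basis \<Longrightarrow> G i \<in> borel_measurable borel"
    and bdd: "\<And>i x. i \<in> Basis \<Longrightarrow> \<bar>G i x\<bar> \<le> M"
    and supp: "\<And>i x. i \<in> Basis \<Longrightarrow> x \<notin> ball x0 R \<Longrightarrow> G i x = 0"
    and curl: "\<And>a b i j. cbox a b \<subseteq> ball x0 R \<Longrightarrow> i \<in> Basis \<Longrightarrow> j \<in> Basis \<Longrightarrow>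
      (\<integral>x. G i x * pd j (bump 1 a b) x \<partial>lborel) = (\<integral>x. G j x * pd i (bump 1 a b) x \<partial>lborel)"
    and r: "0 < r" "r < R"
  obtains W L where "L-lipschitz_on UNIV W" "bounded (range W)"
    "\<And>i. i \<in> Basis \<Longrightarrow> AE x in lborel. x \<in> ball x0 r \<longrightarrow> pd i W x = G i x"
proof -
  let ?D = "real DIM('a)"
  have D: "?D > 0" by simp
  have M: "M \<ge> 0" using bdd[OF SOME_Basis, of x0] by linarith
  have intG: "integrable lborel (G i)" if i: "i \<in> Basis" for i
  proof (rule integrable_bounded_support[OF meas[OF i], where C=M and r="norm x0 + R"])
    have "\<bar>G i x\<bar> \<le> M * indicator (cball 0 (norm x0 + R)) x" for x
    proof (cases "x \<in> ball x0 R")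
      case True
      then have "norm x \<le> norm x0 + R"
        using norm_triangle_sub[of x x0] by (simp add: dist_norm norm_minus_commute)
      then show ?thesis using bdd[OF i, of x] by simp
    qed (use supp[OF i] M in auto)
    then show "AE x in lborel. \<bar>G i x\<bar> \<le> M * indicator (cball 0 (norm x0 + R)) x" by simp
  qed
  \<comment> \<open>The intermediate radius leaves room for the kernels: about any centre in
    \<open>ball x0 r'\<close> the cube of half-width \<open>\<epsilon> n\<close> stays in
    \<open>ball x0 R\<close>.\<close>
  define r' where "r' = (r + R) / 2"
  have r': "r < r'" "r' < R" using r by (auto simp: r'_def)
  define \<epsilon> where "\<epsilon> n = (R - r') / ?D / 2 * (1 / real (Suc n))" for n
  have \<epsilon>: "\<epsilon> n > 0" for n using r' by (simp add: \<epsilon>_def)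
  have \<epsilon>D: "\<epsilon> n * ?D < R - r'" for n
  proof -
    have "\<epsilon> n * ?D = (R - r') * (1 / (2 * real (Suc n)))" using D by (simp add: \<epsilon>_def)
    also have "\<dots> < (R - r') * 1" using r' by (intro mult_strict_left_mono) (auto simp: field_simps)
    finally show ?thesis by simp
  qed
  have \<epsilon>0: "\<epsilon> \<longlonglongrightarrow> 0"
    unfolding \<epsilon>_def[abs_def] using tendsto_mult_right_zero[OF LIMSEQ_1_div_Suc] by blast
  define c where "c n = (\<integral>z. ker (\<epsilon> n) (z::'a) \<partial>lborel)" for n
  have c: "c n > 0" for n unfolding c_def by (rule ker_integral_pos[OF \<epsilon>])
  define P where "P n i x = (\<integral>z. G i z * ker (\<epsilon> n) (z - x) \<partial>lborel) / c n" for n i x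
  define DP where "DP n i x v = (\<integral>z. - (G i z * pd v (ker (\<epsilon> n)) (z - x)) \<partial>lborel) / c n" for n i x v
  have bdG: "integrable lborel (\<lambda>z. G i z * H z)"
    if "i \<in> Basis" "H \<in> borel_measurable borel" "\<And>z. \<bar>H z\<bar> \<le> B" for i H B
  proof (rule Bochner_Integration.integrable_bound)
    show "integrable lborel (\<lambda>z. B * G i z)" using intG[OF that(1)] by simp
    show "(\<lambda>z. G i z * H z) \<in> borel_measurable lborel" using that meas by simp
    show "AE z in lborel. norm (G i z * H z) \<le> norm (B * G i z)"
    proof (rule AE_I2)
      fix z
      have "\<bar>G i z\<bar> * \<bar>H z\<bar> \<le> \<bar>G i z\<bar> * \<bar>B\<bar>" using that(3)[of z] by (intro mult_left_mono) auto
      then show "norm (G i z * H z) \<le> norm (B * G i z)" by (simp add: abs_mult mult.commute)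
    qed
  qed
  have P_der: "(P n i has_derivative DP n i x) (at x)" if "i \<in> Basis" for n i x
    unfolding P_def DP_def 
    by (rule bounded_linear.has_derivative[OF bounded_linear_divide moll_has_derivative[OF intG[OF that]]])
  have kl: "\<exists>K. K-lipschitz_on UNIV (ker (\<epsilon> n) :: 'a \<Rightarrow> real)" for n using ker_lipschitz by metis
  have P_bdd: "\<bar>P n i x\<bar> \<le> M" if i: "i \<in> Basis" for n i x
  proof -
    have "\<bar>\<integral>z. G i z * ker (\<epsilon> n) (z - x) \<partial>lborel\<bar> \<le> (\<integral>z. M * ker (\<epsilon> n) (z - x) \<partial>lborel)"
    proof (intro order_trans[OF integral_abs_bound] integral_mono integrable_mult_right ker_integral_shift(1) integrable_abs)
      show "integrable lborel (\<lambda>z. G i z * ker (\<epsilon> n) (z - x))"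
        by (rule bdG[OF i _ ker_abs_le_1]) measurable
      show "\<bar>G i z * ker (\<epsilon> n) (z - x)\<bar> \<le> M * ker (\<epsilon> n) (z - x)" for z
        using bdd[OF i, of z] ker_nonneg[of "\<epsilon> n" "z - x"] by (auto simp: abs_mult intro: mult_right_mono)
    qed
    also have "\<dots> = M * c n" by (simp add: ker_integral_shift(2) c_def)
    finally show ?thesis using c[of n] by (simp add: P_def abs_divide divide_simps)
  qed
  \<comment> \<open>This constant may depend on \<open>n\<close>; it only supplies the domination in
    \<open>poincare_ball\<close>. The uniform constant for the primitives comes from the bound
    \<open>M\<close> on the fields.\<close>
  have ex_lip: "\<exists>C. \<forall>i\<in>Basis. C-lipschitz_on UNIV (P n i)" for n
  proof -
    obtain K where K: "K-lipschitz_on UNIV (ker (\<epsilon> n) :: 'a \<Rightarrow> real)" using kl by blast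
    have K0: "K \<ge> 0" using K lipschitz_on_nonneg by auto
    define A where "A i = (\<integral>z. \<bar>G i z\<bar> \<partial>lborel)" for i
    have A0: "A i \<ge> 0" for i by (simp add: A_def)
    define S where "S = (\<Sum>i\<in>(Basis::'a set). A i)"
    have AS: "A i \<le> S" if "i \<in> Basis" for i unfolding S_def using that A0 by (intro member_le_sum) auto
    have S0: "S \<ge> 0" using A0 by (simp add: S_def sum_nonneg)
    have "(S * K / c n)-lipschitz_on UNIV (P n i)" if i: "i \<in> Basis" for i
    proof (rule lipschitz_onI)
      fix x y
      have ii: "integrable lborel (\<lambda>z. G i z * ker (\<epsilon> n) (z - x))" for x
        by (rule bdG[OF i _ ker_abs_le_1]) measurable
      have "\<bar>(\<integral>z. G i z * ker (\<epsilon> n) (z - x) \<partial>lborel) - (\<integral>z. G i z * ker (\<epsilon> n) (z - y) \<partial>lborel)\<bar>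
        = \<bar>\<integral>z. G i z * ker (\<epsilon> n) (z - x) - G i z * ker (\<epsilon> n) (z - y) \<partial>lborel\<bar>"
        using ii by simp
      also have "\<dots> \<le> (\<integral>z. \<bar>G i z\<bar> * (K * dist x y) \<partial>lborel)"
      proof (intro order_trans[OF integral_abs_bound] integral_mono integrable_mult_left integrable_abs Bochner_Integration.integrable_diff ii intG i)
        fix z
        have "\<bar>ker (\<epsilon> n) (z - x) - ker (\<epsilon> n) (z - y)\<bar> \<le> K * dist x y"
          using lipschitz_onD[OF K, of "z - x" "z - y"] by (simp add: dist_norm norm_minus_commute)
        then show "\<bar>G i z * ker (\<epsilon> n) (z - x) - G i z * ker (\<epsilon> n) (z - y)\<bar> \<le> \<bar>G i z\<bar> * (K * dist x y)"
          by (simp add: right_diff_distrib[symmetric] abs_mult mult_left_mono)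
      qed
      also have "\<dots> \<le> S * (K * dist x y)" using AS[OF i] K0 by (simp add: A_def mult_right_mono)
      finally have *: "\<bar>(\<integral>z. G i z * ker (\<epsilon> n) (z - x) \<partial>lborel) - (\<integral>z. G i z * ker (\<epsilon> n) (z - y) \<partial>lborel)\<bar> / c n
          \<le> S * (K * dist x y) / c n" using c[of n] by (intro divide_right_mono) auto
      show "dist (P n i x) (P n i y) \<le> S * K / c n * dist x y"
        using * c[of n] by (simp add: P_def dist_real_def diff_divide_distrib[symmetric] abs_divide)
    qed (use S0 K0 c[of n] in auto)
    then show ?thesis by blast
  qed
  have DP_cont: "continuous_on UNIV (\<lambda>x. DP n i x v)" if i: "i \<in> Basis" for n i v
  proof -
    obtain K where K: "K-lipschitz_on UNIV (ker (\<epsilon> n) :: 'a \<Rightarrow> real)" using kl by blast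
    have b: "\<bar>pd v (ker (\<epsilon> n)) y\<bar> \<le> K * norm v" for y :: 'a
      by (rule pd_bound_at[OF K has_derivative_directional[OF ker_has_derivative]])
    have [measurable]: "G i \<in> borel_measurable borel" by (rule meas[OF i])
    have [measurable]: "(\<lambda>z. pd v (ker (\<epsilon> n)) (z - y)) \<in> borel_measurable borel" for y
    proof (rule measurable_compose[of "\<lambda>z. z - y" borel borel])
      show "pd v (ker (\<epsilon> n)) \<in> borel_measurable borel" by (rule pd_measurable) measurable
    qed measurable
    have "continuous (at x) (\<lambda>x. \<integral>z. - (G i z * pd v (ker (\<epsilon> n)) (z - x)) \<partial>lborel)" for x
      unfolding continuous_at_sequentially
    proof (intro allI impI, unfold comp_def)
      fix X :: "nat \<Rightarrow> 'a" assume X: "X \<longlonglongrightarrow> x"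
      show "(\<lambda>m. \<integral>z. - (G i z * pd v (ker (\<epsilon> n)) (z - X m)) \<partial>lborel) \<longlonglongrightarrow> (\<integral>z. - (G i z * pd v (ker (\<epsilon> n)) (z - x)) \<partial>lborel)"
      proof (rule integral_dominated_convergence[where w="\<lambda>z. \<bar>G i z\<bar> * (K * norm v)"])
        show "AE z in lborel. (\<lambda>m. - (G i z * pd v (ker (\<epsilon> n)) (z - X m))) \<longlonglongrightarrow> - (G i z * pd v (ker (\<epsilon> n)) (z - x))"
          using X pd_ker_continuous[of v "\<epsilon> n"]
          by (intro AE_I2 tendsto_intros continuous_on_tendsto_compose[of UNIV "pd v (ker (\<epsilon> n))"]) auto
        show "AE z in lborel. norm (- (G i z * pd v (ker (\<epsilon> n)) (z - X m))) \<le> \<bar>G i z\<bar> * (K * norm v)" for m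
          using b by (intro AE_I2) (auto simp: abs_mult intro: mult_left_mono)
        show "integrable lborel (\<lambda>z. \<bar>G i z\<bar> * (K * norm v))" using intG[OF i] by simp
      qed measurable
    qed
    then show ?thesis unfolding DP_def using c[of n]
      by (intro continuous_on_divide continuous_at_imp_continuous_on ballI continuous_const) auto
  qed
  \<comment> \<open>The derivative of the mollified field at \<open>x\<close> pairs \<open>G\<close>
    with the derivative of a kernel centred at \<open>x\<close>. This kernel is a bump on a box
    inside \<open>ball x0 R\<close>, where the weak equation may be tested.\<close>
  have DP_sym: "DP n i x j = DP n j x i" if ij: "i \<in> Basis" "j \<in> Basis" and x: "x \<in> ball x0 r'" for n i j x
  proof -
    let ?a = "x - \<epsilon> n *\<^sub>R (\<Sum>Basis)" and ?b = "x + \<epsilon> n *\<^sub>R (\<Sum>Basis)"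
    have sub: "cbox ?a ?b \<subseteq> ball x0 R"
    proof
      fix y assume "y \<in> cbox ?a ?b"
      then have "norm (y - x) < R - r'" using cbox_One_norm[of y x "\<epsilon> n"] \<epsilon>D[of n] by auto
      moreover have "norm (x - x0) < r'" using x by (simp add: dist_norm norm_minus_commute)
      ultimately show "y \<in> ball x0 R" using norm_triangle_ineq[of "y - x" "x - x0"] by (simp add: dist_norm norm_minus_commute)
    qed
    have sh: "pd v (ker (\<epsilon> n)) (z - x) = pd v (bump 1 ?a ?b) z" for v z
    proof -
      have "((\<lambda>z. ker (\<epsilon> n) (z - x)) has_derivative (\<lambda>v. pd v (ker (\<epsilon> n)) (z - x))) (at z)"
        by (rule has_derivative_compose[where g="ker (\<epsilon> n)" and f="\<lambda>z. z - x", OF _ ker_has_derivative])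
          (auto intro!: derivative_eq_intros)
      then have "(bump 1 ?a ?b has_derivative (\<lambda>v. pd v (ker (\<epsilon> n)) (z - x))) (at z)" by (simp add: ker_shift)
      from pd_has_derivative[OF this] show ?thesis by simp
    qed
    show ?thesis unfolding DP_def sh using curl[OF sub ij] by simp
  qed
  have "\<exists>w. w x0 = 0 \<and> (\<forall>x\<in>ball x0 r'. (w has_derivative (\<lambda>v. \<Sum>i\<in>Basis. P n i x * (v \<bullet> i))) (at x))" for n
  proof -
    obtain C where C: "\<And>i. i \<in> Basis \<Longrightarrow> C-lipschitz_on UNIV (P n i)" using ex_lip by blast
    obtain w where "w x0 = 0" "\<And>x. x \<in> ball x0 r' \<Longrightarrow> (w has_derivative (\<lambda>v. \<Sum>i\<in>Basis. P n i x * (v \<bullet> i))) (at x)"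
      by (rule poincare_ball[where P="P n" and DP="DP n" and M=M and C=C and r=r' and ?x0.0=x0, OF P_der DP_cont P_bdd C DP_sym]) blast+
    then show ?thesis by blast
  qed
  then obtain w where w0: "\<And>n. w n x0 = 0"
    and wd: "\<And>n x. x \<in> ball x0 r' \<Longrightarrow> (w n has_derivative (\<lambda>v. \<Sum>i\<in>Basis. P n i x * (v \<bullet> i))) (at x)"
    by metis
  define L where "L = M * ?D"
  have L: "L \<ge> 0" using M by (simp add: L_def)
  have wl: "L-lipschitz_on (cball x0 r) (w n)" for n
  proof (rule lipschitz_onI[OF _ L])
    fix x y assume xy: "x \<in> cball x0 r" "y \<in> cball x0 r"
    have "norm (w n x - w n y) \<le> L * norm (x - y)"
    proof (rule differentiable_bound[of "cball x0 r" "w n" "\<lambda>x v. \<Sum>i\<in>Basis. P n i x * (v \<bullet> i)"])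
      fix z assume "z \<in> cball x0 r"
      then have "z \<in> ball x0 r'" using r' by auto
      then show "(w n has_derivative (\<lambda>v. \<Sum>i\<in>Basis. P n i z * (v \<bullet> i))) (at z within cball x0 r)"
        by (rule has_derivative_at_withinI[OF wd])
      show "onorm (\<lambda>v. \<Sum>i\<in>Basis. P n i z * (v \<bullet> i)) \<le> L"
      proof (rule onorm_le)
        fix v :: 'a
        have "norm (\<Sum>i\<in>Basis. P n i z * (v \<bullet> i)) \<le> (\<Sum>i\<in>(Basis::'a set). M * norm v)"
          using P_bdd M by (intro sum_norm_le) (auto simp: abs_mult intro!: mult_mono Basis_le_norm)
        then show "norm (\<Sum>i\<in>Basis. P n i z * (v \<bullet> i)) \<le> L * norm v" by (simp add: L_def mult_ac)
      qed
    qed (use xy in auto)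
    then show "dist (w n x) (w n y) \<le> L * dist x y" by (simp add: dist_norm)
  qed
  have wb: "norm (w n x) \<le> L * r" if x: "x \<in> cball x0 r" for n x
  proof -
    have "dist (w n x) (w n x0) \<le> L * dist x x0" using r x by (intro lipschitz_onD[OF wl]) auto
    also have "\<dots> \<le> L * r" using x L by (intro mult_left_mono) (auto simp: dist_commute)
    finally show ?thesis by (simp add: w0)
  qed
  have equi: "\<exists>d. 0 < d \<and> (\<forall>n y. y \<in> cball x0 r \<and> norm (x - y) < d \<longrightarrow> norm (w n x - w n y) < e)"
    if x: "x \<in> cball x0 r" and e: "0 < e" for x e
  proof (intro exI[of _ "e / (L + 1)"] conjI allI impI)
    show "0 < e / (L + 1)" using e L by simp
    fix n y assume y: "y \<in> cball x0 r \<and> norm (x - y) < e / (L + 1)"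
    have "norm (w n x - w n y) \<le> L * norm (x - y)"
      using lipschitz_onD[OF wl x, of y n] y by (simp add: dist_norm)
    also have "\<dots> \<le> (L + 1) * norm (x - y)" by (intro mult_right_mono) auto
    also have "\<dots> < e" using y L e by (simp add: pos_less_divide_eq mult.commute)
    finally show "norm (w n x - w n y) < e" .
  qed
  obtain g k where g: "continuous_on (cball x0 r) g" "strict_mono (k :: nat \<Rightarrow> nat)"
    "\<And>e. 0 < e \<Longrightarrow> \<exists>N. \<forall>n x. n \<ge> N \<and> x \<in> cball x0 r \<longrightarrow> norm (w (k n) x - g x) < e"
    by (rule Arzela_Ascoli[OF compact_cball wb equi]) blast+
  have glim: "(\<lambda>n. w (k n) x) \<longlonglongrightarrow> g x" if "x \<in> cball x0 r" for x
    using g(3) that unfolding LIMSEQ_iff by blast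
  have gl: "L-lipschitz_on (cball x0 r) g"
  proof (rule lipschitz_onI[OF _ L])
    fix x y assume xy: "x \<in> cball x0 r" "y \<in> cball x0 r"
    have "(\<lambda>n. dist (w (k n) x) (w (k n) y)) \<longlonglongrightarrow> dist (g x) (g y)"
      using xy by (intro tendsto_dist glim)
    then show "dist (g x) (g y) \<le> L * dist x y"
      by (rule LIMSEQ_le_const2) (use lipschitz_onD[OF wl xy] in blast)
  qed
  \<comment> \<open>The primitives are controlled on the closed ball only; composing with the
    projection makes them Lipschitz and bounded everywhere, and leaves them unchanged on the
    ball.\<close>
  define \<pi> where "\<pi> = closest_point (cball x0 r)"
  have \<pi>: "\<pi> x \<in> cball x0 r" for x unfolding \<pi>_def using r by (intro closest_point_in_set) auto
  have \<pi>_id: "\<pi> x = x" if "x \<in> cball x0 r" for x unfolding \<pi>_def using that by (rule closest_point_self)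
  define W where "W x = g (\<pi> x)" for x
  define V where "V n x = w (k n) (\<pi> x)" for n x
  have Wl: "L-lipschitz_on UNIV W"
    unfolding W_def \<pi>_def using r by (intro lipschitz_on_projection_cball gl) auto
  have Vl: "L-lipschitz_on UNIV (V n)" for n
    unfolding V_def \<pi>_def using r by (intro lipschitz_on_projection_cball wl) auto
  have Vlim: "(\<lambda>n. V n x) \<longlonglongrightarrow> W x" for x unfolding V_def W_def by (rule glim[OF \<pi>])
  have Vb: "\<bar>V n x\<bar> \<le> L * r" for n x using wb[OF \<pi>] by (simp add: V_def)
  have Wb: "\<bar>W x\<bar> \<le> L * r" for x
    by (rule LIMSEQ_le_const2[OF tendsto_rabs[OF Vlim]]) (use Vb in blast)
  have pdV: "pd i (V n) x = P (k n) i x" if i: "i \<in> Basis" and x: "x \<in> ball x0 r" for n i x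
  proof -
    have "(V n has_derivative (\<lambda>v. \<Sum>i\<in>Basis. P (k n) i x * (v \<bullet> i))) (at x)"
    proof (rule has_derivative_transform_within_open[where s="ball x0 r"])
      show "(w (k n) has_derivative (\<lambda>v. \<Sum>i\<in>Basis. P (k n) i x * (v \<bullet> i))) (at x)"
        using x r' by (intro wd) auto
      show "w (k n) y = V n y" if "y \<in> ball x0 r" for y using that by (simp add: V_def \<pi>_id)
    qed (use x in auto)
    from pd_has_derivative[OF this, of i] show ?thesis
      using i by (simp add: inner_Basis if_distrib sum.delta cong: if_cong)
  qed
  have [measurable]: "W \<in> borel_measurable borel" "V n \<in> borel_measurable borel" for n
    using lipschitz_measurable[OF Wl] lipschitz_measurable[OF Vl] by auto
  \<comment> \<open>By Fubini and the symmetry of the kernel, the mollification passes from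
    \<open>G\<close> to the test function, where it converges uniformly; this avoids any convergence
    theorem for the mollified fields themselves.\<close>
  have main: "(\<integral>x. pd i W x * \<phi> x \<partial>lborel) = (\<integral>x. G i x * \<phi> x \<partial>lborel)"
    if i: "i \<in> Basis" and \<phi>: "\<phi> = bump m a b" "m > 0" "cbox a b \<subseteq> ball x0 r" for i \<phi> m a b
  proof -
    obtain K where K: "K-lipschitz_on UNIV \<phi>" unfolding \<phi>(1) by (rule bump_lipschitz[OF \<phi>(2)])
    have K0: "K \<ge> 0" using K lipschitz_on_nonneg by auto
    note [measurable] = lipschitz_measurable[OF K] meas[OF i]
    obtain \<rho> where \<rho>: "cbox a b \<subseteq> cball 0 \<rho>"
      using bounded_subset_ballD[OF bounded_cbox, of a b 0] ball_subset_cball by blast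
    have s0: "\<phi> x = 0" if "x \<notin> cbox a b" for x
      unfolding \<phi>(1) using that box_subset_cbox[of a b] by (intro bump_eq_0[OF \<phi>(2)]) blast
    have supp\<phi>: "\<phi> x = 0" if "x \<notin> cball 0 \<rho>" for x using that \<rho> s0 by blast
    have \<phi>b: "\<bar>\<phi> x\<bar> \<le> 1" for x unfolding \<phi>(1) using bump_nonneg[of m a b x] bump_le_1[of m a b x] by simp
    have \<phi>int: "integrable lborel \<phi>"
    proof (rule integrable_bounded_support[where C=1 and r=\<rho>])
      show "AE x in lborel. \<bar>\<phi> x\<bar> \<le> 1 * indicator (cball 0 \<rho>) x"
      proof (rule AE_I2)
        show "\<bar>\<phi> x\<bar> \<le> 1 * indicator (cball 0 \<rho>) x" for x
          using \<phi>b[of x] supp\<phi>[of x] by (cases "x \<in> cball 0 \<rho>") auto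
      qed
    qed measurable
    have D: "(\<phi> has_derivative frechet_derivative \<phi> (at x)) (at x)" for x
      unfolding \<phi>(1) using bump_differentiable frechet_derivative_works by blast
    have pd\<phi>b: "\<bar>pd i \<phi> x\<bar> \<le> K" for x
      using pd_bound_at[OF K has_derivative_directional[OF D], of x i] pd_has_derivative[OF D, of i x] i by simp
    have pd\<phi>0: "pd i \<phi> x = 0" if "x \<notin> cbox a b" for x
    proof -
      have "(\<phi> has_derivative (\<lambda>v. 0)) (at x)"
      proof (rule has_derivative_transform_within_open[where s="- cbox a b"])
        show "((\<lambda>x. 0) has_derivative (\<lambda>v. 0)) (at x)" by simp
        show "0 = \<phi> y" if "y \<in> - cbox a b" for y using that s0 by auto
      qed (use that in auto)
      from pd_has_derivative[OF this] show ?thesis .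
    qed
    have PW: "(\<lambda>n. \<integral>x. V n x * pd i \<phi> x \<partial>lborel) \<longlonglongrightarrow> (\<integral>x. W x * pd i \<phi> x \<partial>lborel)"
    proof (rule integral_dominated_convergence[OF _ _ integrable_const_cball[of "L * r * K" 0 \<rho>]])
      show "AE x in lborel. (\<lambda>n. V n x * pd i \<phi> x) \<longlonglongrightarrow> W x * pd i \<phi> x"
        by (intro AE_I2 tendsto_mult Vlim tendsto_const)
      show "AE x in lborel. norm (V n x * pd i \<phi> x) \<le> L * r * K * indicator (cball 0 \<rho>) x" for n
      proof (rule AE_I2)
        fix x
        show "norm (V n x * pd i \<phi> x) \<le> L * r * K * indicator (cball 0 \<rho>) x"
        proof (cases "x \<in> cball 0 \<rho>")
          case True
          have "\<bar>V n x\<bar> * \<bar>pd i \<phi> x\<bar> \<le> L * r * K" using Vb[of n x] pd\<phi>b[of x] L r by (intro mult_mono) auto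
          then show ?thesis using True by (simp add: abs_mult)
        next
          case False
          then have "pd i \<phi> x = 0" using \<rho> by (intro pd\<phi>0) blast
          then show ?thesis using False by simp
        qed
      qed
    qed measurable
    have Vparts: "(\<integral>x. V n x * pd i \<phi> x \<partial>lborel) = - (\<integral>x. P (k n) i x * \<phi> x \<partial>lborel)" for n
    proof -
      have "(\<integral>x. pd i (V n) x * \<phi> x \<partial>lborel) = - (\<integral>x. V n x * pd i \<phi> x \<partial>lborel)"
        by (rule pd_by_parts[OF Vl K supp\<phi>])
      moreover have "pd i (V n) x * \<phi> x = P (k n) i x * \<phi> x" for x
        using pdV[OF i, of x n] s0[of x] \<phi>(3) by (cases "x \<in> cbox a b") auto
      ultimately show ?thesis by simp
    qed
    have swap: "(\<integral>x. P n i x * \<phi> x \<partial>lborel) = (\<integral>z. G i z * (\<integral>x. \<phi> x * ker (\<epsilon> n) (x - z) \<partial>lborel) \<partial>lborel) / c n" for n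
    proof -
      have GM: "\<bar>G i z\<bar> \<le> M * indicator (cball 0 (norm x0 + \<bar>R\<bar>)) z" for z
      proof (cases "z \<in> ball x0 R")
        case True
        then have "norm z \<le> norm x0 + \<bar>R\<bar>" using norm_triangle_sub[of z x0] by (simp add: dist_norm norm_minus_commute)
        then show ?thesis using bdd[OF i, of z] by simp
      qed (use supp[OF i] M in auto)
      have "integrable lborel (\<lambda>(z, x). G i z * (\<phi> x * ker (\<epsilon> n) (x - z)))"
      proof (rule integrable_bounded_support[where C=M and r="norm x0 + \<bar>R\<bar> + \<bar>\<rho>\<bar>"])
        show "AE y in lborel. \<bar>case y of (z, x) \<Rightarrow> G i z * (\<phi> x * ker (\<epsilon> n) (x - z))\<bar>
          \<le> M * indicator (cball 0 (norm x0 + \<bar>R\<bar> + \<bar>\<rho>\<bar>)) y"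
        proof (rule AE_I2)
          fix y :: "'a \<times> 'a"
          obtain z x where y: "y = (z, x)" by (cases y)
          show "\<bar>case y of (z, x) \<Rightarrow> G i z * (\<phi> x * ker (\<epsilon> n) (x - z))\<bar> \<le> M * indicator (cball 0 (norm x0 + \<bar>R\<bar> + \<bar>\<rho>\<bar>)) y"
          proof (cases "z \<in> cball 0 (norm x0 + \<bar>R\<bar>) \<and> x \<in> cball 0 \<rho>")
            case True
            have "\<bar>\<phi> x\<bar> * \<bar>ker (\<epsilon> n) (x - z)\<bar> \<le> 1 * 1"
              using \<phi>b[of x] ker_nonneg[of "\<epsilon> n" "x - z"] ker_le_1[of "\<epsilon> n" "x - z"] by (intro mult_mono) auto
            then have "\<bar>G i z\<bar> * (\<bar>\<phi> x\<bar> * \<bar>ker (\<epsilon> n) (x - z)\<bar>) \<le> M * (1 * 1)"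
              using M by (intro mult_mono[OF bdd[OF i]]) auto
            moreover have "norm y \<le> norm x0 + \<bar>R\<bar> + \<bar>\<rho>\<bar>"
              using True norm_Pair_le[of z x] by (auto simp: y)
            ultimately show ?thesis by (simp add: y abs_mult)
          next
            case False
            then have "G i z = 0 \<or> \<phi> x = 0" using GM[of z] supp\<phi>[of x] by auto
            then show ?thesis using M by (auto simp: y)
          qed
        qed
        show "(\<lambda>(z, x). G i z * (\<phi> x * ker (\<epsilon> n) (x - z))) \<in> borel_measurable borel"
          unfolding borel_prod[symmetric] by measurable
      qed
      then have int2: "integrable (lborel \<Otimes>\<^sub>M lborel) (\<lambda>(z, x). G i z * (\<phi> x * ker (\<epsilon> n) (x - z)))"
        by (simp add: lborel_prod)
      have "(\<integral>x. P n i x * \<phi> x \<partial>lborel) = (\<integral>x. (\<integral>z. G i z * (\<phi> x * ker (\<epsilon> n) (x - z)) \<partial>lborel) / c n \<partial>lborel)"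
      proof (intro Bochner_Integration.integral_cong refl)
        fix x :: 'a
        have "ker (\<epsilon> n) (z - x) = ker (\<epsilon> n) (x - z)" for z using ker_sym[of "\<epsilon> n" "x - z"] by simp
        then have "(\<integral>z. G i z * ker (\<epsilon> n) (z - x) \<partial>lborel) * \<phi> x = (\<integral>z. G i z * (\<phi> x * ker (\<epsilon> n) (x - z)) \<partial>lborel)"
          by (simp add: integral_mult_left_zero[symmetric] ac_simps)
        then show "P n i x * \<phi> x = (\<integral>z. G i z * (\<phi> x * ker (\<epsilon> n) (x - z)) \<partial>lborel) / c n"
          by (simp add: P_def)
      qed
      also have "\<dots> = (\<integral>x. (\<integral>z. G i z * (\<phi> x * ker (\<epsilon> n) (x - z)) \<partial>lborel) \<partial>lborel) / c n" by simp
      also have "(\<integral>x. (\<integral>z. G i z * (\<phi> x * ker (\<epsilon> n) (x - z)) \<partial>lborel) \<partial>lborel)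
          = (\<integral>z. (\<integral>x. G i z * (\<phi> x * ker (\<epsilon> n) (x - z)) \<partial>lborel) \<partial>lborel)"
        by (rule lborel_pair.Fubini_integral[OF int2])
      finally show ?thesis by simp
    qed
    have lim2: "(\<lambda>n. \<integral>x. P n i x * \<phi> x \<partial>lborel) \<longlonglongrightarrow> (\<integral>z. G i z * \<phi> z \<partial>lborel)"
    proof -
      have "(\<lambda>n. \<integral>z. G i z * ((\<integral>x. \<phi> x * ker (\<epsilon> n) (x - z) \<partial>lborel) / c n) \<partial>lborel) \<longlonglongrightarrow> (\<integral>z. G i z * \<phi> z \<partial>lborel)"
      proof (rule integral_dominated_convergence[where w="\<lambda>z. \<bar>G i z\<bar> * (1 + K * (R - r'))"])
        have cl: "\<bar>(\<integral>x. \<phi> x * ker (\<epsilon> n) (x - z) \<partial>lborel) / c n - \<phi> z\<bar> \<le> K * (\<epsilon> n * ?D)" for n z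
        proof -
          have "\<bar>(\<integral>x. \<phi> x * ker (\<epsilon> n) (x - z) \<partial>lborel) - \<phi> z * c n\<bar> \<le> K * (\<epsilon> n * ?D) * c n"
            unfolding c_def by (rule moll_close(2)[OF K \<epsilon>])
          moreover have "(\<integral>x. \<phi> x * ker (\<epsilon> n) (x - z) \<partial>lborel) / c n - \<phi> z = ((\<integral>x. \<phi> x * ker (\<epsilon> n) (x - z) \<partial>lborel) - \<phi> z * c n) / c n"
            using c[of n] by (simp add: field_simps)
          ultimately show ?thesis using c[of n] by (simp add: abs_divide pos_divide_le_eq)
        qed
        show "AE z in lborel. (\<lambda>n. G i z * ((\<integral>x. \<phi> x * ker (\<epsilon> n) (x - z) \<partial>lborel) / c n)) \<longlonglongrightarrow> G i z * \<phi> z"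
        proof (intro AE_I2 tendsto_mult tendsto_const)
          fix z
          have "(\<lambda>n. K * (\<epsilon> n * ?D)) \<longlonglongrightarrow> 0"
            using tendsto_mult[OF tendsto_const[of K] tendsto_mult[OF \<epsilon>0 tendsto_const[of ?D]]] by simp
          from Lim_null_comparison[OF _ this, of "\<lambda>n. (\<integral>x. \<phi> x * ker (\<epsilon> n) (x - z) \<partial>lborel) / c n - \<phi> z"]
          have "(\<lambda>n. (\<integral>x. \<phi> x * ker (\<epsilon> n) (x - z) \<partial>lborel) / c n - \<phi> z) \<longlonglongrightarrow> 0"
            using cl by (auto intro: always_eventually)
          then show "(\<lambda>n. (\<integral>x. \<phi> x * ker (\<epsilon> n) (x - z) \<partial>lborel) / c n) \<longlonglongrightarrow> \<phi> z"
            by (rule LIM_zero_cancel)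
        qed
        show "AE z in lborel. norm (G i z * ((\<integral>x. \<phi> x * ker (\<epsilon> n) (x - z) \<partial>lborel) / c n)) \<le> \<bar>G i z\<bar> * (1 + K * (R - r'))" for n
        proof (rule AE_I2)
          fix z
          have "K * (\<epsilon> n * ?D) \<le> K * (R - r')" using \<epsilon>D[of n] K0 by (intro mult_left_mono) auto
          then have "\<bar>(\<integral>x. \<phi> x * ker (\<epsilon> n) (x - z) \<partial>lborel) / c n\<bar> \<le> 1 + K * (R - r')"
            using cl[of n z] \<phi>b[of z] by linarith
          then show "norm (G i z * ((\<integral>x. \<phi> x * ker (\<epsilon> n) (x - z) \<partial>lborel) / c n)) \<le> \<bar>G i z\<bar> * (1 + K * (R - r'))"
            unfolding real_norm_def abs_mult by (rule mult_left_mono) simp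
        qed
        show "integrable lborel (\<lambda>z. \<bar>G i z\<bar> * (1 + K * (R - r')))" using intG[OF i] by simp
      qed measurable
      then show ?thesis by (simp add: swap)
    qed
    have "(\<lambda>n. - (\<integral>x. P (k n) i x * \<phi> x \<partial>lborel)) \<longlonglongrightarrow> - (\<integral>z. G i z * \<phi> z \<partial>lborel)"
      using LIMSEQ_subseq_LIMSEQ[OF lim2 g(2)] by (intro tendsto_minus) (simp add: comp_def)
    then have "(\<integral>x. W x * pd i \<phi> x \<partial>lborel) = - (\<integral>z. G i z * \<phi> z \<partial>lborel)"
      using PW unfolding Vparts by (intro LIMSEQ_unique)
    then show ?thesis using pd_by_parts[OF Wl K supp\<phi>, where v=i] by simp
  qed
  show ?thesis
  proof (rule that[OF Wl])
    show "bounded (range W)" using Wb unfolding bounded_iff by auto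
    fix i :: 'a assume i: "i \<in> Basis"
    note [measurable] = meas[OF i]
    define h where "h x = pd i W x - G i x" for x
    have "AE x in lborel. x \<in> ball x0 r \<longrightarrow> h x = 0"
    proof (rule AE_zero_of_bump_integrals[where C="L + M"])
      show "h \<in> borel_measurable borel" unfolding h_def by measurable
      show "AE x in lborel. \<bar>h x\<bar> \<le> L + M"
        using pd_bound_ae[OF Wl, of i]
      proof eventually_elim
        case (elim x)
        then show ?case using bdd[OF i, of x] i by (simp add: h_def)
      qed
      fix m :: real and a b :: 'a assume m: "m > 0" and ab: "cbox a b \<subseteq> ball x0 r"
      have bb: "\<bar>bump m a b x\<bar> \<le> 1" for x using bump_nonneg[of m a b x] bump_le_1[of m a b x] by simp
      have i2: "integrable lborel (\<lambda>x. G i x * bump m a b x)" by (rule bdG[OF i _ bb]) measurable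
      have i1: "integrable lborel (\<lambda>x. pd i W x * bump m a b x)"
      proof (rule Bochner_Integration.integrable_bound[OF integrable_indicator_box[of L a b]])
        show "AE x in lborel. norm (pd i W x * bump m a b x) \<le> norm (L * indicat_real (box a b) x)"
          using pd_bound_ae[OF Wl, of i]
        proof eventually_elim
          case (elim x)
          show ?case
          proof (cases "x \<in> box a b")
            case True
            have "\<bar>pd i W x\<bar> * \<bar>bump m a b x\<bar> \<le> L * 1" using elim bb[of x] i L by (intro mult_mono) auto
            then show ?thesis using True L by (simp add: abs_mult)
          qed (simp add: bump_eq_0[OF m])
        qed
      qed measurable
      show "(\<integral>x. h x * bump m a b x \<partial>lborel) = 0"
        unfolding h_def left_diff_distrib Bochner_Integration.integral_diff[OF i1 i2] using main[OF i refl m ab] by simp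
    qed auto
    then show "AE x in lborel. x \<in> ball x0 r \<longrightarrow> pd i W x = G i x" by (simp add: h_def)
  qed
qed

subsection \<open>The planar Jacobian determinant\<close>

abbreviation e1 :: "real^2" where "e1 \<equiv> axis 1 1"
abbreviation e2 :: "real^2" where "e2 \<equiv> axis 2 1"

definition jac :: "(real^2 \<Rightarrow> real) \<Rightarrow> (real^2 \<Rightarrow> real) \<Rightarrow> real^2 \<Rightarrow> real" where
  "jac a b x = pd e1 a x * pd e2 b x - pd e2 a x * pd e1 b x"

definition det2 :: "real^2 \<Rightarrow> real^2 \<Rightarrow> real" where
  "det2 p q = p $ 1 * q $ 2 - p $ 2 * q $ 1"

text \<open>The clockwise rotation by a right angle. Every vector is of the form
  \<open>rot e\<close>, with \<open>e\<close> orthogonal to it.\<close>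

definition rot :: "real^2 \<Rightarrow> real^2" where
  "rot e = vector [e $ 2, - (e $ 1)]"

lemma rot_nth [simp]: "rot e $ 1 = e $ 2" "rot e $ 2 = - (e $ 1)"
  by (simp_all add: rot_def)

lemma inner_real2: "(x::real^2) \<bullet> y = x $ 1 * y $ 1 + x $ 2 * y $ 2"
  by (simp add: inner_vec_def sum_2)

lemma Basis_real2: "(Basis :: (real^2) set) = {e1, e2}"
  by (auto simp: Basis_vec_def UNIV_2)

lemma norm_e [simp]: "norm e1 = 1" "norm e2 = 1"
  by simp_all

lemma vec_nth_measurable [measurable]: "(\<lambda>x::real^2. x $ i) \<in> borel_measurable borel"
  by (intro borel_measurable_continuous_onI continuous_intros)

text \<open>The left side is orthogonal to \<open>e\<close>, hence a multiple of
  \<open>rot e\<close>. For the columns \<open>p\<close> and \<open>q\<close> of \<open>Du\<close>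
  this says that in the Jacobian of a function of \<open>u\<close> against
  \<open>u \<bullet> e\<close> only the derivative along \<open>rot e\<close> survives.\<close>

lemma det2_rot: "(q \<bullet> e) *\<^sub>R p - (p \<bullet> e) *\<^sub>R q = det2 p q *\<^sub>R rot e"
  by (simp add: vec_eq_iff forall_2 inner_real2 det2_def algebra_simps)

lemma det2_bound: "\<bar>det2 p q\<bar> \<le> norm p * norm q"
proof -
  have "det2 p q = q \<bullet> vector [- (p $ 2), p $ 1]" by (simp add: det2_def inner_real2)
  also have "\<bar>\<dots>\<bar> \<le> norm q * norm (vector [- (p $ 2), p $ 1] :: real^2)" by (rule Cauchy_Schwarz_ineq2)
  also have "norm (vector [- (p $ 2), p $ 1] :: real^2) = norm p"
    by (simp add: norm_eq_sqrt_inner inner_real2 add.commute)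
  finally show ?thesis by (simp add: mult.commute)
qed

lemma pd_zero_outside:
  fixes a :: "'a::real_normed_vector \<Rightarrow> real"
  assumes "open S" "x \<in> S" "\<And>y. y \<in> S \<Longrightarrow> a y = 0"
  shows "pd v a x = 0"
proof -
  have "(a has_derivative (\<lambda>v. 0)) (at x)"
    by (rule has_derivative_transform_within_open[where s=S and f="\<lambda>x. 0"]) (use assms in auto)
  from pd_has_derivative[OF this] show ?thesis .
qed

lemma jac_has_derivative:
  "(a has_derivative A) (at x) \<Longrightarrow> (b has_derivative B) (at x) \<Longrightarrow> jac a b x = A e1 * B e2 - A e2 * B e1"
  by (simp add: jac_def pd_has_derivative)

lemma jac_measurable [measurable]:
  assumes [measurable]: "a \<in> borel_measurable borel" "b \<in> borel_measurable borel"
  shows "jac a b \<in> borel_measurable borel"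
  unfolding jac_def[abs_def] by measurable

lemma jac_bound_ae:
  assumes a: "L-lipschitz_on UNIV a" and b: "K-lipschitz_on UNIV b"
  shows "AE x in lborel. \<bar>jac a b x\<bar> \<le> 2 * L * K"
  using pd_bound_ae[OF a, of e1] pd_bound_ae[OF a, of e2] pd_bound_ae[OF b, of e1] pd_bound_ae[OF b, of e2]
proof eventually_elim
  case (elim x)
  have L: "L \<ge> 0" using a lipschitz_on_nonneg by auto
  have "\<bar>pd e1 a x\<bar> * \<bar>pd e2 b x\<bar> \<le> L * K" "\<bar>pd e2 a x\<bar> * \<bar>pd e1 b x\<bar> \<le> L * K"
    using elim L by (auto intro!: mult_mono)
  then show ?case unfolding jac_def by (intro order_trans[OF abs_triangle_ineq4]) (simp add: abs_mult)
qed

text \<open>The planar Jacobian is a null Lagrangian. For merely Lipschitz functions the usual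
  divergence form would involve second derivatives; \<open>pd_commute\<close> exchanges the two
  derivatives at the level of the integrals instead.\<close>

lemma integral_jac:
  assumes a: "L-lipschitz_on UNIV a" and b: "K-lipschitz_on UNIV b" and supp: "\<And>x. x \<notin> cball 0 r \<Longrightarrow> a x = 0"
  shows "(\<integral>x. jac a b x \<partial>lborel) = 0"
proof -
  note [measurable] = lipschitz_measurable[OF a] lipschitz_measurable[OF b]
  have L: "L \<ge> 0" using a lipschitz_on_nonneg by auto
  have int: "integrable lborel (\<lambda>x. pd v a x * pd w b x)" for v w
  proof (rule integrable_bounded_support[where C="L * norm v * (K * norm w)" and r=r])
    show "AE x in lborel. \<bar>pd v a x * pd w b x\<bar> \<le> L * norm v * (K * norm w) * indicator (cball 0 r) x"
      using pd_bound_ae[OF a, of v] pd_bound_ae[OF b, of w]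
    proof eventually_elim
      case (elim x)
      show ?case
      proof (cases "x \<in> cball 0 r")
        case True
        have "\<bar>pd v a x\<bar> * \<bar>pd w b x\<bar> \<le> L * norm v * (K * norm w)" using elim L by (intro mult_mono) auto
        then show ?thesis using True by (simp add: abs_mult)
      next
        case False
        have "pd v a x = 0" by (rule pd_zero_outside[of "- cball 0 r"]) (use supp False in auto)
        then show ?thesis using False by simp
      qed
    qed
  qed measurable
  show ?thesis
    unfolding jac_def Bochner_Integration.integral_diff[OF int int]
    using pd_commute[OF a b supp, where v=e1 and w=e2] by simp
qed

lemma AE_zero_imp_zero_on_open:
  fixes f :: "'a::euclidean_space \<Rightarrow> real"
  assumes "open S" "continuous_on S f" "AE x in lborel. x \<in> S \<longrightarrow> f x = 0" "x \<in> S"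
  shows "f x = 0"
proof (rule ccontr)
  assume "f x \<noteq> 0"
  define U where "U = S \<inter> f -` (- {0})"
  have U: "open U" unfolding U_def by (rule continuous_open_preimage[OF assms(2,1)]) auto
  have "AE x in lborel. x \<notin> U" using assms(3) by eventually_elim (auto simp: U_def)
  then have "U \<in> null_sets lborel" using U by (subst AE_iff_null_sets) auto
  then have "negligible U" by (simp add: negligible_iff_null_sets null_sets_completionI)
  then have "U = {}" using U open_not_negligible by blast
  with \<open>f x \<noteq> 0\<close> assms(4) show False by (auto simp: U_def)
qed

text \<open>Integration by parts shows that mollifications of \<open>f\<close> have derivative 0 on
  a smaller ball, so they are constant there, and they approximate \<open>f\<close> uniformly. The
  Lipschitz condition matters: Cantor's function is continuous with derivative 0 almost
  everywhere.\<close>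

lemma lipschitz_zero_derivative_constant:
  fixes f :: "'a::euclidean_space \<Rightarrow> real"
  assumes f: "L-lipschitz_on UNIV f" and z: "AE x in lborel. x \<in> ball p \<rho> \<longrightarrow> (f has_derivative (\<lambda>v. 0)) (at x)"
    and xy: "x \<in> ball p \<rho>" "y \<in> ball p \<rho>"
  shows "f x = f y"
proof -
  let ?D = "real DIM('a)"
  have L: "L \<ge> 0" using f lipschitz_on_nonneg by auto
  note [measurable] = lipschitz_measurable[OF f]
  define \<delta> where "\<delta> = \<rho> - max (dist p x) (dist p y)"
  have \<delta>: "\<delta> > 0" using xy by (auto simp: \<delta>_def)
  have key: "\<bar>f x - f y\<bar> \<le> 2 * L * (\<epsilon> * ?D)" if \<epsilon>: "\<epsilon> > 0" "\<epsilon> * ?D < \<delta>" for \<epsilon>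
  proof -
    define c where "c = (\<integral>z. ker \<epsilon> (z::'a) \<partial>lborel)"
    have c: "c > 0" unfolding c_def by (rule ker_integral_pos[OF \<epsilon>(1)])
    \<comment> \<open>Truncation makes \<open>f\<close> integrable. On \<open>ball p \<rho>\<close>,
      which contains the supports of the kernels considered, nothing changes.\<close>
    define G where "G z = indicator (cball 0 (norm p + \<bar>\<rho>\<bar>)) z * f z" for z
    have [measurable]: "cball 0 (norm p + \<bar>\<rho>\<bar>) \<in> sets (borel :: 'a measure)" by (rule borel_closed) simp
    have [measurable]: "G \<in> borel_measurable borel" unfolding G_def[abs_def] by measurable
    have G: "integrable lborel G"
    proof (rule integrable_bounded_support[where C="\<bar>f 0\<bar> + L * (norm p + \<bar>\<rho>\<bar>)" and r="norm p + \<bar>\<rho>\<bar>"])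
      show "AE x in lborel. \<bar>G x\<bar> \<le> (\<bar>f 0\<bar> + L * (norm p + \<bar>\<rho>\<bar>)) * indicator (cball 0 (norm p + \<bar>\<rho>\<bar>)) x"
        using lipschitz_growth[OF f] by (intro AE_I2) (auto simp: G_def indicator_def)
    qed measurable
    have Gf: "G z = f z" if "z \<in> ball p \<rho>" for z
      using that norm_triangle_sub[of z p] by (auto simp: G_def indicator_def dist_norm norm_minus_commute)
    define m where "m q = (\<integral>z. G z * ker \<epsilon> (z - q) \<partial>lborel)" for q
    define B where "B = ball p (\<rho> - \<epsilon> * ?D)"
    have near: "z \<in> ball p \<rho>" if "q \<in> B" "norm (z - q) \<le> \<epsilon> * ?D" for q z
    proof -
      have "dist p z \<le> dist p q + dist q z" by (rule dist_triangle)
      with that show ?thesis by (auto simp: B_def dist_norm norm_minus_commute)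
    qed
    have m0: "(m has_derivative (\<lambda>v. 0)) (at q)" if q: "q \<in> B" for q
    proof -
      have "(\<integral>z. - (G z * pd v (ker \<epsilon>) (z - q)) \<partial>lborel) = 0" for v
      proof -
        define k where "k z = ker \<epsilon> (z - q)" for z
        obtain K where K0: "K-lipschitz_on UNIV (ker \<epsilon> :: 'a \<Rightarrow> real)" by (rule ker_lipschitz)
        have K: "K-lipschitz_on UNIV k"
        proof (rule lipschitz_onI)
          show "dist (k z) (k z') \<le> K * dist z z'" for z z'
            using lipschitz_onD[OF K0, of "z - q" "z' - q"] by (simp add: k_def dist_norm)
        qed (rule lipschitz_on_nonneg[OF K0])
        have ksupp: "norm (z - q) \<le> \<epsilon> * ?D" if "k z \<noteq> 0" for z
          using ker_support[of \<epsilon> "z - q"] that by (simp add: k_def)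
        have supp: "k z = 0" if "z \<notin> cball 0 (norm q + \<epsilon> * ?D)" for z
          using ksupp[of z] that norm_triangle_sub[of z q] by fastforce
        have "(k has_derivative (\<lambda>v. pd v (ker \<epsilon>) (z - q))) (at z)" for z
          unfolding k_def
          by (rule has_derivative_compose[where g="ker \<epsilon>" and f="\<lambda>z. z - q", OF _ ker_has_derivative])
            (auto intro!: derivative_eq_intros)
        then have pdk: "pd v k z = pd v (ker \<epsilon>) (z - q)" for z by (rule pd_has_derivative)
        have "G z * pd v (ker \<epsilon>) (z - q) = f z * pd v k z" for z
        proof (cases "norm (z - q) \<le> \<epsilon> * ?D")
          case True
          then show ?thesis using Gf[OF near[OF q]] pdk by simp
        next
          case False
          have "open {z. \<epsilon> * ?D < norm (z - q)}" by (intro open_Collect_less continuous_intros)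
          then have "pd v k z = 0"
          proof (rule pd_zero_outside)
            show "k y = 0" if "y \<in> {z. \<epsilon> * ?D < norm (z - q)}" for y
              using ksupp[of y] that by fastforce
          qed (use False in simp)
          then show ?thesis using pdk by simp
        qed
        then have "(\<integral>z. G z * pd v (ker \<epsilon>) (z - q) \<partial>lborel) = (\<integral>z. f z * pd v k z \<partial>lborel)" by simp
        also have "\<dots> = - (\<integral>z. pd v f z * k z \<partial>lborel)" using pd_by_parts[OF f K supp, where v=v] by simp
        also have "(\<integral>z. pd v f z * k z \<partial>lborel) = (\<integral>z. 0 \<partial>(lborel :: 'a measure))"
        proof (rule integral_cong_AE)
          show "AE z in lborel. pd v f z * k z = 0"
            using z
          proof eventually_elim
            case (elim z)
            show ?case
            proof (cases "k z = 0")
              case False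
              then have "z \<in> ball p \<rho>" using near[OF q ksupp] by blast
              with elim have "pd v f z = 0" by (metis pd_has_derivative)
              then show ?thesis by simp
            qed simp
          qed
          show "(\<lambda>z. pd v f z * k z) \<in> borel_measurable lborel" unfolding k_def by measurable
        qed simp
        finally show ?thesis by simp
      qed
      with moll_has_derivative[OF G, of \<epsilon> q] show ?thesis unfolding m_def by simp
    qed
    have inB: "x \<in> B" "y \<in> B" using \<epsilon> by (auto simp: B_def \<delta>_def)
    have mc: "m x = m y"
      by (rule has_derivative_zero_unique[of B m, OF _ _ inB])
        (auto simp: B_def intro!: has_derivative_at_withinI m0)
    have mf: "m q = (\<integral>z. f z * ker \<epsilon> (z - q) \<partial>lborel)" if q: "q \<in> B" for q
      unfolding m_def
    proof (intro Bochner_Integration.integral_cong refl)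
      fix z
      show "G z * ker \<epsilon> (z - q) = f z * ker \<epsilon> (z - q)"
        using ker_support[of \<epsilon> "z - q"] Gf[OF near[OF q, of z]] by (cases "ker \<epsilon> (z - q) = 0") auto
    qed
    have "\<bar>m x - f x * c\<bar> \<le> L * (\<epsilon> * ?D) * c" "\<bar>m y - f y * c\<bar> \<le> L * (\<epsilon> * ?D) * c"
      using moll_close(2)[OF f \<epsilon>(1)] mf inB by (auto simp: c_def)
    then have "\<bar>f x * c - f y * c\<bar> \<le> 2 * (L * (\<epsilon> * ?D) * c)" using mc by linarith
    then have "\<bar>f x - f y\<bar> * c \<le> (2 * L * (\<epsilon> * ?D)) * c"
      using c by (simp add: left_diff_distrib[symmetric] abs_mult mult.assoc)
    then show ?thesis using c by simp
  qed
  have "\<bar>f x - f y\<bar> \<le> 0"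
  proof (rule field_le_epsilon)
    fix e :: real assume e: "e > 0"
    define \<epsilon> where "\<epsilon> = min (\<delta> / 2) (e / (2 * L + 1)) / ?D"
    have "\<epsilon> > 0" using \<delta> e L by (simp add: \<epsilon>_def)
    moreover have eD: "\<epsilon> * ?D = min (\<delta> / 2) (e / (2 * L + 1))" by (simp add: \<epsilon>_def)
    moreover have "min (\<delta> / 2) (e / (2 * L + 1)) < \<delta>" using \<delta> by auto
    ultimately have "\<bar>f x - f y\<bar> \<le> 2 * L * min (\<delta> / 2) (e / (2 * L + 1))" using key[of \<epsilon>] by simp
    also have "\<dots> \<le> (2 * L + 1) * (e / (2 * L + 1))" using L \<delta> e by (intro mult_mono) auto
    also have "\<dots> = e" using L by simp
    finally show "\<bar>f x - f y\<bar> \<le> 0 + e" by simp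
  qed
  then show ?thesis by simp
qed

lemma lipschitz_cutoff:
  fixes x0 :: "'a::metric_space"
  assumes ab: "a < b"
  obtains \<eta> where "(1 / (b - a))-lipschitz_on UNIV \<eta>" "\<And>x. 0 \<le> \<eta> x" "\<And>x. \<eta> x \<le> (1::real)"
    "\<And>x. dist x0 x \<le> a \<Longrightarrow> \<eta> x = 1" "\<And>x. b \<le> dist x0 x \<Longrightarrow> \<eta> x = 0"
proof -
  define \<eta> where "\<eta> x = max 0 (min 1 ((b - dist x0 x) / (b - a)))" for x
  have clamp: "\<bar>max 0 (min 1 s) - max 0 (min 1 t)\<bar> \<le> \<bar>s - t\<bar>" for s t :: real
  proof -
    have 1: "\<bar>max 0 p - max 0 q\<bar> \<le> \<bar>p - q\<bar>" for p q :: real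
      by (cases "p \<ge> 0"; cases "q \<ge> 0") auto
    have 2: "\<bar>min 1 s - min 1 t\<bar> \<le> \<bar>s - t\<bar>"
      by (cases "s \<ge> 1"; cases "t \<ge> 1") auto
    show ?thesis using 1 2 by (rule order_trans)
  qed
  show ?thesis
  proof (rule that[of \<eta>])
    show "(1 / (b - a))-lipschitz_on UNIV \<eta>"
    proof (rule lipschitz_onI)
      fix x y
      have "(b - dist x0 x) / (b - a) - (b - dist x0 y) / (b - a) = (dist x0 y - dist x0 x) / (b - a)"
        by (simp add: diff_divide_distrib)
      then have "\<bar>\<eta> x - \<eta> y\<bar> \<le> \<bar>(dist x0 y - dist x0 x) / (b - a)\<bar>"
        unfolding \<eta>_def using clamp by metis
      also have "\<dots> = \<bar>dist x0 y - dist x0 x\<bar> / (b - a)" using ab by (simp add: abs_divide)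
      also have "\<dots> \<le> dist x y / (b - a)"
        using ab by (intro divide_right_mono) (metis abs_dist_diff_le dist_commute, simp)
      finally show "dist (\<eta> x) (\<eta> y) \<le> 1 / (b - a) * dist x y" by (simp add: dist_real_def)
    qed (use ab in simp)
    show "\<eta> x = 1" if "dist x0 x \<le> a" for x
    proof -
      have "1 \<le> (b - dist x0 x) / (b - a)" using that ab by (simp add: pos_le_divide_eq)
      then show ?thesis by (simp add: \<eta>_def)
    qed
    show "\<eta> x = 0" if "b \<le> dist x0 x" for x
    proof -
      have "(b - dist x0 x) / (b - a) \<le> 0" using that ab by (simp add: divide_nonpos_pos)
      then show ?thesis by (simp add: \<eta>_def)
    qed
  qed (auto simp: \<eta>_def)
qed

lemma compact_norm_lower_bound:
  fixes u :: "'a::topological_space \<Rightarrow> 'b::real_normed_vector"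
  assumes "compact K" "continuous_on K u" "\<And>x. x \<in> K \<Longrightarrow> u x \<noteq> 0"
  obtains d where "d > 0" "\<And>x. x \<in> K \<Longrightarrow> d \<le> norm (u x)"
proof (cases "K = {}")
  case True
  then show ?thesis using that[of 1] by auto
next
  case False
  obtain x where "x \<in> K" "\<And>y. y \<in> K \<Longrightarrow> norm (u x) \<le> norm (u y)"
    using continuous_attains_inf[OF assms(1) False continuous_on_norm[OF assms(2)]] by blast
  then show ?thesis using assms(3) by (intro that[of "norm (u x)"]) auto
qed

subsection \<open>Rigidity of proportional gradients\<close>

text \<open>The situation once the potential \<open>w\<close> has been found: the function
  \<open>g\<close> and the equation have disappeared, and \<beta> is the unknown factor between the
  two derivatives. The sign condition makes \<open>Du\<close> invertible almost everywhere on
  \<open>S\<close>, so there \<beta> is determined by \<open>u\<close> and \<open>w\<close>. The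
  bounds on the whole plane are met in the application by extending from a ball.\<close>

locale proportional_gradients =
  fixes u w :: "real^2 \<Rightarrow> real^2" and \<beta> :: "real^2 \<Rightarrow> real" and S :: "(real^2) set"
    and Lu Lw Bu Bw :: real
  assumes u_lip: "Lu-lipschitz_on UNIV u" and u_bdd: "\<And>x. norm (u x) \<le> Bu"
    and w_lip: "Lw-lipschitz_on UNIV w" and w_bdd: "\<And>x. norm (w x) \<le> Bw"
    and S: "open S"
    and good: "AE x in lborel. x \<in> S \<longrightarrow> (\<exists>Du. (u has_derivative Du) (at x) \<and>
      (w has_derivative (\<lambda>v. \<beta> x *\<^sub>R Du v)) (at x) \<and> \<beta> x * det2 (Du e1) (Du e2) > 0)"
begin

lemma Lu: "Lu \<ge> 0" and Lw: "Lw \<ge> 0" and Bu: "Bu \<ge> 0" and Bw: "Bw \<ge> 0"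
  by (rule lipschitz_on_nonneg[OF u_lip] lipschitz_on_nonneg[OF w_lip]
      order_trans[OF norm_ge_zero u_bdd] order_trans[OF norm_ge_zero w_bdd])+

lemma u_cont: "continuous_on A u" and w_cont: "continuous_on A w"
  by (rule continuous_on_subset[OF lipschitz_on_continuous_on[OF u_lip] subset_UNIV]
      continuous_on_subset[OF lipschitz_on_continuous_on[OF w_lip] subset_UNIV])+

lemma uw_measurable [measurable]: "u \<in> borel_measurable borel" "w \<in> borel_measurable borel"
  using lipschitz_measurable[OF u_lip] lipschitz_measurable[OF w_lip] by auto

lemma w_inner_lip: "(Lw * norm e)-lipschitz_on UNIV (\<lambda>x. w x \<bullet> e)"
proof (rule lipschitz_onI)
  fix x y
  have "\<bar>(w x - w y) \<bullet> e\<bar> \<le> norm (w x - w y) * norm e" by (rule Cauchy_Schwarz_ineq2)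
  also have "\<dots> \<le> (Lw * dist x y) * norm e"
    using lipschitz_onD[OF w_lip, of x y] by (intro mult_right_mono) (auto simp: dist_norm)
  finally show "dist (w x \<bullet> e) (w y \<bullet> e) \<le> Lw * norm e * dist x y"
    by (simp add: dist_real_def inner_diff_left mult_ac)
qed (use Lw in simp)

lemma u_inner_lip: "(Lu * norm e)-lipschitz_on UNIV (\<lambda>x. u x \<bullet> e)"
proof (rule lipschitz_onI)
  fix x y
  have "\<bar>(u x - u y) \<bullet> e\<bar> \<le> norm (u x - u y) * norm e" by (rule Cauchy_Schwarz_ineq2)
  also have "\<dots> \<le> (Lu * dist x y) * norm e"
    using lipschitz_onD[OF u_lip, of x y] by (intro mult_right_mono) (auto simp: dist_norm)
  finally show "dist (u x \<bullet> e) (u y \<bullet> e) \<le> Lu * norm e * dist x y"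
    by (simp add: dist_real_def inner_diff_left mult_ac)
qed (use Lu in simp)

text \<open>One component is taken from \<open>w\<close> and the other from \<open>u\<close>, so
  that the factor \<beta> enters exactly once and the Jacobian is \<beta> times that of
  \<open>u\<close>. Expressed through \<open>pd\<close>, it is Borel without recourse to the
  measurability of \<beta>.\<close>

definition m :: "real^2 \<Rightarrow> real" where
  "m = jac (\<lambda>x. w x \<bullet> e1) (\<lambda>x. u x \<bullet> e2)"

lemma m_measurable [measurable]: "m \<in> borel_measurable borel"
  unfolding m_def by measurable

lemma m_eq:
  assumes "(u has_derivative Du) (at x)" "(w has_derivative (\<lambda>v. \<beta> x *\<^sub>R Du v)) (at x)"
  shows "m x = \<beta> x * det2 (Du e1) (Du e2)"
proof -
  have "((\<lambda>x. w x \<bullet> e1) has_derivative (\<lambda>v. (\<beta> x *\<^sub>R Du v) \<bullet> e1)) (at x)"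
    by (rule has_derivative_inner_left[OF assms(2)])
  moreover have "((\<lambda>x. u x \<bullet> e2) has_derivative (\<lambda>v. Du v \<bullet> e2)) (at x)"
    by (rule has_derivative_inner_left[OF assms(1)])
  ultimately show ?thesis
    unfolding m_def by (subst jac_has_derivative) (auto simp: det2_def inner_real2 axis_def algebra_simps)
qed

lemma m_pos_ae: "AE x in lborel. x \<in> S \<longrightarrow> m x > 0"
  using good by eventually_elim (use m_eq in auto)

lemma m_bound_ae: "AE x in lborel. \<bar>m x\<bar> \<le> 2 * Lw * Lu"
  using jac_bound_ae[OF w_inner_lip u_inner_lip, of e1 e2] unfolding m_def by simp

text \<open>On \<open>S\<close> the function \<open>m\<close> is positive and bounded only up to
  null sets. The clamped version is nonnegative and bounded at every point, and for
  \<open>A \<subseteq> S\<close> it agrees almost everywhere with \<open>m\<close> restricted to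
  \<open>A\<close>.\<close>

definition \<mu> :: "(real^2) set \<Rightarrow> real^2 \<Rightarrow> real" where
  "\<mu> A x = indicator A x * min (2 * Lw * Lu) (max 0 (m x))"

lemma \<mu>_bounds: "0 \<le> \<mu> A x" "\<mu> A x \<le> 2 * Lw * Lu"
  using Lu Lw by (auto simp: \<mu>_def indicator_def)

lemma \<mu>_eq_ae:
  assumes "A \<subseteq> S"
  shows "AE x in lborel. \<mu> A x = indicator A x * m x"
  using m_pos_ae m_bound_ae by eventually_elim (use assms in \<open>auto simp: \<mu>_def indicator_def\<close>)

lemma \<mu>_measurable [measurable]:
  assumes [measurable]: "A \<in> sets borel"
  shows "\<mu> A \<in> borel_measurable borel"
  unfolding \<mu>_def[abs_def] by measurable

lemma \<mu>_integrable:
  assumes [measurable]: "H \<in> borel_measurable borel" and H: "\<And>x. x \<in> ball x0 r \<Longrightarrow> \<bar>H x\<bar> \<le> C"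
  shows "integrable lborel (\<lambda>x. H x * \<mu> (ball x0 r) x)"
proof (rule integrable_bounded_support[where C="\<bar>C\<bar> * (2 * Lw * Lu)" and r="norm x0 + \<bar>r\<bar>"])
  show "AE x in lborel. \<bar>H x * \<mu> (ball x0 r) x\<bar> \<le> \<bar>C\<bar> * (2 * Lw * Lu) * indicator (cball 0 (norm x0 + \<bar>r\<bar>)) x"
  proof (rule AE_I2)
    fix x
    show "\<bar>H x * \<mu> (ball x0 r) x\<bar> \<le> \<bar>C\<bar> * (2 * Lw * Lu) * indicator (cball 0 (norm x0 + \<bar>r\<bar>)) x"
    proof (cases "x \<in> ball x0 r")
      case True
      then have "x \<in> cball 0 (norm x0 + \<bar>r\<bar>)"
        using norm_triangle_sub[of x x0] by (auto simp: dist_norm norm_minus_commute)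
      moreover have "\<bar>H x\<bar> * \<bar>\<mu> (ball x0 r) x\<bar> \<le> \<bar>C\<bar> * (2 * Lw * Lu)"
        using H[OF True] \<mu>_bounds[of "ball x0 r" x] by (intro mult_mono) auto
      ultimately show ?thesis by (simp add: abs_mult)
    next
      case False
      then show ?thesis using Lu Lw by (simp add: \<mu>_def)
    qed
  qed
qed measurable

text \<open>The integrand is the Jacobian of \<open>\<phi> (u x) * (\<alpha> + \<gamma> * (w x \<bullet> e)\<^sup>2)\<close> and \<open>w x \<bullet> e\<close>: the derivative of
  the second factor drops out, and of the derivative of \<open>\<phi> \<circ> u\<close> only the part along \<open>rot e\<close> survives.\<close>

lemma transport_identity:
  assumes r: "r > 0" "ball x0 r \<subseteq> S" and s: "s > 0"
    and far: "\<And>x. x \<in> ball x0 r \<Longrightarrow> r / 2 \<le> dist x0 x \<Longrightarrow> 2 * s \<le> norm (u x)"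
    and \<phi>: "K-lipschitz_on UNIV \<phi>" "\<And>y. (\<phi> has_derivative D\<phi> y) (at y)" "\<And>y. 2 * s \<le> norm y \<Longrightarrow> \<phi> y = 0"
      "\<And>y. \<bar>\<phi> y\<bar> \<le> 1"
  shows "(\<integral>x. D\<phi> (u x) (rot e) * (\<alpha> + \<gamma> * (w x \<bullet> e)\<^sup>2) * \<mu> (ball x0 r) x \<partial>lborel) = 0"
proof -
  define q where "q x = \<alpha> + \<gamma> * (w x \<bullet> e)\<^sup>2" for x
  define a where "a x = (if x \<in> ball x0 r then \<phi> (u x) * q x else 0)" for x
  obtain ct :: "real^2 \<Rightarrow> real" where ct_lip: "(1 / (r - r / 2))-lipschitz_on UNIV ct" and ct: "\<And>x. 0 \<le> ct x" "\<And>x. ct x \<le> 1"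
    "\<And>x. dist x0 x \<le> r / 2 \<Longrightarrow> ct x = 1" "\<And>x. r \<le> dist x0 x \<Longrightarrow> ct x = 0"
    using lipschitz_cutoff[of "r / 2" r x0] r(1) by auto
  have K: "K \<ge> 0" using \<phi>(1) lipschitz_on_nonneg by auto
  have web: "\<bar>w x \<bullet> e\<bar> \<le> Bw * norm e" for x
    using Cauchy_Schwarz_ineq2[of "w x" e] w_bdd[of x] by (meson mult_right_mono norm_ge_zero order_trans)
  have BE: "Bw * norm e \<ge> 0" using Bw by simp
  have sq_lip: "(Bw * norm e * (Lw * norm e) + Bw * norm e * (Lw * norm e))-lipschitz_on UNIV (\<lambda>x. (w x \<bullet> e)\<^sup>2)"
    unfolding power2_eq_square
    by (rule lipschitz_on_mult_bounded[OF w_inner_lip _ w_inner_lip]) (use web BE in auto)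
  obtain Lq where Lq: "Lq-lipschitz_on UNIV q"
  proof -
    have "\<bar>\<gamma>\<bar> * (Bw * norm e * (Lw * norm e) + Bw * norm e * (Lw * norm e)) \<ge> 0" using Bw Lw by simp
    then have "(\<bar>\<gamma>\<bar> * (Bw * norm e * (Lw * norm e) + Bw * norm e * (Lw * norm e)))-lipschitz_on UNIV q"
    proof (rule lipschitz_onI[rotated])
      fix x y
      have "\<bar>\<gamma>\<bar> * dist ((w x \<bullet> e)\<^sup>2) ((w y \<bullet> e)\<^sup>2) \<le> \<bar>\<gamma>\<bar> * ((Bw * norm e * (Lw * norm e) + Bw * norm e * (Lw * norm e)) * dist x y)"
        by (intro mult_left_mono lipschitz_onD[OF sq_lip]) auto
      then show "dist (q x) (q y) \<le> \<bar>\<gamma>\<bar> * (Bw * norm e * (Lw * norm e) + Bw * norm e * (Lw * norm e)) * dist x y"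
        by (simp add: q_def dist_real_def right_diff_distrib[symmetric] abs_mult mult.assoc)
    qed
    then show ?thesis by (rule that)
  qed
  define Q where "Q = \<bar>\<alpha>\<bar> + \<bar>\<gamma>\<bar> * (Bw * norm e)\<^sup>2"
  have Q: "\<bar>q x\<bar> \<le> Q" for x
  proof -
    have "(w x \<bullet> e)\<^sup>2 \<le> (Bw * norm e)\<^sup>2" using power_mono[OF web, of x 2] by simp
    then have "\<bar>\<gamma>\<bar> * (w x \<bullet> e)\<^sup>2 \<le> \<bar>\<gamma>\<bar> * (Bw * norm e)\<^sup>2" by (rule mult_left_mono) simp
    then show ?thesis unfolding q_def Q_def
      by (intro order_trans[OF abs_triangle_ineq]) (simp add: abs_mult)
  qed
  have Q0: "Q \<ge> 0" by (simp add: Q_def)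
  have \<phi>u: "(K * Lu)-lipschitz_on UNIV (\<lambda>x. \<phi> (u x))"
    using lipschitz_on_compose2[OF u_lip, of K \<phi>] lipschitz_on_subset[OF \<phi>(1)] by auto
  have \<phi>q: "(1 * Lq + Q * (K * Lu))-lipschitz_on UNIV (\<lambda>x. \<phi> (u x) * q x)"
    by (rule lipschitz_on_mult_bounded[OF \<phi>u _ Lq]) (use \<phi>(4) Q Q0 in auto)
  \<comment> \<open>By \<open>far\<close>, the factor \<open>\<phi> (u x)\<close> already vanishes
    on the outer half of the ball. Hence the abrupt truncation in \<open>a\<close> coincides with
    multiplication by the Lipschitz cutoff \<open>ct\<close>, and \<open>a\<close> is
    Lipschitz.\<close>
  have a_eq: "a x = ct x * (\<phi> (u x) * q x)" for x
  proof -
    consider "dist x0 x < r / 2" | "r / 2 \<le> dist x0 x" "dist x0 x < r" | "r \<le> dist x0 x" by linarith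
    then show ?thesis
    proof cases
      case 1
      then show ?thesis using ct(3)[of x] r(1) by (simp add: a_def)
    next
      case 2
      then have "\<phi> (u x) = 0" using far[of x] \<phi>(3) by auto
      then show ?thesis by (simp add: a_def)
    next
      case 3
      then show ?thesis using ct(4)[of x] by (simp add: a_def)
    qed
  qed
  have \<phi>qb: "\<bar>\<phi> (u x) * q x\<bar> \<le> Q" for x
    using mult_mono[OF \<phi>(4)[of "u x"] Q[of x]] by (simp add: abs_mult)
  obtain La where La: "La-lipschitz_on UNIV a"
  proof -
    have "(1 * (1 * Lq + Q * (K * Lu)) + Q * (1 / (r - r / 2)))-lipschitz_on UNIV (\<lambda>x. ct x * (\<phi> (u x) * q x))"
      by (rule lipschitz_on_mult_bounded[OF ct_lip _ \<phi>q]) (use \<phi>qb Q0 ct(1,2) in auto)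
    then show ?thesis using that by (simp add: a_eq[abs_def])
  qed
  have "(\<integral>x. jac a (\<lambda>x. w x \<bullet> e) x \<partial>lborel) = 0"
  proof (rule integral_jac[OF La w_inner_lip])
    fix x :: "real^2" assume "x \<notin> cball 0 (norm x0 + r)"
    then have "x \<notin> ball x0 r" using norm_triangle_sub[of x x0] by (auto simp: dist_norm norm_minus_commute)
    then show "a x = 0" by (simp add: a_def)
  qed
  moreover have "(\<integral>x. jac a (\<lambda>x. w x \<bullet> e) x \<partial>lborel) =
    (\<integral>x. D\<phi> (u x) (rot e) * (\<alpha> + \<gamma> * (w x \<bullet> e)\<^sup>2) * \<mu> (ball x0 r) x \<partial>lborel)"
  proof (rule integral_cong_AE)
    show "AE x in lborel. jac a (\<lambda>x. w x \<bullet> e) x = D\<phi> (u x) (rot e) * (\<alpha> + \<gamma> * (w x \<bullet> e)\<^sup>2) * \<mu> (ball x0 r) x"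
      using good \<mu>_eq_ae[OF r(2)]
    proof eventually_elim
      case (elim x)
      show ?case
      proof (cases "x \<in> ball x0 r")
        case True
        then obtain Du where Du: "(u has_derivative Du) (at x)" "(w has_derivative (\<lambda>v. \<beta> x *\<^sub>R Du v)) (at x)"
          using elim r(2) by blast
        have D1: "((\<lambda>x. \<phi> (u x)) has_derivative (\<lambda>v. D\<phi> (u x) (Du v))) (at x)"
          by (rule has_derivative_compose[OF Du(1) \<phi>(2)])
        have D2: "((\<lambda>x. w x \<bullet> e) has_derivative (\<lambda>v. (\<beta> x *\<^sub>R Du v) \<bullet> e)) (at x)"
          by (rule has_derivative_inner_left[OF Du(2)])
        have D3: "((\<lambda>x. \<phi> (u x) * q x) has_derivative (\<lambda>v. \<phi> (u x) * (\<gamma> * (2 * (w x \<bullet> e) * ((\<beta> x *\<^sub>R Du v) \<bullet> e))) + D\<phi> (u x) (Du v) * q x)) (at x)"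
        proof -
          have "((\<lambda>x. (w x \<bullet> e) * (w x \<bullet> e)) has_derivative
              (\<lambda>v. (w x \<bullet> e) * ((\<beta> x *\<^sub>R Du v) \<bullet> e) + ((\<beta> x *\<^sub>R Du v) \<bullet> e) * (w x \<bullet> e))) (at x)"
            by (rule has_derivative_mult[OF D2 D2])
          then have "(q has_derivative (\<lambda>v. \<gamma> * (2 * (w x \<bullet> e) * ((\<beta> x *\<^sub>R Du v) \<bullet> e)))) (at x)"
            unfolding q_def power2_eq_square
            by (intro has_derivative_eq_rhs[OF has_derivative_add[OF has_derivative_const has_derivative_mult_right]]) (auto simp: algebra_simps)
          from has_derivative_mult[OF D1 this] show ?thesis .
        qed
        have "(a has_derivative (\<lambda>v. \<phi> (u x) * (\<gamma> * (2 * (w x \<bullet> e) * ((\<beta> x *\<^sub>R Du v) \<bullet> e))) + D\<phi> (u x) (Du v) * q x)) (at x)"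
          by (rule has_derivative_transform_within_open[OF D3, where s="ball x0 r"]) (use True in \<open>auto simp: a_def\<close>)
        from jac_has_derivative[OF this D2]
        have "jac a (\<lambda>x. w x \<bullet> e) x = q x * \<beta> x * (D\<phi> (u x) (Du e1) * (Du e2 \<bullet> e) - D\<phi> (u x) (Du e2) * (Du e1 \<bullet> e))"
          by (simp add: algebra_simps)
        also have "D\<phi> (u x) (Du e1) * (Du e2 \<bullet> e) - D\<phi> (u x) (Du e2) * (Du e1 \<bullet> e)
          = D\<phi> (u x) ((Du e2 \<bullet> e) *\<^sub>R Du e1 - (Du e1 \<bullet> e) *\<^sub>R Du e2)"
          using has_derivative_linear[OF \<phi>(2)] by (simp add: linear_diff linear_scale mult.commute)
        also have "\<dots> = det2 (Du e1) (Du e2) * D\<phi> (u x) (rot e)"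
          using has_derivative_linear[OF \<phi>(2)] by (simp add: det2_rot linear_scale)
        finally show ?thesis using True elim(2) m_eq[OF Du] by (simp add: q_def mult_ac)
      next
        case False
        have "a y = 0" if "y \<in> - cball x0 (r / 2)" for y
          using that far[of y] \<phi>(3)[of "u y"] by (auto simp: a_def)
        then have "pd v a x = 0" for v
          by (intro pd_zero_outside[of "- cball x0 (r / 2)"]) (use False r in auto)
        then show ?thesis using False by (simp add: jac_def \<mu>_def)
      qed
    qed
    note [measurable] = lipschitz_measurable[OF La] lipschitz_measurable[OF w_inner_lip] lipschitz_measurable[OF \<phi>(1)]
    show "jac a (\<lambda>x. w x \<bullet> e) \<in> borel_measurable lborel" by measurable
    have "D\<phi> y (rot e) = pd (rot e) \<phi> y" for y using pd_has_derivative[OF \<phi>(2)] by simp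
    moreover have "(\<lambda>x. pd (rot e) \<phi> (u x)) \<in> borel_measurable borel"
      by (rule measurable_compose[OF uw_measurable(1) pd_measurable]) measurable
    ultimately have [measurable]: "(\<lambda>x. D\<phi> (u x) (rot e)) \<in> borel_measurable borel" by simp
    show "(\<lambda>x. D\<phi> (u x) (rot e) * (\<alpha> + \<gamma> * (w x \<bullet> e)\<^sup>2) * \<mu> (ball x0 r) x) \<in> borel_measurable lborel" by measurable
  qed
  ultimately show ?thesis by simp
qed

text \<open>The centre of the kernel is moved along the segment from 0 to \<open>rot e\<close>; up
  to sign, the derivative of the integral is the one that vanishes by
  \<open>transport_identity\<close>. In the plane the kernel has support radius at most
  \<open>2 * \<epsilon> < s\<close> and the centres have norm at most \<open>s\<close>, so the test
  functions live where the norm is below \<open>2 * s\<close>, away from the values of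
  \<open>u\<close> near the boundary of the ball.\<close>

lemma transport_invariance:
  assumes r: "r > 0" "ball x0 r \<subseteq> S" and \<epsilon>: "\<epsilon> > 0" "2 * \<epsilon> < s"
    and far: "\<And>x. x \<in> ball x0 r \<Longrightarrow> r / 2 \<le> dist x0 x \<Longrightarrow> 2 * s \<le> norm (u x)"
    and y: "norm (rot e) \<le> s"
  shows "(\<integral>x. ker \<epsilon> (u x - rot e) * (\<alpha> + \<gamma> * (w x \<bullet> e)\<^sup>2) * \<mu> (ball x0 r) x \<partial>lborel) =
    (\<integral>x. ker \<epsilon> (u x) * (\<alpha> + \<gamma> * (w x \<bullet> e)\<^sup>2) * \<mu> (ball x0 r) x \<partial>lborel)"
proof -
  define H where "H x = (\<alpha> + \<gamma> * (w x \<bullet> e)\<^sup>2) * \<mu> (ball x0 r) x" for x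
  define C where "C = \<bar>\<alpha>\<bar> + \<bar>\<gamma>\<bar> * (Bw * norm e)\<^sup>2"
  have Cb: "\<bar>\<alpha> + \<gamma> * (w x \<bullet> e)\<^sup>2\<bar> \<le> C" for x
  proof -
    have web: "\<bar>w x \<bullet> e\<bar> \<le> Bw * norm e"
      using Cauchy_Schwarz_ineq2[of "w x" e] w_bdd[of x] by (meson mult_right_mono norm_ge_zero order_trans)
    have "(w x \<bullet> e)\<^sup>2 \<le> (Bw * norm e)\<^sup>2" using power_mono[OF web, of 2] by simp
    then have "\<bar>\<gamma>\<bar> * (w x \<bullet> e)\<^sup>2 \<le> \<bar>\<gamma>\<bar> * (Bw * norm e)\<^sup>2" by (rule mult_left_mono) simp
    then show ?thesis unfolding C_def by (intro order_trans[OF abs_triangle_ineq]) (simp add: abs_mult)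
  qed
  obtain K where K: "K-lipschitz_on UNIV (ker \<epsilon> :: real^2 \<Rightarrow> real)" by (rule ker_lipschitz)
  have K0: "K \<ge> 0" using K lipschitz_on_nonneg by auto
  have s: "s > 0" using \<epsilon> by simp
  define h where "h \<tau> = (\<integral>x. ker \<epsilon> (u x - \<tau> *\<^sub>R rot e) * H x \<partial>lborel)" for \<tau>
  have "(h has_real_derivative 0) (at \<tau> within {0..1})" if \<tau>: "\<tau> \<in> {0..1}" for \<tau>
  proof -
    have "(h has_derivative (\<lambda>\<sigma>. \<integral>x. (- \<sigma> * pd (rot e) (ker \<epsilon>) (u x - \<tau> *\<^sub>R rot e)) * H x \<partial>lborel)) (at \<tau>)"
      unfolding h_def
    proof (rule has_derivative_integral[where g="\<lambda>x. K * norm (rot e) * \<bar>H x\<bar>"])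
      have iH: "integrable lborel (\<lambda>x. (F x * (\<alpha> + \<gamma> * (w x \<bullet> e)\<^sup>2)) * \<mu> (ball x0 r) x)"
        if [measurable]: "F \<in> borel_measurable borel" and "\<And>x. \<bar>F x\<bar> \<le> 1" for F
      proof (rule \<mu>_integrable[where C=C])
        show "\<bar>F x * (\<alpha> + \<gamma> * (w x \<bullet> e)\<^sup>2)\<bar> \<le> C" for x
          using mult_mono[OF that(2)[of x] Cb[of x]] by (simp add: abs_mult)
      qed measurable
      show "integrable lborel (\<lambda>x. ker \<epsilon> (u x - t *\<^sub>R rot e) * H x)" for t
      proof -
        have "(\<lambda>x. ker \<epsilon> (u x - t *\<^sub>R rot e)) \<in> borel_measurable borel" by measurable
        from iH[OF this ker_abs_le_1] show ?thesis by (simp add: H_def mult.assoc)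
      qed
      show "integrable lborel (\<lambda>x. K * norm (rot e) * \<bar>H x\<bar>)"
        using iH[of "\<lambda>x. 1"] by (intro integrable_mult_right integrable_abs) (simp add: H_def[abs_def])
      fix x
      have "((\<lambda>t. ker \<epsilon> (u x - t *\<^sub>R rot e)) has_derivative (\<lambda>\<sigma>. pd (- (\<sigma> *\<^sub>R rot e)) (ker \<epsilon>) (u x - \<tau> *\<^sub>R rot e))) (at \<tau>)"
        by (rule has_derivative_compose[where g="ker \<epsilon>" and f="\<lambda>t. u x - t *\<^sub>R rot e", OF _ ker_has_derivative])
          (auto intro!: derivative_eq_intros)
      moreover have "pd (- (\<sigma> *\<^sub>R rot e)) (ker \<epsilon>) z = - \<sigma> * pd (rot e) (ker \<epsilon>) z" for \<sigma> and z :: "real^2"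
      proof -
        have L: "linear (\<lambda>v. pd v (ker \<epsilon>) z)" by (rule has_derivative_linear[OF ker_has_derivative])
        show ?thesis using linear_neg[OF L, of "\<sigma> *\<^sub>R rot e"] linear_scale[OF L, of \<sigma> "rot e"] by simp
      qed
      ultimately have "((\<lambda>t. ker \<epsilon> (u x - t *\<^sub>R rot e)) has_derivative (\<lambda>\<sigma>. - \<sigma> * pd (rot e) (ker \<epsilon>) (u x - \<tau> *\<^sub>R rot e))) (at \<tau>)"
        by simp
      then show "((\<lambda>t. ker \<epsilon> (u x - t *\<^sub>R rot e) * H x) has_derivative (\<lambda>\<sigma>. (- \<sigma> * pd (rot e) (ker \<epsilon>) (u x - \<tau> *\<^sub>R rot e)) * H x)) (at \<tau>)"
        by (rule has_derivative_mult_left)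
      fix t
      have "\<bar>ker \<epsilon> (u x - t *\<^sub>R rot e) - ker \<epsilon> (u x - \<tau> *\<^sub>R rot e)\<bar> \<le> K * (norm (rot e) * norm (t - \<tau>))"
        using lipschitz_onD[OF K, of "u x - t *\<^sub>R rot e" "u x - \<tau> *\<^sub>R rot e"]
        by (simp add: dist_norm dist_real_def scaleR_left_diff_distrib[symmetric] abs_minus_commute mult.commute)
      then have "\<bar>ker \<epsilon> (u x - t *\<^sub>R rot e) - ker \<epsilon> (u x - \<tau> *\<^sub>R rot e)\<bar> * \<bar>H x\<bar> \<le> K * (norm (rot e) * norm (t - \<tau>)) * \<bar>H x\<bar>"
        by (rule mult_right_mono) simp
      then show "\<bar>ker \<epsilon> (u x - t *\<^sub>R rot e) * H x - ker \<epsilon> (u x - \<tau> *\<^sub>R rot e) * H x\<bar> \<le> K * norm (rot e) * \<bar>H x\<bar> * norm (t - \<tau>)"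
        unfolding left_diff_distrib[symmetric] abs_mult by (simp add: mult_ac)
    qed
    moreover have "(\<integral>x. (- \<sigma> * pd (rot e) (ker \<epsilon>) (u x - \<tau> *\<^sub>R rot e)) * H x \<partial>lborel) = 0" for \<sigma>
    proof -
      have "(\<integral>x. pd (rot e) (ker \<epsilon>) (u x - \<tau> *\<^sub>R rot e) * (\<alpha> + \<gamma> * (w x \<bullet> e)\<^sup>2) * \<mu> (ball x0 r) x \<partial>lborel) = 0"
      proof (rule transport_identity[OF r s far, where \<phi>="\<lambda>v. ker \<epsilon> (v - \<tau> *\<^sub>R rot e)" and D\<phi>="\<lambda>y v. pd v (ker \<epsilon>) (y - \<tau> *\<^sub>R rot e)" and K=K])
        show "K-lipschitz_on UNIV (\<lambda>v. ker \<epsilon> (v - \<tau> *\<^sub>R rot e))"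
        proof (rule lipschitz_onI)
          show "dist (ker \<epsilon> (z - \<tau> *\<^sub>R rot e)) (ker \<epsilon> (z' - \<tau> *\<^sub>R rot e)) \<le> K * dist z z'" for z z'
            using lipschitz_onD[OF K, of "z - \<tau> *\<^sub>R rot e" "z' - \<tau> *\<^sub>R rot e"] by (simp add: dist_norm)
        qed (rule K0)
        show "((\<lambda>v. ker \<epsilon> (v - \<tau> *\<^sub>R rot e)) has_derivative (\<lambda>v. pd v (ker \<epsilon>) (y - \<tau> *\<^sub>R rot e))) (at y)" for y
          by (rule has_derivative_compose[where g="ker \<epsilon>" and f="\<lambda>v. v - \<tau> *\<^sub>R rot e", OF _ ker_has_derivative])
            (auto intro!: derivative_eq_intros)
        show "ker \<epsilon> (z - \<tau> *\<^sub>R rot e) = 0" if "2 * s \<le> norm z" for z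
        proof (rule ccontr)
          assume "ker \<epsilon> (z - \<tau> *\<^sub>R rot e) \<noteq> 0"
          from ker_support[OF this] have "norm (z - \<tau> *\<^sub>R rot e) < s" using \<epsilon> by simp
          moreover have "norm (\<tau> *\<^sub>R rot e) \<le> s" using \<tau> y by (simp add: mult_left_le_one_le order_trans[OF mult_left_le_one_le])
          ultimately show False using that norm_triangle_sub[of z "\<tau> *\<^sub>R rot e"] by linarith
        qed
      qed (use ker_abs_le_1 in auto)
      then show ?thesis by (simp add: H_def mult.assoc)
    qed
    ultimately have "(h has_derivative (\<lambda>\<sigma>. 0)) (at \<tau>)" by simp
    then have "(h has_real_derivative 0) (at \<tau>)" by (simp add: has_field_derivative_def lambda_zero)
    then show ?thesis by (rule has_field_derivative_at_within)
  qed
  then have "\<exists>c. \<forall>\<tau>\<in>{0..1}. h \<tau> = c"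
    by (intro has_field_derivative_zero_constant) auto
  then have "h 1 = h 0" by force
  then show ?thesis by (simp add: h_def H_def mult.assoc)
qed

end

section \<open>Lipschitz bounds for inner products and reciprocals\<close>

lemma lipschitz_on_inner_bounded:
  fixes f g :: "'a::metric_space \<Rightarrow> 'b::real_inner"
  assumes f: "L-lipschitz_on S f" "\<And>x. norm (f x) \<le> A"
    and g: "K-lipschitz_on S g" "\<And>x. norm (g x) \<le> B"
    and nonneg: "0 \<le> A" "0 \<le> B"
  shows "(A * K + B * L)-lipschitz_on S (\<lambda>x. f x \<bullet> g x)"
proof (rule lipschitz_onI)
  have LK: "0 \<le> L" "0 \<le> K" using f g lipschitz_on_nonneg by auto
  then show "0 \<le> A * K + B * L" using nonneg by simp
  fix x y assume x: "x \<in> S" and y: "y \<in> S"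
  have "f x \<bullet> g x - f y \<bullet> g y = f x \<bullet> (g x - g y) + g y \<bullet> (f x - f y)"
    by (simp add: inner_diff_right inner_commute)
  then have "\<bar>f x \<bullet> g x - f y \<bullet> g y\<bar> \<le> norm (f x) * norm (g x - g y) + norm (g y) * norm (f x - f y)"
    using Cauchy_Schwarz_ineq2[of "f x" "g x - g y"] Cauchy_Schwarz_ineq2[of "g y" "f x - f y"] by linarith
  also have "\<dots> \<le> A * (K * dist x y) + B * (L * dist x y)"
    using f(2)[of x] g(2)[of y] lipschitz_onD[OF f(1) x y] lipschitz_onD[OF g(1) x y] nonneg
    by (intro add_mono mult_mono) (auto simp: dist_norm)
  finally show "dist (f x \<bullet> g x) (f y \<bullet> g y) \<le> (A * K + B * L) * dist x y"
    by (simp add: dist_real_def algebra_simps)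
qed

text \<open>Where \<open>g \<ge> c\<close> this is the reciprocal of \<open>g\<close>; the maximum
  provides a substitute that is Lipschitz also where \<open>g\<close> is small.\<close>

lemma lipschitz_on_inverse_max:
  fixes g :: "'a::metric_space \<Rightarrow> real"
  assumes g: "L-lipschitz_on S g" and c: "c > 0"
  shows "(L / c\<^sup>2)-lipschitz_on S (\<lambda>x. 1 / max (g x) c)"
proof (rule lipschitz_onI)
  have L: "L \<ge> 0" using g lipschitz_on_nonneg by auto
  then show "0 \<le> L / c\<^sup>2" by simp
  fix x y assume x: "x \<in> S" and y: "y \<in> S"
  define p where "p = max (g x) c"
  define q where "q = max (g y) c"
  have pq: "p \<ge> c" "q \<ge> c" by (auto simp: p_def q_def)
  have "\<bar>p - q\<bar> \<le> \<bar>g x - g y\<bar>"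
    unfolding p_def q_def by (cases "g x \<ge> c"; cases "g y \<ge> c") auto
  also have "\<dots> \<le> L * dist x y" using lipschitz_onD[OF g x y] by (simp add: dist_real_def)
  finally have 1: "\<bar>q - p\<bar> \<le> L * dist x y" by (simp add: abs_minus_commute)
  have 2: "c\<^sup>2 \<le> p * q" unfolding power2_eq_square using pq c by (intro mult_mono) auto
  have "1 / p - 1 / q = (q - p) / (p * q)" using pq c by (simp add: divide_simps)
  then have "\<bar>1 / p - 1 / q\<bar> = \<bar>q - p\<bar> / (p * q)" using pq c by (simp add: abs_divide abs_mult)
  also have "\<dots> \<le> L * dist x y / c\<^sup>2"
    using 1 2 c by (intro frac_le) auto
  finally show "dist (1 / max (g x) c) (1 / max (g y) c) \<le> L / c\<^sup>2 * dist x y"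
    by (simp add: p_def q_def dist_real_def)
qed

context proportional_gradients
begin

text \<open>For \<open>e\<close> orthogonal to \<open>y\<close>, the integral of \<open>(w x \<bullet> e)\<^sup>2\<close> over the strip \<open>u x \<approx> y\<close> equals that over
  \<open>u x \<approx> 0\<close>, where \<open>w\<close> is small; averaging over \<open>y\<close> gives the estimate.\<close>

lemma small_strip:
  assumes r: "r > 0" "ball x0 r \<subseteq> S" and s: "s > 0"
    and far: "\<And>x. x \<in> ball x0 r \<Longrightarrow> r / 2 \<le> dist x0 x \<Longrightarrow> 2 * s \<le> norm (u x)"
    and \<epsilon>: "\<epsilon> > 0" "4 * \<epsilon> < s" "\<epsilon> \<le> \<eta>"
    and small: "\<And>x. x \<in> ball x0 r \<Longrightarrow> norm (u x) \<le> 2 * \<epsilon> \<Longrightarrow> norm (w x) \<le> \<eta>"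
  shows "(\<integral>\<^sup>+x. ennreal ((det2 (u x) (w x))\<^sup>2 * indicator {x. norm (u x) < s / 2} x * \<mu> (ball x0 r) x) \<partial>lborel)
    \<le> ennreal (8 * \<eta>\<^sup>2 * Bw\<^sup>2 + 2 * (s\<^sup>2 * \<eta>\<^sup>2)) * (\<integral>\<^sup>+x. ennreal (\<mu> (ball x0 r) x) \<partial>lborel)"
proof -
  let ?\<mu> = "\<mu> (ball x0 r)"
  \<comment> \<open>On the support of the kernel \<open>u x\<close> and \<open>y\<close> differ by
    at most \<open>2 * \<eta>\<close>. Replacing \<open>u x\<close> by \<open>y\<close> in the
    squared determinant therefore adds at most 2 (2 \<eta> Bw)^2 = \<alpha>, besides a factor 2 on
    the new square. The second summand of \<kappa> bounds that square on the strip around the fibre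
    of 0.\<close>
  define \<alpha> where "\<alpha> = 8 * \<eta>\<^sup>2 * Bw\<^sup>2"
  have \<alpha>: "\<alpha> \<ge> 0" by (simp add: \<alpha>_def)
  define \<kappa> where "\<kappa> = \<alpha> + 2 * (s\<^sup>2 * \<eta>\<^sup>2)"
  have \<kappa>: "\<kappa> \<ge> 0" using \<alpha> by (simp add: \<kappa>_def)
  have \<eta>: "\<eta> > 0" using \<epsilon> by simp
  define c where "c = (\<integral>z. ker \<epsilon> (z::real^2) \<partial>lborel)"
  have c: "c > 0" unfolding c_def by (rule ker_integral_pos[OF \<epsilon>(1)])
  have ker_y: "(\<integral>\<^sup>+y. ennreal (ker \<epsilon> (z - y)) \<partial>lborel) = ennreal c" for z :: "real^2"
  proof -
    have "ker \<epsilon> (z - y) = ker \<epsilon> (y - z)" for y using ker_sym[of \<epsilon> "y - z"] by simp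
    then have "(\<integral>\<^sup>+y. ennreal (ker \<epsilon> (z - y)) \<partial>lborel) = (\<integral>\<^sup>+y. ennreal (ker \<epsilon> (y - z)) \<partial>lborel)" by simp
    also have "\<dots> = ennreal (\<integral>y. ker \<epsilon> (y - z) \<partial>lborel)"
      by (intro nn_integral_eq_integral ker_integral_shift(1) AE_I2 ker_nonneg)
    finally show ?thesis by (simp add: ker_integral_shift(2) c_def)
  qed
  have [measurable]: "(\<lambda>x. det2 y (w x)) \<in> borel_measurable borel" "(\<lambda>x. det2 (u x) (w x)) \<in> borel_measurable borel" for y
    unfolding det2_def by measurable
  have b2: "\<bar>ker \<epsilon> z * (a + b * (det2 y (w x))\<^sup>2)\<bar> \<le> a + b * (norm y * Bw)\<^sup>2" if "a \<ge> 0" "b \<ge> 0" for a b x y and z :: "real^2"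
  proof -
    have "\<bar>det2 y (w x)\<bar> \<le> norm y * Bw"
      using det2_bound[of y "w x"] w_bdd[of x] by (meson mult_left_mono norm_ge_zero order_trans)
    from power_mono[OF this, of 2] have "(det2 y (w x))\<^sup>2 \<le> (norm y * Bw)\<^sup>2" by simp
    then have "b * (det2 y (w x))\<^sup>2 \<le> b * (norm y * Bw)\<^sup>2" using that by (rule_tac mult_left_mono)
    then have "a + b * (det2 y (w x))\<^sup>2 \<le> a + b * (norm y * Bw)\<^sup>2" by simp
    then have "\<bar>ker \<epsilon> z\<bar> * \<bar>a + b * (det2 y (w x))\<^sup>2\<bar> \<le> 1 * (a + b * (norm y * Bw)\<^sup>2)"
      using that by (intro mult_mono ker_abs_le_1) auto
    then show ?thesis by (simp add: abs_mult)
  qed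
  have fibre: "(\<integral>\<^sup>+x. ennreal (ker \<epsilon> (u x - y) * (\<alpha> + 2 * (det2 y (w x))\<^sup>2) * ?\<mu> x) \<partial>lborel)
      \<le> ennreal \<kappa> * (\<integral>\<^sup>+x. ennreal (ker \<epsilon> (u x - y) * ?\<mu> x) \<partial>lborel)" if y: "y \<in> ball 0 s" for y
  proof -
    define e :: "real^2" where "e = vector [- (y $ 2), y $ 1]"
    have e: "rot e = y" by (simp add: vec_eq_iff forall_2 e_def)
    have we: "w x \<bullet> e = det2 y (w x)" for x by (simp add: inner_real2 e_def det2_def)
    have ys: "norm (rot e) \<le> s" using y e by simp
    note inv = transport_invariance[OF r \<epsilon>(1) _ far ys, unfolded e we]
    have i: "integrable lborel (\<lambda>x. ker \<epsilon> (u x - z) * (a + b * (det2 y (w x))\<^sup>2) * ?\<mu> x)" if "a \<ge> 0" "b \<ge> 0" for a b z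
      by (rule \<mu>_integrable[OF _ b2[OF that]]) measurable
    have i0: "integrable lborel (\<lambda>x. ker \<epsilon> (u x) * (a + b * (det2 y (w x))\<^sup>2) * ?\<mu> x)" if "a \<ge> 0" "b \<ge> 0" for a b
      using i[OF that, of 0] by simp
    have "(\<integral>x. ker \<epsilon> (u x - y) * (\<alpha> + 2 * (det2 y (w x))\<^sup>2) * ?\<mu> x \<partial>lborel)
      = (\<integral>x. ker \<epsilon> (u x) * (\<alpha> + 2 * (det2 y (w x))\<^sup>2) * ?\<mu> x \<partial>lborel)"
      by (rule inv) (use \<epsilon> in auto)
    also have "\<dots> \<le> (\<integral>x. \<kappa> * (ker \<epsilon> (u x) * (1 + 0 * (det2 y (w x))\<^sup>2) * ?\<mu> x) \<partial>lborel)"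
    proof (intro integral_mono i0 integrable_mult_right \<alpha>)
      fix x
      show "ker \<epsilon> (u x) * (\<alpha> + 2 * (det2 y (w x))\<^sup>2) * ?\<mu> x \<le> \<kappa> * (ker \<epsilon> (u x) * (1 + 0 * (det2 y (w x))\<^sup>2) * ?\<mu> x)"
      proof (cases "ker \<epsilon> (u x) = 0 \<or> x \<notin> ball x0 r")
        case True
        then show ?thesis by (auto simp: \<mu>_def)
      next
        case False
        then have "norm (w x) \<le> \<eta>" using ker_support[of \<epsilon> "u x"] by (intro small) auto
        then have "norm y * norm (w x) \<le> s * \<eta>" using y s by (intro mult_mono) auto
        then have "\<bar>det2 y (w x)\<bar> \<le> s * \<eta>" using det2_bound[of y "w x"] by linarith
        from power_mono[OF this, of 2] have "(det2 y (w x))\<^sup>2 \<le> s\<^sup>2 * \<eta>\<^sup>2" by (simp add: power_mult_distrib)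
        then have "\<alpha> + 2 * (det2 y (w x))\<^sup>2 \<le> \<kappa>" by (simp add: \<kappa>_def)
        then have "(\<alpha> + 2 * (det2 y (w x))\<^sup>2) * (ker \<epsilon> (u x) * ?\<mu> x) \<le> \<kappa> * (ker \<epsilon> (u x) * ?\<mu> x)"
          using ker_nonneg \<mu>_bounds(1) by (intro mult_right_mono mult_nonneg_nonneg) auto
        then show ?thesis by (simp add: mult_ac)
      qed
    qed auto
    also have "\<dots> = \<kappa> * (\<integral>x. ker \<epsilon> (u x) * (1 + 0 * (det2 y (w x))\<^sup>2) * ?\<mu> x \<partial>lborel)" by simp
    \<comment> \<open>The invariance is used a second time, now for the total mass, to return from
      the strip around 0 to the strip around \<open>y\<close>.\<close>
    also have "\<dots> = \<kappa> * (\<integral>x. ker \<epsilon> (u x - y) * (1 + 0 * (det2 y (w x))\<^sup>2) * ?\<mu> x \<partial>lborel)"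
      by (subst inv[of 1 0]) (use \<epsilon> in auto)
    finally have le: "(\<integral>x. ker \<epsilon> (u x - y) * (\<alpha> + 2 * (det2 y (w x))\<^sup>2) * ?\<mu> x \<partial>lborel)
      \<le> \<kappa> * (\<integral>x. ker \<epsilon> (u x - y) * ?\<mu> x \<partial>lborel)" by simp
    have "(\<integral>\<^sup>+x. ennreal (ker \<epsilon> (u x - y) * (\<alpha> + 2 * (det2 y (w x))\<^sup>2) * ?\<mu> x) \<partial>lborel)
      = ennreal (\<integral>x. ker \<epsilon> (u x - y) * (\<alpha> + 2 * (det2 y (w x))\<^sup>2) * ?\<mu> x \<partial>lborel)"
      using \<alpha> ker_nonneg \<mu>_bounds(1) by (intro nn_integral_eq_integral i AE_I2 mult_nonneg_nonneg add_nonneg_nonneg) auto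
    also have "\<dots> \<le> ennreal (\<kappa> * (\<integral>x. ker \<epsilon> (u x - y) * ?\<mu> x \<partial>lborel))"
      using le by (rule ennreal_leI)
    also have "\<dots> = ennreal \<kappa> * (\<integral>\<^sup>+x. ennreal (ker \<epsilon> (u x - y) * ?\<mu> x) \<partial>lborel)"
      using i[of 1 0 y] \<kappa> ker_nonneg \<mu>_bounds(1)
      by (subst nn_integral_eq_integral) (auto simp: ennreal_mult' intro!: AE_I2 mult_nonneg_nonneg)
    finally show ?thesis .
  qed
  define f where "f x = (det2 (u x) (w x))\<^sup>2 * indicator {x. norm (u x) < s / 2} x * ?\<mu> x" for x
  have f0: "f x \<ge> 0" for x using \<mu>_bounds(1) by (simp add: f_def)
  have [measurable]: "f \<in> borel_measurable borel" unfolding f_def[abs_def] by measurable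
  have pt: "ennreal (f x) * ennreal (ker \<epsilon> (u x - y)) \<le>
      indicator (ball 0 s) y * ennreal (ker \<epsilon> (u x - y) * (\<alpha> + 2 * (det2 y (w x))\<^sup>2) * ?\<mu> x)" for x y
  proof (cases "norm (u x) < s / 2 \<and> ker \<epsilon> (u x - y) \<noteq> 0")
    case True
    have uy: "norm (u x - y) \<le> 2 * \<epsilon>" using ker_support[of \<epsilon> "u x - y"] True by auto
    have "norm y < s" using uy True \<epsilon> norm_triangle_sub[of y "u x"] by (simp add: norm_minus_commute)
    then have y: "y \<in> ball 0 s" by simp
    have "det2 (u x) (w x) = det2 y (w x) + det2 (u x - y) (w x)" by (simp add: det2_def algebra_simps)
    then have "(det2 (u x) (w x))\<^sup>2 = (det2 y (w x) + det2 (u x - y) (w x))\<^sup>2" by simp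
    also have "\<dots> \<le> 2 * (det2 y (w x))\<^sup>2 + 2 * (det2 (u x - y) (w x))\<^sup>2"
      using sum_squares_bound[of "det2 y (w x)" "det2 (u x - y) (w x)"] by (simp add: power2_sum)
    also have "(det2 (u x - y) (w x))\<^sup>2 \<le> (2 * \<eta> * Bw)\<^sup>2"
    proof -
      have "\<bar>det2 (u x - y) (w x)\<bar> \<le> norm (u x - y) * norm (w x)" by (rule det2_bound)
      also have "\<dots> \<le> 2 * \<eta> * Bw" using uy \<epsilon> w_bdd[of x] \<eta> by (intro mult_mono) auto
      finally show ?thesis using power_mono[of "\<bar>det2 (u x - y) (w x)\<bar>" _ 2] by simp
    qed
    finally have "(det2 (u x) (w x))\<^sup>2 \<le> \<alpha> + 2 * (det2 y (w x))\<^sup>2" by (simp add: \<alpha>_def power_mult_distrib)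
    then have "(det2 (u x) (w x))\<^sup>2 * (?\<mu> x * ker \<epsilon> (u x - y)) \<le> (\<alpha> + 2 * (det2 y (w x))\<^sup>2) * (?\<mu> x * ker \<epsilon> (u x - y))"
      using ker_nonneg \<mu>_bounds(1) by (intro mult_right_mono mult_nonneg_nonneg) auto
    then have "f x * ker \<epsilon> (u x - y) \<le> ker \<epsilon> (u x - y) * (\<alpha> + 2 * (det2 y (w x))\<^sup>2) * ?\<mu> x"
      using True by (simp add: f_def mult_ac)
    then show ?thesis using y f0 by (simp add: ennreal_mult'[symmetric] ennreal_leI)
  next
    case False
    then have "f x = 0 \<or> ker \<epsilon> (u x - y) = 0" by (auto simp: f_def)
    then show ?thesis by auto
  qed
  have [measurable]: "ball 0 s \<in> sets (borel :: (real^2) measure)" by simp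
  have [measurable]: "?\<mu> \<in> borel_measurable borel" by (rule \<mu>_measurable) simp
  \<comment> \<open>The fibre estimates are integrated over \<open>y\<close>. By Fubini the kernel
    contributes its integral \<open>c\<close> on either side, and \<open>c\<close> cancels at the
    end.\<close>
  have "ennreal c * (\<integral>\<^sup>+x. ennreal (f x) \<partial>lborel) = (\<integral>\<^sup>+x. ennreal (f x) * ennreal c \<partial>lborel)"
    by (subst nn_integral_multc) (auto simp: mult.commute)
  also have "\<dots> = (\<integral>\<^sup>+x. (\<integral>\<^sup>+y. ennreal (f x) * ennreal (ker \<epsilon> (u x - y)) \<partial>lborel) \<partial>lborel)"
    by (intro nn_integral_cong) (simp add: nn_integral_cmult ker_y)
  also have "\<dots> \<le> (\<integral>\<^sup>+x. (\<integral>\<^sup>+y. indicator (ball 0 s) y * ennreal (ker \<epsilon> (u x - y) * (\<alpha> + 2 * (det2 y (w x))\<^sup>2) * ?\<mu> x) \<partial>lborel) \<partial>lborel)"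
    by (intro nn_integral_mono pt)
  also have "\<dots> = (\<integral>\<^sup>+y. (\<integral>\<^sup>+x. indicator (ball 0 s) y * ennreal (ker \<epsilon> (u x - y) * (\<alpha> + 2 * (det2 y (w x))\<^sup>2) * ?\<mu> x) \<partial>lborel) \<partial>lborel)"
    unfolding det2_def by (rule lborel_pair.Fubini') measurable
  also have "\<dots> \<le> (\<integral>\<^sup>+y. ennreal \<kappa> * (\<integral>\<^sup>+x. ennreal (ker \<epsilon> (u x - y) * ?\<mu> x) \<partial>lborel) \<partial>lborel)"
  proof (intro nn_integral_mono)
    fix y :: "real^2"
    show "(\<integral>\<^sup>+x. indicator (ball 0 s) y * ennreal (ker \<epsilon> (u x - y) * (\<alpha> + 2 * (det2 y (w x))\<^sup>2) * ?\<mu> x) \<partial>lborel)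
        \<le> ennreal \<kappa> * (\<integral>\<^sup>+x. ennreal (ker \<epsilon> (u x - y) * ?\<mu> x) \<partial>lborel)"
      using fibre[of y] by (cases "y \<in> ball 0 s") auto
  qed
  also have "\<dots> = ennreal \<kappa> * (\<integral>\<^sup>+y. (\<integral>\<^sup>+x. ennreal (ker \<epsilon> (u x - y) * ?\<mu> x) \<partial>lborel) \<partial>lborel)"
    by (rule nn_integral_cmult) measurable
  also have "(\<integral>\<^sup>+y. (\<integral>\<^sup>+x. ennreal (ker \<epsilon> (u x - y) * ?\<mu> x) \<partial>lborel) \<partial>lborel)
      = (\<integral>\<^sup>+x. (\<integral>\<^sup>+y. ennreal (ker \<epsilon> (u x - y) * ?\<mu> x) \<partial>lborel) \<partial>lborel)"
    by (rule lborel_pair.Fubini'[symmetric]) measurable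
  also have "\<dots> = (\<integral>\<^sup>+x. ennreal c * ennreal (?\<mu> x) \<partial>lborel)"
  proof (intro nn_integral_cong)
    fix x
    have "(\<integral>\<^sup>+y. ennreal (ker \<epsilon> (u x - y) * ?\<mu> x) \<partial>lborel) = (\<integral>\<^sup>+y. ennreal (ker \<epsilon> (u x - y)) * ennreal (?\<mu> x) \<partial>lborel)"
      by (intro nn_integral_cong ennreal_mult' ker_nonneg)
    then show "(\<integral>\<^sup>+y. ennreal (ker \<epsilon> (u x - y) * ?\<mu> x) \<partial>lborel) = ennreal c * ennreal (?\<mu> x)"
      by (simp add: nn_integral_multc ker_y)
  qed
  also have "\<dots> = ennreal c * (\<integral>\<^sup>+x. ennreal (?\<mu> x) \<partial>lborel)" by (rule nn_integral_cmult) measurable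
  finally have "ennreal c * (\<integral>\<^sup>+x. ennreal (f x) \<partial>lborel) \<le> ennreal c * (ennreal \<kappa> * (\<integral>\<^sup>+x. ennreal (?\<mu> x) \<partial>lborel))"
    by (simp add: mult.left_commute)
  then have "(\<integral>\<^sup>+x. ennreal (f x) \<partial>lborel) \<le> ennreal \<kappa> * (\<integral>\<^sup>+x. ennreal (?\<mu> x) \<partial>lborel)"
    using c by (subst (asm) ennreal_mult_le_mult_iff) auto
  then show ?thesis by (simp add: f_def \<kappa>_def \<alpha>_def)
qed

text \<open>Since \<open>x0\<close> is the only zero of \<open>u\<close> in the closed ball and
  \<open>w x0 = 0\<close>, compactness shows that \<open>w\<close> is small wherever
  \<open>u\<close> is small. So \<open>small_strip\<close> holds for every \<eta>, while its left
  side does not involve \<eta>. The squared determinant thus has integral 0 against a positive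
  weight; it vanishes almost everywhere on the strip and, by continuity, at every point.\<close>

lemma parallel_near_isolated:
  assumes r: "r > 0" "cball x0 r \<subseteq> S" and w0: "w x0 = 0"
    and iso: "\<And>x. x \<in> cball x0 r \<Longrightarrow> u x = 0 \<Longrightarrow> x = x0"
  obtains s where "s > 0" "\<And>x. x \<in> ball x0 r \<Longrightarrow> norm (u x) < s \<Longrightarrow> det2 (u x) (w x) = 0"
proof -
  have br: "ball x0 r \<subseteq> S" using r by auto
  have "compact (cball x0 r - ball x0 (r / 2))" by (intro compact_diff) auto
  then obtain d where d: "d > 0" "\<And>x. x \<in> cball x0 r - ball x0 (r / 2) \<Longrightarrow> d \<le> norm (u x)"
  proof (rule compact_norm_lower_bound[OF _ u_cont])
    show "u x \<noteq> 0" if "x \<in> cball x0 r - ball x0 (r / 2)" for x using iso[of x] that r by auto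
  qed blast
  define s where "s = d / 2"
  have s: "s > 0" using d by (simp add: s_def)
  have far: "2 * s \<le> norm (u x)" if "x \<in> ball x0 r" "r / 2 \<le> dist x0 x" for x
    using d(2)[of x] that by (auto simp: s_def)
  define Q where "Q = (\<integral>\<^sup>+x. ennreal ((det2 (u x) (w x))\<^sup>2 * indicator {x. norm (u x) < s / 2} x * \<mu> (ball x0 r) x) \<partial>lborel)"
  have [measurable]: "\<mu> (ball x0 r) \<in> borel_measurable borel" by (rule \<mu>_measurable) simp
  have "integrable lborel (\<lambda>x. 1 * \<mu> (ball x0 r) x)" by (rule \<mu>_integrable[where C=1]) auto
  then have A: "(\<integral>\<^sup>+x. ennreal (\<mu> (ball x0 r) x) \<partial>lborel) = ennreal (\<integral>x. \<mu> (ball x0 r) x \<partial>lborel)"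
    by (intro nn_integral_eq_integral AE_I2 \<mu>_bounds(1)) simp
  define A where "A = (\<integral>x. \<mu> (ball x0 r) x \<partial>lborel)"
  have A0: "A \<ge> 0" unfolding A_def by (intro integral_nonneg_AE AE_I2 \<mu>_bounds(1))
  have est: "Q \<le> ennreal (\<eta>\<^sup>2 * ((8 * Bw\<^sup>2 + 2 * s\<^sup>2) * A))" if \<eta>: "\<eta> > 0" for \<eta>
  proof -
    have "compact (cball x0 r \<inter> {x. \<eta> \<le> norm (w x)})"
      by (intro compact_Int_closed closed_Collect_le continuous_intros w_cont) auto
    then obtain d2 where d2: "d2 > 0" "\<And>x. x \<in> cball x0 r \<inter> {x. \<eta> \<le> norm (w x)} \<Longrightarrow> d2 \<le> norm (u x)"
    proof (rule compact_norm_lower_bound[OF _ u_cont])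
      show "u x \<noteq> 0" if "x \<in> cball x0 r \<inter> {x. \<eta> \<le> norm (w x)}" for x
        using iso[of x] that w0 \<eta> by auto
    qed blast
    \<comment> \<open>The bound \<open>s / 5\<close> gives \<open>4 * \<epsilon> < s\<close>, and
      \<open>d2 / 3\<close> makes \<open>norm (u x) \<le> 2 * \<epsilon>\<close> incompatible with
      \<open>\<eta> \<le> norm (w x)\<close>.\<close>
    define \<epsilon> where "\<epsilon> = Min {s / 5, \<eta>, d2 / 3}"
    have \<epsilon>: "\<epsilon> > 0" "\<epsilon> \<le> s / 5" "\<epsilon> \<le> \<eta>" "\<epsilon> \<le> d2 / 3" using s \<eta> d2(1) by (auto simp: \<epsilon>_def)
    have "Q \<le> ennreal (8 * \<eta>\<^sup>2 * Bw\<^sup>2 + 2 * (s\<^sup>2 * \<eta>\<^sup>2)) * (\<integral>\<^sup>+x. ennreal (\<mu> (ball x0 r) x) \<partial>lborel)"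
      unfolding Q_def
    proof (rule small_strip[OF r(1) br s far \<epsilon>(1) _ \<epsilon>(3)])
      show "4 * \<epsilon> < s" using \<epsilon>(2) s by simp
      show "norm (w x) \<le> \<eta>" if "x \<in> ball x0 r" "norm (u x) \<le> 2 * \<epsilon>" for x
      proof (rule ccontr)
        assume "\<not> norm (w x) \<le> \<eta>"
        then have "d2 \<le> norm (u x)" using that by (intro d2(2)) auto
        then show False using that \<epsilon> d2(1) by linarith
      qed
    qed
    also have "\<dots> = ennreal (\<eta>\<^sup>2 * ((8 * Bw\<^sup>2 + 2 * s\<^sup>2) * A))"
      unfolding A A_def[symmetric] using A0 by (simp add: ennreal_mult''[symmetric] algebra_simps)
    finally show ?thesis .
  qed
  define k where "k = (8 * Bw\<^sup>2 + 2 * s\<^sup>2) * A"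
  have k: "k \<ge> 0" using A0 by (simp add: k_def)
  \<comment> \<open>The choice \<eta>^2 = \<delta> / (k + 1) makes the bound at most \<delta>; the
    summand 1 covers \<open>k = 0\<close>.\<close>
  have eps: "Q \<le> 0 + ennreal \<delta>" if "\<delta> > 0" for \<delta>
  proof -
    have "Q \<le> ennreal ((sqrt (\<delta> / (k + 1)))\<^sup>2 * k)"
      unfolding k_def by (rule est) (use that k in \<open>simp add: k_def[symmetric]\<close>)
    also have "(sqrt (\<delta> / (k + 1)))\<^sup>2 * k = \<delta> * (k / (k + 1))" using that k by simp
    also have "ennreal (\<delta> * (k / (k + 1))) \<le> ennreal \<delta>"
      using that k by (intro ennreal_leI mult_left_le) auto
    finally show ?thesis by simp
  qed
  have "Q \<le> 0" by (rule ennreal_le_epsilon) (rule eps)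
  then have Q0: "Q = 0" by simp
  have [measurable]: "(\<lambda>x. det2 (u x) (w x)) \<in> borel_measurable borel" unfolding det2_def by measurable
  have "AE x in lborel. ennreal ((det2 (u x) (w x))\<^sup>2 * indicator {x. norm (u x) < s / 2} x * \<mu> (ball x0 r) x) = 0"
    using Q0 unfolding Q_def by (subst (asm) nn_integral_0_iff_AE) auto
  then have ae: "AE x in lborel. x \<in> ball x0 r \<inter> {x. norm (u x) < s / 2} \<longrightarrow> det2 (u x) (w x) = 0"
    using m_pos_ae \<mu>_eq_ae[OF br]
  proof eventually_elim
    case (elim x)
    show ?case
    proof
      assume x: "x \<in> ball x0 r \<inter> {x. norm (u x) < s / 2}"
      then have "\<mu> (ball x0 r) x > 0" using elim br by auto
      moreover have "(det2 (u x) (w x))\<^sup>2 * \<mu> (ball x0 r) x \<le> 0"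
        using elim(1) x by (simp add: ennreal_eq_0_iff)
      ultimately have "(det2 (u x) (w x))\<^sup>2 \<le> 0" by (simp add: mult_le_0_iff)
      then show "det2 (u x) (w x) = 0" by simp
    qed
  qed
  have op: "open (ball x0 r \<inter> {x. norm (u x) < s / 2})"
    by (intro open_Int open_ball open_Collect_less continuous_intros u_cont)
  have cont: "continuous_on (ball x0 r \<inter> {x. norm (u x) < s / 2}) (\<lambda>x. det2 (u x) (w x))"
    unfolding det2_def by (intro continuous_intros u_cont w_cont)
  show ?thesis
  proof (rule that[of "s / 2"])
    show "det2 (u x) (w x) = 0" if "x \<in> ball x0 r" "norm (u x) < s / 2" for x
      using AE_zero_imp_zero_on_open[OF op cont ae, of x] that by auto
  qed (use s in auto)
qed

text \<open>The factor \<beta> is known almost everywhere only, whereas the ratio \<theta> of the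
  parallel vectors \<open>w\<close> and \<open>u\<close> is locally Lipschitz off \<open>x0\<close>.
  Constancy is proved for \<theta> and then transferred. The ratio is not determined at
  \<open>x0\<close>, where both vectors vanish, so the argument runs on the punctured disc, which is
  connected.\<close>

lemma factor_constant_near_isolated_0:
  assumes r: "r > 0" "cball x0 r \<subseteq> S" and u0: "u x0 = 0" and w0: "w x0 = 0"
    and iso: "\<And>x. x \<in> cball x0 r \<Longrightarrow> u x = 0 \<Longrightarrow> x = x0"
  shows "\<exists>c. \<exists>\<delta>>0. AE x in lborel. x \<in> ball x0 \<delta> \<longrightarrow> \<beta> x = c"
proof -
  obtain s where s: "s > 0" "\<And>x. x \<in> ball x0 r \<Longrightarrow> norm (u x) < s \<Longrightarrow> det2 (u x) (w x) = 0"
    by (rule parallel_near_isolated[OF r w0 iso]) blast+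
  \<comment> \<open>Within this radius the Lipschitz bound gives \<open>norm (u x) < s\<close>; the
    summand 1 covers \<open>Lu = 0\<close>.\<close>
  define \<delta> where "\<delta> = min r (s / (Lu + 1))"
  have \<delta>: "\<delta> > 0" "\<delta> \<le> r" "\<delta> \<le> s / (Lu + 1)" using r s Lu by (auto simp: \<delta>_def)
  define B where "B = ball x0 \<delta>"
  have BS: "B \<subseteq> S" "B \<subseteq> ball x0 r" using \<delta> r by (auto simp: B_def)
  have det0: "det2 (u x) (w x) = 0" if x: "x \<in> B" for x
  proof (rule s(2))
    have "norm (u x) \<le> Lu * dist x x0" using lipschitz_onD[OF u_lip, of x x0] u0 by (simp add: dist_norm)
    also have "\<dots> \<le> (Lu + 1) * dist x x0" by (intro mult_right_mono) auto
    also have "\<dots> < (Lu + 1) * (s / (Lu + 1))" using x \<delta> Lu by (intro mult_strict_left_mono) (auto simp: B_def dist_commute)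
    finally show "norm (u x) < s" using Lu by simp
  qed (use x BS in auto)
  define \<theta> where "\<theta> x = (w x \<bullet> u x) / (u x \<bullet> u x)" for x
  have unz: "u x \<noteq> 0" if "x \<in> B - {x0}" for x using iso[of x] that BS(2) by auto
  have w\<theta>: "w x = \<theta> x *\<^sub>R u x" if x: "x \<in> B - {x0}" for x
  proof -
    have uu: "u x \<bullet> u x \<noteq> 0" using unz[OF x] by simp
    have d: "u x $ 1 * w x $ 2 = u x $ 2 * w x $ 1" using det0[of x] x by (simp add: det2_def)
    have "w x $ 1 * (u x \<bullet> u x) = (w x \<bullet> u x) * u x $ 1"
    proof -
      have "w x $ 1 * (u x \<bullet> u x) - (w x \<bullet> u x) * u x $ 1 = u x $ 2 * (u x $ 2 * w x $ 1 - u x $ 1 * w x $ 2)"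
        by (simp add: inner_real2 algebra_simps)
      then show ?thesis using d by simp
    qed
    moreover have "w x $ 2 * (u x \<bullet> u x) = (w x \<bullet> u x) * u x $ 2"
    proof -
      have "w x $ 2 * (u x \<bullet> u x) - (w x \<bullet> u x) * u x $ 2 = u x $ 1 * (u x $ 1 * w x $ 2 - u x $ 2 * w x $ 1)"
        by (simp add: inner_real2 algebra_simps)
      then show ?thesis using d by simp
    qed
    ultimately show ?thesis using uu by (simp add: vec_eq_iff forall_2 \<theta>_def field_simps)
  qed
  \<comment> \<open>Put \<open>X = w x - \<beta> x *\<^sub>R u x\<close>. Differentiating
    \<open>det2 (u x) (w x) = 0\<close> gives \<open>det2 (Du v) X = 0\<close> for all
    \<open>v\<close>. As \<open>Du\<close> is invertible, \<open>X = 0\<close>.\<close>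
  have w\<beta>: "AE x in lborel. x \<in> B \<longrightarrow> w x = \<beta> x *\<^sub>R u x"
    using good
  proof eventually_elim
    case (elim x)
    show ?case
    proof
      assume x: "x \<in> B"
      then obtain Du where Du: "(u has_derivative Du) (at x)" "(w has_derivative (\<lambda>v. \<beta> x *\<^sub>R Du v)) (at x)"
        "\<beta> x * det2 (Du e1) (Du e2) > 0" using elim BS by auto
      define X where "X = w x - \<beta> x *\<^sub>R u x"
      have dA: "((\<lambda>x. u x $ 1 * w x $ 2 - u x $ 2 * w x $ 1) has_derivative
        (\<lambda>v. (u x $ 1 * (\<beta> x *\<^sub>R Du v) $ 2 + Du v $ 1 * w x $ 2) - (u x $ 2 * (\<beta> x *\<^sub>R Du v) $ 1 + Du v $ 2 * w x $ 1))) (at x)"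
        by (intro has_derivative_diff has_derivative_mult bounded_linear.has_derivative[OF bounded_linear_vec_nth] Du)
      have dB: "((\<lambda>x. u x $ 1 * w x $ 2 - u x $ 2 * w x $ 1) has_derivative (\<lambda>v. 0)) (at x)"
      proof (rule has_derivative_transform_within_open[where f="\<lambda>x. 0" and s=B])
        show "0 = u y $ 1 * w y $ 2 - u y $ 2 * w y $ 1" if "y \<in> B" for y
          using det0[OF that] by (simp add: det2_def)
      qed (use x in \<open>auto simp: B_def\<close>)
      have z: "(u x $ 1 * (\<beta> x *\<^sub>R Du v) $ 2 + Du v $ 1 * w x $ 2) - (u x $ 2 * (\<beta> x *\<^sub>R Du v) $ 1 + Du v $ 2 * w x $ 1) = 0" for v
        using fun_cong[OF has_derivative_unique[OF dA dB], of v] .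
      have X: "Du v $ 1 * X $ 2 = Du v $ 2 * X $ 1" for v
        using z[of v] by (simp add: X_def algebra_simps)
      have "det2 (Du e1) (Du e2) * X $ 1 = Du e1 $ 1 * (Du e2 $ 2 * X $ 1) - Du e2 $ 1 * (Du e1 $ 2 * X $ 1)"
        by (simp add: det2_def algebra_simps)
      also have "\<dots> = 0" by (simp add: X[symmetric])
      finally have X1: "X $ 1 = 0" using Du(3) by auto
      have "det2 (Du e1) (Du e2) * X $ 2 = Du e2 $ 2 * (Du e1 $ 1 * X $ 2) - Du e1 $ 2 * (Du e2 $ 1 * X $ 2)"
        by (simp add: det2_def algebra_simps)
      also have "\<dots> = 0" by (simp add: X)
      finally have X2: "X $ 2 = 0" using Du(3) by auto
      have "X = 0" using X1 X2 by (simp add: vec_eq_iff forall_2)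
      then show "w x = \<beta> x *\<^sub>R u x" by (simp add: X_def)
    qed
  qed
  have loc: "\<exists>\<rho>>0. \<forall>y\<in>ball p \<rho>. \<theta> p = \<theta> y" if p: "p \<in> B - {x0}" for p
  proof -
    define c where "c = (norm (u p) / 2)\<^sup>2"
    have c: "c > 0" using unz[OF p] by (simp add: c_def)
    have "open ((B - {x0}) \<inter> {y. c < u y \<bullet> u y})"
      by (intro open_Int open_Collect_less continuous_intros u_cont) (auto simp: B_def)
    moreover have "c < u p \<bullet> u p"
    proof -
      have "c = (norm (u p))\<^sup>2 / 4" by (simp add: c_def power_divide)
      also have "\<dots> < (norm (u p))\<^sup>2" using unz[OF p] by simp
      finally show ?thesis by (simp only: dot_square_norm)
    qed
    then have "p \<in> (B - {x0}) \<inter> {y. c < u y \<bullet> u y}" using p by simp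
    ultimately obtain \<rho> where \<rho>: "\<rho> > 0" "ball p \<rho> \<subseteq> (B - {x0}) \<inter> {y. c < u y \<bullet> u y}"
      by (rule openE)
    \<comment> \<open>Near \<open>p\<close> the denominator \<open>u x \<bullet> u x\<close> exceeds
      \<open>c\<close>, so there the maximum changes nothing and \<open>f\<close> is \<theta>, while
      \<open>f\<close> is Lipschitz on the whole plane.\<close>
    define f where "f x = (w x \<bullet> u x) * (1 / max (u x \<bullet> u x) c)" for x
    have wu: "(Bw * Lu + Bu * Lw)-lipschitz_on UNIV (\<lambda>x. w x \<bullet> u x)"
      by (rule lipschitz_on_inner_bounded[OF w_lip w_bdd u_lip u_bdd Bw Bu])
    have uu: "(Bu * Lu + Bu * Lu)-lipschitz_on UNIV (\<lambda>x. u x \<bullet> u x)"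
      by (rule lipschitz_on_inner_bounded[OF u_lip u_bdd u_lip u_bdd Bu Bu])
    have inv: "((Bu * Lu + Bu * Lu) / c\<^sup>2)-lipschitz_on UNIV (\<lambda>x. 1 / max (u x \<bullet> u x) c)"
      by (rule lipschitz_on_inverse_max[OF uu c])
    have wub: "\<bar>w x \<bullet> u x\<bar> \<le> Bw * Bu" for x
      using Cauchy_Schwarz_ineq2[of "w x" "u x"] mult_mono[OF w_bdd[of x] u_bdd[of x]] Bw by auto
    have ib: "\<bar>1 / max (u x \<bullet> u x) c\<bar> \<le> 1 / c" for x using c by (simp add: frac_le)
    have fl: "((Bw * Bu) * ((Bu * Lu + Bu * Lu) / c\<^sup>2) + (1 / c) * (Bw * Lu + Bu * Lw))-lipschitz_on UNIV f"
      unfolding f_def[abs_def] by (rule lipschitz_on_mult_bounded[OF wu wub inv ib]) (use Bw Bu c in auto)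
    have f\<theta>: "f y = \<theta> y" if "y \<in> ball p \<rho>" for y
      using \<rho>(2) that by (auto simp: f_def \<theta>_def max_def)
    have "AE x in lborel. x \<in> ball p \<rho> \<longrightarrow> (f has_derivative (\<lambda>v. 0)) (at x)"
      using good w\<beta>
    proof eventually_elim
      case (elim x)
      show ?case
      proof
        assume x: "x \<in> ball p \<rho>"
        then have xB: "x \<in> B - {x0}" using \<rho> by auto
        then obtain Du where Du: "(u has_derivative Du) (at x)" "(w has_derivative (\<lambda>v. \<beta> x *\<^sub>R Du v)) (at x)"
          using elim BS by auto
        have "\<exists>D. (\<theta> has_derivative D) (at x)"
        proof -
          have "u x \<bullet> u x \<noteq> 0" using unz[OF xB] by simp
          from has_derivative_divide[OF has_derivative_inner[OF Du(2) Du(1)] has_derivative_inner[OF Du(1) Du(1)] this]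
          show ?thesis unfolding \<theta>_def[abs_def] by blast
        qed
        then obtain D where D: "(\<theta> has_derivative D) (at x)" by blast
        \<comment> \<open>The derivative of \<open>w\<close> is computed in two ways. Since \<beta>
          and \<theta> agree at \<open>x\<close>, the comparison leaves
          \<open>D v *\<^sub>R u x = 0\<close>.\<close>
        have "((\<lambda>y. \<theta> y *\<^sub>R u y) has_derivative (\<lambda>v. \<theta> x *\<^sub>R Du v + D v *\<^sub>R u x)) (at x)"
          by (rule has_derivative_scaleR[OF D Du(1)])
        then have dw: "(w has_derivative (\<lambda>v. \<theta> x *\<^sub>R Du v + D v *\<^sub>R u x)) (at x)"
        proof (rule has_derivative_transform_within_open[where s="ball p \<rho>"])
          show "\<theta> y *\<^sub>R u y = w y" if "y \<in> ball p \<rho>" for y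
            using w\<theta>[of y] subsetD[OF \<rho>(2) that] by simp
        qed (use x in auto)
        have eq: "\<beta> x *\<^sub>R Du v = \<theta> x *\<^sub>R Du v + D v *\<^sub>R u x" for v
          using fun_cong[OF has_derivative_unique[OF Du(2) dw], of v] .
        have "\<beta> x *\<^sub>R u x = \<theta> x *\<^sub>R u x" using elim(2) xB w\<theta>[OF xB] by auto
        then have "\<beta> x = \<theta> x" using unz[OF xB] by simp
        then have "D v = 0" for v using eq[of v] unz[OF xB] by simp
        then have "D = (\<lambda>v. 0)" by (rule ext)
        with D have "(\<theta> has_derivative (\<lambda>v. 0)) (at x)" by simp
        then show "(f has_derivative (\<lambda>v. 0)) (at x)"
          by (rule has_derivative_transform_within_open[where s="ball p \<rho>"]) (use x f\<theta> in auto)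
      qed
    qed
    note const = lipschitz_zero_derivative_constant[OF fl this]
    have pb: "p \<in> ball p \<rho>" using \<rho>(1) by simp
    have "\<theta> p = \<theta> y" if "y \<in> ball p \<rho>" for y
      using const[OF pb that] unfolding f\<theta>[OF pb] f\<theta>[OF that] .
    then show ?thesis using \<rho>(1) by blast
  qed
  have conn: "connected (B - {x0})"
    unfolding B_def by (rule connected_open_delete) (auto simp: DIM_cart)
  have const: "\<theta> x = \<theta> y" if "x \<in> B - {x0}" "y \<in> B - {x0}" for x y
  proof (rule connected_local_const[OF conn that], rule ballI)
    fix p assume "p \<in> B - {x0}"
    then obtain \<rho> where "\<rho> > 0" "\<forall>y\<in>ball p \<rho>. \<theta> p = \<theta> y" using loc by blast
    then show "\<forall>\<^sub>F y in at p within B - {x0}. \<theta> p = \<theta> y"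
      unfolding eventually_at by (auto simp: dist_commute intro!: exI[of _ \<rho>])
  qed
  have "\<exists>c. \<forall>x\<in>B - {x0}. \<theta> x = c" using const by metis
  then obtain c where c: "\<And>x. x \<in> B - {x0} \<Longrightarrow> \<theta> x = c" by blast
  have "AE x in lborel. x \<in> ball x0 \<delta> \<longrightarrow> \<beta> x = c"
    using w\<beta> AE_lborel_singleton[of x0]
  proof eventually_elim
    case (elim x)
    show ?case
    proof
      assume "x \<in> ball x0 \<delta>"
      then have x: "x \<in> B - {x0}" using elim by (auto simp: B_def)
      then have "\<beta> x *\<^sub>R u x = \<theta> x *\<^sub>R u x" using elim w\<theta>[OF x] by auto
      then show "\<beta> x = c" using unz[OF x] c[OF x] by simp
    qed
  qed
  then show ?thesis using \<delta>(1) by blast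
qed

end

section \<open>The flux estimate and the finiteness of fibres\<close>

lemma integrable_jac:
  assumes a: "L-lipschitz_on UNIV a" and b: "K-lipschitz_on UNIV b" and supp: "\<And>x. x \<notin> cball 0 r \<Longrightarrow> a x = 0"
  shows "integrable lborel (jac a b)"
proof (rule integrable_bounded_support[where C="2 * L * K" and r=r])
  show "AE x in lborel. \<bar>jac a b x\<bar> \<le> 2 * L * K * indicator (cball 0 r) x"
    using jac_bound_ae[OF a b]
  proof eventually_elim
    case (elim x)
    show ?case
    proof (cases "x \<in> cball 0 r")
      case False
      have "pd v a x = 0" for v by (rule pd_zero_outside[of "- cball 0 r"]) (use supp False in auto)
      then show ?thesis using False by (simp add: jac_def)
    qed (use elim in simp)
  qed
qed (use lipschitz_measurable[OF a] lipschitz_measurable[OF b] in measurable)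

text \<open>Components of the radial unit field y / |y|, smoothed at the origin.\<close>

lemma has_derivative_normalised_nth:
  fixes y :: "real^2"
  assumes \<epsilon>: "\<epsilon> > 0"
  shows "((\<lambda>y. y $ i / sqrt (y \<bullet> y + \<epsilon>\<^sup>2)) has_derivative
    (\<lambda>v. v $ i / sqrt (y \<bullet> y + \<epsilon>\<^sup>2) - y $ i * (y \<bullet> v) / sqrt (y \<bullet> y + \<epsilon>\<^sup>2) ^ 3)) (at y)"
proof -
  have pos: "y \<bullet> y + \<epsilon>\<^sup>2 > 0" using \<epsilon> by (simp add: add_nonneg_pos)
  have g: "((\<lambda>y. y \<bullet> y + \<epsilon>\<^sup>2) has_derivative (\<lambda>v. 2 * (y \<bullet> v))) (at y)"
    by (auto intro!: derivative_eq_intros simp: inner_commute)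
  have s: "((\<lambda>y. sqrt (y \<bullet> y + \<epsilon>\<^sup>2)) has_derivative (\<lambda>v. inverse (sqrt (y \<bullet> y + \<epsilon>\<^sup>2)) / 2 * (2 * (y \<bullet> v)))) (at y)"
    by (rule has_derivative_compose[OF g DERIV_real_sqrt[OF pos, unfolded has_field_derivative_def]])
  have n: "((\<lambda>y::real^2. y $ i) has_derivative (\<lambda>v. v $ i)) (at y)"
    by (rule bounded_linear_imp_has_derivative[OF bounded_linear_vec_nth])
  have nz: "sqrt (y \<bullet> y + \<epsilon>\<^sup>2) \<noteq> 0" using pos by simp
  show ?thesis
  proof (rule has_derivative_eq_rhs[OF has_derivative_divide[OF n s nz]], rule ext)
    have "- a * (inverse t * (inverse t / 2 * (2 * b)) * inverse t) + d / t = d / t - a * b / t ^ 3" for a b d t :: real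
    proof -
      have "a * b / t ^ 3 = a * b * (inverse t * inverse t * inverse t)"
        by (simp only: divide_inverse power3_eq_cube inverse_mult_distrib)
      then show ?thesis by simp
    qed
    then show "- (y $ i) * (inverse (sqrt (y \<bullet> y + \<epsilon>\<^sup>2)) * (inverse (sqrt (y \<bullet> y + \<epsilon>\<^sup>2)) / 2 * (2 * (y \<bullet> v))) * inverse (sqrt (y \<bullet> y + \<epsilon>\<^sup>2))) + v $ i / sqrt (y \<bullet> y + \<epsilon>\<^sup>2)
      = v $ i / sqrt (y \<bullet> y + \<epsilon>\<^sup>2) - y $ i * (y \<bullet> v) / sqrt (y \<bullet> y + \<epsilon>\<^sup>2) ^ 3" for v .
  qed
qed

text \<open>Components of y / |y|^2, smoothed at the origin. In the plane the divergence of the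
  unsmoothed field is a multiple of the point mass at 0, so the smoothed divergence detects zeros of
  \<open>u\<close>.\<close>

lemma has_derivative_inverted_nth:
  fixes y :: "real^2"
  assumes \<epsilon>: "\<epsilon> > 0"
  shows "((\<lambda>y. y $ i / (y \<bullet> y + \<epsilon>\<^sup>2)) has_derivative
    (\<lambda>v. v $ i / (y \<bullet> y + \<epsilon>\<^sup>2) - y $ i * (2 * (y \<bullet> v)) / (y \<bullet> y + \<epsilon>\<^sup>2)\<^sup>2)) (at y)"
proof -
  have pos: "y \<bullet> y + \<epsilon>\<^sup>2 > 0" using \<epsilon> by (simp add: add_nonneg_pos)
  have g: "((\<lambda>y. y \<bullet> y + \<epsilon>\<^sup>2) has_derivative (\<lambda>v. 2 * (y \<bullet> v))) (at y)"
    by (auto intro!: derivative_eq_intros simp: inner_commute)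
  have n: "((\<lambda>y::real^2. y $ i) has_derivative (\<lambda>v. v $ i)) (at y)"
    by (rule bounded_linear_imp_has_derivative[OF bounded_linear_vec_nth])
  have nz: "y \<bullet> y + \<epsilon>\<^sup>2 \<noteq> 0" using pos by simp
  show ?thesis
    by (rule has_derivative_eq_rhs[OF has_derivative_divide[OF n g nz]])
      (simp add: divide_inverse power2_eq_square mult_ac)
qed

context proportional_gradients
begin

text \<open>The Jacobian of \<open>\<eta> x * \<phi> (u x)\<close> against
  \<open>w x \<bullet> e\<close> has integral 0. By the product rule it splits into the part where
  \<phi> is differentiated, which \<open>det2_rot\<close> evaluates, and the part where \<eta> is.
  In contrast to \<open>transport_identity\<close>, localisation is by a cutoff in the domain, so
  \<phi> need not vanish at the boundary values of \<open>u\<close>; the price is the term on the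
  right.\<close>

lemma flux_identity:
  assumes R: "cball x0 R \<subseteq> S"
    and \<eta>: "L-lipschitz_on UNIV \<eta>" "\<And>x. \<bar>\<eta> x\<bar> \<le> C" "\<And>x. x \<notin> cball x0 R \<Longrightarrow> \<eta> x = 0"
    and \<phi>: "\<And>y. (\<phi> has_derivative D\<phi> y) (at y)" "K-lipschitz_on UNIV (\<lambda>x. \<phi> (u x))" "\<And>x. \<bar>\<phi> (u x)\<bar> \<le> B"
  shows "integrable lborel (\<lambda>x. \<eta> x * D\<phi> (u x) (rot e) * m x)"
    "integrable lborel (\<lambda>x. \<phi> (u x) * jac \<eta> (\<lambda>x. w x \<bullet> e) x)"
    "(\<integral>x. \<eta> x * D\<phi> (u x) (rot e) * m x \<partial>lborel) = - (\<integral>x. \<phi> (u x) * jac \<eta> (\<lambda>x. w x \<bullet> e) x \<partial>lborel)"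
proof -
  have C: "C \<ge> 0" and B: "B \<ge> 0" using \<eta>(2)[of 0] \<phi>(3)[of 0] by linarith+
  define b where "b x = w x \<bullet> e" for x
  define a where "a x = \<eta> x * \<phi> (u x)" for x
  have b: "(Lw * norm e)-lipschitz_on UNIV b" unfolding b_def by (rule w_inner_lip)
  have a: "(C * K + B * L)-lipschitz_on UNIV a"
    unfolding a_def[abs_def] by (rule lipschitz_on_mult_bounded[OF \<eta>(1,2) \<phi>(2,3) C B])
  have sub: "cball x0 R \<subseteq> cball 0 (norm x0 + \<bar>R\<bar>)"
  proof
    fix x assume "x \<in> cball x0 R"
    then show "x \<in> cball 0 (norm x0 + \<bar>R\<bar>)"
      using norm_triangle_sub[of x x0] by (auto simp: dist_norm norm_minus_commute)
  qed
  have supp: "\<eta> x = 0" "a x = 0" if "x \<notin> cball 0 (norm x0 + \<bar>R\<bar>)" for x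
  proof -
    have "x \<notin> cball x0 R" using that sub by blast
    then show "\<eta> x = 0" "a x = 0" using \<eta>(3) by (simp_all add: a_def)
  qed
  have ia: "integrable lborel (jac a b)" by (rule integrable_jac[OF a b supp(2)])
  have i\<eta>: "integrable lborel (jac \<eta> b)" by (rule integrable_jac[OF \<eta>(1) b supp(1)])
  note [measurable] = lipschitz_measurable[OF \<eta>(1)] lipschitz_measurable[OF b] lipschitz_measurable[OF \<phi>(2)]
  have i2: "integrable lborel (\<lambda>x. \<phi> (u x) * jac \<eta> b x)"
  proof (rule Bochner_Integration.integrable_bound)
    show "integrable lborel (\<lambda>x. B * jac \<eta> b x)" using i\<eta> by simp
    show "AE x in lborel. norm (\<phi> (u x) * jac \<eta> b x) \<le> norm (B * jac \<eta> b x)"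
      using \<phi>(3) B by (intro AE_I2) (auto simp: abs_mult intro!: mult_right_mono)
  qed measurable
  then show "integrable lborel (\<lambda>x. \<phi> (u x) * jac \<eta> (\<lambda>x. w x \<bullet> e) x)" by (simp add: b_def[abs_def])
  have \<phi>m: "\<phi> \<in> borel_measurable borel"
    by (intro borel_measurable_continuous_onI continuous_at_imp_continuous_on ballI has_derivative_continuous[OF \<phi>(1)])
  have "D\<phi> y (rot e) = pd (rot e) \<phi> y" for y using pd_has_derivative[OF \<phi>(1)] by simp
  moreover have "(\<lambda>x. pd (rot e) \<phi> (u x)) \<in> borel_measurable borel"
    by (rule measurable_compose[OF uw_measurable(1) pd_measurable[OF \<phi>m]])
  ultimately have [measurable]: "(\<lambda>x. D\<phi> (u x) (rot e)) \<in> borel_measurable borel" by simp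
  have lm: "(\<lambda>x. \<eta> x * D\<phi> (u x) (rot e) * m x) \<in> borel_measurable lborel" by measurable
  have ae: "AE x in lborel. \<eta> x * D\<phi> (u x) (rot e) * m x = jac a b x - \<phi> (u x) * jac \<eta> b x"
    using good Rademacher[OF \<eta>(1)]
  proof eventually_elim
    case (elim x)
    show ?case
    proof (cases "x \<in> cball x0 R")
      case True
      then obtain Du where Du: "(u has_derivative Du) (at x)" "(w has_derivative (\<lambda>v. \<beta> x *\<^sub>R Du v)) (at x)"
        using elim R by blast
      define E where "E v = (\<Sum>i\<in>Basis. (v \<bullet> i) * pd i \<eta> x)" for v
      have D0: "(\<eta> has_derivative E) (at x)" using elim(2) by (simp add: E_def[abs_def])
      have D1: "((\<lambda>x. \<phi> (u x)) has_derivative (\<lambda>v. D\<phi> (u x) (Du v))) (at x)"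
        by (rule has_derivative_compose[OF Du(1) \<phi>(1)])
      have D2: "(b has_derivative (\<lambda>v. (\<beta> x *\<^sub>R Du v) \<bullet> e)) (at x)"
        unfolding b_def[abs_def] by (rule has_derivative_inner_left[OF Du(2)])
      have D3: "(a has_derivative (\<lambda>v. \<eta> x * D\<phi> (u x) (Du v) + E v * \<phi> (u x))) (at x)"
        unfolding a_def[abs_def] by (rule has_derivative_mult[OF D0 D1])
      have "jac a b x - \<phi> (u x) * jac \<eta> b x = \<eta> x * \<beta> x * (D\<phi> (u x) (Du e1) * (Du e2 \<bullet> e) - D\<phi> (u x) (Du e2) * (Du e1 \<bullet> e))"
        unfolding jac_has_derivative[OF D3 D2] jac_has_derivative[OF D0 D2] by (simp add: algebra_simps)
      also have "D\<phi> (u x) (Du e1) * (Du e2 \<bullet> e) - D\<phi> (u x) (Du e2) * (Du e1 \<bullet> e)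
        = D\<phi> (u x) ((Du e2 \<bullet> e) *\<^sub>R Du e1 - (Du e1 \<bullet> e) *\<^sub>R Du e2)"
        using has_derivative_linear[OF \<phi>(1)] by (simp add: linear_diff linear_scale mult.commute)
      also have "\<dots> = det2 (Du e1) (Du e2) * D\<phi> (u x) (rot e)"
        using has_derivative_linear[OF \<phi>(1)] by (simp add: det2_rot linear_scale)
      finally show ?thesis using m_eq[OF Du] by (simp add: mult_ac)
    next
      case False
      have "pd v \<eta> x = 0" "pd v a x = 0" for v
        by (rule pd_zero_outside[of "- cball x0 R"]; use False \<eta>(3) in \<open>auto simp: a_def\<close>)+
      then show ?thesis using False \<eta>(3) by (simp add: jac_def)
    qed
  qed
  have ae': "AE x in lborel. jac a b x - \<phi> (u x) * jac \<eta> b x = \<eta> x * D\<phi> (u x) (rot e) * m x"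
    using ae by eventually_elim simp
  show "integrable lborel (\<lambda>x. \<eta> x * D\<phi> (u x) (rot e) * m x)"
    by (rule integrable_cong_AE_imp[OF Bochner_Integration.integrable_diff[OF ia i2] lm ae'])
  have "(\<integral>x. \<eta> x * D\<phi> (u x) (rot e) * m x \<partial>lborel) = (\<integral>x. jac a b x - \<phi> (u x) * jac \<eta> b x \<partial>lborel)"
    by (rule integral_cong_AE[OF lm _ ae]) (use ia i2 in auto)
  also have "\<dots> = - (\<integral>x. \<phi> (u x) * jac \<eta> b x \<partial>lborel)"
    using ia i2 integral_jac[OF a b supp(2)] by simp
  finally show "(\<integral>x. \<eta> x * D\<phi> (u x) (rot e) * m x \<partial>lborel) = - (\<integral>x. \<phi> (u x) * jac \<eta> (\<lambda>x. w x \<bullet> e) x \<partial>lborel)"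
    by (simp add: b_def[abs_def])
qed

text \<open>The identities for \<open>\<phi> 1\<close> with \<open>e2\<close> and for
  \<open>\<phi> 2\<close> with \<open>e1\<close> add up to the divergence of the field \<phi> at
  \<open>u x\<close>, integrated against \<open>m\<close>; the lower bound on \<open>m\<close> then
  yields a Lebesgue integral. Each of the two remaining terms carries a Jacobian bounded by 2 L Lw,
  whence the factor 4. The bound \<open>h\<close> may depend on \<open>x\<close>, which allows the
  estimate for one field to feed that for the next.\<close>

lemma flux_bound:
  assumes R: "cball x0 R \<subseteq> S" and c: "c > 0" "AE x in lborel. x \<in> S \<longrightarrow> c \<le> m x"
    and \<eta>: "L-lipschitz_on UNIV \<eta>" "\<And>x. 0 \<le> \<eta> x" "\<And>x. \<eta> x \<le> 1" "\<And>x. x \<notin> cball x0 R \<Longrightarrow> \<eta> x = 0"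
    and \<phi>: "\<And>i y. (\<phi> i has_derivative D\<phi> i y) (at y)" "\<And>i. K-lipschitz_on UNIV (\<lambda>x. \<phi> i (u x))" "\<And>i x. \<bar>\<phi> i (u x)\<bar> \<le> h x"
    and h: "h \<in> borel_measurable borel" "\<And>x. h x \<le> B"
    and div: "\<And>y. 0 \<le> D\<phi> (1::2) y e1 + D\<phi> 2 y e2"
  shows "integrable lborel (\<lambda>x. \<eta> x * (D\<phi> 1 (u x) e1 + D\<phi> 2 (u x) e2))"
    "c * (\<integral>x. \<eta> x * (D\<phi> 1 (u x) e1 + D\<phi> 2 (u x) e2) \<partial>lborel)
      \<le> 4 * L * Lw * (\<integral>x. indicator (cball x0 R) x * h x \<partial>lborel)"
proof -
  have L: "L \<ge> 0" using \<eta>(1) lipschitz_on_nonneg by auto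
  have h0: "0 \<le> h x" for x using \<phi>(3)[of 1 x] by linarith
  have B: "B \<ge> 0" using h0[of 0] h(2)[of 0] by linarith
  have \<eta>1: "\<bar>\<eta> x\<bar> \<le> 1" for x using \<eta>(2,3)[of x] by simp
  have \<phi>B: "\<bar>\<phi> i (u x)\<bar> \<le> B" for i x using \<phi>(3)[of i x] h(2)[of x] by linarith
  note [measurable] = h(1) lipschitz_measurable[OF \<eta>(1)]
  have r2: "rot e2 = e1" "rot e1 = - e2"
    by (simp_all add: vec_eq_iff forall_2 axis_def)
  have lin2: "D\<phi> 2 y (- e2) = - D\<phi> 2 y e2" for y
    using linear_neg[OF has_derivative_linear[OF \<phi>(1)]] .
  note f1 = flux_identity[OF R \<eta>(1) \<eta>1 \<eta>(4) \<phi>(1)[of 1] \<phi>(2)[of 1] \<phi>B[of 1], of e2, unfolded r2]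
  note f2 = flux_identity[OF R \<eta>(1) \<eta>1 \<eta>(4) \<phi>(1)[of 2] \<phi>(2)[of 2] \<phi>B[of 2], of e1, unfolded r2 lin2]
  define d where "d x = D\<phi> 1 (u x) e1 + D\<phi> 2 (u x) e2" for x
  have \<phi>m: "\<phi> i \<in> borel_measurable borel" for i
    by (intro borel_measurable_continuous_onI continuous_at_imp_continuous_on ballI has_derivative_continuous[OF \<phi>(1)])
  have [measurable]: "(\<lambda>x. D\<phi> i (u x) v) \<in> borel_measurable borel" for i v
  proof -
    have "D\<phi> i y v = pd v (\<phi> i) y" for y using pd_has_derivative[OF \<phi>(1)] by simp
    moreover have "(\<lambda>x. pd v (\<phi> i) (u x)) \<in> borel_measurable borel"
      by (rule measurable_compose[OF uw_measurable(1) pd_measurable[OF \<phi>m]])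
    ultimately show ?thesis by simp
  qed
  have [measurable]: "d \<in> borel_measurable borel" unfolding d_def[abs_def] by measurable
  have f2i: "integrable lborel (\<lambda>x. \<eta> x * D\<phi> 2 (u x) e2 * m x)"
    using integrable_minus[OF f2(1)] by simp
  have dm_eq: "\<eta> x * d x * m x = \<eta> x * D\<phi> 1 (u x) e1 * m x + \<eta> x * D\<phi> 2 (u x) e2 * m x" for x
    by (simp add: d_def algebra_simps)
  have idm: "integrable lborel (\<lambda>x. \<eta> x * d x * m x)"
    unfolding dm_eq by (rule Bochner_Integration.integrable_add[OF f1(1) f2i])
  have ge: "AE x in lborel. norm (c * (\<eta> x * d x)) \<le> norm (\<eta> x * d x * m x)"
    using c(2)
  proof eventually_elim
    case (elim x)
    show ?case
    proof (cases "x \<in> cball x0 R")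
      case True
      then have cm: "c \<le> m x" using elim R by blast
      have d0: "0 \<le> \<eta> x * d x" using \<eta>(2) div by (simp add: d_def)
      then have "c * (\<eta> x * d x) \<le> m x * (\<eta> x * d x)" using cm by (intro mult_right_mono)
      moreover have "0 \<le> c * (\<eta> x * d x)" "0 \<le> m x * (\<eta> x * d x)"
        by (rule mult_nonneg_nonneg[OF _ d0], use c(1) cm in simp)+
      ultimately show ?thesis by (simp only: real_norm_def abs_of_nonneg mult.commute[of _ "m x"])
    qed (simp add: \<eta>(4))
  qed
  have icd: "integrable lborel (\<lambda>x. c * (\<eta> x * d x))"
    by (rule Bochner_Integration.integrable_bound[OF idm _ ge]) measurable
  then have "integrable lborel (\<lambda>x. \<eta> x * d x)" using c(1) by simp
  then show "integrable lborel (\<lambda>x. \<eta> x * (D\<phi> 1 (u x) e1 + D\<phi> 2 (u x) e2))" by (simp add: d_def)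
  have jb: "AE x in lborel. \<bar>\<phi> i (u x) * jac \<eta> (\<lambda>x. w x \<bullet> e) x\<bar> \<le> 2 * L * Lw * (indicator (cball x0 R) x * h x)"
    if e: "norm e = 1" for i e
    using jac_bound_ae[OF \<eta>(1) w_inner_lip[of e]]
  proof eventually_elim
    case (elim x)
    show ?case
    proof (cases "x \<in> cball x0 R")
      case True
      have "\<bar>\<phi> i (u x)\<bar> * \<bar>jac \<eta> (\<lambda>x. w x \<bullet> e) x\<bar> \<le> h x * (2 * L * Lw)"
        using elim \<phi>(3)[of i x] h0[of x] e by (intro mult_mono) auto
      then show ?thesis using True by (simp add: abs_mult mult_ac)
    next
      case False
      have "pd v \<eta> x = 0" for v
        by (rule pd_zero_outside[of "- cball x0 R"]; use False \<eta>(4) in auto)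
      then show ?thesis using False by (simp add: jac_def)
    qed
  qed
  have [measurable]: "cball x0 R \<in> sets borel" by simp
  have ih: "integrable lborel (\<lambda>x. indicator (cball x0 R) x * h x)"
  proof (rule Bochner_Integration.integrable_bound[OF integrable_const_cball[of B x0 R]])
    show "AE x in lborel. norm (indicator (cball x0 R) x * h x) \<le> norm (B * indicat_real (cball x0 R) x)"
      using h h0 B by (intro AE_I2) (auto simp: indicator_def)
  qed measurable
  have est: "\<bar>\<integral>x. \<phi> i (u x) * jac \<eta> (\<lambda>x. w x \<bullet> e) x \<partial>lborel\<bar> \<le> 2 * L * Lw * (\<integral>x. indicator (cball x0 R) x * h x \<partial>lborel)"
    if "integrable lborel (\<lambda>x. \<phi> i (u x) * jac \<eta> (\<lambda>x. w x \<bullet> e) x)" "norm e = 1" for i e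
  proof -
    have "\<bar>\<integral>x. \<phi> i (u x) * jac \<eta> (\<lambda>x. w x \<bullet> e) x \<partial>lborel\<bar> \<le> (\<integral>x. 2 * L * Lw * (indicator (cball x0 R) x * h x) \<partial>lborel)"
      using jb[OF that(2), of i] that(1) ih
      by (intro order_trans[OF integral_abs_bound] integral_mono_AE integrable_abs integrable_mult_right)
    then show ?thesis by simp
  qed
  have "c * (\<integral>x. \<eta> x * d x \<partial>lborel) = (\<integral>x. c * (\<eta> x * d x) \<partial>lborel)" by simp
  also have "\<dots> \<le> (\<integral>x. \<eta> x * d x * m x \<partial>lborel)"
  proof (rule integral_mono_AE[OF icd idm])
    show "AE x in lborel. c * (\<eta> x * d x) \<le> \<eta> x * d x * m x"
      using c(2)
    proof eventually_elim
      case (elim x)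
      show ?case
      proof (cases "x \<in> cball x0 R")
        case True
        then have cm: "c \<le> m x" using elim R by blast
        have d0: "0 \<le> \<eta> x * d x" using \<eta>(2) div by (simp add: d_def)
        then have "c * (\<eta> x * d x) \<le> m x * (\<eta> x * d x)" using cm by (intro mult_right_mono)
        then show ?thesis by (simp add: mult.commute)
      qed (simp add: \<eta>(4))
    qed
  qed
  also have "\<dots> = (\<integral>x. \<eta> x * D\<phi> 1 (u x) e1 * m x \<partial>lborel) + (\<integral>x. \<eta> x * D\<phi> 2 (u x) e2 * m x \<partial>lborel)"
    unfolding dm_eq by (rule Bochner_Integration.integral_add[OF f1(1) f2i])
  also have "\<dots> = - (\<integral>x. \<phi> 1 (u x) * jac \<eta> (\<lambda>x. w x \<bullet> e2) x \<partial>lborel) + (\<integral>x. \<phi> 2 (u x) * jac \<eta> (\<lambda>x. w x \<bullet> e1) x \<partial>lborel)"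
    using f1(3) f2(3) by simp
  also have "\<dots> \<le> 4 * L * Lw * (\<integral>x. indicator (cball x0 R) x * h x \<partial>lborel)"
    using est[OF f1(2)] est[OF f2(2)] by (simp add: abs_le_iff)
  finally show "c * (\<integral>x. \<eta> x * (D\<phi> 1 (u x) e1 + D\<phi> 2 (u x) e2) \<partial>lborel)
      \<le> 4 * L * Lw * (\<integral>x. indicator (cball x0 R) x * h x \<partial>lborel)"
    by (simp add: d_def)
qed

end

context proportional_gradients
begin

text \<open>The flux bound for the fields \<open>y / sqrt (|y|\<^sup>2 + \<epsilon>\<^sup>2)\<close> bounds the local integral of \<open>1 / |u|\<close>; hence for
  the fields \<open>y / (|y|\<^sup>2 + \<epsilon>\<^sup>2)\<close> it bounds the integral of \<open>2 \<epsilon>\<^sup>2 / (|u|\<^sup>2 + \<epsilon>\<^sup>2)\<^sup>2\<close> uniformly in \<open>\<epsilon>\<close>, whereas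
  every point of the fibre contributes a fixed positive amount to the latter.\<close>

lemma fibre_isolated_0:
  assumes c: "c > 0" "AE x in lborel. x \<in> S \<longrightarrow> c \<le> m x" and x0: "x0 \<in> S" and u0: "u x0 = 0"
  obtains r where "r > 0" "cball x0 r \<subseteq> S" "\<And>x. x \<in> cball x0 r \<Longrightarrow> u x = 0 \<Longrightarrow> x = x0"
proof -
  obtain \<rho>' where "\<rho>' > 0" "cball x0 \<rho>' \<subseteq> S" using S x0 by (meson open_contains_cball)
  \<comment> \<open>Three nested balls are needed: zeros are counted in the radius \<rho>, where
    \<open>\<eta>2\<close> is 1, and \<open>\<eta>2\<close> is supported in the radius
    \<open>2 * \<rho>\<close>, where \<open>\<eta>1\<close> is 1.\<close>
  define \<rho> where "\<rho> = \<rho>' / 3"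
  have \<rho>: "\<rho> > 0" "cball x0 (3 * \<rho>) \<subseteq> S" using \<open>\<rho>' > 0\<close> \<open>cball x0 \<rho>' \<subseteq> S\<close> by (auto simp: \<rho>_def)
  have \<rho>2: "cball x0 (2 * \<rho>) \<subseteq> S" using \<rho> by auto
  obtain \<eta>1 :: "real^2 \<Rightarrow> real" where \<eta>1: "(1 / (3 * \<rho> - 2 * \<rho>))-lipschitz_on UNIV \<eta>1" "\<And>x. 0 \<le> \<eta>1 x" "\<And>x. \<eta>1 x \<le> 1"
    "\<And>x. dist x0 x \<le> 2 * \<rho> \<Longrightarrow> \<eta>1 x = 1" "\<And>x. 3 * \<rho> \<le> dist x0 x \<Longrightarrow> \<eta>1 x = 0"
    using lipschitz_cutoff[of "2 * \<rho>" "3 * \<rho>" x0] \<rho> by auto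
  obtain \<eta>2 :: "real^2 \<Rightarrow> real" where \<eta>2: "(1 / (2 * \<rho> - \<rho>))-lipschitz_on UNIV \<eta>2" "\<And>x. 0 \<le> \<eta>2 x" "\<And>x. \<eta>2 x \<le> 1"
    "\<And>x. dist x0 x \<le> \<rho> \<Longrightarrow> \<eta>2 x = 1" "\<And>x. 2 * \<rho> \<le> dist x0 x \<Longrightarrow> \<eta>2 x = 0"
    using lipschitz_cutoff[of \<rho> "2 * \<rho>" x0] \<rho> by auto
  have out1: "\<eta>1 x = 0" if "x \<notin> cball x0 (3 * \<rho>)" for x using that by (intro \<eta>1(5)) auto
  have out2: "\<eta>2 x = 0" if "x \<notin> cball x0 (2 * \<rho>)" for x using that by (intro \<eta>2(5)) auto
  note [measurable] = lipschitz_measurable[OF \<eta>1(1)] lipschitz_measurable[OF \<eta>2(1)]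
  have [measurable]: "cball x0 t \<in> sets borel" for t by simp
  define C1 where "C1 = 4 * (1 / \<rho>) * Lw * (\<integral>x. indicator (cball x0 (3 * \<rho>)) x * 1 \<partial>lborel) / c"
  define C2 where "C2 = 4 * (1 / \<rho>) * Lw * C1 / c"
  have uu_lip: "(Bu * Lu + Bu * Lu)-lipschitz_on UNIV (\<lambda>x. u x \<bullet> u x)"
    by (rule lipschitz_on_inner_bounded[OF u_lip u_bdd u_lip u_bdd Bu Bu])
  have ui_lip: "Lu-lipschitz_on UNIV (\<lambda>x. u x $ i)" for i
  proof (rule lipschitz_onI[OF _ Lu])
    fix x y
    have "\<bar>(u x - u y) $ i\<bar> \<le> norm (u x - u y)" by (rule component_le_norm_cart)
    then show "dist (u x $ i) (u y $ i) \<le> Lu * dist x y"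
      using lipschitz_onD[OF u_lip, of x y] by (simp add: dist_norm)
  qed
  have ui_bdd: "\<bar>u x $ i\<bar> \<le> Bu" for x i
    using component_le_norm_cart[of "u x" i] u_bdd[of x] by linarith
  \<comment> \<open>What matters is that \<open>C2\<close> does not depend on \<epsilon>.\<close>
  have energy: "integrable lborel (\<lambda>x. \<eta>2 x * (2 * \<epsilon>\<^sup>2 / (u x \<bullet> u x + \<epsilon>\<^sup>2)\<^sup>2))"
    "(\<integral>x. \<eta>2 x * (2 * \<epsilon>\<^sup>2 / (u x \<bullet> u x + \<epsilon>\<^sup>2)\<^sup>2) \<partial>lborel) \<le> C2" if \<epsilon>: "\<epsilon> > 0" for \<epsilon>
  proof -
    define q where "q y = y \<bullet> y + \<epsilon>\<^sup>2" for y :: "real^2"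
    define s where "s y = sqrt (q y)" for y
    have q: "q y > 0" "q y \<ge> \<epsilon>\<^sup>2" for y using \<epsilon> by (simp_all add: q_def add_nonneg_pos)
    have s: "s y > 0" "(s y)\<^sup>2 = q y" for y using q[of y] by (simp_all add: s_def)
    have s\<epsilon>: "s y \<ge> \<epsilon>" for y using q(2)[of y] \<epsilon> by (simp add: s_def real_le_rsqrt)
    have yi: "\<bar>y $ i\<bar> \<le> s y" for y i
    proof -
      have "(y $ i)\<^sup>2 \<le> y \<bullet> y" using component_le_norm_cart[of y i] by (simp add: abs_le_square_iff[symmetric] flip: power2_norm_eq_inner)
      also have "\<dots> \<le> q y" by (simp add: q_def)
      finally show ?thesis unfolding s_def by (rule real_le_rsqrt[of "\<bar>y $ i\<bar>", simplified])
    qed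
    have [measurable]: "(\<lambda>x. s (u x)) \<in> borel_measurable borel" unfolding s_def q_def by measurable
    have s_lip: "Lu-lipschitz_on UNIV (\<lambda>x. s (u x))"
    proof (rule lipschitz_onI[OF _ Lu])
      fix x y
      have e: "s z = norm (z, \<epsilon>)" for z by (simp add: s_def q_def norm_Pair power2_norm_eq_inner)
      have "\<bar>norm (u x, \<epsilon>) - norm (u y, \<epsilon>)\<bar> \<le> norm ((u x, \<epsilon>) - (u y, \<epsilon>))" by (rule norm_triangle_ineq3)
      also have "\<dots> = norm (u x - u y)" by (simp add: norm_Pair)
      finally show "dist (s (u x)) (s (u y)) \<le> Lu * dist x y"
        using lipschitz_onD[OF u_lip, of x y] by (simp add: e dist_norm)
    qed
    define \<phi>1 where "\<phi>1 i y = y $ i / s y" for i :: 2 and y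
    define D1 where "D1 i y v = v $ i / s y - y $ i * (y \<bullet> v) / s y ^ 3" for i :: 2 and y v
    define \<phi>2 where "\<phi>2 i y = y $ i / q y" for i :: 2 and y
    define D2 where "D2 i y v = v $ i / q y - y $ i * (2 * (y \<bullet> v)) / (q y)\<^sup>2" for i :: 2 and y v
    have d1: "(\<phi>1 i has_derivative D1 i y) (at y)" for i y
      using has_derivative_normalised_nth[OF \<epsilon>, of i y] by (simp add: \<phi>1_def[abs_def] D1_def[abs_def] s_def q_def)
    have d2: "(\<phi>2 i has_derivative D2 i y) (at y)" for i y
      using has_derivative_inverted_nth[OF \<epsilon>, of i y] by (simp add: \<phi>2_def[abs_def] D2_def[abs_def] q_def)
    have inv_s: "(Lu / \<epsilon>\<^sup>2)-lipschitz_on UNIV (\<lambda>x. 1 / s (u x))"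
      using lipschitz_on_inverse_max[OF s_lip \<epsilon>] s\<epsilon> by (simp add: max_absorb1)
    have inv_q: "((Bu * Lu + Bu * Lu) / (\<epsilon>\<^sup>2)\<^sup>2)-lipschitz_on UNIV (\<lambda>x. 1 / q (u x))"
    proof -
      have "(Bu * Lu + Bu * Lu)-lipschitz_on UNIV (\<lambda>x. q (u x))"
        using uu_lip by (simp add: q_def lipschitz_on_def dist_real_def)
      from lipschitz_on_inverse_max[OF this, of "\<epsilon>\<^sup>2"] show ?thesis using \<epsilon> q(2) by (simp add: max_absorb1)
    qed
    have s_inv_le: "\<bar>1 / s y\<bar> \<le> 1 / \<epsilon>" for y using s\<epsilon>[of y] \<epsilon> by (simp add: frac_le)
    have iq: "\<bar>1 / q y\<bar> \<le> 1 / \<epsilon>\<^sup>2" for y using q[of y] \<epsilon> by (simp add: frac_le)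
    have l1: "(Bu * (Lu / \<epsilon>\<^sup>2) + 1 / \<epsilon> * Lu)-lipschitz_on UNIV (\<lambda>x. \<phi>1 i (u x))" for i
      using lipschitz_on_mult_bounded[OF ui_lip[of i] ui_bdd inv_s s_inv_le Bu] \<epsilon> by (simp add: \<phi>1_def)
    have l2: "(Bu * ((Bu * Lu + Bu * Lu) / (\<epsilon>\<^sup>2)\<^sup>2) + 1 / \<epsilon>\<^sup>2 * Lu)-lipschitz_on UNIV (\<lambda>x. \<phi>2 i (u x))" for i
      using lipschitz_on_mult_bounded[OF ui_lip[of i] ui_bdd inv_q iq Bu] \<epsilon> by (simp add: \<phi>2_def)
    have b1: "\<bar>\<phi>1 i y\<bar> \<le> 1" for i y
      using yi[of y i] s(1)[of y] by (simp add: \<phi>1_def abs_divide)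
    have b2: "\<bar>\<phi>2 i y\<bar> \<le> 1 / s y" for i y
    proof -
      have "\<bar>y $ i\<bar> / q y \<le> s y / q y" using yi[of y i] q(1)[of y] by (intro divide_right_mono) auto
      also have "\<dots> = 1 / s y" using s(1)[of y] by (simp add: s(2)[symmetric] power2_eq_square)
      finally show ?thesis using q(1)[of y] by (simp add: \<phi>2_def abs_divide)
    qed
    have yy: "y \<bullet> y = y $ 1 * y $ 1 + y $ 2 * y $ 2" for y :: "real^2" by (rule inner_real2)
    \<comment> \<open>The divergence of the field y / s is 2/s - |y|^2/s^3, and |y|^2 is at most
      s^2.\<close>
    have div1: "D1 1 y e1 + D1 2 y e2 \<ge> 1 / s y" for y
    proof -
      have 1: "D1 1 y e1 + D1 2 y e2 = 2 / s y - (y \<bullet> y) / s y ^ 3"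
        unfolding D1_def by (simp add: yy inner_real2 axis_def add_divide_distrib)
      have 2: "(y \<bullet> y) / s y ^ 3 \<le> (s y)\<^sup>2 / s y ^ 3"
        using s(1)[of y] by (intro divide_right_mono) (simp_all add: s(2) q_def)
      have 3: "(s y)\<^sup>2 / s y ^ 3 = 1 / s y" using s(1)[of y] by (simp add: power2_eq_square power3_eq_cube)
      have 4: "2 / s y = 1 / s y + 1 / s y" by simp
      show ?thesis using 2 unfolding 1 3 4 by linarith
    qed
    \<comment> \<open>The divergence of y / q is 2/q - 2|y|^2/q^2. In dimension two the coefficients
      match, so that only the contribution of \<open>\<epsilon>\<^sup>2\<close> in \<open>q\<close>
      remains.\<close>
    have div2: "D2 1 y e1 + D2 2 y e2 = 2 * \<epsilon>\<^sup>2 / (q y)\<^sup>2" for y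
    proof -
      have "D2 1 y e1 + D2 2 y e2 = 2 / q y - 2 * (y \<bullet> y) / (q y)\<^sup>2"
        unfolding D2_def by (simp add: yy inner_real2 axis_def add_divide_distrib mult.left_commute)
      also have "2 / q y = 2 * q y / (q y)\<^sup>2" using q(1)[of y] by (simp add: power2_eq_square)
      finally show ?thesis by (simp add: q_def diff_divide_distrib[symmetric])
    qed
    have div1': "0 \<le> D1 1 y e1 + D1 2 y e2" for y
      using div1[of y] s(1)[of y] by (meson less_imp_le order_trans zero_less_divide_1_iff)
    have div2': "0 \<le> D2 1 y e1 + D2 2 y e2" for y unfolding div2 by simp
    have i1: "integrable lborel (\<lambda>x. \<eta>1 x * (D1 1 (u x) e1 + D1 2 (u x) e2))"
      and e1: "c * (\<integral>x. \<eta>1 x * (D1 1 (u x) e1 + D1 2 (u x) e2) \<partial>lborel)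
        \<le> 4 * (1 / (3 * \<rho> - 2 * \<rho>)) * Lw * (\<integral>x. indicator (cball x0 (3 * \<rho>)) x * 1 \<partial>lborel)"
      by (rule flux_bound[OF \<rho>(2) c \<eta>1(1-3) out1 d1 l1 b1, where B=1]; (simp add: div1')?)+
    have E1: "(\<integral>x. \<eta>1 x * (1 / s (u x)) \<partial>lborel) \<le> C1" and iE1: "integrable lborel (\<lambda>x. \<eta>1 x * (1 / s (u x)))"
    proof -
      have pt: "\<eta>1 x * (1 / s (u x)) \<le> \<eta>1 x * (D1 1 (u x) e1 + D1 2 (u x) e2)" for x
        by (rule mult_left_mono[OF div1 \<eta>1(2)])
      have nn: "0 \<le> \<eta>1 x * (1 / s (u x))" for x using \<eta>1(2)[of x] s(1)[of "u x"] by simp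
      show i: "integrable lborel (\<lambda>x. \<eta>1 x * (1 / s (u x)))"
      proof (rule Bochner_Integration.integrable_bound[OF i1])
        show "AE x in lborel. norm (\<eta>1 x * (1 / s (u x))) \<le> norm (\<eta>1 x * (D1 1 (u x) e1 + D1 2 (u x) e2))"
          using pt nn by (intro AE_I2) (smt (verit) real_norm_def)
      qed measurable
      have "c * (\<integral>x. \<eta>1 x * (1 / s (u x)) \<partial>lborel) \<le> c * (\<integral>x. \<eta>1 x * (D1 1 (u x) e1 + D1 2 (u x) e2) \<partial>lborel)"
        using c(1) by (intro mult_left_mono integral_mono[OF i i1] pt) auto
      also note e1
      finally have "(\<integral>x. \<eta>1 x * (1 / s (u x)) \<partial>lborel)
          \<le> 4 * (1 / (3 * \<rho> - 2 * \<rho>)) * Lw * (\<integral>x. indicator (cball x0 (3 * \<rho>)) x * 1 \<partial>lborel) / c"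
        by (subst pos_le_divide_eq[OF c(1)], subst mult.commute)
      also have "\<dots> = C1" by (simp add: C1_def)
      finally show "(\<integral>x. \<eta>1 x * (1 / s (u x)) \<partial>lborel) \<le> C1" .
    qed
    have hm: "(\<lambda>x. 1 / s (u x)) \<in> borel_measurable borel" by measurable
    have hb: "1 / s (u x) \<le> 1 / \<epsilon>" for x using s_inv_le[of "u x"] by linarith
    \<comment> \<open>The components of the second field are bounded by \<open>1 / s (u x)\<close>,
      so its boundary term is controlled by the integral that the first field has bounded by
      \<open>C1\<close>.\<close>
    note fb = flux_bound[OF \<rho>2 c \<eta>2(1-3) out2 d2 l2 b2 hm hb div2']
    have i2: "integrable lborel (\<lambda>x. \<eta>2 x * (D2 1 (u x) e1 + D2 2 (u x) e2))" by (rule fb(1))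
    have e2: "c * (\<integral>x. \<eta>2 x * (D2 1 (u x) e1 + D2 2 (u x) e2) \<partial>lborel)
        \<le> 4 * (1 / (2 * \<rho> - \<rho>)) * Lw * (\<integral>x. indicator (cball x0 (2 * \<rho>)) x * (1 / s (u x)) \<partial>lborel)"
      by (rule fb(2))
    show "integrable lborel (\<lambda>x. \<eta>2 x * (2 * \<epsilon>\<^sup>2 / (u x \<bullet> u x + \<epsilon>\<^sup>2)\<^sup>2))"
      using i2 by (simp only: div2 q_def)
    have "(\<integral>x. indicator (cball x0 (2 * \<rho>)) x * (1 / s (u x)) \<partial>lborel) \<le> (\<integral>x. \<eta>1 x * (1 / s (u x)) \<partial>lborel)"
    proof (rule integral_mono[OF _ iE1])
      show le: "indicator (cball x0 (2 * \<rho>)) x * (1 / s (u x)) \<le> \<eta>1 x * (1 / s (u x))" for x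
      proof (rule mult_right_mono)
        show "indicator (cball x0 (2 * \<rho>)) x \<le> \<eta>1 x" using \<eta>1(2)[of x] \<eta>1(4)[of x] by (auto simp: indicator_def)
      qed (use s(1)[of "u x"] in simp)
      show "integrable lborel (\<lambda>x. indicator (cball x0 (2 * \<rho>)) x * (1 / s (u x)))"
      proof (rule Bochner_Integration.integrable_bound[OF iE1])
        show "AE x in lborel. norm (indicator (cball x0 (2 * \<rho>)) x * (1 / s (u x))) \<le> norm (\<eta>1 x * (1 / s (u x)))"
        proof (rule AE_I2)
          fix x
          have "0 \<le> indicator (cball x0 (2 * \<rho>)) x * (1 / s (u x))" using s(1)[of "u x"] by simp
          then show "norm (indicator (cball x0 (2 * \<rho>)) x * (1 / s (u x))) \<le> norm (\<eta>1 x * (1 / s (u x)))"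
            unfolding real_norm_def using le[of x] by linarith
        qed
      qed measurable
    qed
    also note E1
    finally have "4 * (1 / (2 * \<rho> - \<rho>)) * Lw * (\<integral>x. indicator (cball x0 (2 * \<rho>)) x * (1 / s (u x)) \<partial>lborel)
      \<le> 4 * (1 / (2 * \<rho> - \<rho>)) * Lw * C1"
      using \<rho> Lw by (intro mult_left_mono) auto
    with e2 have "c * (\<integral>x. \<eta>2 x * (2 * \<epsilon>\<^sup>2 / (u x \<bullet> u x + \<epsilon>\<^sup>2)\<^sup>2) \<partial>lborel) \<le> 4 * (1 / (2 * \<rho> - \<rho>)) * Lw * C1"
      by (simp only: div2 q_def)
    then have "(\<integral>x. \<eta>2 x * (2 * \<epsilon>\<^sup>2 / (u x \<bullet> u x + \<epsilon>\<^sup>2)\<^sup>2) \<partial>lborel) \<le> 4 * (1 / (2 * \<rho> - \<rho>)) * Lw * C1 / c"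
      by (subst pos_le_divide_eq[OF c(1)], subst mult.commute)
    also have "\<dots> = C2" by (simp add: C2_def)
    finally show "(\<integral>x. \<eta>2 x * (2 * \<epsilon>\<^sup>2 / (u x \<bullet> u x + \<epsilon>\<^sup>2)\<^sup>2) \<partial>lborel) \<le> C2" .
  qed
  \<comment> \<open>On the ball of radius \<epsilon> about a zero,
    \<open>norm (u x) \<le> Lu * \<epsilon>\<close>, so the integrand of the energy is at least 2 /
    ((Lu^2 + 1)^2 \<epsilon>^2). Times the area of the ball this is \<open>V\<close>, from which
    \<epsilon> has dropped out.\<close>
  define V where "V = unit_ball_vol (real DIM(real^2)) * 2 / (Lu\<^sup>2 + 1)\<^sup>2"
  have LL: "Lu\<^sup>2 + 1 > 0" by (simp add: add_nonneg_pos)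
  have V: "V > 0" unfolding V_def using LL unit_ball_vol_pos[of "real DIM(real^2)"] by (intro divide_pos_pos) auto
  define Z where "Z = {z \<in> ball x0 \<rho>. u z = 0}"
  have count: "real (card F) * V \<le> C2" if F: "finite F" "F \<subseteq> Z" "F \<noteq> {}" for F
  proof -
    have "\<exists>d>0. \<forall>z\<in>F. ball z d \<subseteq> ball x0 \<rho> \<and> (\<forall>z'\<in>F. z' \<noteq> z \<longrightarrow> 2 * d \<le> dist z z')"
    proof -
      have "\<exists>d>0. ball z d \<subseteq> ball x0 \<rho> \<and> (\<forall>z'\<in>F. z' \<noteq> z \<longrightarrow> 2 * d \<le> dist z z')" if z: "z \<in> F" for z
      proof -
        obtain a where a: "a > 0" "ball z a \<subseteq> ball x0 \<rho>"
          using z F(2) open_ball[of x0 \<rho>] unfolding Z_def by (metis (no_types, lifting) mem_Collect_eq openE subsetD)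
        obtain b where b: "b > 0" "\<forall>z'\<in>F. z' \<noteq> z \<longrightarrow> b \<le> dist z z'" using finite_set_avoid[OF F(1)] by blast
        have 1: "ball z (min a (b / 2)) \<subseteq> ball x0 \<rho>" using a(2) by auto
        have "2 * min a (b / 2) \<le> b" by (simp add: min_def)
        then have "\<forall>z'\<in>F. z' \<noteq> z \<longrightarrow> 2 * min a (b / 2) \<le> dist z z'" using b(2) order_trans by blast
        with 1 show ?thesis using a(1) b(1) by (intro exI[of _ "min a (b / 2)"]) simp
      qed
      then obtain d where d: "\<And>z. z \<in> F \<Longrightarrow> d z > 0" "\<And>z. z \<in> F \<Longrightarrow> ball z (d z) \<subseteq> ball x0 \<rho>"
        "\<And>z z'. z \<in> F \<Longrightarrow> z' \<in> F \<Longrightarrow> z' \<noteq> z \<Longrightarrow> 2 * d z \<le> dist z z'" by metis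
      define e where "e = Min (d ` F)"
      have e: "e > 0" "\<And>z. z \<in> F \<Longrightarrow> e \<le> d z" using F d(1) by (auto simp: e_def)
      have "ball z e \<subseteq> ball x0 \<rho>" if "z \<in> F" for z
        using d(2)[OF that] e(2)[OF that] subset_ball[of e "d z" z] by blast
      moreover have "2 * e \<le> dist z z'" if "z \<in> F" "z' \<in> F" "z' \<noteq> z" for z z'
        using d(3)[OF that] e(2)[OF that(1)] by linarith
      ultimately show ?thesis using e(1) by blast
    qed
    \<comment> \<open>The radius is chosen after the finite set \<open>F\<close>, small enough for
      disjoint balls inside \<open>ball x0 \<rho>\<close>; the uniform energy bound permits this,
      and the balls contribute \<open>V\<close> each.\<close>
    then obtain \<epsilon> where \<epsilon>: "\<epsilon> > 0" "\<And>z. z \<in> F \<Longrightarrow> ball z \<epsilon> \<subseteq> ball x0 \<rho>"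
      "\<And>z z'. z \<in> F \<Longrightarrow> z' \<in> F \<Longrightarrow> z' \<noteq> z \<Longrightarrow> 2 * \<epsilon> \<le> dist z z'" by blast
    define A where "A = (\<Union>z\<in>F. ball z \<epsilon>)"
    have [measurable]: "A \<in> sets borel" unfolding A_def by (intro borel_open open_UN ballI open_ball)
    have disj: "disjoint_family_on (\<lambda>z. ball z \<epsilon>) F"
      unfolding disjoint_family_on_def
    proof (intro ballI impI)
      fix z z' assume "z \<in> F" "z' \<in> F" "z \<noteq> z'"
      then have "2 * \<epsilon> \<le> dist z z'" using \<epsilon>(3) by auto
      then show "ball z \<epsilon> \<inter> ball z' \<epsilon> = {}" by (intro disjoint_ballI) simp
    qed
    have "measure lborel A = (\<Sum>z\<in>F. measure lborel (ball z \<epsilon>))"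
      unfolding A_def using disj F(1) emeasure_bounded_finite[OF bounded_ball]
      by (intro measure_finite_Union) (auto simp: less_top[symmetric])
    also have "\<dots> = real (card F) * (unit_ball_vol (real DIM(real^2)) * \<epsilon>\<^sup>2)"
      using \<epsilon>(1) by (simp add: content_ball)
    finally have mA: "measure lborel A = real (card F) * (unit_ball_vol (real DIM(real^2)) * \<epsilon>\<^sup>2)" .
    have bA: "A \<subseteq> cball x0 \<rho>" using \<epsilon>(2) ball_subset_cball[of x0 \<rho>] unfolding A_def by blast
    have finA: "emeasure lborel A < \<infinity>" by (rule emeasure_bounded_finite[OF bounded_subset[OF bounded_cball bA]])
    define k where "k = 2 * \<epsilon>\<^sup>2 / ((Lu\<^sup>2 + 1) * \<epsilon>\<^sup>2)\<^sup>2"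
    have "(\<integral>x. k * indicator A x \<partial>lborel) \<le> (\<integral>x. \<eta>2 x * (2 * \<epsilon>\<^sup>2 / (u x \<bullet> u x + \<epsilon>\<^sup>2)\<^sup>2) \<partial>lborel)"
    proof (rule integral_mono[OF _ energy(1)[OF \<epsilon>(1)]])
      show "integrable lborel (\<lambda>x. k * indicator A x)" using finA by (intro integrable_mult_right integrable_real_indicator) auto
      fix x
      show "k * indicator A x \<le> \<eta>2 x * (2 * \<epsilon>\<^sup>2 / (u x \<bullet> u x + \<epsilon>\<^sup>2)\<^sup>2)"
      proof (cases "x \<in> A")
        case True
        then obtain z where z: "z \<in> F" "dist z x < \<epsilon>" by (auto simp: A_def)
        have "u z = 0" using z F(2) by (auto simp: Z_def)
        then have "norm (u x) \<le> Lu * dist x z" using lipschitz_onD[OF u_lip, of x z] by (simp add: dist_norm)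
        also have "\<dots> \<le> Lu * \<epsilon>" using z Lu by (intro mult_left_mono) (auto simp: dist_commute)
        finally have "(norm (u x))\<^sup>2 \<le> (Lu * \<epsilon>)\<^sup>2" by (rule power_mono) simp
        then have le: "u x \<bullet> u x + \<epsilon>\<^sup>2 \<le> (Lu\<^sup>2 + 1) * \<epsilon>\<^sup>2"
          by (simp add: power2_norm_eq_inner power_mult_distrib algebra_simps)
        have pos: "0 < u x \<bullet> u x + \<epsilon>\<^sup>2" using \<epsilon>(1) by (simp add: add_nonneg_pos)
        have "k \<le> 2 * \<epsilon>\<^sup>2 / (u x \<bullet> u x + \<epsilon>\<^sup>2)\<^sup>2"
          unfolding k_def using le pos by (intro frac_le power_mono) auto
        moreover have "\<eta>2 x = 1" using bA True by (intro \<eta>2(4)) auto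
        ultimately show ?thesis using True by simp
      next
        case False
        then show ?thesis using \<eta>2(2)[of x] by simp
      qed
    qed
    also have "\<dots> \<le> C2" by (rule energy(2)[OF \<epsilon>(1)])
    finally have "k * measure lborel A \<le> C2" by simp
    moreover have "k * measure lborel A = real (card F) * V"
    proof -
      have "2 * e / (l * e)\<^sup>2 * (n * (v * e)) = n * (v * 2 / l\<^sup>2)" if "e > 0" "l > 0" for e l n v :: real
        using that by (simp add: power2_eq_square field_simps)
      from this[of "\<epsilon>\<^sup>2" "Lu\<^sup>2 + 1"] show ?thesis
        unfolding mA k_def V_def using \<epsilon>(1) LL by simp
    qed
    ultimately show ?thesis by simp
  qed
  have "finite Z"
  proof (rule ccontr)
    assume inf: "infinite Z"
    obtain n where n: "C2 < real n * V" using reals_Archimedean3[OF V] by blast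
    obtain F where F: "F \<subseteq> Z" "finite F" "card F = Suc n" using infinite_arbitrarily_large[OF inf] by blast
    then have "F \<noteq> {}" by auto
    with F have "real (Suc n) * V \<le> C2" using count[of F] by simp
    moreover have "real n * V \<le> real (Suc n) * V" using V by (intro mult_right_mono) auto
    ultimately show False using n by linarith
  qed
  from finite_set_avoid[OF this] obtain d where d: "d > 0" "\<And>z. z \<in> Z \<Longrightarrow> z \<noteq> x0 \<Longrightarrow> d \<le> dist x0 z" by metis
  define r where "r = min (d / 2) (\<rho> / 2)"
  have r: "r > 0" "r < d" "r < \<rho>" using d(1) \<rho>(1) by (auto simp: r_def)
  show ?thesis
  proof (rule that[of r])
    show "cball x0 r \<subseteq> S" using r \<rho> by (intro order_trans[OF _ \<rho>(2)]) auto
    fix x assume x: "x \<in> cball x0 r" "u x = 0"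
    then have "x \<in> Z" using r by (auto simp: Z_def)
    then show "x = x0" using d(2)[of x] x r by fastforce
  qed (rule r(1))
qed

lemma shift: "proportional_gradients (\<lambda>x. u x - u x0) (\<lambda>x. w x - w x0) \<beta> S Lu Lw (2 * Bu) (2 * Bw)"
proof
  show "Lu-lipschitz_on UNIV (\<lambda>x. u x - u x0)" "Lw-lipschitz_on UNIV (\<lambda>x. w x - w x0)"
    using u_lip w_lip by (simp_all add: lipschitz_on_def dist_norm)
  show "norm (u x - u x0) \<le> 2 * Bu" for x
    using norm_triangle_ineq4[of "u x" "u x0"] u_bdd[of x] u_bdd[of x0] by linarith
  show "norm (w x - w x0) \<le> 2 * Bw" for x
    using norm_triangle_ineq4[of "w x" "w x0"] w_bdd[of x] w_bdd[of x0] by linarith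
  show "AE x in lborel. x \<in> S \<longrightarrow> (\<exists>Du. ((\<lambda>x. u x - u x0) has_derivative Du) (at x) \<and>
    ((\<lambda>x. w x - w x0) has_derivative (\<lambda>v. \<beta> x *\<^sub>R Du v)) (at x) \<and> \<beta> x * det2 (Du e1) (Du e2) > 0)"
    using good
  proof eventually_elim
    case (elim x)
    have "((\<lambda>x. f x - a) has_derivative D) (at x)" if "(f has_derivative D) (at x)" for f :: "real^2 \<Rightarrow> real^2" and D a
      using has_derivative_diff[OF that has_derivative_const[of a]] by simp
    with elim show ?case by blast
  qed
qed (rule S)

end

lemma (in proportional_gradients) factor_constant_near_isolated:
  assumes r: "r > 0" "cball x0 r \<subseteq> S" and iso: "\<And>x. x \<in> cball x0 r \<Longrightarrow> u x = u x0 \<Longrightarrow> x = x0"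
  shows "\<exists>c. \<exists>\<delta>>0. AE x in lborel. x \<in> ball x0 \<delta> \<longrightarrow> \<beta> x = c"
proof -
  interpret sh: proportional_gradients "\<lambda>x. u x - u x0" "\<lambda>x. w x - w x0" \<beta> S Lu Lw "2 * Bu" "2 * Bw"
    by (rule shift)
  show ?thesis
    by (rule sh.factor_constant_near_isolated_0[OF r]) (use iso in auto)
qed

lemma (in proportional_gradients) factor_constant_near_nondegenerate:
  assumes c: "c > 0" "AE x in lborel. x \<in> S \<longrightarrow> c \<le> m x" and x0: "x0 \<in> S"
  shows "\<exists>k. \<exists>\<delta>>0. AE x in lborel. x \<in> ball x0 \<delta> \<longrightarrow> \<beta> x = k"
proof -
  interpret sh: proportional_gradients "\<lambda>x. u x - u x0" "\<lambda>x. w x - w x0" \<beta> S Lu Lw "2 * Bu" "2 * Bw"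
    by (rule shift)
  \<comment> \<open>Difference quotients do not see the constants that are subtracted, so the lower
    bound on \<open>m\<close> carries over to the shifted maps.\<close>
  have "sh.m = m"
    by (simp add: sh.m_def m_def jac_def[abs_def] pd_def inner_diff_left)
  then obtain r where r: "r > 0" "cball x0 r \<subseteq> S" "\<And>x. x \<in> cball x0 r \<Longrightarrow> u x - u x0 = 0 \<Longrightarrow> x = x0"
    using sh.fibre_isolated_0[of c x0] c x0 by auto
  show ?thesis
    by (rule factor_constant_near_isolated[OF r(1,2)]) (use r(3) in auto)
qed

subsection \<open>The local structure of weak solutions\<close>

text \<open>By Lindelof's theorem countably many of the balls cover \<open>S\<close>, and countably
  many null sets have a null union.\<close>

lemma AE_locally:
  fixes S :: "'a::euclidean_space set"
  assumes loc: "\<And>x. x \<in> S \<Longrightarrow> \<exists>d>0. AE y in M. y \<in> ball x d \<longrightarrow> P y"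
  shows "AE y in M. y \<in> S \<longrightarrow> P y"
proof -
  obtain d where d: "\<And>x. x \<in> S \<Longrightarrow> d x > 0" "\<And>x. x \<in> S \<Longrightarrow> AE y in M. y \<in> ball x (d x) \<longrightarrow> P y"
    using loc by metis
  obtain F where F: "F \<subseteq> (\<lambda>x. ball x (d x)) ` S" "countable F" "\<Union>F = (\<Union>x\<in>S. ball x (d x))"
    using Lindelof[of "(\<lambda>x. ball x (d x)) ` S"] by auto
  have "AE y in M. \<forall>B\<in>F. y \<in> B \<longrightarrow> P y"
    unfolding AE_ball_countable[OF F(2)] using F(1) d(2) by blast
  then show ?thesis
  proof eventually_elim
    case (elim y)
    have "y \<in> \<Union>F" if "y \<in> S" unfolding F(3) using that d(1) by force
    then show ?case using elim by blast
  qed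
qed

text \<open>An injective linear map on a Euclidean space expands norms by at least some
  \<open>B > 0\<close>; near \<open>x0\<close> the linearisation error is at most half of that,
  which excludes a second preimage.\<close>

lemma isolated_of_invertible_derivative:
  fixes f :: "'a::real_normed_vector \<Rightarrow> 'b::euclidean_space"
  assumes D: "(f has_derivative D) (at x0)" and inj: "inj D"
  shows "\<exists>r>0. \<forall>x\<in>cball x0 r. f x = f x0 \<longrightarrow> x = x0"
proof -
  obtain B where B: "B > 0" "\<And>x. B * norm x \<le> norm (D x)"
    using linear_inj_bounded_below_pos[OF has_derivative_linear[OF D] inj] by blast
  obtain d where d: "d > 0" "\<And>y. norm (y - x0) < d \<Longrightarrow> norm (f y - f x0 - D (y - x0)) \<le> B / 2 * norm (y - x0)"
    using D B(1) unfolding has_derivative_at_alt by (meson half_gt_zero)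
  have "x = x0" if "x \<in> cball x0 (d / 2)" "f x = f x0" for x
  proof -
    have "norm (x - x0) < d" using that(1) d(1) by (simp add: dist_norm norm_minus_commute)
    from d(2)[OF this] have "norm (D (x - x0)) \<le> B / 2 * norm (x - x0)" using that(2) by simp
    then have "B * norm (x - x0) \<le> 0" using B(2)[of "x - x0"] by simp
    then have "norm (x - x0) \<le> 0" using B(1) by (simp add: mult_le_0_iff)
    then show ?thesis by simp
  qed
  then show ?thesis using d(1) by (intro exI[of _ "d / 2"]) auto
qed

lemma lipschitz_differentiable_ae:
  fixes f :: "'a::euclidean_space \<Rightarrow> 'b::euclidean_space"
  assumes f: "L-lipschitz_on UNIV f"
  shows "AE x in lborel. f differentiable (at x)"
proof -
  have "AE x in lborel. (\<lambda>x. f x \<bullet> i) differentiable (at x)" if i: "i \<in> Basis" for i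
  proof -
    have "L-lipschitz_on UNIV (\<lambda>x. f x \<bullet> i)"
    proof (rule lipschitz_onI)
      fix x y
      have "\<bar>(f x - f y) \<bullet> i\<bar> \<le> dist (f x) (f y)"
        using Cauchy_Schwarz_ineq2[of "f x - f y" i] i by (simp add: dist_norm)
      also have "\<dots> \<le> L * dist x y" using lipschitz_onD[OF f] by simp
      finally show "dist (f x \<bullet> i) (f y \<bullet> i) \<le> L * dist x y" by (simp add: dist_real_def inner_diff_left)
    qed (rule lipschitz_on_nonneg[OF f])
    from Rademacher[OF this] show ?thesis by eventually_elim (auto simp: differentiable_def)
  qed
  then have "AE x in lborel. \<forall>i\<in>Basis. (\<lambda>x. f x \<bullet> i) differentiable (at x)"
    by (subst AE_ball_countable) (auto simp: countable_finite)
  then show ?thesis by eventually_elim (simp add: differentiable_componentwise_within[of f _ UNIV])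
qed

lemma jacobian_nth:
  fixes f :: "real^'n \<Rightarrow> real^'m"
  assumes "(f has_derivative D) (at x)"
  shows "jacobian f (at x) $ k $ j = D (axis j 1) $ k" "pd v (\<lambda>x. f x $ k) x = D v $ k"
proof -
  have "jacobian f (at x) = matrix D"
    using frechet_derivative_at[OF assms] by (simp add: jacobian_def)
  then show "jacobian f (at x) $ k $ j = D (axis j 1) $ k" by (simp add: matrix_def)
  have "((\<lambda>x. f x $ k) has_derivative (\<lambda>v. D v $ k)) (at x)"
    using assms by (rule bounded_linear.has_derivative[OF bounded_linear_vec_nth])
  then show "pd v (\<lambda>x. f x $ k) x = D v $ k" by (rule pd_has_derivative)
qed

lemma cof_nth:
  "cof X $ 1 $ 1 = X $ 2 $ 2" "cof X $ 1 $ 2 = - X $ 1 $ 2" "cof X $ 2 $ 1 = - X $ 2 $ 1" "cof X $ 2 $ 2 = X $ 1 $ 1"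
  by (simp_all add: cof_def minor_def det_1 three_eq_one_2)

lemma bump_test_function:
  assumes "cbox a b \<subseteq> \<Omega>"
  shows "(\<lambda>x. bump 1 a b x *\<^sub>R axis k 1) \<in> test_functions \<Omega>"
proof -
  have "Ck n (\<lambda>x. bump 1 a b x *\<^sub>R axis k (1::real))" for n
    by (rule Ck_bounded_linear[OF bounded_linear_scaleR_left Ck_bump])
  moreover have sub: "closure {x. bump 1 a b x *\<^sub>R axis k (1::real) \<noteq> 0} \<subseteq> cbox a b"
    using bump_eq_0[of 1 _ a b] box_subset_cbox[of a b] by (intro closure_minimal) auto
  moreover have "compact (closure {x. bump 1 a b x *\<^sub>R axis k (1::real) \<noteq> 0})"
    using sub bounded_subset[OF bounded_cbox sub] by (simp add: compact_eq_bounded_closed)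
  ultimately show ?thesis using assms by (auto simp: test_functions_def)
qed

text \<open>The weak equation is an integral for the completed measure, and its integrand is
  unspecified where \<open>u\<close> is not differentiable. Replacing the integrand by a Borel
  function equal to it almost everywhere makes the results on \<open>lborel\<close>
  applicable.\<close>

lemma lebesgue_integral_lborel_AE:
  fixes f h :: "'a::euclidean_space \<Rightarrow> 'b::euclidean_space"
  assumes [measurable]: "h \<in> borel_measurable borel" and ae: "AE x in lborel. f x = h x"
  shows "integral\<^sup>L lebesgue f = integral\<^sup>L lborel h"
proof -
  have h: "h \<in> borel_measurable lebesgue" by (rule measurable_completion) simp
  have ae': "AE x in lebesgue. h x = f x" using AE_completion[OF ae] by (simp add: eq_commute)
  have "integral\<^sup>L lebesgue f = integral\<^sup>L lebesgue h"
    by (rule integral_cong_AE[OF borel_measurable_AE[OF h ae'] h]) (use ae' in auto)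
  also have "\<dots> = integral\<^sup>L lborel h" by (rule integral_completion) simp
  finally show ?thesis .
qed

text \<open>Each row of \<open>transpose (cof (jacobian u (at x)))\<close> is, up to sign, the
  gradient of the other component of \<open>u\<close>, rotated by a right angle. A test function
  directed along one axis therefore turns the divergence equation into the weak curl-freeness of
  \<open>h (det Du)\<close> times the gradient of one component, and \<open>potential_exists\<close>
  supplies the components of \<open>w\<close>.\<close>

lemma local_structure:
  fixes u :: "real^2 \<Rightarrow> real^2" and \<Omega> :: "(real^2) set" and h :: "real \<Rightarrow> real"
  assumes \<Omega>: "open \<Omega>" and lip: "L-lipschitz_on \<Omega> u"
    and h: "continuous_on UNIV h" and h_pos: "\<And>t. t \<noteq> 0 \<Longrightarrow> h t * t > 0"
    and div: "weakly_div_free \<Omega> (\<lambda>x. h (det (jacobian u (at x))) *\<^sub>R transpose (cof (jacobian u (at x))))"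
    and nz: "AE x in lborel. x \<in> \<Omega> \<longrightarrow> det (jacobian u (at x)) \<noteq> 0"
    and x0: "x0 \<in> \<Omega>"
  obtains r U w Lu Lw Bu Bw where "r > 0" "ball x0 r \<subseteq> \<Omega>" "\<And>x. x \<in> ball x0 r \<Longrightarrow> U x = u x"
    "proportional_gradients U w (\<lambda>x. h (det (jacobian u (at x)))) (ball x0 r) Lu Lw Bu Bw"
    "AE x in lborel. x \<in> ball x0 r \<longrightarrow> u differentiable (at x)"
proof -
  obtain R where R: "R > 0" "cball x0 R \<subseteq> \<Omega>" using \<Omega> x0 open_contains_cball by blast
  \<comment> \<open>All assumptions on \<open>u\<close> concern \<Omega>; \<open>U\<close> is a
    bounded extension from a closed ball in \<Omega>, Lipschitz on the whole plane.\<close>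
  define U where "U x = u (closest_point (cball x0 R) x)" for x
  have U_lip: "L-lipschitz_on UNIV U"
    unfolding U_def[abs_def]
    by (rule lipschitz_on_projection_cball) (use lipschitz_on_subset[OF lip R(2)] R(1) in auto)
  have L: "L \<ge> 0" using U_lip lipschitz_on_nonneg by auto
  have U_eq: "U x = u x" if "x \<in> ball x0 R" for x
    using that closest_point_self[of x "cball x0 R"] by (simp add: U_def)
  have "bounded (u ` cball x0 R)"
    by (intro compact_imp_bounded compact_continuous_image)
      (use lipschitz_on_continuous_on[OF lipschitz_on_subset[OF lip R(2)]] in auto)
  moreover have "U x \<in> u ` cball x0 R" for x
    unfolding U_def using closest_point_in_set[of "cball x0 R" x] R(1) by simp
  ultimately obtain Bu where Bu: "\<And>x. norm (U x) \<le> Bu" unfolding bounded_iff by blast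
  define V where "V k x = U x $ k" for k x
  have V_lip: "L-lipschitz_on UNIV (V k)" for k
  proof (rule lipschitz_onI)
    fix x y
    have "\<bar>(U x - U y) $ k\<bar> \<le> dist (U x) (U y)" unfolding dist_norm by (rule component_le_norm_cart)
    also have "\<dots> \<le> L * dist x y" using lipschitz_onD[OF U_lip] by simp
    finally show "dist (V k x) (V k y) \<le> L * dist x y" by (simp add: dist_real_def V_def)
  qed (rule L)
  have [measurable]: "V k \<in> borel_measurable borel" for k by (rule lipschitz_measurable[OF V_lip])
  have same_derivative: "(u has_derivative D) (at x) \<longleftrightarrow> (U has_derivative D) (at x)" if "x \<in> ball x0 R" for D x
    using that U_eq by (intro iffI) (erule has_derivative_transform_within_open[where s = "ball x0 R"]; simp)+
  define \<beta> where "\<beta> x = h (det (jacobian u (at x)))" for x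
  have diff: "AE x in lborel. x \<in> ball x0 R \<longrightarrow> u differentiable (at x)"
    using lipschitz_differentiable_ae[OF U_lip]
    by eventually_elim (use same_derivative in \<open>auto simp: differentiable_def\<close>)
  have grad_structure: "AE x in lborel. x \<in> ball x0 R \<longrightarrow> (\<exists>D. (u has_derivative D) (at x) \<and> (U has_derivative D) (at x) \<and>
      (\<forall>k j. jacobian u (at x) $ k $ j = pd (axis j 1) (V k) x) \<and> (\<forall>k v. pd v (V k) x = D v $ k) \<and>
      det (jacobian u (at x)) = det2 (D e1) (D e2) \<and>
      \<beta> x = h (jac (V 1) (V 2) x) \<and> \<beta> x * det2 (D e1) (D e2) > 0)"
    using diff nz
  proof eventually_elim
    case (elim x)
    show ?case
    proof
      assume x: "x \<in> ball x0 R"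
      then obtain D where D: "(u has_derivative D) (at x)" using elim by (auto simp: differentiable_def)
      then have DU: "(U has_derivative D) (at x)" using same_derivative[OF x] by simp
      have pd: "pd v (V k) x = D v $ k" for v k
        using jacobian_nth(2)[OF DU] by (simp add: V_def[abs_def])
      have jac: "jacobian u (at x) $ k $ j = pd (axis j 1) (V k) x" for k j
        using jacobian_nth(1)[OF D] pd by simp
      have det: "det (jacobian u (at x)) = det2 (D e1) (D e2)"
        by (simp add: det_2 jac pd det2_def algebra_simps)
      have "jac (V 1) (V 2) x = det (jacobian u (at x))" by (simp add: det_2 jac jac_def)
      moreover have "det (jacobian u (at x)) \<noteq> 0" using elim(2) x R(2) ball_subset_cball by blast
      ultimately show "\<exists>D. (u has_derivative D) (at x) \<and> (U has_derivative D) (at x) \<and>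
        (\<forall>k j. jacobian u (at x) $ k $ j = pd (axis j 1) (V k) x) \<and> (\<forall>k v. pd v (V k) x = D v $ k) \<and>
        det (jacobian u (at x)) = det2 (D e1) (D e2) \<and>
        \<beta> x = h (jac (V 1) (V 2) x) \<and> \<beta> x * det2 (D e1) (D e2) > 0"
        using D DU pd jac det h_pos by (intro exI[of _ D]) (auto simp: \<beta>_def)
    qed
  qed
  \<comment> \<open>Almost everywhere the Jacobian of two functions with Lipschitz constant
    \<open>L\<close> lies in this compact interval, so the factor is essentially bounded although
    \<open>h\<close> itself may be unbounded.\<close>
  have "bounded (h ` {- (2 * L * L)..2 * L * L})"
    by (intro compact_imp_bounded compact_continuous_image) (use h continuous_on_subset in auto)
  then obtain H where H': "\<forall>y \<in> h ` {- (2 * L * L)..2 * L * L}. norm y \<le> H" unfolding bounded_iff by blast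
  have H: "\<bar>h t\<bar> \<le> H" if "\<bar>t\<bar> \<le> 2 * L * L" for t
    using H'[rule_format, of "h t"] that by (simp add: abs_le_iff)
  have "H \<ge> 0" using H[of 0] L abs_ge_zero[of "h 0"] by (auto intro: order_trans)
  define M where "M = H * L"
  have M: "M \<ge> 0" using \<open>H \<ge> 0\<close> L by (simp add: M_def)
  have [measurable]: "h \<in> borel_measurable borel" using h by (rule borel_measurable_continuous_onI)
  \<comment> \<open>\<open>potential_exists\<close> asks for fields that are Borel, bounded
    everywhere and zero off the ball. Clamping and restricting achieve this and, for unit
    directions, change nothing almost everywhere on the ball.\<close>
  define G where "G k i x = indicator (ball x0 R) x * max (- M) (min M (h (jac (V 1) (V 2) x) * pd i (V k) x))" for k i x
  have [measurable]: "ball x0 R \<in> sets borel" by simp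
  have G_meas [measurable]: "G k i \<in> borel_measurable borel" for k i unfolding G_def[abs_def] by measurable
  have G_bdd: "\<bar>G k i x\<bar> \<le> M" for k i x using M by (auto simp: G_def indicator_def)
  have G_out: "G k i x = 0" if "x \<notin> ball x0 R" for k i x using that by (simp add: G_def)
  have G_eq: "AE x in lborel. x \<in> ball x0 R \<longrightarrow> G k i x = \<beta> x * pd i (V k) x" if "norm i = 1" for k i
    using grad_structure pd_bound_ae[OF V_lip, of i k] jac_bound_ae[OF V_lip V_lip, of 1 2]
  proof eventually_elim
    case (elim x)
    show ?case
    proof
      assume x: "x \<in> ball x0 R"
      then have b: "\<beta> x = h (jac (V 1) (V 2) x)" using elim(1) by blast
      have "\<bar>h (jac (V 1) (V 2) x) * pd i (V k) x\<bar> \<le> M"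
        unfolding abs_mult M_def using elim(2) H[OF elim(3)] that \<open>H \<ge> 0\<close> by (intro mult_mono) auto
      then have "max (- M) (min M (h (jac (V 1) (V 2) x) * pd i (V k) x)) = h (jac (V 1) (V 2) x) * pd i (V k) x" by linarith
      then show "G k i x = \<beta> x * pd i (V k) x" using x b by (simp add: G_def)
    qed
  qed
  have G_integrable: "integrable lborel (\<lambda>x. G k i x * pd j (bump 1 a b) x)"
    if "cbox a b \<subseteq> ball x0 R" for k i j and a b :: "real^2"
  proof -
    obtain K where K: "K-lipschitz_on UNIV (bump 1 a b)" using bump_lipschitz[of 1 a b] by auto
    have [measurable]: "bump 1 a b \<in> borel_measurable borel" by (rule bump_measurable)
    show ?thesis
    proof (rule Bochner_Integration.integrable_bound[OF integrable_const_cball[of "M * (K * norm j)" x0 R]])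
      show "AE x in lborel. norm (G k i x * pd j (bump 1 a b) x) \<le> norm (M * (K * norm j) * indicat_real (cball x0 R) x)"
        using pd_bound_ae[OF K, of j]
      proof eventually_elim
        case (elim x)
        have "\<bar>G k i x * pd j (bump 1 a b) x\<bar> \<le> M * (K * norm j)"
          unfolding abs_mult using elim G_bdd M by (intro mult_mono) auto
        moreover have "G k i x = 0" if "x \<notin> cball x0 R" using that by (intro G_out) auto
        ultimately show ?case by (cases "x \<in> cball x0 R") (auto simp: indicator_def)
      qed
    qed measurable
  qed
  have curl12: "(\<integral>x. G k e1 x * pd e2 (bump 1 a b) x \<partial>lborel) = (\<integral>x. G k e2 x * pd e1 (bump 1 a b) x \<partial>lborel)"
    if ab: "cbox a b \<subseteq> ball x0 R" for a b k
  proof -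
    \<comment> \<open>The gradient of component \<open>k\<close> stands in the other row
      \<open>l\<close>, and \<open>s\<close> is the sign that the rotation produces there.\<close>
    define l :: 2 where "l = (if k = 1 then 2 else 1)"
    define s :: real where "s = (if k = 1 then 1 else - 1)"
    let ?\<eta> = "\<lambda>x. bump 1 a b x *\<^sub>R (axis l 1 :: real^2)"
    let ?h = "\<lambda>x. s * (G k e1 x * pd e2 (bump 1 a b) x - G k e2 x * pd e1 (bump 1 a b) x)"
    have [measurable]: "bump 1 a b \<in> borel_measurable borel" by (rule bump_measurable)
    have "?\<eta> \<in> test_functions \<Omega>"
      by (rule bump_test_function) (use ab R(2) ball_subset_cball in blast)
    then have "(LINT x:\<Omega>|lebesgue. (\<beta> x *\<^sub>R transpose (cof (jacobian u (at x)))) \<bullet> jacobian ?\<eta> (at x)) = 0"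
      using div unfolding weakly_div_free_def \<beta>_def by blast
    moreover have "(LINT x:\<Omega>|lebesgue. (\<beta> x *\<^sub>R transpose (cof (jacobian u (at x)))) \<bullet> jacobian ?\<eta> (at x)) = (\<integral>x. ?h x \<partial>lborel)"
      unfolding set_lebesgue_integral_def
    proof (rule lebesgue_integral_lborel_AE)
      show "?h \<in> borel_measurable borel" by measurable
      show "AE x in lborel. indicat_real \<Omega> x *\<^sub>R ((\<beta> x *\<^sub>R transpose (cof (jacobian u (at x)))) \<bullet> jacobian ?\<eta> (at x)) = ?h x"
        using grad_structure G_eq[OF norm_e(1), of k] G_eq[OF norm_e(2), of k]
      proof eventually_elim
        case (elim x)
        have bd: "(bump 1 a b has_derivative frechet_derivative (bump 1 a b) (at x)) (at x)"
          using bump_differentiable frechet_derivative_works by blast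
        have "(?\<eta> has_derivative (\<lambda>v. frechet_derivative (bump 1 a b) (at x) v *\<^sub>R axis l 1)) (at x)"
          by (rule has_derivative_scaleR_left[OF bd])
        from jacobian_nth(1)[OF this] have J: "jacobian ?\<eta> (at x) $ i $ j = pd (axis j 1) (bump 1 a b) x * axis l 1 $ i" for i j
          by (simp add: pd_has_derivative[OF bd])
        then have J': "jacobian ?\<eta> (at x) $ i $ j = (if i = l then pd (axis j 1) (bump 1 a b) x else 0)" for i j
          by (simp add: axis_def)
        show ?case
        proof (cases "x \<in> ball x0 R")
          case True
          then have "x \<in> \<Omega>" using R(2) ball_subset_cball by blast
          obtain D where "\<forall>k j. jacobian u (at x) $ k $ j = pd (axis j 1) (V k) x" using elim(1) True by blast
          note u = this[rule_format]
          have "(\<beta> x *\<^sub>R transpose (cof (jacobian u (at x)))) \<bullet> jacobian ?\<eta> (at x) =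
            (if l = 1 then \<beta> x * (pd e2 (V 2) x * pd e1 (bump 1 a b) x - pd e1 (V 2) x * pd e2 (bump 1 a b) x)
             else \<beta> x * (pd e1 (V 1) x * pd e2 (bump 1 a b) x - pd e2 (V 1) x * pd e1 (bump 1 a b) x))"
            using exhaust_2[of l] by (auto simp: inner_vec_def sum_2 J' transpose_def cof_nth u algebra_simps)
          moreover have "k = 1 \<and> l = 2 \<and> s = 1 \<or> k = 2 \<and> l = 1 \<and> s = - 1"
            using exhaust_2[of k] by (auto simp: l_def s_def)
          ultimately show ?thesis
            using \<open>x \<in> \<Omega>\<close> mp[OF elim(2) True] mp[OF elim(3) True] by (elim disjE conjE) (simp_all add: right_diff_distrib)
        next
          case False
          then have "x \<in> - cbox a b" using ab by blast
          then have "pd v (bump 1 a b) x = 0" for v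
            by (intro pd_zero_outside[of "- cbox a b"] bump_eq_0) (use box_subset_cbox[of a b] in \<open>auto simp: open_Compl\<close>)
          then have "jacobian ?\<eta> (at x) = 0" by (simp add: vec_eq_iff J)
          then show ?thesis using G_out[OF False] by simp
        qed
      qed
    qed
    moreover have "(\<integral>x. ?h x \<partial>lborel) =
        s * ((\<integral>x. G k e1 x * pd e2 (bump 1 a b) x \<partial>lborel) - (\<integral>x. G k e2 x * pd e1 (bump 1 a b) x \<partial>lborel))"
      using G_integrable[OF ab] by simp
    ultimately show ?thesis by (simp add: s_def split: if_splits)
  qed
  have pot: "\<exists>W K. K-lipschitz_on UNIV W \<and> bounded (range W) \<and>
      (\<forall>i\<in>Basis. AE x in lborel. x \<in> ball x0 (R / 2) \<longrightarrow> pd i W x = G k i x)" for k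
  proof -
    have curl: "(\<integral>x. G k i x * pd j (bump 1 a b) x \<partial>lborel) = (\<integral>x. G k j x * pd i (bump 1 a b) x \<partial>lborel)"
      if "cbox a b \<subseteq> ball x0 R" "i \<in> Basis" "j \<in> Basis" for a b i j
      using that curl12[OF that(1), of k] by (auto simp: Basis_real2)
    obtain W K where "K-lipschitz_on UNIV W" "bounded (range W)"
      "\<And>i. i \<in> Basis \<Longrightarrow> AE x in lborel. x \<in> ball x0 (R / 2) \<longrightarrow> pd i W x = G k i x"
      by (rule potential_exists[of "G k" M x0 R "R / 2"]) (use G_meas G_bdd G_out curl R(1) in auto)
    then show ?thesis by blast
  qed
  obtain W where "\<forall>k. \<exists>K. K-lipschitz_on UNIV (W k) \<and> bounded (range (W k)) \<and>
      (\<forall>i\<in>Basis. AE x in lborel. x \<in> ball x0 (R / 2) \<longrightarrow> pd i (W k) x = G k i x)"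
    by (rule exE[OF choice], rule allI, rule pot)
  from choice[OF this] obtain K where WK: "\<forall>k. (K k)-lipschitz_on UNIV (W k) \<and> bounded (range (W k)) \<and>
      (\<forall>i\<in>Basis. AE x in lborel. x \<in> ball x0 (R / 2) \<longrightarrow> pd i (W k) x = G k i x)"
    by (elim exE)
  have W_lip: "(K k)-lipschitz_on UNIV (W k)" and W_bdd: "\<exists>B. \<forall>x. \<bar>W k x\<bar> \<le> B" for k
    using WK by (auto simp: bounded_iff)
  have W: "AE x in lborel. x \<in> ball x0 (R / 2) \<longrightarrow> pd i (W k) x = G k i x" if "i \<in> Basis" for k i
    using WK that by blast
  define w :: "real^2 \<Rightarrow> real^2" where "w x = (\<chi> k. W k x)" for x
  have w_lip: "(K 1 + K 2)-lipschitz_on UNIV w"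
  proof (rule lipschitz_onI)
    fix x y
    have "dist (w x) (w y) \<le> (\<Sum>k\<in>UNIV. \<bar>(w x - w y) $ k\<bar>)" unfolding dist_norm by (rule norm_le_l1_cart)
    also have "\<dots> = dist (W 1 x) (W 1 y) + dist (W 2 x) (W 2 y)" by (simp add: sum_2 w_def dist_real_def)
    also have "\<dots> \<le> K 1 * dist x y + K 2 * dist x y" by (intro add_mono lipschitz_onD[OF W_lip]) auto
    finally show "dist (w x) (w y) \<le> (K 1 + K 2) * dist x y" by (simp add: algebra_simps)
  qed (use lipschitz_on_nonneg[OF W_lip] in simp)
  obtain B where B: "\<forall>k x. \<bar>W k x\<bar> \<le> B k" by (rule exE[OF choice], rule allI, rule W_bdd)
  have w_bdd: "norm (w x) \<le> B 1 + B 2" for x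
    using norm_le_l1_cart[of "w x"] B[rule_format, of 1 x] B[rule_format, of 2 x] by (simp add: sum_2 w_def)
  have R2: "ball x0 (R / 2) \<subseteq> ball x0 R" using R(1) by (intro subset_ball) simp
  have W': "AE x in lborel. \<forall>k. x \<in> ball x0 (R / 2) \<longrightarrow> pd e1 (W k) x = G k e1 x \<and> pd e2 (W k) x = G k e2 x"
  proof -
    have "e1 \<in> Basis" "e2 \<in> Basis" by (simp_all add: Basis_real2)
    then show ?thesis
      unfolding forall_2 using W[of e1 1] W[of e2 1] W[of e1 2] W[of e2 2] by (auto elim: eventually_elim2)
  qed
  have G': "AE x in lborel. \<forall>k. x \<in> ball x0 R \<longrightarrow> G k e1 x = \<beta> x * pd e1 (V k) x \<and> G k e2 x = \<beta> x * pd e2 (V k) x"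
    unfolding forall_2 using G_eq[OF norm_e(1), of 1] G_eq[OF norm_e(2), of 1] G_eq[OF norm_e(1), of 2] G_eq[OF norm_e(2), of 2]
    by eventually_elim blast
  show ?thesis
  proof
    show "R / 2 > 0" using R(1) by simp
    show "ball x0 (R / 2) \<subseteq> \<Omega>" using R2 R(2) ball_subset_cball by blast
    show "U x = u x" if "x \<in> ball x0 (R / 2)" for x using that R2 U_eq by blast
    show "AE x in lborel. x \<in> ball x0 (R / 2) \<longrightarrow> u differentiable (at x)"
      using diff by eventually_elim (use R2 in blast)
    show "proportional_gradients U w (\<lambda>x. h (det (jacobian u (at x)))) (ball x0 (R / 2)) L (K 1 + K 2) Bu (B 1 + B 2)"
    proof
      show "AE x in lborel. x \<in> ball x0 (R / 2) \<longrightarrow> (\<exists>Du. (U has_derivative Du) (at x) \<and>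
        (w has_derivative (\<lambda>v. h (det (jacobian u (at x))) *\<^sub>R Du v)) (at x) \<and>
        h (det (jacobian u (at x))) * det2 (Du e1) (Du e2) > 0)"
        using grad_structure lipschitz_differentiable_ae[OF w_lip] W' G'
      proof eventually_elim
        case (elim x)
        show ?case
        proof
          assume x: "x \<in> ball x0 (R / 2)"
          then have x': "x \<in> ball x0 R" using R2 by blast
          obtain D where D: "(U has_derivative D) (at x)" "\<And>k v. pd v (V k) x = D v $ k"
            "\<beta> x * det2 (D e1) (D e2) > 0" using elim(1) x' by blast
          obtain D' where D': "(w has_derivative D') (at x)" using elim(2) by (auto simp: differentiable_def)
          have D'_nth: "D' v $ k = pd v (W k) x" for v k using jacobian_nth(2)[OF D'] by (simp add: w_def)
          \<comment> \<open>Rademacher's theorem gives \<open>w\<close> a total derivative almost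
            everywhere; it is determined by the partial derivatives, which are prescribed by
            \<open>G\<close>.\<close>
          have "D' = (\<lambda>v. \<beta> x *\<^sub>R D v)"
          proof (rule linear_eq_stdbasis)
            show "linear D'" by (rule has_derivative_linear[OF D'])
            show "linear (\<lambda>v. \<beta> x *\<^sub>R D v)" by (rule linear_compose_scale_right[OF has_derivative_linear[OF D(1)]])
            show "D' b = \<beta> x *\<^sub>R D b" if "b \<in> Basis" for b
            proof -
              have "D' b $ k = (\<beta> x *\<^sub>R D b) $ k" for k
                using that elim(3,4) x x' D(2) by (auto simp: Basis_real2 D'_nth)
              then show ?thesis by (simp add: vec_eq_iff)
            qed
          qed
          then show "\<exists>Du. (U has_derivative Du) (at x) \<and>
            (w has_derivative (\<lambda>v. h (det (jacobian u (at x))) *\<^sub>R Du v)) (at x) \<and>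
            h (det (jacobian u (at x))) * det2 (Du e1) (Du e2) > 0"
            using D D' by (auto simp: \<beta>_def)
        qed
      qed
    qed (use U_lip Bu w_lip w_bdd in auto)
  qed
qed

lemma det_jacobian_real2:
  fixes u :: "real^2 \<Rightarrow> real^2"
  assumes "(u has_derivative D) (at x)"
  shows "det (jacobian u (at x)) = det2 (D e1) (D e2)"
  by (simp add: det_2 det2_def jacobian_nth(1)[OF assms] algebra_simps)

text \<open>If the centre of one ball lies in another, the two meet in a nonempty open set, which is
  not null, so their constants agree. The constant is thus a locally constant function of the
  centre, and \<open>S\<close> is connected.\<close>

lemma ae_constant_on_of_locally:
  fixes f :: "'a::euclidean_space \<Rightarrow> real"
  assumes S: "connected S"
    and loc: "\<And>x. x \<in> S \<Longrightarrow> \<exists>c. \<exists>d>0. AE y in lborel. y \<in> ball x d \<longrightarrow> f y = c"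
  shows "ae_constant_on f S"
proof (cases "S = {}")
  case True
  then show ?thesis by (simp add: ae_constant_on_def)
next
  case False
  then obtain a where a: "a \<in> S" by blast
  obtain c where "\<forall>x\<in>S. \<exists>d>0. AE y in lborel. y \<in> ball x d \<longrightarrow> f y = c x"
    using bchoice[of S "\<lambda>x c. \<exists>d>0. AE y in lborel. y \<in> ball x d \<longrightarrow> f y = c"] loc by blast
  from bchoice[OF this] obtain d where d: "\<forall>x\<in>S. d x > 0 \<and> (AE y in lborel. y \<in> ball x (d x) \<longrightarrow> f y = c x)"
    by blast
  have c_eq: "c x = c y" if x: "x \<in> S" and y: "y \<in> S" and xy: "y \<in> ball x (d x)" for x y
  proof -
    have "AE z in lborel. z \<in> ball x (d x) \<longrightarrow> f z = c x" "AE z in lborel. z \<in> ball y (d y) \<longrightarrow> f z = c y"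
      using d x y by blast+
    then have "AE z in lborel. z \<in> ball x (d x) \<inter> ball y (d y) \<longrightarrow> c x - c y = 0"
      by eventually_elim auto
    moreover have "y \<in> ball x (d x) \<inter> ball y (d y)" using xy d y by simp
    ultimately have "c x - c y = 0"
      using AE_zero_imp_zero_on_open[of "ball x (d x) \<inter> ball y (d y)" "\<lambda>z. c x - c y" y] by (simp add: open_Int)
    then show ?thesis by simp
  qed
  have c_const: "c a = c x" if x: "x \<in> S" for x
  proof (rule connected_local_const[OF S a x], rule ballI)
    fix y assume y: "y \<in> S"
    show "eventually (\<lambda>z. c y = c z) (at y within S)"
      unfolding eventually_at using c_eq[OF y] d y by (intro exI[of _ "d y"]) (auto simp: dist_commute)
  qed
  have "AE y in lborel. y \<in> S \<longrightarrow> f y = c a"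
  proof (rule AE_locally)
    fix x assume "x \<in> S"
    then show "\<exists>\<delta>>0. AE y in lborel. y \<in> ball x \<delta> \<longrightarrow> f y = c a"
      using d[rule_format, of x] c_const[of x] by (intro exI[of _ "d x"]) simp
  qed
  then show ?thesis unfolding ae_constant_on_def by (auto intro: AE_completion)
qed

theorem theorem1:
  fixes \<Omega> :: "(real^2) set"
    and u :: "real^2 \<Rightarrow> real^2"
    and g g' g'' :: "real \<Rightarrow> real"
    and Du :: "real^2 \<Rightarrow> real^2^2"
  defines "Du \<equiv> \<lambda>x. jacobian u (at x)"
  assumes "open \<Omega>" "connected \<Omega>"
    and "\<exists>L. L-lipschitz_on \<Omega> u"
    and "\<And>t. (g has_real_derivative g' t) (at t)"
    and "\<And>t. (g' has_real_derivative g'' t) (at t)"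
    and "continuous_on UNIV g''"
    and "\<And>t. g'' t > 0"
    and "g 0 = 0" "g' 0 = 0"
    and "weakly_div_free \<Omega> (\<lambda>x. g' (det (Du x)) *\<^sub>R transpose (cof (Du x)))"
    and "AE x\<in>\<Omega> in lebesgue. det (Du x) \<noteq> 0"
  shows "(\<exists>\<Omega>\<^sub>0. open \<Omega>\<^sub>0 \<and> \<Omega>\<^sub>0 \<subseteq> \<Omega> \<and> emeasure lebesgue (\<Omega> - \<Omega>\<^sub>0) = 0 \<and>
            ae_locally_constant_on (\<lambda>x. det (Du x)) \<Omega>\<^sub>0) \<and>
         ((\<exists>\<delta>>0. AE x\<in>\<Omega> in lebesgue. (det (Du x))\<^sup>2 \<ge> \<delta>) \<longrightarrow>
            ae_constant_on (\<lambda>x. det (Du x)) \<Omega>)"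
proof -
  note \<Omega> = assms(2) and conn = assms(3) and div = assms(11)
  define d where "d x = det (jacobian u (at x))" for x
  have Du: "det (Du x) = d x" for x by (simp add: Du_def d_def)
  obtain L where lip: "L-lipschitz_on \<Omega> u" using assms(4) by blast
  have g'_mono: "g' s < g' t" if "s < t" for s t
    using DERIV_pos_imp_increasing[OF that] assms(6,8) by blast
  have g'_inj: "inj g'"
    by (rule linorder_injI) (use g'_mono in fastforce)
  have g'_cont: "continuous_on UNIV g'"
    using assms(6) by (intro continuous_at_imp_continuous_on) (auto intro: DERIV_isCont)
  have g'_pos: "g' t * t > 0" if "t \<noteq> 0" for t
    using that g'_mono[of 0 t] g'_mono[of t 0] assms(10)
    by (cases "t > 0") (auto simp: zero_less_mult_iff)
  have nz: "AE x in lborel. x \<in> \<Omega> \<longrightarrow> d x \<noteq> 0"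
    using assms(12) by (simp add: AE_completion_iff Du)
  have structure_at: "\<exists>r U w Lu Lw Bu Bw. r > 0 \<and> ball x0 r \<subseteq> \<Omega> \<and> (\<forall>x \<in> ball x0 r. U x = u x) \<and>
      proportional_gradients U w (\<lambda>x. g' (d x)) (ball x0 r) Lu Lw Bu Bw \<and>
      (AE x in lborel. x \<in> ball x0 r \<longrightarrow> u differentiable (at x))" if x0: "x0 \<in> \<Omega>" for x0
  proof -
    obtain r U w Lu Lw Bu Bw where "r > 0" "ball x0 r \<subseteq> \<Omega>" "\<And>x. x \<in> ball x0 r \<Longrightarrow> U x = u x"
      "proportional_gradients U w (\<lambda>x. g' (det (jacobian u (at x)))) (ball x0 r) Lu Lw Bu Bw"
      "AE x in lborel. x \<in> ball x0 r \<longrightarrow> u differentiable (at x)"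
      by (rule local_structure[OF \<Omega> lip g'_cont g'_pos div[unfolded Du_def] nz[unfolded d_def] x0]) (assumption, rule that)
    then show ?thesis unfolding d_def by blast
  qed
  \<comment> \<open>As \<open>g'\<close> is injective, constancy of the factor returns constancy of
    the determinant.\<close>
  have det_const: "AE x in lborel. x \<in> ball x0 \<delta> \<longrightarrow> d x = inv g' k"
    if "AE x in lborel. x \<in> ball x0 \<delta> \<longrightarrow> g' (d x) = k" for x0 \<delta> k
    using that by eventually_elim (use inv_f_f[OF g'_inj] in auto)
  show ?thesis
  proof (intro conjI impI)
    \<comment> \<open>This is the largest open subset of \<Omega> on which the determinant is
      essentially locally constant; it remains to see that it contains almost every point of
      \<Omega>.\<close>
    define \<Omega>\<^sub>0 where "\<Omega>\<^sub>0 = \<Union>{V. open V \<and> V \<subseteq> \<Omega> \<and> ae_constant_on (\<lambda>x. det (Du x)) V}"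
    have "AE x in lborel. x \<in> \<Omega> \<longrightarrow> u differentiable (at x)"
      by (rule AE_locally) (use structure_at in blast)
    then have "AE x in lborel. x \<in> \<Omega> \<longrightarrow> x \<in> \<Omega>\<^sub>0"
      using nz
    proof eventually_elim
      case (elim x0)
      show ?case
      proof
        assume x0: "x0 \<in> \<Omega>"
        obtain r U w Lu Lw Bu Bw where r: "r > 0" "ball x0 r \<subseteq> \<Omega>" "\<forall>x \<in> ball x0 r. U x = u x"
          and pg: "proportional_gradients U w (\<lambda>x. g' (d x)) (ball x0 r) Lu Lw Bu Bw"
          using structure_at[OF x0] by blast
        have D: "(u has_derivative (\<lambda>v. jacobian u (at x0) *v v)) (at x0)"
          using elim(1) x0 jacobian_works by blast
        have "inj (\<lambda>v. jacobian u (at x0) *v v)"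
          using elim(2) x0 by (simp add: d_def inj_matrix_vector_mult invertible_det_nz)
        from isolated_of_invertible_derivative[OF D this]
        obtain s where s: "s > 0" "\<forall>x\<in>cball x0 s. u x = u x0 \<longrightarrow> x = x0" by blast
        define t where "t = min s (r / 2)"
        have t: "t > 0" "cball x0 t \<subseteq> ball x0 r" "t \<le> s" using s r(1) by (auto simp: t_def)
        have "\<exists>k. \<exists>\<delta>>0. AE x in lborel. x \<in> ball x0 \<delta> \<longrightarrow> g' (d x) = k"
        proof (rule proportional_gradients.factor_constant_near_isolated[OF pg t(1,2)])
          fix x assume x: "x \<in> cball x0 t" "U x = U x0"
          then have "x \<in> ball x0 r" using t(2) by blast
          then have "u x = u x0" using x(2) r(1,3) by simp
          then show "x = x0" using s(2) x(1) t(3) by simp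
        qed
        then obtain k \<delta> where k: "\<delta> > 0" "AE x in lborel. x \<in> ball x0 \<delta> \<longrightarrow> g' (d x) = k" by blast
        have "AE x in lebesgue. x \<in> ball x0 (min \<delta> r) \<longrightarrow> det (Du x) = inv g' k"
          using AE_completion[OF det_const[OF k(2)]] by eventually_elim (simp add: Du)
        then have "ae_constant_on (\<lambda>x. det (Du x)) (ball x0 (min \<delta> r))"
          unfolding ae_constant_on_def by blast
        moreover have "ball x0 (min \<delta> r) \<subseteq> \<Omega>" using r(2) by auto
        moreover have "x0 \<in> ball x0 (min \<delta> r)" using k(1) r(1) by simp
        ultimately show "x0 \<in> \<Omega>\<^sub>0" unfolding \<Omega>\<^sub>0_def using open_ball by blast
      qed
    qed
    then have "AE x in lebesgue. \<not> (x \<in> \<Omega> \<and> x \<notin> \<Omega>\<^sub>0)"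
      by (rule AE_completion[THEN AE_mp]) simp
    from emeasure_eq_0_AE[OF this] have "emeasure lebesgue (\<Omega> - \<Omega>\<^sub>0) = 0"
      by (simp add: set_diff_eq)
    moreover have "open \<Omega>\<^sub>0" "\<Omega>\<^sub>0 \<subseteq> \<Omega>" by (auto simp: \<Omega>\<^sub>0_def)
    moreover have "ae_locally_constant_on (\<lambda>x. det (Du x)) \<Omega>\<^sub>0"
      unfolding ae_locally_constant_on_def
    proof
      fix x assume "x \<in> \<Omega>\<^sub>0"
      then obtain V where V: "open V" "x \<in> V" "V \<subseteq> \<Omega>" "ae_constant_on (\<lambda>x. det (Du x)) V"
        unfolding \<Omega>\<^sub>0_def by blast
      then have "V \<subseteq> \<Omega>\<^sub>0" unfolding \<Omega>\<^sub>0_def by blast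
      then show "\<exists>V. open V \<and> x \<in> V \<and> V \<subseteq> \<Omega>\<^sub>0 \<and> ae_constant_on (\<lambda>x. det (Du x)) V" using V by blast
    qed
    ultimately show "\<exists>\<Omega>\<^sub>0. open \<Omega>\<^sub>0 \<and> \<Omega>\<^sub>0 \<subseteq> \<Omega> \<and> emeasure lebesgue (\<Omega> - \<Omega>\<^sub>0) = 0 \<and>
            ae_locally_constant_on (\<lambda>x. det (Du x)) \<Omega>\<^sub>0" by blast
  next
    assume "\<exists>\<delta>>0. AE x\<in>\<Omega> in lebesgue. (det (Du x))\<^sup>2 \<ge> \<delta>"
    then obtain \<delta> where \<delta>: "\<delta> > 0" "AE x in lborel. x \<in> \<Omega> \<longrightarrow> (d x)\<^sup>2 \<ge> \<delta>"
      by (auto simp: AE_completion_iff Du)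
    define s where "s = sqrt \<delta>"
    have s: "s > 0" using \<delta>(1) by (simp add: s_def)
    \<comment> \<open>Since \<open>g'\<close> increases through 0, the product
      \<open>g' t * t\<close> grows as \<open>t\<close> moves away from 0 on either side. Over all
      \<open>t\<close> with \<open>t\<^sup>2 \<ge> \<delta>\<close> its minimum is thus taken at
      \<open>s\<close> or at \<open>- s\<close>.\<close>
    define c where "c = min (g' s * s) (g' (- s) * (- s))"
    have c: "c > 0" using g'_pos[of s] g'_pos[of "- s"] s by (simp add: c_def)
    have g'_ge: "c \<le> g' t * t" if "t\<^sup>2 \<ge> \<delta>" for t
    proof -
      have "s \<le> \<bar>t\<bar>" using real_sqrt_le_mono[OF that] by (simp add: s_def)
      then consider "s \<le> t" | "t \<le> - s" by linarith
      then show ?thesis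
      proof cases
        case 1
        then have "g' s * s \<le> g' t * t"
          using s g'_mono[of s t] g'_mono[of 0 s] assms(10) by (intro mult_mono) (auto simp: le_less)
        then show ?thesis by (simp add: c_def)
      next
        case 2
        then have "(- g' (- s)) * s \<le> (- g' t) * (- t)"
          using s g'_mono[of t "- s"] g'_mono[of "- s" 0] assms(10) by (intro mult_mono) (auto simp: le_less)
        then show ?thesis by (simp add: c_def)
      qed
    qed
    have "\<exists>k. \<exists>\<delta>>0. AE x in lborel. x \<in> ball x0 \<delta> \<longrightarrow> g' (d x) = k" if x0: "x0 \<in> \<Omega>" for x0
    proof -
      obtain r U w Lu Lw Bu Bw where r: "r > 0" "ball x0 r \<subseteq> \<Omega>" "\<forall>x \<in> ball x0 r. U x = u x"
        and pg: "proportional_gradients U w (\<lambda>x. g' (d x)) (ball x0 r) Lu Lw Bu Bw"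
        using structure_at[OF x0] by blast
      interpret pg: proportional_gradients U w "\<lambda>x. g' (d x)" "ball x0 r" Lu Lw Bu Bw by (rule pg)
      show ?thesis
      proof (rule pg.factor_constant_near_nondegenerate[OF c])
        show "AE x in lborel. x \<in> ball x0 r \<longrightarrow> c \<le> pg.m x"
          using pg.good \<delta>(2)
        proof eventually_elim
          case (elim x)
          show ?case
          proof
            assume x: "x \<in> ball x0 r"
            then obtain D where D: "(U has_derivative D) (at x)" "(w has_derivative (\<lambda>v. g' (d x) *\<^sub>R D v)) (at x)"
              using elim(1) by blast
            have "(u has_derivative D) (at x)"
              by (rule has_derivative_transform_within_open[OF D(1) open_ball x]) (use r(3) in simp)
            then have "d x = det2 (D e1) (D e2)" unfolding d_def by (rule det_jacobian_real2)
            then have "pg.m x = g' (d x) * d x" using pg.m_eq[OF D] by simp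
            then show "c \<le> pg.m x" using g'_ge elim(2) x r(2) by auto
          qed
        qed
        show "x0 \<in> ball x0 r" using r(1) by simp
      qed
    qed
    then have "\<exists>k. \<exists>\<delta>>0. AE x in lborel. x \<in> ball x0 \<delta> \<longrightarrow> d x = k" if "x0 \<in> \<Omega>" for x0
      using that det_const by blast
    from ae_constant_on_of_locally[OF conn this]
    show "ae_constant_on (\<lambda>x. det (Du x)) \<Omega>" by (simp add: Du)
  qed
qed

end
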